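(* For every nonempty subset $\Phi\subset\{\alpha_1,\dots,\alpha_r\}$ there exists an abelian T-motive $M$ over $\mathbb F_q[T]$ with complete multiplication by $\mathbf A_{\mathfrak K}$ having CM-type $\Phi$.
   Context: $\mathbb C_\infty$ is the completion of an algebraic closure of $\mathbb F_q((1/\theta))$; $\iota:\mathbb F_q(T)\to\mathbb C_\infty$, $T\mapsto\theta$. $\mathfrak K$ is a finite separable extension of $\mathbb F_q(T)$ of degree $r$ such that $\mathfrak K\otimes_{\mathbb F_q}\mathbb C_\infty$ is a field; $X\to\mathbb P^1$ is the corresponding covering of smooth projective curves over $\mathbb C_\infty$, and it is assumed that exactly one point $\infty$ of $X$ lies over $\infty\in\mathbb P^1$. $\mathbf A_{\mathfrak K}\subset\mathfrak K$ is the ring of elements regular outside $\infty$; $\alpha_1,\dots,\alpha_r:\mathfrak K\to\mathbb C_\infty$ are the embeddings over $\iota$. $\mathbb C_\infty[T,\tau]$ has relations $Ta=aT$, $T\tau=\tau T$, $\tau a=a^q\tau$; an abelian T-motive is a left $\mathbb C_\infty[T,\tau]$-module free and finitely generated over $\mathbb C_\infty[T]$ and $\mathbb C_\infty[\tau]$ with $(T-\theta)^m(M/\tau M)=0$ for some $m$. $M$ has complete multiplication by $\mathbf A_{\mathfrak K}$ with CM-type $\Phi$ if $\mathbf A_{\mathfrak K}$ acts on $M$ by $\mathbb C_\infty[T,\tau]$-endomorphisms extending the action of $\mathbb F_q[T]$, $M$ has rank $r$, and the representation of $\mathfrak K$ on the $\mathbb C_\infty$-vector space $M/\tau M$ is isomorphic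 to $\bigoplus_{\alpha\in\Phi}\alpha$.
   Formalization: The assumption that K⊗C∞ (over F_q) is a field never holds literally, since T⊗1−1⊗θ is a nonzero non-unit; it is read as: K⊗C∞ is a domain, and the function field of X is its field of fractions. *)

theory Defs
  imports
    "HOL-Analysis.Abstract_Metric_Spaces"
    "HOL-Algebra.Algebraic_Closure_Type"
    "HOL-Algebra.AbelCoset"
    "HOL-Algebra.Module"
begin

definition field_hom :: "('a::field \<Rightarrow> 'b::field) \<Rightarrow> bool" where
  "field_hom h \<longleftrightarrow> h 1 = 1 \<and> (\<forall>x y. h (x + y) = h x + h y) \<and> (\<forall>x y. h (x * y) = h x * h y)"

subsection \<open>The field \<open>C\<^sub>\<infinity>\<close>\<close>

definition nonarch_abs_value :: "('a::field \<Rightarrow> real) \<Rightarrow> bool" where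
  "nonarch_abs_value v \<longleftrightarrow>
     (\<forall>x. 0 \<le> v x) \<and> (\<forall>x. v x = 0 \<longleftrightarrow> x = 0) \<and>
     (\<forall>x y. v (x * y) = v x * v y) \<and> (\<forall>x y. v (x + y) \<le> max (v x) (v y))"

text \<open>
  The local field with uniformiser \<open>1/\<theta>\<close> is the type \<^typ>\<open>'f fls\<close> of Laurent series in
  \<open>X = 1/\<theta>\<close>. Its absolute value has a unique extension to the algebraic closure, so prescribing
  \<open>v\<close> on Laurent series determines it on the image of \<open>e\<close>.
\<close>

definition completed_alg_closure ::
    "('f::{field,finite} fls alg_closure \<Rightarrow> 'c::field) \<Rightarrow> ('c \<Rightarrow> real) \<Rightarrow> bool" where
  "completed_alg_closure e v \<longleftrightarrow>
     field_hom e \<and> nonarch_abs_value v \<and>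
     (\<forall>f. f \<noteq> 0 \<longrightarrow> v (e (to_ac f)) = real CARD('f) powi (- fls_subdegree f)) \<and>
     Metric_space.mcomplete UNIV (\<lambda>x y. v (x - y)) \<and>
     Metric_space.mtopology UNIV (\<lambda>x y. v (x - y)) closure_of range e = UNIV"

definition theta :: "('f::field fls alg_closure \<Rightarrow> 'c) \<Rightarrow> 'c" where
  "theta e = e (to_ac fls_X_inv)"

definition const_C :: "('f::field fls alg_closure \<Rightarrow> 'c) \<Rightarrow> 'f \<Rightarrow> 'c" where
  "const_C e c = e (to_ac (fls_const c))"

definition poly_fract :: "'f::field poly \<Rightarrow> 'f poly fract" where
  "poly_fract p = Fraction_Field.Fract p 1"

definition T_fract :: "'f::field poly fract" where
  "T_fract = poly_fract [:0, 1:]"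

definition is_iota ::
    "('f::field fls alg_closure \<Rightarrow> 'c::field) \<Rightarrow> ('f poly fract \<Rightarrow> 'c) \<Rightarrow> bool" where
  "is_iota e \<iota> \<longleftrightarrow>
     field_hom \<iota> \<and> (\<forall>c. \<iota> (poly_fract [:c:]) = const_C e c) \<and> \<iota> T_fract = theta e"

subsection \<open>The extension of \<open>F\<^sub>q(T)\<close>, its curve, and its ring of regular elements\<close>

definition finite_separable_extension ::
    "('a::field \<Rightarrow> 'k::field) \<Rightarrow> nat \<Rightarrow> bool" where
  "finite_separable_extension j r \<longleftrightarrow>
     field_hom j \<and>
     (\<exists>B. finite B \<and> card B = r \<and> \<not> module.dependent (\<lambda>c x. j c * x) B \<and>
          module.span (\<lambda>c x. j c * x) B = UNIV) \<and>
     (\<forall>x. \<exists>p. irreducible p \<and> coprime p (pderiv p) \<and> poly (map_poly j p) x = 0)"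

definition embeddings_over :: "('a \<Rightarrow> 'k::field) \<Rightarrow> ('a \<Rightarrow> 'c::field) \<Rightarrow> ('k \<Rightarrow> 'c) set" where
  "embeddings_over j \<iota> = {\<alpha>. field_hom \<alpha> \<and> (\<forall>x. \<alpha> (j x) = \<iota> x)}"

text \<open>
  \<open>L\<close> is the field obtained from \<open>K \<otimes> C\<close>, the tensor product being over the constant field:
  the canonical map \<open>K \<otimes> C \<rightarrow> L\<close> is injective (a family in \<open>K\<close> that is free over the constants
  remains free over \<open>C\<close>) and \<open>L\<close> is the fraction field of its image. The tensor product itself
  contains the non-invertible element \<open>T \<otimes> 1 - 1 \<otimes> \<theta>\<close>, so passing to fractions is necessary;
  \<open>L\<close> is equally the tensor product of \<open>K\<close> and \<open>C(T)\<close> over the rational function field.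
\<close>

definition tensor_field ::
    "('f::field \<Rightarrow> 'k::field) \<Rightarrow> ('f \<Rightarrow> 'c::field) \<Rightarrow> ('k \<Rightarrow> 'l::field) \<Rightarrow> ('c \<Rightarrow> 'l) \<Rightarrow> bool" where
  "tensor_field i\<^sub>K i\<^sub>C j\<^sub>K j\<^sub>C \<longleftrightarrow>
     field_hom j\<^sub>K \<and> field_hom j\<^sub>C \<and> (\<forall>c. j\<^sub>K (i\<^sub>K c) = j\<^sub>C (i\<^sub>C c)) \<and>
     (\<forall>B. \<not> module.dependent (\<lambda>c x. i\<^sub>K c * x) B \<longrightarrow>
          \<not> module.dependent (\<lambda>c z. j\<^sub>C c * z) (j\<^sub>K ` B)) \<and>
     (\<forall>z. \<exists>u \<in> module.span (\<lambda>c z. j\<^sub>C c * z) (range j\<^sub>K).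
          \<exists>w \<in> module.span (\<lambda>c z. j\<^sub>C c * z) (range j\<^sub>K). w \<noteq> 0 \<and> z = u / w)"

text \<open>
  Points of the smooth projective curve with function field \<open>L\<close> over \<open>C\<close>, each given by its local
  ring, i.e. by a proper valuation ring of \<open>L\<close> containing the constants.
\<close>

definition curve_points :: "('c::field \<Rightarrow> 'l::field) \<Rightarrow> 'l set set" where
  "curve_points j\<^sub>C =
     {P. range j\<^sub>C \<subseteq> P \<and> P \<noteq> UNIV \<and>
         (\<forall>x\<in>P. \<forall>y\<in>P. x - y \<in> P \<and> x * y \<in> P) \<and>
         (\<forall>x. x \<noteq> 0 \<longrightarrow> x \<in> P \<or> inverse x \<in> P)}"

text \<open>A point lies over \<open>\<infinity>\<close> iff the coordinate \<open>t\<close> of the projective line has a pole there.\<close>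

definition points_over_infinity :: "('c::field \<Rightarrow> 'l::field) \<Rightarrow> 'l \<Rightarrow> 'l set set" where
  "points_over_infinity j\<^sub>C t = {P \<in> curve_points j\<^sub>C. t \<notin> P}"

definition regular_outside ::
    "('k::field \<Rightarrow> 'l::field) \<Rightarrow> ('c::field \<Rightarrow> 'l) \<Rightarrow> 'l set \<Rightarrow> 'k set" where
  "regular_outside j\<^sub>K j\<^sub>C Pinf = {x. \<forall>P \<in> curve_points j\<^sub>C. P \<noteq> Pinf \<longrightarrow> j\<^sub>K x \<in> P}"

subsection \<open>The ring \<open>C\<^sub>\<infinity>[T,\<tau>]\<close> and its left modules\<close>

text \<open>
  An element \<open>\<Sum> F\<^sub>i(T) \<tau>\<^sup>i\<close> is encoded in \<^typ>\<open>'c poly poly\<close>: the outer indeterminate is \<open>\<tau>\<close>, the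
  inner one is \<open>T\<close>. The product is determined by \<open>\<tau>\<^sup>i g(T) = g\<^sup>(\<^sup>i\<^sup>)(T) \<tau>\<^sup>i\<close>, where the coefficients
  of \<open>g\<^sup>(\<^sup>i\<^sup>)\<close> are the \<open>q\<^sup>i\<close>-th powers of those of \<open>g\<close>.
\<close>

definition frob_twist :: "nat \<Rightarrow> nat \<Rightarrow> 'c::field poly \<Rightarrow> 'c poly" where
  "frob_twist q i g = map_poly (\<lambda>a. a ^ (q ^ i)) g"

definition skew_mult :: "nat \<Rightarrow> 'c::field poly poly \<Rightarrow> 'c poly poly \<Rightarrow> 'c poly poly" where
  "skew_mult q F G =
     (\<Sum>i\<le>degree F. \<Sum>j\<le>degree G. monom (coeff F i * frob_twist q i (coeff G j)) (i + j))"

definition skew_ring :: "nat \<Rightarrow> 'c::field poly poly ring" where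
  "skew_ring q = \<lparr>carrier = UNIV, monoid.mult = skew_mult q, one = 1, ring.zero = 0, add = (+)\<rparr>"

definition sc :: "'c::field \<Rightarrow> 'c poly poly" where
  "sc c = [:[:c:]:]"

definition T_el :: "'c::field poly poly" where
  "T_el = [:[:0, 1:]:]"

definition tau :: "'c::field poly poly" where
  "tau = [:0, 1:]"

lemma frob_twist_simps:
  fixes g h :: "'c::field poly"
  assumes "prime CHAR('c)" "q = CHAR('c) ^ n"
  shows "frob_twist q i (0 :: 'c poly) = 0" "frob_twist q i (1 :: 'c poly) = 1"
    "frob_twist q i (g + h) = frob_twist q i g + frob_twist q i h"
    "frob_twist q i (g * h) = frob_twist q i g * frob_twist q i h"
    "frob_twist q i (frob_twist q k g) = frob_twist q (i + k) g"
    "frob_twist q 0 g = g"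
proof -
  have qp: "q > 0" using assms prime_gt_0_nat by auto
  have z: "(0::'c) ^ (q ^ i) = 0" for i using qp by simp
  have add: "(a + b) ^ (q ^ i) = a ^ (q ^ i) + b ^ (q ^ i)" for a b :: 'c and i
    using freshmans_dream'[of "q ^ i" "n * i" a b] assms by (simp add: power_mult)
  have sum: "(\<Sum>x\<in>A. f x) ^ (q ^ i) = (\<Sum>x\<in>A. f x ^ (q ^ i))" for A :: "nat set" and f :: "nat \<Rightarrow> 'c"
    by (induction A rule: infinite_finite_induct) (auto simp: z add)
  have c: "coeff (frob_twist q i g) k = coeff g k ^ (q ^ i)" for i k and g :: "'c poly"
    unfolding frob_twist_def by (subst coeff_map_poly) (auto simp: z)
  show "frob_twist q i (0 :: 'c poly) = 0" "frob_twist q i (1 :: 'c poly) = 1" "frob_twist q 0 g = g"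
    "frob_twist q i (g + h) = frob_twist q i g + frob_twist q i h"
    "frob_twist q i (g * h) = frob_twist q i g * frob_twist q i h"
    "frob_twist q i (frob_twist q k g) = frob_twist q (i + k) g"
    by (auto intro!: poly_eqI simp: c z add coeff_mult sum power_mult_distrib coeff_1
             simp flip: power_mult power_add) (simp_all add: power_add mult.commute)
qed

lemma coeff_skew_mult:
  fixes F G :: "'c::field poly poly"
  assumes "prime CHAR('c)" "q = CHAR('c) ^ n"
  shows "coeff (skew_mult q F G) k = (\<Sum>i\<le>k. coeff F i * frob_twist q i (coeff G (k - i)))"
proof -
  note tw = frob_twist_simps[OF assms]
  have inner: "(\<Sum>j\<le>degree G. coeff (monom (coeff F i * frob_twist q i (coeff G j)) (i + j)) k)
      = (if i \<le> k then coeff F i * frob_twist q i (coeff G (k - i)) else 0)" for i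
  proof (cases "i \<le> k")
    case True
    have "(\<Sum>j\<le>degree G. coeff (monom (coeff F i * frob_twist q i (coeff G j)) (i + j)) k)
       = (\<Sum>j\<le>degree G. if j = k - i then coeff F i * frob_twist q i (coeff G (k - i)) else 0)"
      using True by (intro sum.cong) auto
    also have "\<dots> = coeff F i * frob_twist q i (coeff G (k - i))"
      by (auto simp: tw coeff_eq_0)
    finally show ?thesis using True by simp
  qed (auto intro!: sum.neutral)
  have "coeff (skew_mult q F G) k
      = (\<Sum>i\<le>degree F. if i \<le> k then coeff F i * frob_twist q i (coeff G (k - i)) else 0)"
    unfolding skew_mult_def coeff_sum inner ..
  also have "\<dots> = (\<Sum>i\<le>max k (degree F). if i \<le> k then coeff F i * frob_twist q i (coeff G (k - i)) else 0)"
    by (intro sum.mono_neutral_left) (auto simp: coeff_eq_0)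
  also have "\<dots> = (\<Sum>i\<le>k. coeff F i * frob_twist q i (coeff G (k - i)))"
    by (intro sum.mono_neutral_cong_right) auto
  finally show ?thesis .
qed

lemma ring_skew_ring:
  assumes "prime CHAR('c::field)" "q = CHAR('c) ^ n"
  shows "ring (skew_ring q :: 'c poly poly ring)"
proof -
  note tw = frob_twist_simps[OF assms] and cf = coeff_skew_mult[OF assms]
  have tws: "frob_twist q i (sum f A) = (\<Sum>x\<in>A. frob_twist q i (f x))"
    for i A and f :: "nat \<Rightarrow> 'c poly"
    by (induction A rule: infinite_finite_induct) (auto simp: tw)
  have assoc: "skew_mult q (skew_mult q F G) H = skew_mult q F (skew_mult q G H)"
    for F G H :: "'c poly poly"
  proof (rule poly_eqI)
    fix k
    define f where "f i j l = coeff F i * frob_twist q i (coeff G j) * frob_twist q (i + j) (coeff H l)"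
      for i j l
    have "coeff (skew_mult q (skew_mult q F G) H) k = (\<Sum>m\<le>k. \<Sum>i\<le>m. f i (m - i) (k - m))"
      by (simp add: cf f_def sum_distrib_right)
    also have "\<dots> = (\<Sum>i\<le>k. \<Sum>j\<le>k - i. f i j (k - i - j))"
      using sum.triangle_reindex_eq[of "\<lambda>i j. f i j (k - (i + j))" k]
      by (simp add: sum.Sigma Sigma_def sum.triangle_reindex_eq flip: diff_diff_left)
        (auto intro!: sum.reindex_bij_witness[of _ "\<lambda>(i, j). (i + j, i)" "\<lambda>(m, i). (i, m - i)"])
    also have "\<dots> = coeff (skew_mult q F (skew_mult q G H)) k"
      by (simp add: cf f_def tws tw sum_distrib_left mult.assoc)
    finally show "coeff (skew_mult q (skew_mult q F G) H) k = coeff (skew_mult q F (skew_mult q G H)) k" .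
  qed
  have l1: "skew_mult q 1 F = F" for F :: "'c poly poly"
  proof (rule poly_eqI)
    fix k
    have "coeff (skew_mult q 1 F) k = (\<Sum>i\<le>k. if i = 0 then coeff F k else 0)"
      unfolding cf by (intro sum.cong) (auto simp: tw coeff_1)
    thus "coeff (skew_mult q 1 F) k = coeff F k" by simp
  qed
  have r1: "skew_mult q F 1 = F" for F :: "'c poly poly"
  proof (rule poly_eqI)
    fix k
    have "coeff (skew_mult q F 1) k = (\<Sum>i\<le>k. if i = k then coeff F k else 0)"
      unfolding cf by (intro sum.cong) (auto simp: tw coeff_1)
    thus "coeff (skew_mult q F 1) k = coeff F k" by simp
  qed
  have ex: "\<exists>G. F + G = 0" for F :: "'c poly poly" by (rule exI[of _ "-F"]) simp
  show ?thesis
    unfolding skew_ring_def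
    by unfold_locales
      (auto simp: assoc l1 r1 Units_def ex add.commute intro!: poly_eqI
        simp: cf tw algebra_simps sum.distrib)
qed

lemma skew_ring_relations:
  fixes a :: "'c::field"
  assumes "prime CHAR('c)" "q = CHAR('c) ^ n"
  shows "skew_mult q T_el (sc a) = skew_mult q (sc a) T_el"
    "skew_mult q T_el tau = skew_mult q tau T_el"
    "skew_mult q tau (sc a) = skew_mult q (sc (a ^ q)) tau"
proof -
  have "q > 0" using assms prime_gt_0_nat by auto
  thus "skew_mult q T_el (sc a) = skew_mult q (sc a) T_el"
    "skew_mult q T_el tau = skew_mult q tau T_el"
    "skew_mult q tau (sc a) = skew_mult q (sc (a ^ q)) tau"
    by (simp_all add: skew_mult_def T_el_def tau_def sc_def frob_twist_def map_poly_pCons)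
qed

definition C_T :: "'c::field poly poly set" where
  "C_T = range (\<lambda>f. [:f:])"

definition C_tau :: "'c::field poly poly set" where
  "C_tau = range (map_poly (\<lambda>c. [:c:]))"

text \<open>The library's \<^locale>\<open>module\<close> requires a commutative ring of scalars.\<close>

locale left_module = R?: ring R + M?: abelian_group M
  for R :: "('a, 'n) ring_scheme" (structure) and M :: "('a, 'b, 'm) module_scheme" (structure) +
  assumes smult_closed: "\<lbrakk>a \<in> carrier R; x \<in> carrier M\<rbrakk> \<Longrightarrow> a \<odot>\<^bsub>M\<^esub> x \<in> carrier M"
    and smult_l_distr: "\<lbrakk>a \<in> carrier R; b \<in> carrier R; x \<in> carrier M\<rbrakk> \<Longrightarrow>
         (a \<oplus>\<^bsub>R\<^esub> b) \<odot>\<^bsub>M\<^esub> x = a \<odot>\<^bsub>M\<^esub> x \<oplus>\<^bsub>M\<^esub> b \<odot>\<^bsub>M\<^esub> x"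
    and smult_r_distr: "\<lbrakk>a \<in> carrier R; x \<in> carrier M; y \<in> carrier M\<rbrakk> \<Longrightarrow>
         a \<odot>\<^bsub>M\<^esub> (x \<oplus>\<^bsub>M\<^esub> y) = a \<odot>\<^bsub>M\<^esub> x \<oplus>\<^bsub>M\<^esub> a \<odot>\<^bsub>M\<^esub> y"
    and smult_assoc: "\<lbrakk>a \<in> carrier R; b \<in> carrier R; x \<in> carrier M\<rbrakk> \<Longrightarrow>
         (a \<otimes>\<^bsub>R\<^esub> b) \<odot>\<^bsub>M\<^esub> x = a \<odot>\<^bsub>M\<^esub> (b \<odot>\<^bsub>M\<^esub> x)"
    and smult_one: "x \<in> carrier M \<Longrightarrow> \<one>\<^bsub>R\<^esub> \<odot>\<^bsub>M\<^esub> x = x"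

definition free_of_rank :: "'a set \<Rightarrow> ('a, 'b) module \<Rightarrow> nat \<Rightarrow> bool" where
  "free_of_rank S M n \<longleftrightarrow>
     (\<exists>B. finite B \<and> card B = n \<and> B \<subseteq> carrier M \<and>
        (\<forall>x \<in> carrier M. \<exists>!c. c \<in> B \<rightarrow>\<^sub>E S \<and> x = (\<Oplus>\<^bsub>M\<^esub> b \<in> B. c b \<odot>\<^bsub>M\<^esub> b)))"

text \<open>For \<open>f\<close> preserving the subgroup \<open>H\<close> this is the induced map \<open>H + x \<mapsto> H + f x\<close> on cosets.\<close>

definition coset_map :: "('a, 'b) module \<Rightarrow> 'b set \<Rightarrow> ('b \<Rightarrow> 'b) \<Rightarrow> 'b set \<Rightarrow> 'b set" where
  "coset_map M H f Q = (\<Union>x\<in>Q. H +>\<^bsub>M\<^esub> f x)"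

definition quot_module :: "('a, 'b) module \<Rightarrow> 'b set \<Rightarrow> ('a, 'b set) module" where
  "quot_module M H =
     \<lparr>carrier = a_rcosets\<^bsub>M\<^esub> H, monoid.mult = undefined, one = undefined,
      ring.zero = H, add = set_add M, module.smult = (\<lambda>a. coset_map M H (\<lambda>x. a \<odot>\<^bsub>M\<^esub> x))\<rparr>"

definition tau_image :: "('c::field poly poly, 'b) module \<Rightarrow> 'b set" where
  "tau_image M = (\<lambda>x. tau \<odot>\<^bsub>M\<^esub> x) ` carrier M"

definition mod_tau :: "('c::field poly poly, 'b) module \<Rightarrow> ('c poly poly, 'b set) module" where
  "mod_tau M = quot_module M (tau_image M)"

definition abelian_T_motive :: "nat \<Rightarrow> 'c::field \<Rightarrow> ('c poly poly, 'b) module \<Rightarrow> bool" where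
  "abelian_T_motive q \<theta> M \<longleftrightarrow>
     left_module (skew_ring q) M \<and>
     (\<exists>n. free_of_rank C_T M n) \<and> (\<exists>n. free_of_rank C_tau M n) \<and>
     (\<exists>m::nat. \<forall>Q \<in> carrier (mod_tau M).
        ((T_el - sc \<theta>) [^]\<^bsub>skew_ring q\<^esub> m) \<odot>\<^bsub>mod_tau M\<^esub> Q = \<zero>\<^bsub>mod_tau M\<^esub>)"

subsection \<open>Complete multiplication\<close>

text \<open>Ring homomorphisms from the subring \<open>A\<close> to the \<open>S\<close>-linear endomorphisms of \<open>M\<close>.\<close>

definition acts_linearly ::
    "'k::field set \<Rightarrow> 'a set \<Rightarrow> ('a, 'b) module \<Rightarrow> ('k \<Rightarrow> 'b \<Rightarrow> 'b) \<Rightarrow> bool" where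
  "acts_linearly A S M act \<longleftrightarrow>
     (\<forall>a\<in>A. act a \<in> carrier M \<rightarrow> carrier M \<and>
        (\<forall>x\<in>carrier M. \<forall>y\<in>carrier M. act a (x \<oplus>\<^bsub>M\<^esub> y) = act a x \<oplus>\<^bsub>M\<^esub> act a y) \<and>
        (\<forall>s\<in>S. \<forall>x\<in>carrier M. act a (s \<odot>\<^bsub>M\<^esub> x) = s \<odot>\<^bsub>M\<^esub> act a x)) \<and>
     (\<forall>x\<in>carrier M. act 1 x = x) \<and>
     (\<forall>a\<in>A. \<forall>b\<in>A. \<forall>x\<in>carrier M.
        act (a + b) x = act a x \<oplus>\<^bsub>M\<^esub> act b x \<and> act (a * b) x = act a (act b x))"

text \<open>
  The representation \<open>\<rho>\<close> of \<open>K\<close> on the \<open>C\<close>-vector space \<open>V\<close> is isomorphic to the direct sum of the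
  characters in \<open>\<Phi>\<close>, realised on the functions \<open>\<Phi> \<rightarrow> C\<close>.
\<close>

definition rep_iso_sum ::
    "('c::field poly poly, 'v) module \<Rightarrow> ('k \<Rightarrow> 'v \<Rightarrow> 'v) \<Rightarrow> ('k \<Rightarrow> 'c) set \<Rightarrow> bool" where
  "rep_iso_sum V \<rho> \<Phi> \<longleftrightarrow>
     (\<exists>\<phi>. bij_betw \<phi> (carrier V) (\<Phi> \<rightarrow>\<^sub>E UNIV) \<and>
        (\<forall>u\<in>carrier V. \<forall>v\<in>carrier V. \<forall>\<alpha>\<in>\<Phi>. \<phi> (u \<oplus>\<^bsub>V\<^esub> v) \<alpha> = \<phi> u \<alpha> + \<phi> v \<alpha>) \<and>
        (\<forall>c. \<forall>v\<in>carrier V. \<forall>\<alpha>\<in>\<Phi>. \<phi> (sc c \<odot>\<^bsub>V\<^esub> v) \<alpha> = c * \<phi> v \<alpha>) \<and>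
        (\<forall>x. \<forall>v\<in>carrier V. \<forall>\<alpha>\<in>\<Phi>. \<phi> (\<rho> x v) \<alpha> = \<alpha> x * \<phi> v \<alpha>))"

text \<open>
  \<open>j\<close> embeds the rational function field in \<open>K\<close>, \<open>i\<^sub>C\<close> embeds its constants in \<open>C\<close>, and
  \<open>A \<subseteq> K\<close>. The representation \<open>\<rho>\<close> of \<open>K\<close> is the (unique) extension of the action induced by \<open>A\<close>.
\<close>

definition has_complete_multiplication ::
    "('f::field poly fract \<Rightarrow> 'k::field) \<Rightarrow> ('f \<Rightarrow> 'c::field) \<Rightarrow> 'k set \<Rightarrow> nat \<Rightarrow> ('k \<Rightarrow> 'c) set \<Rightarrow>
     ('c poly poly, 'b) module \<Rightarrow> bool" where
  "has_complete_multiplication j i\<^sub>C A r \<Phi> M \<longleftrightarrow>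
     free_of_rank C_T M r \<and>
     (\<exists>act. acts_linearly A UNIV M act \<and>
        (\<forall>p. \<forall>x\<in>carrier M. act (j (poly_fract p)) x = [:map_poly i\<^sub>C p:] \<odot>\<^bsub>M\<^esub> x) \<and>
        (\<exists>\<rho>. acts_linearly UNIV (range sc) (mod_tau M) \<rho> \<and>
           (\<forall>a\<in>A. \<forall>Q\<in>carrier (mod_tau M). \<rho> a Q = coset_map M (tau_image M) (act a) Q) \<and>
           rep_iso_sum (mod_tau M) \<rho> \<Phi>))"

end

theory Submission
  imports Defs "HOL-Algebra.Sylow"
begin

text \<open>
  The motive is realised as a fractional ideal \<open>I\<close> of \<open>A \<otimes> C\<close> inside the function field \<open>L\<close>, with
  \<open>\<tau>\<close> acting as \<open>x \<mapsto> f \<sigma>(x)\<close>, where \<open>\<sigma>\<close> is the Frobenius of the factor \<open>C\<close>. For a single embedding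
  \<open>\<alpha>\<close> the pair \<open>(I, f)\<close> comes from a Drinfeld module of rank one: \<open>\<alpha>(A)\<close> is a lattice in \<open>C\<close>, because
  uniqueness of the point over infinity makes all embeddings induce the same absolute value on \<open>K\<close>,
  and the exponential function of this lattice carries an action of \<open>A\<close> by \<open>q\<close>-linear polynomials.
  The polynomials in \<open>\<tau>\<close> embed in \<open>L\<close> as a fractional ideal, by sending 1 to 1. For general \<open>\<Phi>\<close> one
  multiplies these ideals and these \<open>f\<close> (Drinfeld's shtuka functions). The degree at infinity shows that
  \<open>I\<close> is free of rank \<open>r\<close> over \<open>C[T]\<close> and of rank at most \<open>|\<Phi>|\<close> over \<open>C[\<tau>]\<close>. Each factor of \<open>f\<close> makes
  the fibre of \<open>\<tau> I\<close> vanish at its point \<open>\<alpha>\<close>, and counting dimensions identifies \<open>I / \<tau> I\<close> with \<open>C\<^sup>\<Phi>\<close>.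
\<close>

text \<open>Riemann-Roch is replaced by a counting principle. All spaces carry a degree whose graded
  pieces have dimension at most one, so a basis is a choice of one vector per degree and a
  codimension is a number of missing degrees. For K over the finite field this needs residue degree
  one at infinity: a larger residue field would split over C and produce several points over
  infinity. The degree on L is read off from the action of A tensor C on the polynomials in \<tau>,
  so one Drinfeld module has to exist before L is graded. There \<open>a\<close> acts by right
  multiplication with its Drinfeld polynomial, which commutes with scalars and \<tau> on the left;
  the module obtained has rank one over A tensor C and hence embeds in L, and the factor of f
  attached to \<alpha> is the image of \<tau>. It vanishes at \<alpha> relative to the ideal because
  left multiples of \<tau> have constant coefficient 0 while 1 does not. In the final count an upper
  bound for the rank over C[\<tau>] is enough, because the fibres already map I onto all of
  C^\<Phi>; q-th roots in C make \<tau>I a C-subspace.\<close>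

section \<open>Linear systems and the order of a finite field\<close>

lemma homogeneous_system_nontrivial:
  fixes mu :: "'i \<Rightarrow> 'j \<Rightarrow> 'c::field"
  assumes "finite Y" "finite S" "card Y < card S"
  shows "\<exists>l. (\<exists>x\<in>S. l x \<noteq> 0) \<and> (\<forall>y\<in>Y. (\<Sum>x\<in>S. l x * mu x y) = 0)"
  using assms
proof (induction Y arbitrary: S mu rule: finite_induct)
  case empty
  then show ?case by (intro exI[of _ "\<lambda>_. 1"]) (auto simp: card_gt_0_iff)
next
  case (insert y Y)
  show ?case
  proof (cases "\<forall>x\<in>S. mu x y = 0")
    case True
    from insert obtain l where "\<exists>x\<in>S. l x \<noteq> 0" "\<forall>y\<in>Y. (\<Sum>x\<in>S. l x * mu x y) = 0"
      by (metis Suc_lessD card_insert_disjoint)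
    with True show ?thesis by (intro exI[of _ l]) auto
  next
    case False
    then obtain x0 where x0: "x0 \<in> S" "mu x0 y \<noteq> 0" by auto
    define S' where "S' = S - {x0}"
    have S': "finite S'" "card Y < card S'" "S = insert x0 S'" "x0 \<notin> S'"
      using insert x0 by (auto simp: S'_def)
    \<comment> \<open>Gaussian elimination: solving the equation \<open>y\<close> for the unknown
      \<open>l x0\<close> leaves a system with coefficients \<open>mu'\<close> in one unknown and
      one equation fewer.\<close>
    define mu' where "mu' x z = mu x z - mu x y / mu x0 y * mu x0 z" for x z
    from insert.IH[OF S'(1,2), of mu'] obtain l where l: "\<exists>x\<in>S'. l x \<noteq> 0"
      "\<And>z. z \<in> Y \<Longrightarrow> (\<Sum>x\<in>S'. l x * mu' x z) = 0" by auto
    define l' where "l' = l(x0 := - (\<Sum>x\<in>S'. l x * (mu x y / mu x0 y)))"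
    have ex: "\<exists>x\<in>S. l' x \<noteq> 0" using l(1) S' by (auto simp: l'_def)
    have sm: "(\<Sum>x\<in>S. l' x * mu x z) = (\<Sum>x\<in>S'. l x * mu' x z)" for z
    proof -
      have "(\<Sum>x\<in>S. l' x * mu x z) = l' x0 * mu x0 z + (\<Sum>x\<in>S'. l' x * mu x z)"
        using S' by simp
      also have "(\<Sum>x\<in>S'. l' x * mu x z) = (\<Sum>x\<in>S'. l x * mu x z)"
        using S' by (intro sum.cong) (auto simp: l'_def)
      finally show ?thesis
        by (simp add: l'_def mu'_def algebra_simps sum_subtractf sum_distrib_left)
    qed
    have "mu' x y = 0" for x using x0 by (simp add: mu'_def)
    then have "\<forall>z\<in>insert y Y. (\<Sum>x\<in>S. l' x * mu x z) = 0" using l(2) by (simp add: sm)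
    with ex show ?thesis by blast
  qed
qed

text \<open>A prime dividing the order of the additive group gives, by Sylow's theorem, a subgroup
  of that order, hence a nonzero element killed by the prime; so the prime is the
  characteristic.\<close>

lemma CARD_finite_field_prime_power:
  "prime CHAR('f::{field,finite})" "\<exists>n. CARD('f) = CHAR('f) ^ n"
proof -
  show p: "prime CHAR('f)" by (rule prime_CHAR_semidom, rule finite_imp_CHAR_pos) simp
  define G :: "'f monoid" where "G = \<lparr>carrier = UNIV, monoid.mult = (+), one = 0\<rparr>"
  interpret G: group G
  proof (rule groupI)
    fix x assume "x \<in> carrier G"
    show "\<exists>y\<in>carrier G. y \<otimes>\<^bsub>G\<^esub> x = \<one>\<^bsub>G\<^esub>" by (rule bexI[of _ "- x"]) (auto simp: G_def)
  qed (auto simp: G_def add.assoc)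
  have pw: "x [^]\<^bsub>G\<^esub> (n::nat) = of_nat n * x" for x n
    by (induction n) (auto simp: G_def nat_pow_def algebra_simps)
  have "l = CHAR('f)" if l: "l \<in> prime_factors CARD('f)" for l
  proof (rule ccontr)
    assume ne: "l \<noteq> CHAR('f)"
    have pl: "prime l" using l by auto
    obtain m where m: "CARD('f) = l ^ 1 * m" using l by (auto elim: dvdE)
    from sylow_thm[OF pl G.is_group, of 1 m] m obtain H where H: "subgroup H G" "card H = l"
      by (auto simp: Coset.order_def G_def)
    then interpret HH: group "G\<lparr>carrier := H\<rparr>" by (simp add: G.subgroup_imp_group)
    have "card H > 1" using H pl prime_gt_1_nat by auto
    then have "\<not> H \<subseteq> {0}" using card_mono[of "{0}" H] by force
    then obtain x where x: "x \<in> H" "x \<noteq> 0" by auto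
    have "x [^]\<^bsub>G\<lparr>carrier := H\<rparr>\<^esub> Coset.order (G\<lparr>carrier := H\<rparr>) = \<one>\<^bsub>G\<lparr>carrier := H\<rparr>\<^esub>"
      by (rule HH.pow_order_eq_1) (use x in auto)
    then have "x [^]\<^bsub>G\<^esub> l = 0" using H by (simp add: Coset.order_def nat_pow_def G_def)
    then have "of_nat l = (0::'f)" using x by (simp add: pw)
    then have "CHAR('f) dvd l" by (simp add: of_nat_eq_0_iff_char_dvd)
    with ne pl p show False using primes_dvd_imp_eq by blast
  qed
  then have sub: "prime_factors CARD('f) \<subseteq> {CHAR('f)}" by auto
  have "CARD('f) = (\<Prod>p \<in> prime_factors CARD('f). p ^ multiplicity p CARD('f))"
    by (rule prime_factorization_nat) simp
  also have "\<dots> = CHAR('f) ^ (if prime_factors CARD('f) = {} then 0 else multiplicity CHAR('f) CARD('f))"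
    using sub by (cases "prime_factors CARD('f) = {}") (auto simp: subset_singleton_iff)
  finally have "CARD('f) = \<dots>" .
  then show "\<exists>n. CARD('f) = CHAR('f) ^ n" by blast
qed

section \<open>Vector spaces graded by a degree with one-dimensional pieces\<close>

text \<open>\<open>D\<close> behaves like a pole order: ultrametric, and by \<open>D_cancel\<close>
  two vectors of equal degree are proportional modulo lower degree. Its value at 0 is left open,
  hence the side conditions. Instances are K over the finite field, and L and the polynomials in
  \<tau> over C.\<close>

locale graded_space = vector_space scale
  for scale :: "'a::field \<Rightarrow> 'v::ab_group_add \<Rightarrow> 'v" (infixr \<open>\<cdot>\<close> 75) +
  fixes D :: "'v \<Rightarrow> int"
  assumes D_add: "x \<noteq> 0 \<Longrightarrow> y \<noteq> 0 \<Longrightarrow> x + y \<noteq> 0 \<Longrightarrow> D (x + y) \<le> max (D x) (D y)"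
    and D_scale: "c \<noteq> 0 \<Longrightarrow> x \<noteq> 0 \<Longrightarrow> D (c \<cdot> x) = D x"
    and D_cancel: "x \<noteq> 0 \<Longrightarrow> y \<noteq> 0 \<Longrightarrow> D x = D y \<Longrightarrow> \<exists>c. x - c \<cdot> y = 0 \<or> D (x - c \<cdot> y) < D x"
begin

lemma D_uminus: "x \<noteq> 0 \<Longrightarrow> D (- x) = D x"
  using D_scale[of "-1" x] by simp

lemma D_add_eq:
  assumes "x \<noteq> 0" "y = 0 \<or> D y < D x"
  shows "x + y \<noteq> 0" "D (x + y) = D x"
proof -
  have "x + y \<noteq> 0 \<and> D (x + y) = D x"
  proof (cases "y = 0")
    case False
    then have y: "D y < D x" using assms by auto
    have ne: "x + y \<noteq> 0"
    proof
      assume "x + y = 0"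
      then have "x = - y" by (simp add: eq_neg_iff_add_eq_0)
      then show False using y D_uminus[OF False] by simp
    qed
    have "D x \<le> max (D (x + y)) (D y)"
      using D_add[of "x + y" "- y"] ne False assms(1) D_uminus[OF False] by simp
    then show ?thesis using D_add[of x y] ne False assms(1) y by auto
  qed (use assms in auto)
  then show "x + y \<noteq> 0" "D (x + y) = D x" by auto
qed

lemma D_sum_less:
  assumes "\<And>i. i \<in> I \<Longrightarrow> x i = 0 \<or> D (x i) < m"
  shows "sum x I = 0 \<or> D (sum x I) < m"
  using assms
proof (induction I rule: infinite_finite_induct)
  case (insert i I)
  then have "x i = 0 \<or> D (x i) < m" "sum x I = 0 \<or> D (sum x I) < m" by auto
  then show ?case using insert(1,2) D_add[of "x i" "sum x I"]
    by (cases "x i = 0"; cases "sum x I = 0"; cases "x i + sum x I = 0") auto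
qed auto

lemma D_sum_distinct:
  assumes "finite I" "I \<noteq> {}" "\<And>i. i \<in> I \<Longrightarrow> x i \<noteq> 0" "inj_on (\<lambda>i. D (x i)) I"
  shows "\<exists>i\<in>I. (\<Sum>i\<in>I. x i) \<noteq> 0 \<and> D (\<Sum>i\<in>I. x i) = D (x i) \<and> (\<forall>k\<in>I. D (x k) \<le> D (x i))"
proof -
  have "finite ((\<lambda>i. D (x i)) ` I)" "(\<lambda>i. D (x i)) ` I \<noteq> {}" using assms by auto
  then have "Max ((\<lambda>i. D (x i)) ` I) \<in> (\<lambda>i. D (x i)) ` I" by (rule Max_in)
  then obtain i where i: "i \<in> I" "D (x i) = Max ((\<lambda>i. D (x i)) ` I)" by auto
  then have mx: "\<forall>k\<in>I. D (x k) \<le> D (x i)" using assms by simp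
  have "(\<Sum>k\<in>I - {i}. x k) = 0 \<or> D (\<Sum>k\<in>I - {i}. x k) < D (x i)"
  proof (rule D_sum_less)
    fix k assume k: "k \<in> I - {i}"
    then have "D (x k) \<noteq> D (x i)" using i(1) assms(4) by (auto dest: inj_onD)
    then show "x k = 0 \<or> D (x k) < D (x i)" using mx k by force
  qed
  note * = D_add_eq[OF assms(3)[OF i(1)] this]
  have "(\<Sum>k\<in>I. x k) = x i + (\<Sum>k\<in>I - {i}. x k)"
    using i assms by (simp add: sum.remove)
  then show ?thesis using * i(1) mx by (intro bexI[of _ i]) auto
qed

text \<open>With \<open>u k\<close> the \<open>k\<close>-th iterate of an operator at a vector, this
  is the polynomial \<open>p\<close> in that operator. Scalars stand to the left of the iterates, so
  that the operator may be semilinear, as \<tau> is.\<close>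

definition ev :: "'a poly \<Rightarrow> (nat \<Rightarrow> 'v) \<Rightarrow> 'v" where
  "ev p u = (\<Sum>k\<le>degree p. coeff p k \<cdot> u k)"

lemma ev_bound: "degree p \<le> n \<Longrightarrow> ev p u = (\<Sum>k\<le>n. coeff p k \<cdot> u k)"
  unfolding ev_def by (intro sum.mono_neutral_left) (auto simp: coeff_eq_0)

lemma ev_add: "ev (p + p') u = ev p u + ev p' u"
proof -
  define n where "n = max (degree p) (degree p')"
  have "degree (p + p') \<le> n" "degree p \<le> n" "degree p' \<le> n"
    by (auto simp: n_def degree_add_le_max)
  then show ?thesis by (simp add: ev_bound[of _ n] scale_left_distrib sum.distrib)
qed

lemma ev_diff: "ev (p - p') u = ev p u - ev p' u"
  using ev_add[of "p - p'" p' u] by simp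

lemma ev_0 [simp]: "ev 0 u = 0"
  by (simp add: ev_def)

lemma ev_monom: "ev (monom c k) u = c \<cdot> u k"
proof -
  have "ev (monom c k) u = (\<Sum>i\<le>k. if i = k then c \<cdot> u k else 0)"
    unfolding ev_bound[OF degree_monom_le] by (intro sum.cong) auto
  then show ?thesis by simp
qed

text \<open>The operator raises degrees by \<open>d\<close>, so in each residue class of degrees
  modulo \<open>d\<close> an element of least degree reaches, by iteration, every degree of the
  class that occurs. Cancelling leading terms terminates because degrees are bounded below, and the
  iterates are independent because their degrees are pairwise distinct.\<close>

lemma graded_operator_basis:
  fixes t :: "'v \<Rightarrow> 'v" and V :: "'v set" and d m :: int
  assumes V: "subspace V" and tV: "\<And>x. x \<in> V \<Longrightarrow> t x \<in> V"
    and t: "\<And>x. x \<in> V \<Longrightarrow> x \<noteq> 0 \<Longrightarrow> t x \<noteq> 0 \<and> D (t x) = D x + d"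
    and d: "d > 0" and m: "\<And>x. x \<in> V \<Longrightarrow> x \<noteq> 0 \<Longrightarrow> m \<le> D x"
  obtains B where "finite B" "B \<subseteq> V" "card B = card ((\<lambda>x. D x mod d) ` (V - {0}))"
    "\<And>x. x \<in> V \<Longrightarrow> \<exists>c. x = (\<Sum>b\<in>B. ev (c b) (\<lambda>k. (t ^^ k) b))"
    "\<And>c. (\<Sum>b\<in>B. ev (c b) (\<lambda>k. (t ^^ k) b)) = 0 \<Longrightarrow> \<forall>b\<in>B. c b = 0"
proof -
  define Cl where "Cl = (\<lambda>x. D x mod d) ` (V - {0})"
  have finCl: "finite Cl"
    by (rule finite_subset[of _ "{0..<d}"]) (use d in \<open>auto simp: Cl_def\<close>)
  have "\<exists>b. b \<in> V - {0} \<and> D b mod d = i \<and> (\<forall>x\<in>V - {0}. D x mod d = i \<longrightarrow> D b \<le> D x)"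
    if i: "i \<in> Cl" for i
  proof -
    obtain x0 where x0: "x0 \<in> V - {0}" "D x0 mod d = i" using i by (auto simp: Cl_def)
    define P where "P b \<longleftrightarrow> b \<in> V - {0} \<and> D b mod d = i" for b
    have "P x0" using x0 by (simp add: P_def)
    then obtain b where b: "P b" "\<And>y. nat (D y - m) < nat (D b - m) \<Longrightarrow> \<not> P y"
      using exists_least_iff[of "\<lambda>n. \<exists>y. P y \<and> nat (D y - m) = n"] by metis
    have "D b \<le> D x" if "P x" for x
      using b(1) b(2)[of x] that m[of b] m[of x] by (force simp: P_def)
    with b(1) show ?thesis by (auto simp: P_def)
  qed
  then obtain \<beta> where \<beta>: "\<And>i. i \<in> Cl \<Longrightarrow> \<beta> i \<in> V - {0} \<and> D (\<beta> i) mod d = i \<and>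
      (\<forall>x\<in>V - {0}. D x mod d = i \<longrightarrow> D (\<beta> i) \<le> D x)" by metis
  define B where "B = \<beta> ` Cl"
  have inj: "inj_on \<beta> Cl" using \<beta> by (metis inj_onI)
  have finB: "finite B" using finCl by (simp add: B_def)
  have BV: "B \<subseteq> V - {0}" using \<beta> by (auto simp: B_def)
  have cardB: "card B = card Cl" using card_image[OF inj] by (simp add: B_def)
  have Binj: "b = b'" if "b \<in> B" "b' \<in> B" "D b mod d = D b' mod d" for b b'
    using that \<beta> by (auto simp: B_def)
  have Bmin: "\<exists>b\<in>B. D x mod d = D b mod d \<and> D b \<le> D x" if "x \<in> V" "x \<noteq> 0" for x
  proof -
    have i: "D x mod d \<in> Cl" using that by (auto simp: Cl_def)
    then show ?thesis using \<beta>[OF i] that by (intro bexI[of _ "\<beta> (D x mod d)"]) (auto simp: B_def)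
  qed
  have tk: "(t ^^ k) x \<in> V \<and> (x \<noteq> 0 \<longrightarrow> (t ^^ k) x \<noteq> 0 \<and> D ((t ^^ k) x) = D x + int k * d)"
    if "x \<in> V" for x k
    by (induction k) (use that tV t in \<open>auto simp: algebra_simps\<close>)
  have gen: "\<exists>c. x = (\<Sum>b\<in>B. ev (c b) (\<lambda>k. (t ^^ k) b))" if "x \<in> V" for x
    using that
  proof (induction "nat (D x - m + 1)" arbitrary: x rule: less_induct)
    case less
    show ?case
    proof (cases "x = 0")
      case True
      then show ?thesis by (intro exI[of _ "\<lambda>_. 0"]) simp
    next
      case False
      obtain b where b: "b \<in> B" "D x mod d = D b mod d" "D b \<le> D x" using Bmin[OF less(2) False] by auto
      \<comment> \<open>The difference of the degrees is a nonnegative multiple of \<open>d\<close>,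
        so \<open>k\<close> applications of \<open>t\<close> lift \<open>b\<close> exactly to the
        degree of \<open>x\<close>.\<close>
      define k where "k = nat ((D x - D b) div d)"
      have "d dvd D x - D b" using b(2) by (simp add: mod_eq_dvd_iff)
      then have k: "D x = D b + int k * d" using b(3) d
        by (auto simp: k_def pos_imp_zdiv_nonneg_iff elim!: dvdE)
      define y where "y = (t ^^ k) b"
      have y: "y \<in> V" "y \<noteq> 0" "D y = D x" using tk[of b k] b(1) BV k by (auto simp: y_def)
      obtain a where a: "x - a \<cdot> y = 0 \<or> D (x - a \<cdot> y) < D x" using D_cancel[of x y] False y by auto
      have xy: "x - a \<cdot> y \<in> V" using V less(2) y(1) by (intro subspace_diff subspace_scale)
      have "\<exists>c. x - a \<cdot> y = (\<Sum>b\<in>B. ev (c b) (\<lambda>k. (t ^^ k) b))"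
      proof (cases "x - a \<cdot> y = 0")
        case True
        then show ?thesis by (intro exI[of _ "\<lambda>_. 0"]) simp
      next
        case ne: False
        show ?thesis by (rule less(1)) (use a ne xy m[OF xy ne] in auto)
      qed
      then obtain c where c: "x - a \<cdot> y = (\<Sum>b\<in>B. ev (c b) (\<lambda>k. (t ^^ k) b))" ..
      have "(\<Sum>b'\<in>B. ev ((c(b := c b + monom a k)) b') (\<lambda>k. (t ^^ k) b'))
          = (\<Sum>b'\<in>B. ev (c b') (\<lambda>k. (t ^^ k) b') + (if b' = b then a \<cdot> y else 0))"
        by (intro sum.cong) (auto simp: ev_add ev_monom y_def)
      also have "\<dots> = x - a \<cdot> y + a \<cdot> y" using finB b(1) by (simp add: sum.distrib c)
      finally show ?thesis by (intro exI[of _ "c(b := c b + monom a k)"]) simp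
    qed
  qed
  have uniq: "\<forall>b\<in>B. c b = 0" if z: "(\<Sum>b\<in>B. ev (c b) (\<lambda>k. (t ^^ k) b)) = 0" for c
  proof (rule ccontr)
    assume "\<not> ?thesis"
    then obtain b where b: "b \<in> B" "c b \<noteq> 0" by auto
    \<comment> \<open>The nonzero terms of the relation, indexed by basis vector and exponent. The
      degree of a term determines its class modulo \<open>d\<close>, hence the vector, and then the
      exponent.\<close>
    define I where "I = (SIGMA b:B. {k. k \<le> degree (c b) \<and> coeff (c b) k \<noteq> 0})"
    define g where "g = (\<lambda>(b, k). coeff (c b) k \<cdot> (t ^^ k) b)"
    have "(\<Sum>b\<in>B. ev (c b) (\<lambda>k. (t ^^ k) b)) = (\<Sum>b\<in>B. \<Sum>k\<in>{k. k \<le> degree (c b) \<and> coeff (c b) k \<noteq> 0}. g (b, k))"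
      unfolding ev_def g_def by (intro sum.cong refl sum.mono_neutral_cong_right) auto
    also have "\<dots> = (\<Sum>i\<in>I. g i)" unfolding I_def using finB
      by (subst sum.Sigma) (auto simp: case_prod_unfold)
    finally have g0: "(\<Sum>i\<in>I. g i) = 0" using z by simp
    have gD: "g (b, k) \<noteq> 0 \<and> D (g (b, k)) = D b + int k * d" if "(b, k) \<in> I" for b k
    proof -
      have "b \<in> V" "b \<noteq> 0" "coeff (c b) k \<noteq> 0" using that BV by (auto simp: I_def)
      then show ?thesis using tk[of b k] D_scale[of "coeff (c b) k" "(t ^^ k) b"] by (simp add: g_def)
    qed
    have "finite I" using finB by (auto simp: I_def)
    moreover have "(b, degree (c b)) \<in> I" using b by (auto simp: I_def)
    moreover have "inj_on (\<lambda>i. D (g i)) I"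
    proof (rule inj_onI, clarify)
      fix b k b' k' assume i: "(b, k) \<in> I" "(b', k') \<in> I" "D (g (b, k)) = D (g (b', k'))"
      then have e: "D b + int k * d = D b' + int k' * d" using gD by simp
      have "(D b + int k * d) mod d = (D b' + int k' * d) mod d" by (simp only: e)
      then have "D b mod d = D b' mod d" by simp
      then have "b = b'" using Binj i by (auto simp: I_def)
      then show "b = b' \<and> k = k'" using e d by simp
    qed
    moreover have "g i \<noteq> 0" if "i \<in> I" for i using gD that by (cases i) auto
    ultimately show False using D_sum_distinct[of I g] g0 by blast
  qed
  show ?thesis using that[of B] finB BV cardB gen uniq unfolding Cl_def by auto
qed

text \<open>\<open>V\<close> modulo \<open>Y\<close> is spanned by one vector for each degree missed
  by \<open>Y\<close>, so at most \<open>card G\<close> of them. This is the form in which finite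
  codimension is exploited: enough vectors of \<open>V\<close> always have a nontrivial combination
  in \<open>Y\<close>.\<close>

lemma dependent_modulo_subspace:
  fixes V Y :: "'v set" and w :: "'x \<Rightarrow> 'v"
  assumes V: "subspace V" and Y: "subspace Y" "Y \<subseteq> V"
    and m: "\<And>x. x \<in> V \<Longrightarrow> x \<noteq> 0 \<Longrightarrow> m \<le> D x"
    and g: "finite G" "D ` (V - {0}) \<subseteq> G \<union> D ` (Y - {0})"
    and S: "finite S" "card G < card S" and w: "\<And>x. x \<in> S \<Longrightarrow> w x \<in> V"
  shows "\<exists>l. (\<exists>x\<in>S. l x \<noteq> 0) \<and> (\<Sum>x\<in>S. l x \<cdot> w x) \<in> Y"
proof -
  define G' where "G' = D ` (V - {0}) \<inter> G"
  have "\<exists>h. \<forall>i\<in>G'. h i \<in> V - {0} \<and> D (h i) = i"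
    by (intro bchoice) (auto simp: G'_def)
  then obtain h where h: "\<And>i. i \<in> G' \<Longrightarrow> h i \<in> V - {0} \<and> D (h i) = i" by blast
  have finG': "finite G'" using g by (simp add: G'_def)
  have red: "\<exists>mu. x - (\<Sum>i\<in>G'. mu i \<cdot> h i) \<in> Y" if "x \<in> V" for x
    using that
  proof (induction "nat (D x - m + 1)" arbitrary: x rule: less_induct)
    case less
    show ?case
    proof (cases "x = 0")
      case True
      then show ?thesis using Y by (intro exI[of _ "\<lambda>_. 0"]) (simp add: subspace_0)
    next
      case False
      show ?thesis
      proof (cases "D x \<in> G'")
        case True
        obtain y where hy: "y = h (D x)" by simp
        then have y: "y \<in> V" "y \<noteq> 0" "D y = D x" using h[OF True] by simp_all
        obtain a where a: "x - a \<cdot> y = 0 \<or> D (x - a \<cdot> y) < D x"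
          using D_cancel[of x y] False y by auto
        have xy: "x - a \<cdot> y \<in> V" using V less(2) y by (intro subspace_diff subspace_scale) auto
        have "\<exists>mu. x - a \<cdot> y - (\<Sum>i\<in>G'. mu i \<cdot> h i) \<in> Y"
        proof (cases "x - a \<cdot> y = 0")
          case True
          then show ?thesis using Y by (intro exI[of _ "\<lambda>_. 0"]) (simp add: subspace_0)
        next
          case ne: False
          show ?thesis by (rule less(1)) (use a ne xy m[OF xy ne] in auto)
        qed
        then obtain mu where mu: "x - a \<cdot> y - (\<Sum>i\<in>G'. mu i \<cdot> h i) \<in> Y" ..
        have "(\<Sum>i\<in>G'. (mu(D x := mu (D x) + a)) i \<cdot> h i)
            = (\<Sum>i\<in>G'. mu i \<cdot> h i + (if i = D x then a \<cdot> y else 0))"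
          by (intro sum.cong) (auto simp: scale_left_distrib hy)
        also have "\<dots> = (\<Sum>i\<in>G'. mu i \<cdot> h i) + a \<cdot> y" using finG' True by (simp add: sum.distrib)
        finally show ?thesis using mu
          by (intro exI[of _ "mu(D x := mu (D x) + a)"]) (simp add: algebra_simps)
      next
        case G: False
        have "D x \<in> D ` (V - {0})" using less(2) False by auto
        then have "D x \<in> D ` (Y - {0})" using g(2) G by (auto simp: G'_def)
        then obtain y where "D x = D y" "y \<in> Y - {0}" by (rule imageE)
        then have y: "y \<in> Y" "y \<noteq> 0" "D y = D x" by simp_all
        obtain a where a: "x - a \<cdot> y = 0 \<or> D (x - a \<cdot> y) < D x"
          using D_cancel[of x y] False y by auto
        have xy: "x - a \<cdot> y \<in> V" using V less(2) y Y by (intro subspace_diff subspace_scale) auto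
        have "\<exists>mu. x - a \<cdot> y - (\<Sum>i\<in>G'. mu i \<cdot> h i) \<in> Y"
        proof (cases "x - a \<cdot> y = 0")
          case True
          then show ?thesis using Y by (intro exI[of _ "\<lambda>_. 0"]) (simp add: subspace_0)
        next
          case ne: False
          show ?thesis by (rule less(1)) (use a ne xy m[OF xy ne] in auto)
        qed
        then obtain mu where "x - a \<cdot> y - (\<Sum>i\<in>G'. mu i \<cdot> h i) \<in> Y" ..
        then have "x - a \<cdot> y - (\<Sum>i\<in>G'. mu i \<cdot> h i) + a \<cdot> y \<in> Y"
          using y Y by (intro subspace_add subspace_scale)
        then show ?thesis by (intro exI[of _ mu]) (simp add: algebra_simps)
      qed
    qed
  qed
  then have "\<forall>x\<in>S. \<exists>mu. w x - (\<Sum>i\<in>G'. mu i \<cdot> h i) \<in> Y" using w by blast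
  then obtain mu where mu: "\<And>x. x \<in> S \<Longrightarrow> w x - (\<Sum>i\<in>G'. mu x i \<cdot> h i) \<in> Y" by metis
  have "card G' < card S" using S g card_mono[of G G'] by (auto simp: G'_def)
  from homogeneous_system_nontrivial[OF finG' S(1) this, of mu] obtain l
    where l: "\<exists>x\<in>S. l x \<noteq> 0" "\<And>i. i \<in> G' \<Longrightarrow> (\<Sum>x\<in>S. l x * mu x i) = 0" by auto
  have "(\<Sum>x\<in>S. \<Sum>i\<in>G'. (l x * mu x i) \<cdot> h i) = (\<Sum>i\<in>G'. (\<Sum>x\<in>S. l x * mu x i) \<cdot> h i)"
    by (subst sum.swap) (simp add: scale_sum_left)
  then have z: "(\<Sum>x\<in>S. \<Sum>i\<in>G'. (l x * mu x i) \<cdot> h i) = 0" using l(2) by simp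
  have "(\<Sum>x\<in>S. l x \<cdot> (w x - (\<Sum>i\<in>G'. mu x i \<cdot> h i))) \<in> Y"
    using Y mu by (intro subspace_sum subspace_scale)
  then have "(\<Sum>x\<in>S. l x \<cdot> w x) \<in> Y"
    by (simp add: scale_right_diff_distrib sum_subtractf scale_sum_right z)
  then show ?thesis using l(1) by auto
qed

end

section \<open>Field homomorphisms and their effect on polynomials\<close>

lemma field_hom_simps:
  assumes "field_hom h"
  shows "h 0 = 0" "h 1 = 1" "h (x + y) = h x + h y" "h (- x) = - h x" "h (x - y) = h x - h y"
    "h (x * y) = h x * h y" "h (x ^ n) = h x ^ n" "h x = h y \<longleftrightarrow> x = y" "h x = 0 \<longleftrightarrow> x = 0"
    "h (inverse x) = inverse (h x)" "h (x / y) = h x / h y"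
    "h (sum f B) = (\<Sum>i\<in>B. h (f i))" "h (prod f B) = (\<Prod>i\<in>B. h (f i))"
proof -
  have a: "h (x + y) = h x + h y" and m: "h (x * y) = h x * h y" and o: "h 1 = 1" for x y
    using assms by (auto simp: field_hom_def)
  show z: "h 0 = 0" using a[of 0 0] by (metis add.right_neutral add_left_cancel)
  have n: "h (- x) = - h x" for x using a[of x "- x"] z by (simp add: eq_neg_iff_add_eq_0 add.commute)
  have s: "h (x - y) = h x - h y" for x y using a[of x "- y"] n by simp
  have i: "x \<noteq> 0 \<Longrightarrow> h x * h (inverse x) = 1" for x using m[of x "inverse x"] o by simp
  have zz: "h x = 0 \<longleftrightarrow> x = 0" for x using i[of x] z by (cases "x = 0") auto
  have e: "h x = h y \<longleftrightarrow> x = y" for x y using s[of x y] zz[of "x - y"] by auto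
  have inv: "h (inverse x) = inverse (h x)" for x
    using i[of x] z by (cases "x = 0") (auto simp: inverse_unique)
  show "h 1 = 1" "h (x + y) = h x + h y" "h (- x) = - h x" "h (x - y) = h x - h y"
    "h (x * y) = h x * h y" "h x = h y \<longleftrightarrow> x = y" "h x = 0 \<longleftrightarrow> x = 0" "h (inverse x) = inverse (h x)"
    by (rule o a n s m e zz inv)+
  show "h (x ^ n) = h x ^ n" by (induction n) (auto simp: m o)
  show "h (x / y) = h x / h y" by (simp add: divide_inverse m inv)
  show "h (sum f B) = (\<Sum>i\<in>B. h (f i))" by (induction B rule: infinite_finite_induct) (auto simp: z a)
  show "h (prod f B) = (\<Prod>i\<in>B. h (f i))" by (induction B rule: infinite_finite_induct) (auto simp: o m)
qed

lemma field_hom_vector_space: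
  assumes "field_hom h"
  shows "vector_space (\<lambda>c x. h c * x)"
  by unfold_locales (auto simp: field_hom_simps[OF assms] algebra_simps)

lemma coeff_map_poly_hom: "field_hom h \<Longrightarrow> coeff (map_poly h p) n = h (coeff p n)"
  by (simp add: coeff_map_poly field_hom_simps)

lemma field_hom_comp: "field_hom g \<Longrightarrow> field_hom h \<Longrightarrow> field_hom (\<lambda>x. g (h x))"
  by (auto simp: field_hom_def)

lemma map_poly_hom_simps:
  assumes "field_hom h"
  shows "map_poly h (p + p') = map_poly h p + map_poly h p'"
    "map_poly h (p * p') = map_poly h p * map_poly h p'"
    "map_poly h p = 0 \<longleftrightarrow> p = 0"
    "map_poly h (pderiv p) = pderiv (map_poly h p)"
    "degree (map_poly h p) = degree p"
proof -
  have nat: "h (of_nat n) = of_nat n" for n by (induction n) (auto simp: field_hom_simps[OF assms])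
  show "map_poly h (p + p') = map_poly h p + map_poly h p'"
    "map_poly h (p * p') = map_poly h p * map_poly h p'"
    "map_poly h (pderiv p) = pderiv (map_poly h p)"
    by (auto intro!: poly_eqI simp: coeff_map_poly_hom[OF assms] field_hom_simps[OF assms] coeff_mult
        coeff_pderiv nat simp del: of_nat_Suc)
  show "map_poly h p = 0 \<longleftrightarrow> p = 0"
    by (auto simp: poly_eq_iff coeff_map_poly_hom[OF assms] field_hom_simps[OF assms])
  show "degree (map_poly h p) = degree p"
    by (rule degree_map_poly) (simp add: field_hom_simps[OF assms])
qed

subsection \<open>Subrings and Chevalley's extension theorem\<close>

definition is_subring :: "'a::comm_ring_1 set \<Rightarrow> bool" where
  "is_subring R \<longleftrightarrow> 1 \<in> R \<and> (\<forall>x\<in>R. \<forall>y\<in>R. x - y \<in> R \<and> x * y \<in> R)"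

lemma is_subringD:
  assumes "is_subring R"
  shows "1 \<in> R" "0 \<in> R" "x \<in> R \<Longrightarrow> y \<in> R \<Longrightarrow> x - y \<in> R" "x \<in> R \<Longrightarrow> y \<in> R \<Longrightarrow> x * y \<in> R"
    "x \<in> R \<Longrightarrow> - x \<in> R" "x \<in> R \<Longrightarrow> y \<in> R \<Longrightarrow> x + y \<in> R" "x \<in> R \<Longrightarrow> x ^ n \<in> R"
    "(\<And>i. i \<in> I \<Longrightarrow> f i \<in> R) \<Longrightarrow> sum f I \<in> R" "(\<And>i. i \<in> I \<Longrightarrow> f i \<in> R) \<Longrightarrow> prod f I \<in> R"
proof -
  have o: "1 \<in> R" and d: "x \<in> R \<Longrightarrow> y \<in> R \<Longrightarrow> x - y \<in> R" and m: "x \<in> R \<Longrightarrow> y \<in> R \<Longrightarrow> x * y \<in> R" for x y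
    using assms by (auto simp: is_subring_def)
  have z: "0 \<in> R" using d[OF o o] by simp
  have n: "- x \<in> R" if "x \<in> R" for x using d[OF z that] by simp
  have a: "x + y \<in> R" if "x \<in> R" "y \<in> R" for x y using d[OF that(1) n[OF that(2)]] by simp
  show "1 \<in> R" "0 \<in> R" "x \<in> R \<Longrightarrow> y \<in> R \<Longrightarrow> x - y \<in> R" "x \<in> R \<Longrightarrow> y \<in> R \<Longrightarrow> x * y \<in> R"
    "x \<in> R \<Longrightarrow> - x \<in> R" "x \<in> R \<Longrightarrow> y \<in> R \<Longrightarrow> x + y \<in> R"
    by (fact o z | erule (1) d m a | erule n)+
  show "x \<in> R \<Longrightarrow> x ^ n \<in> R" by (induction n) (auto simp: o m)
  show "(\<And>i. i \<in> I \<Longrightarrow> f i \<in> R) \<Longrightarrow> sum f I \<in> R"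
    by (induction I rule: infinite_finite_induct) (auto simp: z a)
  show "(\<And>i. i \<in> I \<Longrightarrow> f i \<in> R) \<Longrightarrow> prod f I \<in> R"
    by (induction I rule: infinite_finite_induct) (auto simp: o m)
qed

text \<open>Finite sums of products, encoded by lists. For a subring \<open>V\<close> containing
  \<open>J\<close> this is the ideal of \<open>V\<close> generated by \<open>J\<close>; for two
  fractional ideals it is their product, and it is used in both ways.\<close>

definition generated_ideal :: "'a::comm_ring_1 set \<Rightarrow> 'a set \<Rightarrow> 'a set" where
  "generated_ideal J V = {\<Sum>(a, v)\<leftarrow>xs. a * v | xs. set xs \<subseteq> J \<times> V}"

lemma generated_idealE:
  assumes "x \<in> generated_ideal J V"
  obtains xs where "set xs \<subseteq> J \<times> V" "(\<Sum>(a, v)\<leftarrow>xs. a * v) = x"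
  using assms unfolding generated_ideal_def by blast

lemma generated_idealI: "set xs \<subseteq> J \<times> V \<Longrightarrow> (\<Sum>(a, v)\<leftarrow>xs. a * v) \<in> generated_ideal J V"
  unfolding generated_ideal_def by blast

lemma generated_ideal_0: "0 \<in> generated_ideal J V"
  unfolding generated_ideal_def by (rule CollectI, rule exI[of _ "[]"]) simp

lemma generated_ideal_incl: "a \<in> J \<Longrightarrow> v \<in> V \<Longrightarrow> a * v \<in> generated_ideal J V"
  unfolding generated_ideal_def by (rule CollectI, rule exI[of _ "[(a, v)]"]) simp

lemma generated_ideal_add:
  assumes "x \<in> generated_ideal J V" "y \<in> generated_ideal J V"
  shows "x + y \<in> generated_ideal J V"
proof -
  obtain xs ys where xs: "set xs \<subseteq> J \<times> V" "x = (\<Sum>(a, v)\<leftarrow>xs. a * v)"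
    "set ys \<subseteq> J \<times> V" "y = (\<Sum>(a, v)\<leftarrow>ys. a * v)"
    using assms unfolding generated_ideal_def by auto
  then show ?thesis unfolding generated_ideal_def by (intro CollectI exI[of _ "xs @ ys"]) auto
qed

lemma generated_ideal_mult:
  assumes "is_subring V" "x \<in> generated_ideal J V" "y \<in> V"
  shows "y * x \<in> generated_ideal J V"
proof -
  obtain xs where "set xs \<subseteq> J \<times> V" "x = (\<Sum>(a, v)\<leftarrow>xs. a * v)"
    using assms unfolding generated_ideal_def by auto
  then show ?thesis
  proof (induction xs arbitrary: x)
    case (Cons av xs)
    obtain a v where av: "av = (a, v)" "a \<in> J" "v \<in> V" using Cons(2) by (cases av) auto
    have "y * x = a * (y * v) + y * (\<Sum>(a, v)\<leftarrow>xs. a * v)" using Cons(3) av by (simp add: algebra_simps)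
    then show ?case using Cons av is_subringD(4)[OF assms(1,3)]
      by (auto intro!: generated_ideal_add generated_ideal_incl)
  qed (simp add: generated_ideal_0)
qed

lemma generated_ideal_subset: "is_subring V \<Longrightarrow> J \<subseteq> V \<Longrightarrow> generated_ideal J V \<subseteq> V"
proof
  fix x assume V: "is_subring V" "J \<subseteq> V" "x \<in> generated_ideal J V"
  then obtain xs where "set xs \<subseteq> J \<times> V" "x = (\<Sum>(a, v)\<leftarrow>xs. a * v)"
    unfolding generated_ideal_def by auto
  then show "x \<in> V"
    by (induction xs arbitrary: x) (use V is_subringD(1-6)[OF V(1)] in auto)
qed

text \<open>The exchange step: a relation of degree \<open>n\<close> in \<open>x\<close> is shortened using one of degree
  \<open>k \<le> n\<close> in \<open>1/x\<close>.\<close>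

lemma shorten_relation:
  fixes x :: "'l::field"
  assumes V: "is_subring V" "J \<subseteq> V" and x: "x \<noteq> 0" and k: "k \<le> Suc n"
    and u: "\<And>i. u i \<in> generated_ideal J V" "(\<Sum>i\<le>Suc n. u i * x ^ i) = 1"
    and w: "\<And>i. w i \<in> generated_ideal J V" "(\<Sum>i\<le>k. w i * inverse x ^ i) = 1"
  shows "\<exists>u. (\<forall>i. u i \<in> generated_ideal J V) \<and> (\<Sum>i\<le>n. u i * x ^ i) = 1"
proof -
  \<comment> \<open>By the relation for the inverse, \<open>c\<close> times the top power of
    \<open>x\<close> is a combination of lower powers. So the relation for \<open>x\<close> is
    multiplied by \<open>c\<close>, its top term is replaced, and \<open>w 0\<close> is added to
    restore the value 1.\<close>
  define c where "c = 1 - w 0"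
  define u' where "u' i = c * u i + (if i = 0 then w 0 else 0)
      + (if Suc n - i \<le> k then u (Suc n) * w (Suc n - i) else 0)" for i
  have sub: "y \<in> V" if "y \<in> generated_ideal J V" for y using generated_ideal_subset[OF V] that by auto
  have c: "c \<in> V" using is_subringD(1-6)[OF V(1)] sub[OF w(1)] by (simp add: c_def)
  have "u' i \<in> generated_ideal J V" for i
    unfolding u'_def using generated_ideal_mult[OF V(1)] u(1) w(1) c sub
    by (auto intro!: generated_ideal_add generated_ideal_0)
  moreover have "(\<Sum>i\<le>n. u' i * x ^ i) = 1"
  proof -
    have "(\<Sum>i\<le>n. if Suc n - i \<le> k then u (Suc n) * w (Suc n - i) * x ^ i else 0)
        = (\<Sum>l\<in>{1..k}. u (Suc n) * w l * x ^ (Suc n - l))"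
      unfolding sum.inter_filter[OF finite_atMost, symmetric]
      by (rule sum.reindex_bij_witness[of _ "\<lambda>l. Suc n - l" "\<lambda>i. Suc n - i"]) (use k in auto)
    also have "\<dots> = u (Suc n) * x ^ Suc n * (\<Sum>l\<in>{1..k}. w l * inverse x ^ l)"
      unfolding sum_distrib_left
    proof (rule sum.cong[OF refl])
      fix l assume "l \<in> {1..k}"
      then have l: "l \<le> Suc n" using k by auto
      have "x ^ (Suc n - l) = x ^ Suc n * inverse x ^ l" using l x
        by (simp add: power_diff power_inverse divide_inverse)
      then show "u (Suc n) * w l * x ^ (Suc n - l) = u (Suc n) * x ^ Suc n * (w l * inverse x ^ l)" by simp
    qed
    also have "(\<Sum>l\<in>{1..k}. w l * inverse x ^ l) = c"
    proof -
      have "{..k} = insert 0 {1..k}" by auto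
      then have "(\<Sum>i\<le>k. w i * inverse x ^ i) = w 0 + (\<Sum>l\<in>{1..k}. w l * inverse x ^ l)" by simp
      then show ?thesis using w(2) by (simp add: c_def eq_diff_eq add.commute)
    qed
    finally have 3: "(\<Sum>i\<le>n. if Suc n - i \<le> k then u (Suc n) * w (Suc n - i) * x ^ i else 0)
        = u (Suc n) * x ^ Suc n * c" .
    have "(\<Sum>i\<le>n. u' i * x ^ i) = (\<Sum>i\<le>n. c * (u i * x ^ i) + (if i = 0 then w 0 else 0)
       + (if Suc n - i \<le> k then u (Suc n) * w (Suc n - i) * x ^ i else 0))"
      unfolding u'_def by (intro sum.cong) (auto simp: algebra_simps)
    also have "\<dots> = c * (\<Sum>i\<le>n. u i * x ^ i) + w 0 + u (Suc n) * x ^ Suc n * c"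
      by (simp only: sum.distrib 3) (simp add: sum_distrib_left)
    also have "\<dots> = c * (\<Sum>i\<le>Suc n. u i * x ^ i) + w 0" by (simp add: algebra_simps)
    finally show ?thesis unfolding u(2) by (simp add: c_def)
  qed
  ultimately show ?thesis by blast
qed

text \<open>Among the rings above \<open>R\<close> in which \<open>J\<close> generates a proper
  ideal, a maximal one is a valuation ring: otherwise adjoining \<open>x\<close> and adjoining its
  inverse would both make the ideal trivial. Nonzero elements of \<open>J\<close> are then
  non-units, and \<open>z\<close> guarantees that the ring is not the whole field.\<close>

lemma exists_curve_point:
  fixes jC :: "'c::field \<Rightarrow> 'l::field"
  assumes R: "is_subring R" "range jC \<subseteq> R" and J: "J \<subseteq> R" "1 \<notin> generated_ideal J R"
    and z: "z \<in> J" "z \<noteq> 0"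
  shows "\<exists>P\<in>curve_points jC. R \<subseteq> P \<and> (\<forall>x\<in>J. x \<noteq> 0 \<longrightarrow> inverse x \<notin> P)"
proof -
  define \<A> where "\<A> = {V. is_subring V \<and> R \<subseteq> V \<and> 1 \<notin> generated_ideal J V}"
  have "\<exists>M\<in>\<A>. \<forall>V\<in>\<A>. M \<subseteq> V \<longrightarrow> V = M"
  proof (rule subset_Zorn_nonempty)
    show "\<A> \<noteq> {}" using R J by (auto simp: \<A>_def)
  next
    fix \<C> assume \<C>: "\<C> \<noteq> {}" "subset.chain \<A> \<C>"
    then have A: "\<C> \<subseteq> \<A>" and ch: "\<And>a b. a \<in> \<C> \<Longrightarrow> b \<in> \<C> \<Longrightarrow> a \<subseteq> b \<or> b \<subseteq> a"
      by (auto simp: subset.chain_def)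
    \<comment> \<open>Finitely many elements of the union lie in one member of the chain, so a
      representation of 1 would already occur in a member.\<close>
    have fin: "\<exists>a\<in>\<C>. F \<subseteq> a" if "finite F" "F \<subseteq> \<Union>\<C>" for F
      using that
    proof (induction F rule: finite_induct)
      case empty
      then show ?case using \<C>(1) by auto
    next
      case (insert x F)
      then obtain a b where "a \<in> \<C>" "F \<subseteq> a" "b \<in> \<C>" "x \<in> b" by auto
      then show ?case using ch[of a b] by (meson insert_subset subset_trans subsetD)
    qed
    have "is_subring (\<Union>\<C>)" unfolding is_subring_def
    proof (intro conjI ballI)
      show "1 \<in> \<Union>\<C>" using \<C>(1) A by (force simp: \<A>_def is_subring_def)
    next
      fix x y assume "x \<in> \<Union>\<C>" "y \<in> \<Union>\<C>"
      then obtain a where "a \<in> \<C>" "{x, y} \<subseteq> a" using fin[of "{x, y}"] by auto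
      moreover have "is_subring a" using A \<open>a \<in> \<C>\<close> by (auto simp: \<A>_def)
      ultimately show "x - y \<in> \<Union>\<C>" "x * y \<in> \<Union>\<C>" using is_subringD(3,4)[of a x y] by auto
    qed
    moreover have "R \<subseteq> \<Union>\<C>" using \<C>(1) A by (auto simp: \<A>_def)
    moreover have "1 \<notin> generated_ideal J (\<Union>\<C>)"
    proof
      assume "1 \<in> generated_ideal J (\<Union>\<C>)"
      then obtain xs where xs: "set xs \<subseteq> J \<times> \<Union>\<C>" "(\<Sum>(a, v)\<leftarrow>xs. a * v) = 1"
        by (rule generated_idealE)
      have "snd p \<in> \<Union>\<C>" if "p \<in> set xs" for p using subsetD[OF xs(1) that] by (simp only: mem_Times_iff)
      then have "snd ` set xs \<subseteq> \<Union>\<C>" by blast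
      then obtain a where a: "a \<in> \<C>" "snd ` set xs \<subseteq> a" using fin[of "snd ` set xs"] by auto
      have "p \<in> J \<times> a" if "p \<in> set xs" for p
        using subsetD[OF xs(1) that] a(2) that by (simp add: mem_Times_iff image_subset_iff)
      then have "set xs \<subseteq> J \<times> a" by blast
      then have "1 \<in> generated_ideal J a" using generated_idealI[of xs J a] xs(2) by simp
      then show False using a A by (auto simp: \<A>_def)
    qed
    ultimately show "\<Union>\<C> \<in> \<A>" by (auto simp: \<A>_def)
  qed
  then obtain V where "V \<in> \<A>" and mx: "\<And>W. W \<in> \<A> \<Longrightarrow> V \<subseteq> W \<Longrightarrow> W = V" by auto
  then have V: "is_subring V" "R \<subseteq> V" "1 \<notin> generated_ideal J V" by (auto simp: \<A>_def)
  have JV: "J \<subseteq> V" using V J by auto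
  \<comment> \<open>By maximality, adjoining \<open>x\<close> makes the ideal trivial; collecting
    powers of \<open>x\<close> turns this into a relation with coefficients in the ideal of
    \<open>V\<close>.\<close>
  have rel: "\<exists>n u. (\<forall>i. u i \<in> generated_ideal J V) \<and> (\<Sum>i\<le>n. u i * x ^ i) = 1" if xV: "x \<notin> V" for x
  proof -
    define W where "W = {poly p x | p. \<forall>i. coeff p i \<in> V}"
    have "is_subring W" unfolding is_subring_def
    proof (intro conjI ballI)
      show "1 \<in> W" unfolding W_def by (rule CollectI, rule exI[of _ 1]) (auto simp: coeff_1 is_subringD(1-6)[OF V(1)])
    next
      fix a b assume "a \<in> W" "b \<in> W"
      then obtain p p' where p: "\<forall>i. coeff p i \<in> V" "\<forall>i. coeff p' i \<in> V" "a = poly p x" "b = poly p' x"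
        by (auto simp: W_def)
      show "a - b \<in> W" unfolding W_def using p is_subringD(1-6)[OF V(1)]
        by (intro CollectI exI[of _ "p - p'"]) auto
      show "a * b \<in> W" unfolding W_def using p is_subringD(1-6)[OF V(1)]
        by (intro CollectI exI[of _ "p * p'"]) (auto simp: coeff_mult intro!: is_subringD(8)[OF V(1)])
    qed
    moreover have VW: "V \<subseteq> W"
    proof
      fix a assume "a \<in> V"
      then show "a \<in> W" unfolding W_def using is_subringD(1-6)[OF V(1)]
        by (intro CollectI exI[of _ "[:a:]"]) (auto simp: coeff_pCons split: nat.split)
    qed
    moreover have "x \<in> W" unfolding W_def using is_subringD(1-6)[OF V(1)]
      by (intro CollectI exI[of _ "[:0, 1:]"]) (auto simp: coeff_pCons split: nat.split)
    ultimately have "1 \<in> generated_ideal J W" using mx[of W] V xV by (auto simp: \<A>_def)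
    then obtain xs where xs: "set xs \<subseteq> J \<times> W" "(\<Sum>(a, v)\<leftarrow>xs. a * v) = 1"
      by (rule generated_idealE)
    have "\<exists>p. (\<forall>i. coeff p i \<in> generated_ideal J V) \<and> (\<Sum>(a, v)\<leftarrow>xs. a * v) = poly p x"
      using xs(1)
    proof (induction xs)
      case Nil
      then show ?case by (intro exI[of _ 0]) (auto simp: generated_ideal_0)
    next
      case (Cons av xs)
      obtain a p where av: "av = (a, poly p x)" "a \<in> J" "\<forall>i. coeff p i \<in> V"
        using Cons(2) by (cases av) (auto simp: W_def)
      obtain p' where p': "\<forall>i. coeff p' i \<in> generated_ideal J V" "(\<Sum>(a, v)\<leftarrow>xs. a * v) = poly p' x"
        using Cons by auto
      show ?case using av p' by (intro exI[of _ "smult a p + p'"])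
          (auto intro!: generated_ideal_add generated_ideal_incl)
    qed
    then obtain p where p: "\<forall>i. coeff p i \<in> generated_ideal J V" "poly p x = 1" using xs(2) by auto
    then show ?thesis by (intro exI[of _ "degree p"] exI[of _ "coeff p"]) (simp add: poly_altdef)
  qed
  define S where "S x n \<longleftrightarrow> (\<exists>u. (\<forall>i. u i \<in> generated_ideal J V) \<and> (\<Sum>i\<le>n. u i * x ^ i) = 1)"
    for x :: 'l and n :: nat
  have S0: "\<not> S x 0" for x
  proof
    assume "S x 0"
    then obtain u where u: "\<forall>i. u i \<in> generated_ideal J V" "(\<Sum>i\<le>0. u i * x ^ i) = 1" unfolding S_def by blast
    then have "u 0 \<in> generated_ideal J V" by blast
    moreover have "u 0 = 1" using u(2) by simp
    ultimately show False using V(3) by simp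
  qed
  \<comment> \<open>Relations of least degree for \<open>x\<close> and for its inverse cannot
    coexist, since the longer of the two could be shortened.\<close>
  have step: False if "x \<noteq> 0" "S x n" "S (inverse x) k" "k \<le> n" "\<And>m. S x m \<Longrightarrow> n \<le> m" for x n k
  proof (cases n)
    case 0
    then show False using that S0 by simp
  next
    case (Suc n')
    have "S x n'" using that Suc shorten_relation[OF V(1) JV that(1), of k n'] unfolding S_def by blast
    then show False using that(5) Suc by force
  qed
  have val: "x \<in> V \<or> inverse x \<in> V" if "x \<noteq> 0" for x
  proof (rule ccontr)
    assume "\<not> ?thesis"
    then have "\<exists>n. S x n" "\<exists>n. S (inverse x) n" using rel by (auto simp: S_def)
    then obtain n k where n: "S x n" "\<And>m. S x m \<Longrightarrow> n \<le> m"
      and k: "S (inverse x) k" "\<And>m. S (inverse x) m \<Longrightarrow> k \<le> m"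
      by (metis LeastI_ex Least_le)
    show False
    proof (cases "k \<le> n")
      case True
      then show False using step[OF that n(1) k(1)] n(2) by blast
    next
      case False
      then show False using step[of "inverse x" k n] that n(1) k by simp
    qed
  qed
  have inv: "inverse x \<notin> V" if "x \<in> J" "x \<noteq> 0" for x
    using generated_ideal_incl[OF that(1), of "inverse x" V] that V(3) by auto
  have "V \<in> curve_points jC" unfolding curve_points_def
    using R V val inv[OF z] is_subringD(1-6)[OF V(1)] by auto
  then show ?thesis using V inv by (intro bexI[of _ V]) auto
qed

subsection \<open>Extension of scalars\<close>

locale scalar_extension =
  fixes iK :: "'f::field \<Rightarrow> 'k::field" and iC :: "'f \<Rightarrow> 'c::field"
    and jK :: "'k \<Rightarrow> 'l::field" and jC :: "'c \<Rightarrow> 'l"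
  assumes hom_iK: "field_hom iK" and hom_iC: "field_hom iC"
    and tensor: "tensor_field iK iC jK jC"
begin

lemma hom_jK: "field_hom jK" and hom_jC: "field_hom jC" and jK_iK: "jK (iK c) = jC (iC c)"
  using tensor by (auto simp: tensor_field_def)

sublocale VK: vector_space "\<lambda>c x. iK c * x" by (rule field_hom_vector_space[OF hom_iK])
sublocale VL: vector_space "\<lambda>c x. jC c * x" by (rule field_hom_vector_space[OF hom_jC])

declare VK.scale_scale [simp del] VL.scale_scale [simp del]

lemmas iK_simps [simp] = field_hom_simps[OF hom_iK]
lemmas iC_simps [simp] = field_hom_simps[OF hom_iC]
lemmas jK_simps [simp] = field_hom_simps[OF hom_jK]
lemmas jC_simps [simp] = field_hom_simps[OF hom_jC]

lemma independent_image: "VK.independent B \<Longrightarrow> VL.independent (jK ` B)"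
  using tensor by (auto simp: tensor_field_def)

definition lin :: "('c \<times> 'k) list \<Rightarrow> 'l" where
  "lin xs = (\<Sum>(c, x)\<leftarrow>xs. jC c * jK x)"

lemma lin_simps [simp]: "lin [] = 0" "lin ((c, x) # xs) = jC c * jK x + lin xs" "lin (xs @ ys) = lin xs + lin ys"
  by (auto simp: lin_def)

definition lsum :: "('c \<Rightarrow> 'e::ab_group_add \<Rightarrow> 'e) \<Rightarrow> ('k \<Rightarrow> 'e) \<Rightarrow> ('c \<times> 'k) list \<Rightarrow> 'e" where
  "lsum scl h xs = (\<Sum>(c, x)\<leftarrow>xs. scl c (h x))"

lemma lsum_simps [simp]: "lsum scl h [] = 0" "lsum scl h ((c, x) # xs) = scl c (h x) + lsum scl h xs"
  "lsum scl h (xs @ ys) = lsum scl h xs + lsum scl h ys"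
  by (auto simp: lsum_def)

text \<open>Linear disjointness: after expansion along a basis of the finitely many vectors
  involved, which stays independent over C, all coefficients of the relation vanish. This is the
  well-definedness of maps on the tensor product.\<close>

lemma lsum_eq_0:
  fixes scl :: "'c \<Rightarrow> 'e::ab_group_add \<Rightarrow> 'e"
  assumes scl: "vector_space scl" and U: "VK.subspace U"
    and h: "\<And>x y. x \<in> U \<Longrightarrow> y \<in> U \<Longrightarrow> h (x + y) = h x + h y"
      "\<And>c x. x \<in> U \<Longrightarrow> h (iK c * x) = scl (iC c) (h x)"
    and xs: "snd ` set xs \<subseteq> U" "lin xs = 0"
  shows "lsum scl h xs = 0"
proof -
  interpret E: vector_space scl by (rule scl)
  obtain B where B: "B \<subseteq> snd ` set xs" "VK.independent B" "snd ` set xs \<subseteq> VK.span B"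
    using VK.maximal_independent_subset by metis
  have finB: "finite B" using B(1) by (rule finite_subset) simp
  define mu where "mu x b = VK.representation B x b" for x b
  have rep: "x = (\<Sum>b\<in>B. iK (mu x b) * b)" if "x \<in> snd ` set xs" for x
    using VK.sum_representation_eq[OF B(2) _ finB order_refl, of x] B(3) that by (auto simp: mu_def)
  have h0: "h 0 = 0" using h(2)[of 0 0] U by (simp add: VK.subspace_0)
  have hs: "h (\<Sum>b\<in>B'. iK (g b) * b) = (\<Sum>b\<in>B'. scl (iC (g b)) (h b))" if "B' \<subseteq> B" for B' g
    using finite_subset[OF that finB] that
  proof (induction B' rule: finite_induct)
    case (insert b B')
    have bU: "c \<in> U" if "c \<in> B" for c using that B(1) xs(1) by auto
    have "(\<Sum>b\<in>B'. iK (g b) * b) \<in> U" using insert bU U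
      by (intro VK.subspace_sum VK.subspace_scale) auto
    then show ?case using insert bU[of b] U by (simp add: h VK.subspace_scale)
  qed (simp add: h0)
  define k where "k ys b = (\<Sum>(c, x)\<leftarrow>ys. c * iC (mu x b))" for ys b
  have *: "lin ys = (\<Sum>b\<in>B. jC (k ys b) * jK b) \<and> lsum scl h ys = (\<Sum>b\<in>B. scl (k ys b) (h b))"
    if "set ys \<subseteq> set xs" for ys
    using that
  proof (induction ys)
    case (Cons cx ys)
    obtain c x where cx: "cx = (c, x)" by (cases cx)
    have "x \<in> snd ` set xs" using Cons(2) cx by force
    note r = rep[OF this]
    have kk: "k (cx # ys) b = c * iC (mu x b) + k ys b" for b by (simp add: k_def cx)
    have "jK x = (\<Sum>b\<in>B. jC (iC (mu x b)) * jK b)"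
      by (subst r) (simp add: jK_iK)
    moreover have "h x = (\<Sum>b\<in>B. scl (iC (mu x b)) (h b))" by (subst r) (simp add: hs)
    ultimately show ?case using Cons
      by (simp add: cx kk[unfolded cx] sum.distrib algebra_simps sum_distrib_left
          E.scale_left_distrib E.scale_sum_right)
  qed (simp add: k_def)
  have inj: "inj_on jK B" by (auto simp: inj_on_def)
  have "(\<Sum>y\<in>jK ` B. jC (k xs (inv_into B jK y)) * y) = (\<Sum>b\<in>B. jC (k xs b) * jK b)"
    by (subst sum.reindex[OF inj]) (auto simp: inj intro!: sum.cong)
  also have "\<dots> = 0" using *[of xs] xs(2) by simp
  finally have "k xs (inv_into B jK y) = 0" if "y \<in> jK ` B" for y
    using VL.independentD[OF independent_image[OF B(2)], of "jK ` B" "\<lambda>y. k xs (inv_into B jK y)" y] finB that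
    by simp
  then have "k xs b = 0" if "b \<in> B" for b using that inj by force
  then show ?thesis using *[of xs] by simp
qed

definition span_of :: "'k set \<Rightarrow> 'l set" where
  "span_of U = {lin xs | xs. snd ` set xs \<subseteq> U}"

text \<open>The extension of \<open>h\<close> from \<open>U\<close> to its C-span, evaluated on an
  arbitrary presentation. The target has its own scalar multiplication \<open>scl\<close>, so that
  C-linear and Frobenius-semilinear extensions are instances of one construction.\<close>

definition extend :: "'k set \<Rightarrow> ('c \<Rightarrow> 'e::ab_group_add \<Rightarrow> 'e) \<Rightarrow> ('k \<Rightarrow> 'e) \<Rightarrow> 'l \<Rightarrow> 'e" where
  "extend U scl h z = lsum scl h (SOME xs. snd ` set xs \<subseteq> U \<and> lin xs = z)"

lemma extend_lin:
  fixes scl :: "'c \<Rightarrow> 'e::ab_group_add \<Rightarrow> 'e"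
  assumes "vector_space scl" "VK.subspace U"
    "\<And>x y. x \<in> U \<Longrightarrow> y \<in> U \<Longrightarrow> h (x + y) = h x + h y"
    "\<And>c x. x \<in> U \<Longrightarrow> h (iK c * x) = scl (iC c) (h x)" "snd ` set xs \<subseteq> U"
  shows "extend U scl h (lin xs) = lsum scl h xs"
proof -
  interpret E: vector_space scl by fact
  define ys where "ys = (SOME ys. snd ` set ys \<subseteq> U \<and> lin ys = lin xs)"
  have ys: "snd ` set ys \<subseteq> U \<and> lin ys = lin xs" unfolding ys_def by (rule someI[of _ xs]) (use assms(5) in simp)
  define neg where "neg = map (\<lambda>(c, x). (- c, x :: 'k)) ys"
  have n: "lin neg = - lin ys" "lsum scl h neg = - lsum scl h ys" unfolding neg_def
    by (induction ys) (auto simp: E.scale_minus_left)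
  have "snd ` set neg = snd ` set ys" by (force simp: neg_def)
  then have sub: "snd ` set (xs @ neg) \<subseteq> U" "lin (xs @ neg) = 0"
    using ys assms(5) n by (simp_all add: image_Un)
  have "lsum scl h (xs @ neg) = 0"
    by (rule lsum_eq_0[OF assms(1,2) _ _ sub]) (use assms(3,4) in auto)
  then show ?thesis by (simp add: extend_def ys_def[symmetric] n)
qed

definition lprod :: "('c \<times> 'k) list \<Rightarrow> ('c \<times> 'k) list \<Rightarrow> ('c \<times> 'k) list" where
  "lprod xs ys = concat (map (\<lambda>(c, x). map (\<lambda>(d, y). (c * d, x * y)) ys) xs)"

lemma lprod_simps [simp]:
  "lprod [] ys = []" "lprod ((c, x) # xs) ys = map (\<lambda>(d, y). (c * d, x * y)) ys @ lprod xs ys"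
  by (auto simp: lprod_def)

lemma span_of_product:
  assumes U: "is_subring U" and xs: "snd ` set xs \<subseteq> U" and ys: "snd ` set ys \<subseteq> U"
  shows "snd ` set (lprod xs ys) \<subseteq> U" "lin (lprod xs ys) = lin xs * lin ys"
proof -
  show "snd ` set (lprod xs ys) \<subseteq> U"
  proof (rule image_subsetI)
    fix p assume "p \<in> set (lprod xs ys)"
    then obtain c x d y where p: "(c, x) \<in> set xs" "(d, y) \<in> set ys" "p = (c * d, x * y)"
      unfolding lprod_def by auto
    have "x \<in> U" using xs imageI[OF p(1), of snd] by auto
    moreover have "y \<in> U" using ys imageI[OF p(2), of snd] by auto
    ultimately show "snd p \<in> U" using is_subringD(4)[OF U] p(3) by simp
  qed
  have 1: "lin (map (\<lambda>(d, y). (c * d, x * y)) ys) = jC c * jK x * lin ys" for c x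
  proof (induction ys)
    case (Cons p ys)
    then show ?case by (cases p) (simp add: distrib_left mult_ac)
  qed simp
  show "lin (lprod xs ys) = lin xs * lin ys"
  proof (induction xs)
    case (Cons a xs)
    then show ?case by (cases a) (simp add: 1 distrib_right)
  qed simp
qed

lemma is_subring_span_of:
  assumes U: "is_subring U"
  shows "is_subring (span_of U)"
  unfolding is_subring_def
proof (intro conjI ballI)
  show "1 \<in> span_of U" unfolding span_of_def
    by (rule CollectI, rule exI[of _ "[(1, 1)]"]) (use is_subringD(1-6)[OF U] in simp)
next
  fix x y assume "x \<in> span_of U" "y \<in> span_of U"
  then obtain xs ys where xs: "x = lin xs" "snd ` set xs \<subseteq> U" and ys: "y = lin ys" "snd ` set ys \<subseteq> U"
    by (auto simp: span_of_def)
  have n: "lin (map (\<lambda>(c, x). (- c, x :: 'k)) ys) = - lin ys" for ys by (induction ys) auto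
  have "snd ` set (map (\<lambda>(c, x). (- c, x :: 'k)) ys) = snd ` set ys" by force
  then show "x - y \<in> span_of U" unfolding span_of_def using xs ys
    by (intro CollectI exI[of _ "xs @ map (\<lambda>(c, x). (- c, x)) ys"]) (simp add: n image_Un)
  show "x * y \<in> span_of U" unfolding span_of_def xs(1) ys(1)
    using span_of_product[OF U xs(2) ys(2)] by (intro CollectI exI[of _ "lprod xs ys"]) simp
qed

lemma extend_mult:
  fixes scl :: "'c \<Rightarrow> 'e::comm_ring_1 \<Rightarrow> 'e"
  assumes scl: "vector_space scl" "\<And>c d x y. scl c x * scl d y = scl (c * d) (x * y)"
    and U: "is_subring U" "\<And>c. iK c \<in> U"
    and h: "\<And>x y. x \<in> U \<Longrightarrow> y \<in> U \<Longrightarrow> h (x + y) = h x + h y"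
    "\<And>c x. x \<in> U \<Longrightarrow> h (iK c * x) = scl (iC c) (h x)"
    "\<And>x y. x \<in> U \<Longrightarrow> y \<in> U \<Longrightarrow> h (x * y) = h x * h y"
    and z: "x \<in> span_of U" "y \<in> span_of U"
  shows "extend U scl h (x * y) = extend U scl h x * extend U scl h y"
    "extend U scl h (x + y) = extend U scl h x + extend U scl h y"
proof -
  interpret E: vector_space scl by fact
  obtain xs ys where xs: "x = lin xs" "snd ` set xs \<subseteq> U" and ys: "y = lin ys" "snd ` set ys \<subseteq> U"
    using z by (auto simp: span_of_def)
  have sub: "VK.subspace U" using is_subringD(1-6)[OF U(1)] U(2) by (auto simp: VK.subspace_def)
  have ex: "extend U scl h (lin xs) = lsum scl h xs" if "snd ` set xs \<subseteq> U" for xs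
    by (rule extend_lin[OF scl(1) sub _ _ that]) (use h(1,2) in auto)
  note pr = span_of_product[OF U(1) xs(2) ys(2)]
  have 1: "lsum scl h (map (\<lambda>(d, y). (c * d, x * y)) ys) = scl c (h x) * lsum scl h ys" if "x \<in> U" for c x
    using ys(2)
  proof (induction ys)
    case (Cons p ys)
    then show ?case by (cases p) (simp add: distrib_left scl(2) h(3) that)
  qed simp
  have "lsum scl h (lprod xs ys) = lsum scl h xs * lsum scl h ys"
    using xs(2)
  proof (induction xs)
    case (Cons a xs)
    then show ?case by (cases a) (simp add: 1 distrib_right)
  qed simp
  then show "extend U scl h (x * y) = extend U scl h x * extend U scl h y"
    unfolding xs(1) ys(1) ex[OF xs(2)] ex[OF ys(2)] by (simp only: pr(2)[symmetric] ex[OF pr(1)])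
  show "extend U scl h (x + y) = extend U scl h x + extend U scl h y"
    using ex[of "xs @ ys"] xs ys by (simp add: ex image_Un)
qed

text \<open>The homomorphism extends to the C-span of \<open>U\<close> with values in C, and its
  kernel generates a proper ideal. At the point furnished by Chevalley's theorem the kernel consists
  of non-units, so \<open>h\<close> becomes the residue map there; \<open>z\<close> supplies a
  nonzero element of the kernel.\<close>

lemma exists_curve_point_of_hom:
  assumes U: "is_subring U" "\<And>c. iK c \<in> U"
    and h: "\<And>x y. x \<in> U \<Longrightarrow> y \<in> U \<Longrightarrow> h (x + y) = h x + h y"
    "\<And>x y. x \<in> U \<Longrightarrow> y \<in> U \<Longrightarrow> h (x * y) = h x * h y"
    "\<And>c. h (iK c) = iC c"
    and z: "z \<in> U" "z \<noteq> 0" "h z = 0"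
  shows "\<exists>P\<in>curve_points jC. \<forall>x\<in>U. jK x \<in> P \<and> (jK x \<noteq> jC (h x) \<longrightarrow> inverse (jK x - jC (h x)) \<notin> P)"
proof -
  define R where "R = span_of U"
  define H where "H = extend U (*) h"
  have vs: "vector_space ((*) :: 'c \<Rightarrow> 'c \<Rightarrow> 'c)" by unfold_locales (auto simp: algebra_simps)
  have h2: "h (iK c * x) = iC c * h x" if "x \<in> U" for c x using h U that by simp
  have R: "is_subring R" unfolding R_def by (rule is_subring_span_of[OF U(1)])
  have sub: "VK.subspace U" using is_subringD(1-6)[OF U(1)] U(2) by (auto simp: VK.subspace_def)
  have ex: "extend U (*) h (lin xs) = lsum (*) h xs" if "snd ` set xs \<subseteq> U" for xs
    by (rule extend_lin[OF vs sub _ _ that]) (use h(1) h2 in auto)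
  have Hm: "H (x * y) = H x * H y" "H (x + y) = H x + H y" if "x \<in> R" "y \<in> R" for x y
    using extend_mult[OF vs _ U, of h x y] h(1,2) h2 that unfolding H_def R_def by (simp_all add: mult_ac)
  have c1: "jC c \<in> R" for c unfolding R_def span_of_def
    by (rule CollectI, rule exI[of _ "[(c, 1)]"]) (use is_subringD(1-6)[OF U(1)] in simp)
  have h1: "h 1 = 1" using h(3)[of 1] by simp
  have HC: "H (jC c) = c" for c
  proof -
    have "H (lin [(c, 1)]) = lsum (*) h [(c, 1)]"
      unfolding H_def by (rule ex) (simp add: is_subringD(1)[OF U(1)])
    then show ?thesis by (simp add: h1)
  qed
  define J where "J = {z \<in> R. H z = 0}"
  have J: "generated_ideal J R \<subseteq> J"
  proof
    fix z assume "z \<in> generated_ideal J R"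
    then obtain xs where "set xs \<subseteq> J \<times> R" "z = (\<Sum>(a, v)\<leftarrow>xs. a * v)" unfolding generated_ideal_def by auto
    then show "z \<in> J"
    proof (induction xs arbitrary: z)
      case Nil
      then show ?case using HC[of 0] is_subringD(1-6)[OF R] by (simp add: J_def)
    next
      case (Cons av xs)
      obtain a v where av: "av = (a, v)" "a \<in> J" "v \<in> R" using Cons(2) by (cases av) auto
      have "(\<Sum>(a, v)\<leftarrow>xs. a * v) \<in> J" using Cons by auto
      then show ?case using Cons(3) av is_subringD(1-6)[OF R] by (auto simp: J_def Hm)
    qed
  qed
  have "1 \<notin> J" using HC[of 1] by (simp add: J_def)
  then have J1: "1 \<notin> generated_ideal J R" using J by auto
  have mem: "jK x \<in> R" "jK x - jC (h x) \<in> J" if x: "x \<in> U" for x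
  proof -
    show xR: "jK x \<in> R" unfolding R_def span_of_def
      by (rule CollectI, rule exI[of _ "[(1, x)]"]) (use x in simp)
    have "H (lin [(1, x), (- h x, 1)]) = lsum (*) h [(1, x), (- h x, 1)]"
      unfolding H_def by (rule ex) (simp add: is_subringD(1)[OF U(1)] x)
    then have "H (jK x - jC (h x)) = 0" by (simp add: h1)
    then show "jK x - jC (h x) \<in> J" using xR c1 is_subringD(1-6)[OF R] by (simp add: J_def)
  qed
  have "jK z \<in> J" "jK z \<noteq> 0" using mem(2)[OF z(1)] z by simp_all
  then obtain P where "P \<in> curve_points jC" "R \<subseteq> P" "\<forall>x\<in>J. x \<noteq> 0 \<longrightarrow> inverse x \<notin> P"
    using exists_curve_point[OF R _ _ J1, of jC "jK z"] c1 unfolding J_def by blast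
  then show ?thesis using mem by (intro bexI[of _ P]) auto
qed

end

section \<open>Non-archimedean absolute values and the field C\<close>

locale nonarch_field =
  fixes v :: "'c::field \<Rightarrow> real"
  assumes nonarch: "nonarch_abs_value v"
begin

lemma v_nonneg [simp]: "0 \<le> v x" and v_eq_0 [simp]: "v x = 0 \<longleftrightarrow> x = 0"
  and v_mult: "v (x * y) = v x * v y" and v_add: "v (x + y) \<le> max (v x) (v y)"
  using nonarch by (auto simp: nonarch_abs_value_def)

lemma v_pos [simp]: "0 < v x \<longleftrightarrow> x \<noteq> 0"
  using v_nonneg[of x] v_eq_0[of x] by linarith

lemma v_0 [simp]: "v 0 = 0" by simp

lemma v_1 [simp]: "v 1 = 1"
  using v_mult[of 1 1] v_eq_0[of 1] by simp

lemma v_uminus [simp]: "v (- x) = v x"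
proof -
  have "v (- 1) ^ 2 = 1" using v_mult[of "-1" "-1"] by (simp add: power2_eq_square)
  then have "v (- 1) = 1" using v_nonneg[of "-1"] by (simp add: power2_eq_1_iff)
  then show ?thesis using v_mult[of "-1" x] by simp
qed

lemma v_diff: "v (x - y) \<le> max (v x) (v y)"
  using v_add[of x "- y"] by simp

lemma v_diff_commute: "v (x - y) = v (y - x)"
  using v_uminus[of "x - y"] by simp

lemma v_power: "v (x ^ n) = v x ^ n"
  by (induction n) (auto simp: v_mult)

lemma v_inverse: "v (inverse x) = inverse (v x)"
  using v_mult[of x "inverse x"] by (cases "x = 0") (auto simp: inverse_unique)

lemma v_divide: "v (x / y) = v x / v y"
  by (simp add: divide_inverse v_mult v_inverse)

lemma v_add_eq: "v y < v x \<Longrightarrow> v (x + y) = v x"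
  using v_add[of x y] v_diff[of "x + y" y] by (auto simp: max_def split: if_splits)

lemma v_sum_less: "0 < B \<Longrightarrow> (\<And>i. i \<in> I \<Longrightarrow> v (f i) < B) \<Longrightarrow> v (sum f I) < B"
proof (induction I rule: infinite_finite_induct)
  case (insert i I)
  then have "v (f i) < B" "v (sum f I) < B" by auto
  then show ?case using v_add[of "f i" "sum f I"] insert(1,2) by (simp add: max_def split: if_splits)
qed auto

lemma v_sum_distinct:
  assumes "finite I" "I \<noteq> {}" "\<And>i. i \<in> I \<Longrightarrow> f i \<noteq> 0" "inj_on (\<lambda>i. v (f i)) I"
  shows "sum f I \<noteq> 0"
proof -
  have "Max ((\<lambda>i. v (f i)) ` I) \<in> (\<lambda>i. v (f i)) ` I" using assms by (intro Max_in) auto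
  then obtain i where i: "i \<in> I" "v (f i) = Max ((\<lambda>i. v (f i)) ` I)" by auto
  have "v (sum f (I - {i})) < v (f i)"
  proof (rule v_sum_less)
    fix k assume k: "k \<in> I - {i}"
    then have "v (f k) \<noteq> v (f i)" using i(1) assms(4) by (auto dest: inj_onD)
    moreover have "v (f k) \<le> v (f i)" unfolding i(2) using k assms(1) by (intro Max_ge) auto
    ultimately show "v (f k) < v (f i)" by simp
  qed (use assms(3)[OF i(1)] in simp)
  then have "v (f i + sum f (I - {i})) = v (f i)" by (rule v_add_eq)
  then have "v (sum f I) = v (f i)" using i(1) assms(1) by (simp add: sum.remove)
  then show ?thesis using assms(3)[OF i(1)] by auto
qed

end

lemma completed_alg_closureD:
  fixes e :: "'f::{field,finite} fls alg_closure \<Rightarrow> 'c::field"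
  assumes "completed_alg_closure e v"
  shows "field_hom e" "nonarch_abs_value v"
    "c \<noteq> 0 \<Longrightarrow> v (const_C e c) = 1" "v (theta e) = real CARD('f)"
    "\<epsilon> > 0 \<Longrightarrow> \<exists>y. v (e y - x) < \<epsilon>"
    "(\<And>\<epsilon>. \<epsilon> > 0 \<Longrightarrow> \<exists>N. \<forall>m\<ge>N. \<forall>n\<ge>N. v (s m - s n) < \<epsilon>) \<Longrightarrow> \<exists>l. (\<lambda>n. v (s n - l)) \<longlonglongrightarrow> 0"
proof -
  show h: "field_hom e" and na: "nonarch_abs_value v" using assms by (auto simp: completed_alg_closure_def)
  interpret nonarch_field v by unfold_locales (rule na)
  have vf: "f \<noteq> 0 \<Longrightarrow> v (e (to_ac f)) = real CARD('f) powi (- fls_subdegree f)" for f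
    using assms by (auto simp: completed_alg_closure_def)
  show "c \<noteq> 0 \<Longrightarrow> v (const_C e c) = 1" using vf[of "fls_const c"] by (simp add: const_C_def)
  show "v (theta e) = real CARD('f)" using vf[of fls_X_inv] by (simp add: theta_def)
  interpret M: Metric_space UNIV "\<lambda>x y. v (x - y)"
  proof
    fix x y z
    show "v (x - y) = v (y - x)" by (rule v_diff_commute)
    have "v (x - z) \<le> max (v (x - y)) (v (y - z))" using v_add[of "x - y" "y - z"] by simp
    then show "v (x - z) \<le> v (x - y) + v (y - z)"
      using v_nonneg[of "x - y"] v_nonneg[of "y - z"] by linarith
  qed auto
  have d: "M.mtopology closure_of range e = UNIV" and c: "M.mcomplete"
    using assms by (auto simp: completed_alg_closure_def)
  show "\<exists>y. v (e y - x) < \<epsilon>" if "\<epsilon> > 0"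
  proof -
    have "x \<in> M.mtopology closure_of range e" by (simp add: d)
    then show ?thesis using that by (force simp: M.metric_closure_of M.in_mball v_diff_commute)
  qed
  show "\<exists>l. (\<lambda>n. v (s n - l)) \<longlonglongrightarrow> 0"
    if "\<And>\<epsilon>. \<epsilon> > 0 \<Longrightarrow> \<exists>N. \<forall>m\<ge>N. \<forall>n\<ge>N. v (s m - s n) < \<epsilon>"
  proof -
    have "M.MCauchy s" using that by (simp add: M.MCauchy_def)
    then obtain l where "limitin M.mtopology s l sequentially" using c by (auto simp: M.mcomplete_def)
    then show ?thesis unfolding M.limitin_metric_dist_null by auto
  qed
qed

lemma CHAR_eq_of_hom:
  assumes "field_hom (h :: 'f::field \<Rightarrow> 'c::field)"
  shows "CHAR('c) = CHAR('f)"
proof -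
  have h: "h (of_nat n) = of_nat n" for n by (induction n) (auto simp: field_hom_simps[OF assms])
  have "of_nat n = (0::'c) \<longleftrightarrow> of_nat n = (0::'f)" for n
    using field_hom_simps(9)[OF assms, of "of_nat n"] by (simp add: h)
  then have "CHAR('c) dvd n \<longleftrightarrow> CHAR('f) dvd n" for n by (simp add: of_nat_eq_0_iff_char_dvd)
  then show ?thesis by (meson dvd_antisym dvd_refl)
qed

lemma frobenius_over_finite_field:
  assumes h: "field_hom (h :: 'f::{field,finite} \<Rightarrow> 'c::field)"
  shows "prime CHAR('c)" "\<exists>n. CARD('f) = CHAR('c) ^ n"
    "(x + y :: 'c) ^ (CARD('f) ^ k) = x ^ (CARD('f) ^ k) + y ^ (CARD('f) ^ k)"
    "(x - y :: 'c) ^ (CARD('f) ^ k) = x ^ (CARD('f) ^ k) - y ^ (CARD('f) ^ k)"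
    "(sum g I :: 'c) ^ (CARD('f) ^ k) = (\<Sum>i\<in>I. g i ^ (CARD('f) ^ k))"
    "h c ^ (CARD('f) ^ k) = h c"
    "x ^ CARD('f) = x \<Longrightarrow> \<exists>c. x = h c"
    "x ^ (CARD('f) ^ k) = y ^ (CARD('f) ^ k) \<longleftrightarrow> x = y"
proof -
  show p: "prime CHAR('c)" unfolding CHAR_eq_of_hom[OF h] by (rule CARD_finite_field_prime_power)
  show n: "\<exists>n. CARD('f) = CHAR('c) ^ n" unfolding CHAR_eq_of_hom[OF h] by (rule CARD_finite_field_prime_power)
  then obtain n where "CARD('f) = CHAR('c) ^ n" ..
  then have q: "CARD('f) ^ k = CHAR('c) ^ (n * k)" by (simp add: power_mult)
  show add: "(x + y) ^ (CARD('f) ^ k) = x ^ (CARD('f) ^ k) + y ^ (CARD('f) ^ k)" for x y :: 'c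
    by (rule freshmans_dream'[OF p q])
  show diff: "(x - y) ^ (CARD('f) ^ k) = x ^ (CARD('f) ^ k) - y ^ (CARD('f) ^ k)" for x y :: 'c
    using add[of "x - y" y] by (simp add: eq_diff_eq)
  show "(sum g I :: 'c) ^ (CARD('f) ^ k) = (\<Sum>i\<in>I. g i ^ (CARD('f) ^ k))"
    by (rule freshmans_dream_sum'[OF p q])
  show "x ^ (CARD('f) ^ k) = y ^ (CARD('f) ^ k) \<longleftrightarrow> x = y"
    using diff[of x y] by (metis eq_iff_diff_eq_0 power_eq_0_iff)
  have fixd: "c ^ CARD('f) = c" for c :: 'f
  proof (cases "c = 0")
    case False
    \<comment> \<open>Multiplication by a nonzero \<open>c\<close> permutes the nonzero elements, so
      their product is unchanged when each is multiplied by \<open>c\<close>.\<close>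
    have "bij_betw ((*) c) (UNIV - {0}) (UNIV - {0})"
      by (rule bij_betwI[of _ _ _ "\<lambda>x. x / c"]) (use False in auto)
    then have "(\<Prod>x\<in>UNIV - {0}. x) = (\<Prod>x\<in>UNIV - {0}. c * x)"
      by (rule prod.reindex_bij_betw[symmetric])
    also have "\<dots> = c ^ (CARD('f) - 1) * (\<Prod>x\<in>UNIV - {0}. x)"
      by (simp add: prod.distrib card_Diff_singleton)
    finally have "c ^ (CARD('f) - 1) = 1" by simp
    moreover have "CARD('f) = Suc (CARD('f) - 1)" by simp
    ultimately show ?thesis by (metis mult.right_neutral power_Suc)
  qed simp
  show "h c ^ (CARD('f) ^ k) = h c"
  proof (induction k)
    case (Suc k)
    have "h c ^ (CARD('f) ^ Suc k) = (h c ^ CARD('f)) ^ (CARD('f) ^ k)" by (simp add: power_mult)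
    also have "h c ^ CARD('f) = h c" using fixd[of c] by (metis field_hom_simps(7)[OF h])
    finally show ?case using Suc by simp
  qed simp
  show "\<exists>c. x = h c" if x: "x ^ CARD('f) = x"
  proof -
    \<comment> \<open>The constants already account for q roots of X^q - X, so there is no room for
      others.\<close>
    define g :: "'c poly" where "g = monom 1 CARD('f) - monom 1 1"
    have "card {0, 1 :: 'f} \<le> CARD('f)" by (rule card_mono) auto
    then have c2: "CARD('f) > 1" by simp
    have "coeff g CARD('f) = 1" using c2 by (simp add: g_def)
    then have g0: "g \<noteq> 0" by auto
    have dg: "degree g \<le> CARD('f)" unfolding g_def using c2
      by (intro degree_diff_le) (auto intro: order_trans[OF degree_monom_le])
    have roots: "poly g z = 0 \<longleftrightarrow> z ^ CARD('f) = z" for z by (simp add: g_def poly_monom)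
    have "range h \<subseteq> {z. poly g z = 0}"
      using fixd by (auto simp: roots simp flip: field_hom_simps(7)[OF h])
    moreover have "card (range h) = CARD('f)"
      by (intro card_image) (auto simp: inj_on_def field_hom_simps[OF h])
    moreover have "finite {z. poly g z = 0}" by (rule poly_roots_finite[OF g0])
    moreover have "card {z. poly g z = 0} \<le> CARD('f)"
      using card_poly_roots_bound[OF g0] dg by simp
    ultimately have "range h = {z. poly g z = 0}" by (metis card_seteq)
    then show ?thesis using x by (auto simp: roots)
  qed
qed

lemma const_C_hom:
  assumes "field_hom e"
  shows "field_hom (const_C e)"
  by (simp add: field_hom_def const_C_def field_hom_simps[OF assms]
      flip: fls_const_mult_const fls_plus_const)

text \<open>The image of the algebraic closure is dense and has all q-th roots. Since the q-th power
  of a distance is the distance of the q-th powers, roots of an approximating sequence are again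
  Cauchy, and their limit is a root of the limit.\<close>

lemma completion_perfect:
  fixes e :: "'f::{field,finite} fls alg_closure \<Rightarrow> 'c::field"
  assumes c: "completed_alg_closure e v"
  shows "\<exists>d. d ^ CARD('f) = (x :: 'c)"
proof -
  note D = completed_alg_closureD[OF c]
  interpret nonarch_field v by unfold_locales (rule D)
  note F = frobenius_over_finite_field[OF const_C_hom[OF D(1)]]
  have q: "CARD('f) > 0" by simp
  have "\<exists>y. v (y ^ CARD('f) - x) < (1 / 2) ^ n" for n
  proof -
    obtain y where y: "v (e y - x) < (1 / 2) ^ n" using D(5)[of "(1 / 2) ^ n" x] by auto
    obtain z where "z ^ CARD('f) = y" using nth_root_exists[of "CARD('f)" y] by auto
    then have "e z ^ CARD('f) = e y" by (simp flip: field_hom_simps(7)[OF D(1)])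
    then show ?thesis using y by (intro exI[of _ "e z"]) simp
  qed
  then obtain s where s: "\<And>n. v (s n ^ CARD('f) - x) < (1 / 2) ^ n" by metis
  have sd: "v (s m - s n) ^ CARD('f) < (1 / 2) ^ N" if "N \<le> m" "N \<le> n" for m n N
  proof -
    have "v (s m - s n) ^ CARD('f) = v ((s m ^ CARD('f) - x) - (s n ^ CARD('f) - x))"
      using F(4)[of "s m" "s n" 1] by (simp flip: v_power)
    also have "\<dots> \<le> max (v (s m ^ CARD('f) - x)) (v (s n ^ CARD('f) - x))" by (rule v_diff)
    also have "\<dots> < (1 / 2) ^ N"
      using less_le_trans[OF s[of m] power_decreasing[OF that(1)]]
        less_le_trans[OF s[of n] power_decreasing[OF that(2)]] by simp
    finally show ?thesis .
  qed
  have "\<exists>l. (\<lambda>n. v (s n - l)) \<longlonglongrightarrow> 0"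
  proof (rule D(6))
    fix \<epsilon> :: real assume e: "\<epsilon> > 0"
    then obtain N where N: "(1 / 2) ^ N < \<epsilon> ^ CARD('f)"
      using real_arch_pow_inv[of "\<epsilon> ^ CARD('f)" "1 / 2"] by auto
    have "v (s m - s n) < \<epsilon>" if "m \<ge> N" "n \<ge> N" for m n
      using sd[OF that] N e by (meson less_trans less_imp_le power_less_imp_less_base)
    then show "\<exists>N. \<forall>m\<ge>N. \<forall>n\<ge>N. v (s m - s n) < \<epsilon>" by blast
  qed
  then obtain l where l: "(\<lambda>n. v (s n - l)) \<longlonglongrightarrow> 0" ..
  have "(\<lambda>n. v (s n - l) ^ CARD('f)) \<longlonglongrightarrow> 0 ^ CARD('f)" by (intro tendsto_intros l)
  moreover have "(0::real) ^ CARD('f) = 0" using q by simp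
  ultimately have 1: "(\<lambda>n. v (s n - l) ^ CARD('f)) \<longlonglongrightarrow> 0" by (simp only:)
  have 2: "(\<lambda>n. (1 / 2 :: real) ^ n) \<longlonglongrightarrow> 0" by (intro LIMSEQ_realpow_zero) auto
  have "v (l ^ CARD('f) - x) \<le> v (s n - l) ^ CARD('f) + (1 / 2) ^ n" for n
  proof -
    have "l ^ CARD('f) - x = (s n ^ CARD('f) - x) - (s n - l) ^ CARD('f)"
      using F(4)[of "s n" l 1] by simp
    then have "v (l ^ CARD('f) - x) \<le> max (v (s n ^ CARD('f) - x)) (v (s n - l) ^ CARD('f))"
      by (metis v_diff v_power)
    also have "\<dots> \<le> v (s n - l) ^ CARD('f) + (1 / 2) ^ n" 
    proof -
      have *: "max a b \<le> b + c" if "a < c" "0 \<le> b" "0 \<le> c" for a b c :: real using that by (auto simp: max_def)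
      show ?thesis by (rule *) (use s[of n] in simp_all)
    qed
    finally show ?thesis .
  qed
  then have "v (l ^ CARD('f) - x) \<le> 0 + 0" by (intro LIMSEQ_le_const[OF tendsto_add[OF 1 2]]) auto
  then have "v (l ^ CARD('f) - x) = 0" by (intro antisym) simp_all
  then have "l ^ CARD('f) = x" by simp
  then show ?thesis ..
qed

text \<open>Over the algebraic closure \<open>g\<close> splits, and its leading coefficient has
  absolute value 1. So the value of \<open>g\<close> at \<open>x\<close> has the size of the product
  of the distances from \<open>x\<close> to the roots, and one of these must be below 1. This does
  the work of lifting roots from the residue field.\<close>

lemma completion_residue_root:
  fixes e :: "'f::{field,finite} fls alg_closure \<Rightarrow> 'c::field"
  assumes c: "completed_alg_closure e v" and g: "g \<noteq> 0" "v (poly (map_poly (const_C e) g) x) < 1"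
  shows "\<exists>\<zeta>. poly (map_poly (const_C e) g) \<zeta> = 0 \<and> v (x - \<zeta>) < 1"
proof -
  note D = completed_alg_closureD[OF c]
  interpret nonarch_field v by unfold_locales (rule D)
  define k :: "'f \<Rightarrow> 'f fls alg_closure" where "k c = to_ac (fls_const c)" for c
  have k: "field_hom k" by (simp add: k_def field_hom_def flip: fls_const_mult_const fls_plus_const)
  have cC: "const_C e = (\<lambda>c. e (k c))" by (auto simp: const_C_def k_def)
  have mp: "map_poly (const_C e) g = map_poly e (map_poly k g)"
    by (rule poly_eqI) (simp add: coeff_map_poly_hom const_C_hom D(1) k cC field_hom_comp)
  have "map_poly k g \<noteq> 0" using g map_poly_hom_simps(3)[OF k] by simp
  then obtain Z where Z: "map_poly k g = smult (lead_coeff (map_poly k g)) (\<Prod>z\<in>#Z. [:- z, 1:])"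
    using alg_closed_imp_factorization by blast
  define l where "l = e (lead_coeff (map_poly k g))"
  have "lead_coeff (map_poly k g) = k (lead_coeff g)"
    by (simp add: map_poly_hom_simps(5)[OF k] coeff_map_poly_hom[OF k])
  then have vl: "v l = 1" using D(3)[of "lead_coeff g"] g(1) by (simp add: l_def cC)
  have pr: "map_poly e (\<Prod>z\<in>#Z. [:- z, 1:]) = (\<Prod>z\<in>#Z. [:- e z, 1:])"
  proof (induction Z)
    case (add z Z)
    have "map_poly e (\<Prod>z\<in>#add_mset z Z. [:- z, 1:]) = map_poly e [:- z, 1:] * map_poly e (\<Prod>z\<in>#Z. [:- z, 1:])"
      by (simp only: map_poly_hom_simps(2)[OF D(1), symmetric] image_mset_add_mset prod_mset.add_mset)
    then show ?case using add by (simp add: map_poly_pCons field_hom_simps[OF D(1)])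
  qed (simp add: map_poly_1' field_hom_simps[OF D(1)])
  have fac: "map_poly (const_C e) g = smult l (\<Prod>z\<in>#Z. [:- e z, 1:])"
    unfolding mp pr[symmetric] l_def
    by (subst Z) (auto intro!: poly_eqI simp: coeff_map_poly_hom[OF D(1)] field_hom_simps[OF D(1)])
  have ev: "poly (map_poly (const_C e) g) y = l * (\<Prod>z\<in>#Z. y - e z)" for y
    unfolding fac by (simp add: poly_prod_mset image_mset.compositionality o_def)
  have "v (\<Prod>z\<in>#Z. x - e z) = (\<Prod>z\<in>#Z. v (x - e z))" by (induction Z) (auto simp: v_mult)
  then have lt: "(\<Prod>z\<in>#Z. v (x - e z)) < 1" using g(2) by (simp add: ev v_mult vl)
  have "\<exists>z. z \<in># Z \<and> v (x - e z) < 1"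
  proof (rule ccontr)
    assume "\<not> ?thesis"
    then have "\<And>z. z \<in># Z \<Longrightarrow> 1 \<le> v (x - e z)" by (meson not_less)
    then have "1 \<le> (\<Prod>z\<in>#Z. v (x - e z))"
    proof (induction Z)
      case (add z Z)
      then show ?case using mult_mono[of 1 "v (x - e z)" 1 "\<Prod>z\<in>#Z. v (x - e z)"] by simp
    qed simp
    then show False using lt by simp
  qed
  then obtain z where z: "z \<in># Z" "v (x - e z) < 1" by blast
  have "(\<Prod>w\<in>#Z. e z - e w) = 0" using z(1) by (auto simp: prod_mset_zero_iff)
  then show ?thesis using z by (intro exI[of _ "e z"]) (simp add: ev)
qed

section \<open>Fractions of polynomials and separable equations\<close>

lemma poly_fract_simps:
  "poly_fract (p + p') = poly_fract p + poly_fract p'" "poly_fract (p * p') = poly_fract p * poly_fract p'"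
  "poly_fract 1 = 1" "poly_fract p = 0 \<longleftrightarrow> p = 0" "poly_fract 0 = 0"
  by (simp_all add: poly_fract_def Zero_fract_def One_fract_def eq_fract)

lemma fract_eq_quotient: "\<exists>u w. w \<noteq> 0 \<and> x = poly_fract u / poly_fract w"
proof (cases x)
  case (Fract a b)
  then show ?thesis by (intro exI[of _ a] exI[of _ b]) (simp add: poly_fract_def)
qed

lemma common_denominator:
  fixes c :: "nat \<Rightarrow> 'f::field poly fract"
  shows "\<exists>d u. d \<noteq> 0 \<and> (\<forall>i\<le>n. poly_fract d * c i = poly_fract (u i))"
proof (induction n)
  case 0
  obtain u w where "w \<noteq> 0" "c 0 = poly_fract u / poly_fract w" using fract_eq_quotient by blast
  then show ?case by (intro exI[of _ w] exI[of _ "\<lambda>_. u"]) (simp add: poly_fract_simps)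
next
  case (Suc n)
  then obtain d u where du: "d \<noteq> 0" "\<forall>i\<le>n. poly_fract d * c i = poly_fract (u i)" by blast
  obtain a w where aw: "w \<noteq> 0" "c (Suc n) = poly_fract a / poly_fract w" using fract_eq_quotient by blast
  have "poly_fract (d * w) * c i = poly_fract (if i = Suc n then d * a else w * u i)" if "i \<le> Suc n" for i
    using that du aw by (auto simp: poly_fract_simps le_Suc_eq mult_ac)
  then show ?case using du aw
    by (intro exI[of _ "d * w"] exI[of _ "\<lambda>i. if i = Suc n then d * a else w * u i"]) simp
qed

lemma poly_pderiv_sum:
  fixes p :: "'a::idom poly"
  assumes "degree p \<le> n"
  shows "poly (pderiv p) x = (\<Sum>i\<le>n. of_nat i * coeff p i * x ^ (i - 1))"
proof -
  have "p = (\<Sum>i\<le>n. monom (coeff p i) i)" using assms by (simp add: poly_as_sum_of_monoms')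
  then have "pderiv p = pderiv (\<Sum>i\<le>n. monom (coeff p i) i)" by simp
  also have "\<dots> = (\<Sum>i\<le>n. pderiv (monom (coeff p i) i))"
    by (induction n) (auto simp: pderiv_add)
  finally show ?thesis by (simp add: pderiv_monom poly_sum poly_monom)
qed

text \<open>A polynomial of least degree among those vanishing at \<open>x\<close> divides all of
  them, so it would be a common divisor. Applied to a polynomial and its derivative, this makes the
  root of a separable equation simple.\<close>

lemma coprime_roots:
  fixes p p' :: "'a::field poly" and h :: "'a \<Rightarrow> 'k::field"
  assumes h: "field_hom h" and c: "coprime p p'" and z: "poly (map_poly h p) x = 0" "poly (map_poly h p') x = 0"
  shows "p = 0 \<and> p' = 0"
proof (rule ccontr)
  assume "\<not> ?thesis"
  then have ne: "\<exists>g. g \<noteq> 0 \<and> poly (map_poly h g) x = 0" using z by auto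
  then obtain g where g: "g \<noteq> 0" "poly (map_poly h g) x = 0"
      "\<And>f. f \<noteq> 0 \<Longrightarrow> poly (map_poly h f) x = 0 \<Longrightarrow> degree g \<le> degree f"
    using ex_has_least_nat[of "\<lambda>g. g \<noteq> 0 \<and> poly (map_poly h g) x = 0" _ degree] by blast
  have dv: "g dvd f" if f: "poly (map_poly h f) x = 0" for f
  proof -
    have "map_poly h f = map_poly h (f div g) * map_poly h g + map_poly h (f mod g)"
      by (simp flip: map_poly_hom_simps(1,2)[OF h])
    then have "poly (map_poly h (f mod g)) x = 0" using f g(2) by simp
    then have "f mod g = 0" using g(3)[of "f mod g"] degree_mod_less[OF g(1), of f] by (cases "f mod g = 0") auto
    then show ?thesis by (simp add: mod_eq_0_iff_dvd)
  qed
  have "is_unit g" using c dv[OF z(1)] dv[OF z(2)] by (simp add: coprime_def)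
  then obtain a where a: "g = [:a:]" "a \<noteq> 0" by (auto simp: is_unit_poly_iff dvd_field_iff)
  then show False using g(2) field_hom_simps[OF h] by (simp add: map_poly_pCons)
qed

section \<open>The place at infinity\<close>

text \<open>\<open>\<alpha>0\<close> is an arbitrary reference embedding through which elements of K
  are measured; \<open>emb_value_unique\<close> shows that the absolute value does not depend on
  it.\<close>

locale cm_curve = nonarch_field v +
  scalar_extension "\<lambda>c. j (poly_fract [:c:])" iC jK jC
  for j :: "'f::{field,finite} poly fract \<Rightarrow> 'k::field" and iC :: "'f \<Rightarrow> 'c::field"
    and jK :: "'k \<Rightarrow> 'l::field" and jC :: "'c \<Rightarrow> 'l" and v :: "'c \<Rightarrow> real" +
  fixes q r :: nat and \<theta> :: 'c and Pinf :: "'l set" and \<alpha>0 :: "'k \<Rightarrow> 'c"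
  assumes q_def: "q = CARD('f)"
    and ext: "finite_separable_extension j r"
    and v_iC: "c \<noteq> 0 \<Longrightarrow> v (iC c) = 1" and v_theta: "v \<theta> = real q"
    and residue_root: "g \<noteq> 0 \<Longrightarrow> v (poly (map_poly iC g) x) < 1 \<Longrightarrow>
          \<exists>\<zeta>. poly (map_poly iC g) \<zeta> = 0 \<and> v (x - \<zeta>) < 1"
    and over_inf: "points_over_infinity jC (jK (j T_fract)) = {Pinf}"
    and \<alpha>0: "field_hom \<alpha>0" "\<alpha>0 (j (poly_fract [:c:])) = iC c" "\<alpha>0 (j T_fract) = \<theta>"
begin

abbreviation iK :: "'f \<Rightarrow> 'k" where "iK c \<equiv> j (poly_fract [:c:])"
abbreviation TK :: 'k where "TK \<equiv> j T_fract"
abbreviation A :: "'k set" where "A \<equiv> regular_outside jK jC Pinf"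

definition J :: "'f poly \<Rightarrow> 'k" where "J p = j (poly_fract p)"

definition emb :: "('k \<Rightarrow> 'c) \<Rightarrow> bool" where
  "emb \<alpha> \<longleftrightarrow> field_hom \<alpha> \<and> (\<forall>c. \<alpha> (iK c) = iC c) \<and> \<alpha> TK = \<theta>"

lemma emb0: "emb \<alpha>0" using \<alpha>0 by (simp add: emb_def)

lemma embD: "emb \<alpha> \<Longrightarrow> field_hom \<alpha>" "emb \<alpha> \<Longrightarrow> \<alpha> (iK c) = iC c" "emb \<alpha> \<Longrightarrow> \<alpha> TK = \<theta>"
  by (auto simp: emb_def)

lemma hom_j: "field_hom j" using ext by (simp add: finite_separable_extension_def)

lemmas frob = frobenius_over_finite_field[OF hom_iC, folded q_def]

lemma q_gt_1: "q > 1"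
proof -
  have "card {0, 1 :: 'f} \<le> q" unfolding q_def by (rule card_mono) auto
  then show ?thesis by simp
qed

lemma J_simps [simp]: "J 0 = 0" "J 1 = 1" "J (p + p') = J p + J p'" "J (p * p') = J p * J p'"
  "J p = 0 \<longleftrightarrow> p = 0" "J [:c:] = iK c" "J [:0, 1:] = TK"
  by (simp_all add: J_def poly_fract_simps field_hom_simps[OF hom_j] T_fract_def)

lemma j_poly_fract_0 [simp]: "j (poly_fract 0) = 0"
  using J_simps(1) by (simp only: J_def)

lemma J_pCons: "J (pCons c p) = iK c + TK * J p"
proof -
  have "pCons c p = [:c:] + [:0, 1:] * p" by simp
  then show ?thesis by (simp only: J_simps)
qed

lemma J_altdef: "J p = poly (map_poly iK p) TK"
  by (induction p) (auto simp: J_pCons map_poly_pCons)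

lemma emb_J: "emb \<alpha> \<Longrightarrow> \<alpha> (J p) = poly (map_poly iC p) \<theta>"
  by (induction p) (auto simp: J_pCons map_poly_pCons embD field_hom_simps[OF embD(1)])

lemma v_poly_theta: "p \<noteq> 0 \<Longrightarrow> v (poly (map_poly iC p) \<theta>) = real q ^ degree p"
proof (induction p)
  case (pCons c p)
  show ?case
  proof (cases "p = 0")
    case True
    then show ?thesis using pCons(1) v_iC by (simp add: map_poly_pCons)
  next
    case False
    have "v (iC c) \<le> 1" using v_iC[of c] by (cases "c = 0") auto
    moreover have "(1::real) < real q ^ Suc (degree p)" using q_gt_1 by (intro one_less_power) auto
    moreover have "v (\<theta> * poly (map_poly iC p) \<theta>) = real q ^ Suc (degree p)" using pCons False by (simp add: v_mult v_theta)
    ultimately have "v (\<theta> * poly (map_poly iC p) \<theta> + iC c) = real q ^ Suc (degree p)" by (subst v_add_eq) auto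
    then show ?thesis using False by (simp add: map_poly_pCons add.commute)
  qed
qed simp

lemma v_emb_J: "emb \<alpha> \<Longrightarrow> p \<noteq> 0 \<Longrightarrow> v (\<alpha> (J p)) = real q ^ degree p"
  by (simp add: emb_J v_poly_theta)

text \<open>Separability with denominators cleared: the coefficients are polynomials in T, so that
  the equation and its derivative can later be specialised at T = \<theta>.\<close>

lemma separable_relation:
  "\<exists>n P. (\<Sum>i\<le>n. J (P i) * x ^ i) = 0 \<and> (\<Sum>i\<le>n. of_nat i * J (P i) * x ^ (i - 1)) \<noteq> 0"
proof -
  obtain p where p: "irreducible p" "coprime p (pderiv p)" "poly (map_poly j p) x = 0"
    using ext unfolding finite_separable_extension_def by blast
  have p0: "p \<noteq> 0" using p(1) by auto
  define n where "n = degree p"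
  have d0: "poly (pderiv (map_poly j p)) x \<noteq> 0"
    using coprime_roots[OF hom_j p(2,3)] p0 map_poly_hom_simps(4)[OF hom_j, of p] by auto
  obtain d u where du: "d \<noteq> 0" "\<forall>i\<le>n. poly_fract d * coeff p i = poly_fract (u i)"
    using common_denominator by blast
  have u: "J (u i) = J d * coeff (map_poly j p) i" if "i \<le> n" for i
    using du(2) that by (simp add: J_def coeff_map_poly_hom[OF hom_j] flip: field_hom_simps(6)[OF hom_j])
  have dg: "degree (map_poly j p) = n" by (simp add: n_def map_poly_hom_simps[OF hom_j])
  have "(\<Sum>i\<le>n. J (u i) * x ^ i) = (\<Sum>i\<le>n. J d * (coeff (map_poly j p) i * x ^ i))"
    by (intro sum.cong) (auto simp: u)
  also have "\<dots> = J d * poly (map_poly j p) x" by (simp add: poly_altdef dg sum_distrib_left)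
  finally have 1: "(\<Sum>i\<le>n. J (u i) * x ^ i) = 0" using p by simp
  have "(\<Sum>i\<le>n. of_nat i * J (u i) * x ^ (i - 1))
      = (\<Sum>i\<le>n. J d * (of_nat i * coeff (map_poly j p) i * x ^ (i - 1)))"
    by (intro sum.cong) (auto simp: u)
  also have "\<dots> = J d * poly (pderiv (map_poly j p)) x"
    by (simp add: poly_pderiv_sum[OF eq_refl[OF dg]] sum_distrib_left)
  finally have "(\<Sum>i\<le>n. of_nat i * J (u i) * x ^ (i - 1)) \<noteq> 0" using d0 du(1) by simp
  with 1 show ?thesis by blast
qed

lemma relation: "\<exists>n P. (\<Sum>i\<le>n. J (P i) * x ^ i) = 0 \<and> (\<exists>i\<le>n. P i \<noteq> 0)"
proof -
  obtain n P where "(\<Sum>i\<le>n. J (P i) * x ^ i) = 0" "(\<Sum>i\<le>n. of_nat i * J (P i) * x ^ (i - 1)) \<noteq> 0"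
    using separable_relation[of x] by blast
  moreover from this(2) obtain i where "i \<le> n" "of_nat i * J (P i) * x ^ (i - 1) \<noteq> 0"
    by (metis (no_types, lifting) atMost_iff sum.neutral)
  ultimately show ?thesis by (intro exI[of _ n] exI[of _ P]) auto
qed

text \<open>The algebraic closure of the constant field in C, described as the elements fixed by
  some power of the Frobenius. It serves as a system of representatives for residues.\<close>

definition Fbar :: "'c set" where "Fbar = {z. \<exists>m>0. z ^ (q ^ m) = z}"

lemma Fbar_power: "(z :: 'c) ^ (q ^ m) = z \<Longrightarrow> z ^ (q ^ (m * n)) = z"
proof (induction n)
  case (Suc n)
  have "q ^ (m * Suc n) = q ^ m * q ^ (m * n)" by (simp add: power_add)
  then have "z ^ (q ^ (m * Suc n)) = (z ^ (q ^ m)) ^ (q ^ (m * n))" by (simp only: power_mult[of z])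
  then show ?case using Suc by simp
qed simp

lemma Fbar_pair:
  assumes "z \<in> Fbar" "w \<in> Fbar"
  obtains m where "m > 0" "z ^ (q ^ m) = z" "w ^ (q ^ m) = w"
proof -
  obtain m n where "m > 0" "z ^ (q ^ m) = z" "n > 0" "w ^ (q ^ n) = w" using assms by (auto simp: Fbar_def)
  then show ?thesis using that[of "m * n"] Fbar_power[of z m n] Fbar_power[of w n m] by (simp add: mult.commute)
qed

lemma Fbar_closed: "z \<in> Fbar \<Longrightarrow> w \<in> Fbar \<Longrightarrow> z + w \<in> Fbar"
  "z \<in> Fbar \<Longrightarrow> w \<in> Fbar \<Longrightarrow> z - w \<in> Fbar"  "z \<in> Fbar \<Longrightarrow> w \<in> Fbar \<Longrightarrow> z * w \<in> Fbar"
proof -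
  assume "z \<in> Fbar" "w \<in> Fbar"
  then obtain m where "m > 0" "z ^ (q ^ m) = z" "w ^ (q ^ m) = w" by (rule Fbar_pair)
  then show "z + w \<in> Fbar" "z - w \<in> Fbar" "z * w \<in> Fbar" unfolding Fbar_def
    by (intro CollectI exI[of _ m]; simp add: frob power_mult_distrib)+
qed

lemma Fbar_iC: "iC c \<in> Fbar"
  unfolding Fbar_def using frob(6)[of c 1] by (intro CollectI exI[of _ 1]) simp

lemma v_Fbar: "z \<in> Fbar \<Longrightarrow> z \<noteq> 0 \<Longrightarrow> v z = 1"
proof -
  assume z: "z \<in> Fbar" "z \<noteq> 0"
  then obtain m where m: "m > 0" "z ^ (q ^ m) = z" by (auto simp: Fbar_def)
  have "1 < q ^ m" using q_gt_1 m(1) by (intro one_less_power) auto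
  then obtain k where k: "q ^ m = Suc k" "k > 0" by (cases "q ^ m") auto
  have "z * z ^ k = z" using m(2) unfolding k by simp
  then have "v z ^ k = 1" using z by (simp flip: v_power)
  then show "v z = 1" using k power_eq_iff_eq_base[of k "v z" 1] by simp
qed

text \<open>The Frobenius maps roots of a polynomial with constant coefficients to roots, so the
  orbit of \<open>z\<close> is finite; as the Frobenius is injective, a repetition in the orbit
  makes \<open>z\<close> itself periodic.\<close>

lemma Fbar_root:
  assumes "g \<noteq> 0" "poly (map_poly iC g) z = 0"
  shows "z \<in> Fbar"
proof -
  have "poly (map_poly iC g) (z ^ (q ^ i)) = poly (map_poly iC g) z ^ (q ^ i)" for i
    by (simp add: poly_altdef frob power_mult_distrib coeff_map_poly_hom[OF hom_iC] power_commutes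
        flip: power_mult) (simp add: mult.commute)
  then have "range (\<lambda>i. z ^ (q ^ i)) \<subseteq> {x. poly (map_poly iC g) x = 0}"
    using assms(2) q_gt_1 by auto
  moreover have "finite {x. poly (map_poly iC g) x = 0}"
    by (rule poly_roots_finite) (use assms(1) in \<open>simp add: map_poly_hom_simps[OF hom_iC]\<close>)
  ultimately have "finite (range (\<lambda>i. z ^ (q ^ i)))" by (rule finite_subset)
  then have "\<not> inj (\<lambda>i. z ^ (q ^ i))" using finite_imageD infinite_UNIV_nat by blast
  then obtain a b where "a < b" "z ^ (q ^ a) = z ^ (q ^ b)"
    unfolding inj_def by (metis linorder_neqE_nat)
  moreover have "z ^ (q ^ b) = (z ^ (q ^ (b - a))) ^ (q ^ a)"
    using \<open>a < b\<close> by (simp flip: power_mult power_add)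
  ultimately have "z ^ (q ^ (b - a)) = z" using frob(8)[of z a "z ^ (q ^ (b - a))"] by simp
  then show ?thesis using \<open>a < b\<close> unfolding Fbar_def by (intro CollectI exI[of _ "b - a"]) simp
qed

text \<open>In an algebraic equation for \<open>x\<close> let \<open>d\<close> be the highest degree
  in T of a coefficient. Dividing by \<theta>^d, only the coefficients of T^d survive up to an error
  below 1, and they form a nonzero polynomial \<open>g\<close> over the constants that is small at
  \<open>\<alpha> x\<close>.\<close>

lemma residue_exists:
  assumes a: "emb \<alpha>" and x: "v (\<alpha> x) \<le> 1"
  shows "\<exists>z\<in>Fbar. v (\<alpha> x - z) < 1"
proof -
  note h = field_hom_simps[OF embD(1)[OF a]]
  obtain n P where P: "(\<Sum>i\<le>n. J (P i) * x ^ i) = 0" "\<exists>i\<le>n. P i \<noteq> 0" using relation by blast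
  define S where "S = {i. i \<le> n \<and> P i \<noteq> 0}"
  have S: "finite S" "S \<noteq> {}" using P(2) by (auto simp: S_def)
  define d where "d = Max ((\<lambda>i. degree (P i)) ` S)"
  have "d \<in> (\<lambda>i. degree (P i)) ` S" unfolding d_def using S by (intro Max_in) auto
  then obtain i0 where i0: "i0 \<le> n" "P i0 \<noteq> 0" "degree (P i0) = d" by (auto simp: S_def)
  have dd: "degree (P i) \<le> d" if "i \<le> n" for i
    using that S Max_ge[of "(\<lambda>i. degree (P i)) ` S" "degree (P i)"] unfolding d_def
    by (cases "P i = 0") (auto simp: S_def)
  define g where "g = (\<Sum>i\<le>n. monom (coeff (P i) d) i)"
  have cg: "coeff g i = (if i \<le> n then coeff (P i) d else 0)" for i
    by (simp add: g_def coeff_sum)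
  have g0: "g \<noteq> 0" using i0 cg[of i0] by auto
  have dg: "degree g \<le> n" unfolding g_def by (intro degree_sum_le) (auto intro: order_trans[OF degree_monom_le])
  have pg: "poly (map_poly iC g) y = (\<Sum>i\<le>n. iC (coeff (P i) d) * y ^ i)" for y
  proof -
    have "poly (map_poly iC g) y = (\<Sum>i\<le>n. coeff (map_poly iC g) i * y ^ i)"
      unfolding poly_altdef map_poly_hom_simps(5)[OF hom_iC] using dg
      by (intro sum.mono_neutral_left) (auto simp: coeff_map_poly_hom[OF hom_iC] coeff_eq_0)
    then show ?thesis by (simp add: coeff_map_poly_hom[OF hom_iC] cg)
  qed
  define E where "E i = poly (map_poly iC (P i)) \<theta> - iC (coeff (P i) d) * \<theta> ^ d" for i
  have vE: "v (E i) < real q ^ d" if i: "i \<le> n" for i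
  proof -
    define R where "R = P i - monom (coeff (P i) d) d"
    have P_eq: "P i = R + monom (coeff (P i) d) d" by (simp add: R_def)
    have "map_poly iC (monom (coeff (P i) d) d) = monom (iC (coeff (P i) d)) d"
      by (rule poly_eqI) (simp add: coeff_map_poly_hom[OF hom_iC])
    then have "E i = poly (map_poly iC R) \<theta>" unfolding E_def
      by (subst P_eq) (simp add: map_poly_hom_simps[OF hom_iC] poly_monom)
    moreover have "R = 0 \<or> degree R < d"
    proof (rule ccontr)
      assume c: "\<not> ?thesis"
      have "degree R \<le> d" unfolding R_def using dd[OF i] degree_monom_le by (intro degree_diff_le)
      then have "degree R = d" using c by auto
      moreover have "coeff R d = 0" by (simp add: R_def)
      ultimately show False using c by auto
    qed
    ultimately show ?thesis using v_poly_theta[of R] q_gt_1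
      by (cases "R = 0") (auto intro: power_strict_increasing)
  qed
  have "\<alpha> (\<Sum>i\<le>n. J (P i) * x ^ i) = 0" using P(1) h by simp
  then have "(\<Sum>i\<le>n. poly (map_poly iC (P i)) \<theta> * \<alpha> x ^ i) = 0" by (simp add: h emb_J[OF a])
  then have "(\<Sum>i\<le>n. E i * \<alpha> x ^ i) = - (\<theta> ^ d * poly (map_poly iC g) (\<alpha> x))"
    by (simp add: E_def pg algebra_simps sum_subtractf sum_distrib_left)
  then have "v (\<theta> ^ d * poly (map_poly iC g) (\<alpha> x)) = v (\<Sum>i\<le>n. E i * \<alpha> x ^ i)" by simp
  also have "\<dots> < real q ^ d"
  proof (rule v_sum_less)
    fix i assume "i \<in> {..n}"
    then have "v (E i) < real q ^ d" using vE by simp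
    moreover have "v (\<alpha> x) ^ i \<le> 1" using x by (intro power_le_one) auto
    then have "v (E i) * v (\<alpha> x) ^ i \<le> v (E i)" using mult_left_mono[of _ 1 "v (E i)"] by fastforce
    ultimately show "v (E i * \<alpha> x ^ i) < real q ^ d" by (simp add: v_mult v_power)
  qed (use q_gt_1 in simp)
  finally have "v (poly (map_poly iC g) (\<alpha> x)) < 1" using q_gt_1 by (simp add: v_mult v_power v_theta)
  from residue_root[OF g0 this] show ?thesis using Fbar_root[OF g0] by blast
qed

definition residue :: "('k \<Rightarrow> 'c) \<Rightarrow> 'k \<Rightarrow> 'c" where
  "residue \<alpha> x = (SOME z. z \<in> Fbar \<and> v (\<alpha> x - z) < 1)"

lemma residue: "emb \<alpha> \<Longrightarrow> v (\<alpha> x) \<le> 1 \<Longrightarrow> residue \<alpha> x \<in> Fbar \<and> v (\<alpha> x - residue \<alpha> x) < 1"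
  unfolding residue_def by (rule someI_ex) (use residue_exists in blast)

text \<open>Distinct elements of \<open>Fbar\<close> have distance exactly 1, so at most one of them
  is closer than 1 to \<open>\<alpha> x\<close>.\<close>

lemma residue_eqI:
  assumes "emb \<alpha>" "v (\<alpha> x) \<le> 1" "z \<in> Fbar" "v (\<alpha> x - z) < 1"
  shows "residue \<alpha> x = z"
proof (rule ccontr)
  assume ne: "residue \<alpha> x \<noteq> z"
  note R = residue[OF assms(1,2)]
  have "v (residue \<alpha> x - z) = 1" using Fbar_closed(2)[of _ z] R assms(3) ne by (intro v_Fbar) auto
  moreover have "v (residue \<alpha> x - z) \<le> max (v (\<alpha> x - z)) (v (\<alpha> x - residue \<alpha> x))"
    using v_diff[of "\<alpha> x - z" "\<alpha> x - residue \<alpha> x"] by simp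
  ultimately show False using R assms(4) by (simp add: max_def split: if_splits)
qed

lemma residue_hom:
  assumes a: "emb \<alpha>" and xy: "v (\<alpha> x) \<le> 1" "v (\<alpha> y) \<le> 1"
  shows "residue \<alpha> (x + y) = residue \<alpha> x + residue \<alpha> y" "residue \<alpha> (x * y) = residue \<alpha> x * residue \<alpha> y"
    "residue \<alpha> (iK c) = iC c" "v (\<alpha> (x - y)) \<le> 1" "v (\<alpha> (x * y)) \<le> 1"
proof -
  note h = field_hom_simps[OF embD(1)[OF a]]
  note rx = residue[OF a xy(1)] and ry = residue[OF a xy(2)]
  show "v (\<alpha> (x - y)) \<le> 1" using v_diff[of "\<alpha> x" "\<alpha> y"] xy by (simp add: h)
  show p: "v (\<alpha> (x * y)) \<le> 1" using xy by (simp add: h v_mult mult_le_one)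
  have s: "v (\<alpha> (x + y)) \<le> 1" using v_add[of "\<alpha> x" "\<alpha> y"] xy by (simp add: h)
  have "v (\<alpha> (iK c)) \<le> 1" using v_iC[of c] by (cases "c = 0") (simp_all add: embD(2)[OF a] h)
  then show "residue \<alpha> (iK c) = iC c"
    by (rule residue_eqI[OF a _ Fbar_iC]) (simp add: embD(2)[OF a])
  have e: "\<alpha> (x + y) - (residue \<alpha> x + residue \<alpha> y) = (\<alpha> x - residue \<alpha> x) + (\<alpha> y - residue \<alpha> y)" by (simp add: h)
  have "v (\<alpha> (x + y) - (residue \<alpha> x + residue \<alpha> y)) < 1"
    unfolding e by (rule le_less_trans[OF v_add]) (use rx ry in simp)
  then show "residue \<alpha> (x + y) = residue \<alpha> x + residue \<alpha> y"
    using rx ry by (intro residue_eqI[OF a s] Fbar_closed) auto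
  have "v (residue \<alpha> y) \<le> 1" using v_Fbar[of "residue \<alpha> y"] ry by (cases "residue \<alpha> y = 0") auto
  then have "v ((\<alpha> x - residue \<alpha> x) * residue \<alpha> y) < 1"
    using rx mult_left_mono[of "v (residue \<alpha> y)" 1 "v (\<alpha> x - residue \<alpha> x)"] by (simp add: v_mult)
  moreover have "v (\<alpha> x * (\<alpha> y - residue \<alpha> y)) < 1"
    using ry xy mult_right_mono[of "v (\<alpha> x)" 1 "v (\<alpha> y - residue \<alpha> y)"] by (simp add: v_mult)
  moreover have e': "\<alpha> (x * y) - residue \<alpha> x * residue \<alpha> y
      = \<alpha> x * (\<alpha> y - residue \<alpha> y) + (\<alpha> x - residue \<alpha> x) * residue \<alpha> y" by (simp add: h algebra_simps)
  ultimately have "v (\<alpha> (x * y) - residue \<alpha> x * residue \<alpha> y) < 1"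
    unfolding e' by (intro le_less_trans[OF v_add]) simp
  then show "residue \<alpha> (x * y) = residue \<alpha> x * residue \<alpha> y"
    using rx ry by (intro residue_eqI[OF a p] Fbar_closed) auto
qed

text \<open>Twisting the residue map by a power of Frobenius gives another place of \<open>L\<close> over infinity;
  since there is only one, the residues are Frobenius-invariant.\<close>

lemma Pinf_residue:
  assumes a: "emb \<alpha>" and x: "v (\<alpha> x) \<le> 1"
  shows "jK x \<in> Pinf" "jK x \<noteq> jC (residue \<alpha> x ^ (q ^ k)) \<Longrightarrow> inverse (jK x - jC (residue \<alpha> x ^ (q ^ k))) \<notin> Pinf"
proof -
  note h = field_hom_simps[OF embD(1)[OF a]]
  define U where "U = {x. v (\<alpha> x) \<le> 1}"
  have U: "is_subring U" using residue_hom(4,5)[OF a] by (auto simp: is_subring_def U_def h)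
  have iU: "iK c \<in> U" for c using v_iC[of c] by (cases "c = 0") (auto simp: U_def embD[OF a] h)
  define hh where "hh x = residue \<alpha> x ^ (q ^ k)" for x
  \<comment> \<open>The inverse of T is the nonzero element of the kernel required for the
    construction of a point; the same element shows afterwards that T has a pole there.\<close>
  have vT: "v (\<alpha> (inverse TK)) < 1" using q_gt_1 by (simp add: h v_inverse embD[OF a] v_theta inverse_less_1_iff)
  have T0: "TK \<noteq> 0" using J_simps(5)[of "[:0, 1:]"] by simp
  have rT: "residue \<alpha> (inverse TK) = 0"
    using vT Fbar_iC[of 0] by (intro residue_eqI[OF a]) auto
  have hT: "hh (inverse TK) = 0" using q_gt_1 by (simp add: hh_def rT)
  obtain P where P: "P \<in> curve_points jC"
      "\<And>x. x \<in> U \<Longrightarrow> jK x \<in> P \<and> (jK x \<noteq> jC (hh x) \<longrightarrow> inverse (jK x - jC (hh x)) \<notin> P)"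
  proof -
    have "\<exists>P\<in>curve_points jC. \<forall>x\<in>U. jK x \<in> P \<and> (jK x \<noteq> jC (hh x) \<longrightarrow> inverse (jK x - jC (hh x)) \<notin> P)"
    proof (rule exists_curve_point_of_hom[OF U iU])
      fix x y assume "x \<in> U" "y \<in> U"
      then have xy: "v (\<alpha> x) \<le> 1" "v (\<alpha> y) \<le> 1" by (auto simp: U_def)
      show "hh (x + y) = hh x + hh y" "hh (x * y) = hh x * hh y"
        by (simp_all only: hh_def residue_hom(1,2)[OF a xy] frob power_mult_distrib)
    next
      show "hh (iK c) = iC c" for c
        using residue_hom(3)[OF a x x, of c] by (simp add: hh_def frob)
      show "inverse TK \<in> U" using vT by (simp add: U_def)
      show "inverse TK \<noteq> 0" using T0 by simp
      show "hh (inverse TK) = 0" by (rule hT)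
    qed
    then show ?thesis using that by blast
  qed
  have "inverse TK \<in> U" using vT by (simp add: U_def)
  from P(2)[OF this] have "jK TK \<notin> P" using T0 by (simp add: hT)
  then have "P = Pinf" using over_inf P(1) unfolding points_over_infinity_def by blast
  moreover have "x \<in> U" using x by (simp add: U_def)
  ultimately show "jK x \<in> Pinf" "jK x \<noteq> jC (residue \<alpha> x ^ (q ^ k)) \<Longrightarrow> inverse (jK x - jC (residue \<alpha> x ^ (q ^ k))) \<notin> Pinf"
    using P(2)[of x] by (auto simp: hh_def)
qed

lemma Pinf_point: "Pinf \<in> curve_points jC" "jK TK \<notin> Pinf"
  using over_inf unfolding points_over_infinity_def by blast+

lemma curve_pointD:
  assumes "P \<in> curve_points jC"
  shows "is_subring P" "jC c \<in> P" "x \<noteq> 0 \<Longrightarrow> x \<notin> P \<Longrightarrow> inverse x \<in> P"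
proof -
  note * = assms[unfolded curve_points_def mem_Collect_eq]
  have P: "range jC \<subseteq> P" "\<forall>x\<in>P. \<forall>y\<in>P. x - y \<in> P \<and> x * y \<in> P"
    "\<forall>x. x \<noteq> 0 \<longrightarrow> x \<in> P \<or> inverse x \<in> P"
    by (rule conjunct1[OF *], rule conjunct1[OF conjunct2[OF conjunct2[OF *]]],
        rule conjunct2[OF conjunct2[OF conjunct2[OF *]]])
  show "jC c \<in> P" using P(1) by auto
  have "jC 1 \<in> P" by (rule subsetD[OF P(1)]) (rule rangeI)
  then show "is_subring P" using P(2) unfolding is_subring_def by simp
  show "x \<noteq> 0 \<Longrightarrow> x \<notin> P \<Longrightarrow> inverse x \<in> P" using spec[OF P(3), of x] by blast
qed

text \<open>If \<open>\<alpha> x\<close> is larger than 1, then the inverse of \<open>x\<close> has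
  residue 0 and is a non-unit at \<open>Pinf\<close>, so \<open>x\<close> has a pole there.\<close>

lemma Pinf_iff: assumes a: "emb \<alpha>" shows "jK x \<in> Pinf \<longleftrightarrow> v (\<alpha> x) \<le> 1"
proof
  assume x: "jK x \<in> Pinf"
  show "v (\<alpha> x) \<le> 1"
  proof (rule ccontr)
    assume "\<not> v (\<alpha> x) \<le> 1"
    then have v1: "v (\<alpha> x) > 1" by simp
    then have x0: "x \<noteq> 0" using field_hom_simps(1)[OF embD(1)[OF a]] by auto
    have lt: "v (\<alpha> (inverse x)) < 1"
      using v1 by (simp add: field_hom_simps[OF embD(1)[OF a]] v_inverse inverse_less_1_iff)
    then have "residue \<alpha> (inverse x) = 0" using Fbar_iC[of 0] by (intro residue_eqI[OF a]) auto
    then show False using Pinf_residue(2)[OF a, of "inverse x" 0] lt x0 x by simp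
  qed
qed (use Pinf_residue(1)[OF a] in auto)

text \<open>The residue \<open>z\<close> and its Frobenius conjugate z^q are both residues of
  \<open>x\<close> at the one point \<open>Pinf\<close>. If they differed, two non-units of a
  valuation ring would differ by a nonzero constant. Hence \<open>z\<close> is fixed by the
  Frobenius: infinity has residue degree one over the finite field.\<close>

lemma residue_rational:
  assumes a: "emb \<alpha>" and x: "v (\<alpha> x) \<le> 1"
  shows "\<exists>c. v (\<alpha> x - iC c) < 1"
proof -
  define z where "z = residue \<alpha> x"
  define b where "b = jK x - jC z"
  define b' where "b' = jK x - jC (z ^ q)"
  note P = curve_pointD[OF Pinf_point(1)]
  have b: "b \<noteq> 0 \<Longrightarrow> inverse b \<notin> Pinf" "b' \<noteq> 0 \<Longrightarrow> inverse b' \<notin> Pinf"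
    using Pinf_residue(2)[OF a x, of 0] Pinf_residue(2)[OF a x, of 1] by (auto simp: b_def b'_def z_def)
  \<comment> \<open>With d = c + w and d/c regular, 1/c = (d/c - 1)/w would be regular although
    \<open>c\<close> is a non-unit. As the ring is a valuation ring, one of the two quotients of
    \<open>b\<close> and \<open>b'\<close> is regular.\<close>
  have key: False if "w \<noteq> 0" "c \<noteq> 0 \<Longrightarrow> inverse c \<notin> Pinf" "d = c + jC w" "c \<noteq> 0 \<Longrightarrow> d / c \<in> Pinf" "d \<noteq> 0 \<Longrightarrow> inverse d \<notin> Pinf"
    for w c d
  proof (cases "c = 0")
    case True
    then have "inverse d = jC (inverse w)" "d \<noteq> 0" using that by simp_all
    then show False using P(2)[of "inverse w"] that(5) by simp
  next
    case False
    have "inverse c = (d / c - 1) * jC (inverse w)" using that(1,3) False by (simp add: field_simps)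
    also have "\<dots> \<in> Pinf" using that(4)[OF False] P(2)[of "inverse w"] is_subringD(1,3,4)[OF P(1)] by simp
    finally show False using that(2) False by simp
  qed
  have "z ^ q = z"
  proof (rule ccontr)
    assume ne: "z ^ q \<noteq> z"
    have e: "b = b' + jC (z ^ q - z)" "b' = b + jC (z - z ^ q)" by (simp_all add: b_def b'_def)
    have w: "z ^ q - z \<noteq> 0" "z - z ^ q \<noteq> 0" using ne by auto
    show False
    proof (cases "b / b' \<in> Pinf")
      case True
      then show False using key[OF w(1) b(2) e(1) _ b(1)] by blast
    next
      case False
      then have "b / b' \<noteq> 0" using is_subringD(2)[OF P(1)] by auto
      then have "b' / b \<in> Pinf" using P(3)[of "b / b'"] False by simp
      then show False using key[OF w(2) b(1) e(2) _ b(2)] by blast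
    qed
  qed
  then obtain c where "z = iC c" using frob(7) by blast
  then show ?thesis using residue[OF a x] by (auto simp: z_def)
qed

text \<open>The elements of value at most 1 are the same for all embeddings, by
  \<open>Pinf_iff\<close>, and they determine the absolute value: if two embeddings disagreed at
  \<open>x\<close>, some x^k / T^n would be inside the unit ball for one and outside for the
  other.\<close>

lemma emb_value_unique:
  assumes a: "emb \<alpha>" and b: "emb \<beta>"
  shows "v (\<alpha> x) = v (\<beta> x)"
proof -
  have le: "\<not> v (\<alpha> x) < v (\<beta> x)" if a: "emb \<alpha>" and b: "emb \<beta>" and x0: "x \<noteq> 0" for \<alpha> \<beta>
  proof
    assume lt: "v (\<alpha> x) < v (\<beta> x)"
    note ha = field_hom_simps[OF embD(1)[OF a]] and hb = field_hom_simps[OF embD(1)[OF b]]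
    have pos: "v (\<alpha> x) > 0" "v (\<beta> x) > 0" using x0 by (simp_all add: ha hb)
    define u where "u = log q (v (\<alpha> x))"
    define w where "w = log q (v (\<beta> x))"
    have q1: "real q > 1" using q_gt_1 by simp
    have "u < w" unfolding u_def w_def using pos q1 lt by simp
    then obtain k where k: "1 < real k * (w - u)" using ex_less_of_nat_mult[of "w - u" 1] by auto
    \<comment> \<open>An integer strictly between \<open>k * u\<close> and \<open>k * w\<close>,
      which exists because \<open>k\<close> makes this interval longer than 1.\<close>
    define n where "n = \<lfloor>k * u\<rfloor> + 1"
    have n: "k * u < n" "n < k * w" unfolding n_def using k by (simp_all add: algebra_simps) linarith+
    define y where "y = x ^ k / TK powi n"
    have hp: "g (TK powi n) = \<theta> powi n" if "emb g" for g
      using embD[OF that] by (cases "n \<ge> 0") (simp_all add: power_int_def field_hom_simps[OF embD(1)[OF that]])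
    have vt: "v (\<theta> powi n) = real q powr n"
      using q1 v_theta by (simp add: power_int_def v_power v_inverse powr_real_of_int power_inverse)
    have va: "v (\<alpha> y) = real q powr (k * u - n)"
    proof -
      have "v (\<alpha> x) ^ k = real q powr (k * u)" using pos q1 powr_powr[of "real q" u "real k"]
        by (simp add: u_def powr_realpow mult.commute)
      then show ?thesis by (simp add: y_def ha v_divide v_power hp[OF a] vt powr_diff)
    qed
    have vb: "v (\<beta> y) = real q powr (k * w - n)"
    proof -
      have "v (\<beta> x) ^ k = real q powr (k * w)" using pos q1 powr_powr[of "real q" w "real k"]
        by (simp add: w_def powr_realpow mult.commute)
      then show ?thesis by (simp add: y_def hb v_divide v_power hp[OF b] vt powr_diff)
    qed
    have "v (\<alpha> y) < 1" unfolding va using n q1 by (simp add: powr_less_one)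
    moreover have "v (\<beta> y) > 1" unfolding vb using n q1 by simp
    ultimately show False using Pinf_iff[OF a, of y] Pinf_iff[OF b, of y] by simp
  qed
  show ?thesis
  proof (cases "x = 0")
    case True
    then show ?thesis using field_hom_simps(1)[OF embD(1)[OF a]] field_hom_simps(1)[OF embD(1)[OF b]] by simp
  next
    case False
    show ?thesis using le[OF a b False] le[OF b a False] by simp
  qed
qed

end

section \<open>The ring A, the ramification index at infinity, and the degrees occurring in
  A\<close>

context cm_curve
begin

lemma A_iff: "x \<in> A \<longleftrightarrow> (\<forall>P\<in>curve_points jC. P \<noteq> Pinf \<longrightarrow> jK x \<in> P)"
  by (simp add: regular_outside_def)

lemma A_subring: "is_subring A"
  unfolding is_subring_def
proof (intro conjI ballI)
  show "1 \<in> A" unfolding A_iff using is_subringD(1)[OF curve_pointD(1)] by simp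
  fix x y assume xy: "x \<in> A" "y \<in> A"
  show "x - y \<in> A" unfolding A_iff jK_simps
    using is_subringD(3)[OF curve_pointD(1)] xy[unfolded A_iff] by simp
  show "x * y \<in> A" unfolding A_iff jK_simps
    using is_subringD(4)[OF curve_pointD(1)] xy[unfolded A_iff] by simp
qed

lemma A_iK: "iK c \<in> A"
  unfolding A_iff jK_iK using curve_pointD(2) by blast

lemma A_TK: "TK \<in> A"
  unfolding A_iff
proof (intro ballI impI, rule ccontr)
  fix P assume "P \<in> curve_points jC" "P \<noteq> Pinf" "jK TK \<notin> P"
  then have "P \<in> points_over_infinity jC (jK TK)" by (simp add: points_over_infinity_def)
  then show False using over_inf \<open>P \<noteq> Pinf\<close> by simp
qed

lemma A_J: "J p \<in> A"
  by (induction p) (simp_all add: J_pCons is_subringD(2,4,6)[OF A_subring] A_iK A_TK)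

lemma A_subspace: "VK.subspace A"
  unfolding VK.subspace_def using is_subringD(2,4,6)[OF A_subring] A_iK by simp

lemma TK_nonzero [simp]: "TK \<noteq> 0" using J_simps(5)[of "[:0, 1:]"] by simp

text \<open>If c + s y is regular, then so are s y and y, the latter because the inverse of
  \<open>s\<close> is regular. By induction y is a constant, and regularity of s y forces it to be
  0. Thus elements with a pole are transcendental over C.\<close>

lemma poly_in_valuation_ring:
  assumes P: "P \<in> curve_points jC" and s: "s \<notin> P" and f: "poly (map_poly jC f) s \<in> P"
  shows "degree f = 0"
  using f
proof (induction f)
  case (pCons c p)
  note sub = curve_pointD(1)[OF P]
  have s0: "s \<noteq> 0" using is_subringD(2)[OF sub] s by auto
  have isP: "inverse s \<in> P" by (rule curve_pointD(3)[OF P s0 s])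
  define y where "y = poly (map_poly jC p) s"
  have "jC c + s * y \<in> P" using pCons(3) by (simp add: map_poly_pCons y_def)
  then have sy: "s * y \<in> P" using is_subringD(3)[OF sub _ curve_pointD(2)[OF P, of c]] by force
  have "inverse s * (s * y) \<in> P" by (rule is_subringD(4)[OF sub isP sy])
  then have "y \<in> P" using s0 by (simp add: mult.assoc[symmetric])
  then have dp: "degree p = 0" using pCons(2) by (simp add: y_def)
  then obtain d where d: "p = [:d:]" by (rule degree_eq_zeroE)
  have "d = 0"
  proof (rule ccontr)
    assume d0: "d \<noteq> 0"
    have "y = jC d" by (simp add: y_def d map_poly_pCons)
    then have "s = s * y * jC (inverse d)" using d0 by simp
    also have "\<dots> \<in> P" by (rule is_subringD(4)[OF sub sy curve_pointD(2)[OF P]])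
    finally show False using s by simp
  qed
  then show ?case by (simp add: d)
qed simp

text \<open>A nonzero element of A vanishing at infinity would have no pole at all. But its inverse
  \<open>s\<close> has a pole at infinity, hence generates a proper ideal in the polynomial ring
  C[s], and Chevalley's theorem gives a point at which \<open>s\<close> vanishes and
  \<open>a\<close> has a pole.\<close>

lemma A_value_ge_1:
  assumes a: "a \<in> A" "a \<noteq> 0"
  shows "v (\<alpha>0 a) \<ge> 1"
proof (rule ccontr)
  assume "\<not> ?thesis"
  then have lt: "v (\<alpha>0 a) < 1" by simp
  note h = field_hom_simps[OF embD(1)[OF emb0]]
  define s where "s = jK (inverse a)"
  have aP: "jK a \<in> Pinf" using Pinf_iff[OF emb0, of a] lt by simp
  have "v (\<alpha>0 a) > 0" using a(2) by (simp add: h)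
  then have "v (\<alpha>0 (inverse a)) > 1" using lt by (simp add: h v_inverse one_less_inverse_iff)
  then have sP: "s \<notin> Pinf" using Pinf_iff[OF emb0, of "inverse a"] by (simp add: s_def)
  define R where "R = range (\<lambda>p. poly (map_poly jC p) s)"
  have RI: "poly (map_poly jC p) s \<in> R" for p by (simp add: R_def)
  have mo: "map_poly jC 1 = 1" "map_poly jC (p - p') = map_poly jC p - map_poly jC p'" for p p'
    by (auto intro!: poly_eqI simp: coeff_map_poly_hom[OF hom_jC] coeff_1)
  have R: "is_subring R"
    unfolding is_subring_def R_def using RI[of 1]
    by (auto simp: mo R_def simp flip: poly_mult poly_diff map_poly_hom_simps(2)[OF hom_jC])
      (metis mo(2) rangeI)
  have cR: "range jC \<subseteq> R"
  proof (rule image_subsetI)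
    fix c show "jC c \<in> R" using RI[of "[:c:]"] by (simp add: map_poly_pCons)
  qed
  have sR: "{s} \<subseteq> R" using RI[of "[:0, 1:]"] by (simp add: map_poly_pCons)
  have gen: "\<exists>p. x = s * poly (map_poly jC p) s" if x: "x \<in> generated_ideal {s} R" for x
  proof -
    obtain xs where xs: "set xs \<subseteq> {s} \<times> R" "(\<Sum>(a, v)\<leftarrow>xs. a * v) = x" by (rule generated_idealE[OF x])
    have "\<exists>p. (\<Sum>(a, v)\<leftarrow>xs. a * v) = s * poly (map_poly jC p) s" using xs(1)
    proof (induction xs)
      case Nil
      then show ?case by (intro exI[of _ 0]) simp
    next
      case (Cons y xs)
      then obtain p where p: "(\<Sum>(a, v)\<leftarrow>xs. a * v) = s * poly (map_poly jC p) s" by auto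
      obtain p' where "y = (s, poly (map_poly jC p') s)" using Cons(2) by (auto simp: R_def)
      then show ?case using p
        by (intro exI[of _ "p' + p"]) (simp add: map_poly_hom_simps[OF hom_jC] distrib_left)
    qed
    then show ?thesis using xs(2) by simp
  qed
  have n1: "1 \<notin> generated_ideal {s} R"
  proof
    assume "1 \<in> generated_ideal {s} R"
    then obtain p where p: "1 = s * poly (map_poly jC p) s" using gen by blast
    then have "poly (map_poly jC (pCons 0 p)) s = 1" by (simp add: map_poly_pCons)
    then have "poly (map_poly jC (pCons 0 p)) s \<in> Pinf"
      using is_subringD(1)[OF curve_pointD(1)[OF Pinf_point(1)]] by simp
    then have "degree (pCons 0 p) = 0" by (rule poly_in_valuation_ring[OF Pinf_point(1) sP])
    then have "p = 0" by (simp split: if_splits)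
    then show False using p by simp
  qed
  have "s \<noteq> 0" using a(2) by (simp add: s_def)
  then obtain P where P: "P \<in> curve_points jC" "inverse s \<notin> P"
    using exists_curve_point[OF R cR sR n1, of s] by auto
  have "inverse s = jK a" by (simp add: s_def)
  then show False using P aP a(1) A_iff by metis
qed

text \<open>The leading coefficient of an equation times \<open>x\<close> is integral over the
  polynomials in T, so it is regular at every point where T is.\<close>

lemma A_denominator: "\<exists>d. d \<noteq> 0 \<and> J d * x \<in> A"
proof -
  obtain n P where P: "(\<Sum>i\<le>n. J (P i) * x ^ i) = 0" "\<exists>i\<le>n. P i \<noteq> 0" using relation by blast
  define k where "k = Max {i. i \<le> n \<and> P i \<noteq> 0}"
  have fin: "finite {i. i \<le> n \<and> P i \<noteq> 0}" by simp
  have "k \<in> {i. i \<le> n \<and> P i \<noteq> 0}" unfolding k_def by (rule Max_in[OF fin]) (use P(2) in auto)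
  then have k: "k \<le> n" "P k \<noteq> 0" by auto
  have Pz: "P i = 0" if "k < i" "i \<le> n" for i
  proof (rule ccontr)
    assume "P i \<noteq> 0"
    then have "i \<le> k" unfolding k_def using that by (intro Max_ge[OF fin]) simp
    then show False using that by simp
  qed
  have "(\<Sum>i\<le>n. J (P i) * x ^ i) = (\<Sum>i\<le>k. J (P i) * x ^ i)"
    using k(1) Pz by (intro sum.mono_neutral_right) auto
  then have rel: "(\<Sum>i\<le>k. J (P i) * x ^ i) = 0" using P(1) by simp
  have k0: "k \<noteq> 0" using rel k(2) by (cases k) auto
  then obtain m where m: "k = Suc m" by (cases k) auto
  define d where "d = P k"
  have "J d * x \<in> A" unfolding A_iff
  proof (intro ballI impI, rule ccontr)
    fix Q assume Q: "Q \<in> curve_points jC" "Q \<noteq> Pinf" "jK (J d * x) \<notin> Q"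
    note sub = curve_pointD(1)[OF Q(1)]
    define y where "y = jK (J d * x)"
    have y0: "y \<noteq> 0" using Q(3) is_subringD(2)[OF sub] by (auto simp: y_def)
    have iy: "inverse y \<in> Q" using curve_pointD(3)[OF Q(1) y0] Q(3) by (simp add: y_def)
    define c where "c i = jK (J (P i * d ^ (m - i)))" for i
    have cQ: "c i \<in> Q" for i using A_J Q(1,2) unfolding c_def A_iff by blast
    have Jp: "J (d ^ i) = J d ^ i" for i by (induction i) auto
    \<comment> \<open>Multiplication by the power of the leading coefficient with exponent
      \<open>k - 1\<close> makes the equation monic in \<open>J d * x\<close>.\<close>
    have "J d ^ m * (\<Sum>i\<le>k. J (P i) * x ^ i) = (\<Sum>i\<le>m. J (P i * d ^ (m - i)) * (J d * x) ^ i) + (J d * x) ^ k"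
    proof -
      have t: "J d ^ m * (J (P i) * x ^ i) = J (P i * d ^ (m - i)) * (J d * x) ^ i" if "i \<le> m" for i
      proof -
        have "J d ^ m = J d ^ (m - i) * J d ^ i" using that by (simp flip: power_add)
        then show ?thesis by (simp add: Jp power_mult_distrib mult_ac)
      qed
      have "J d ^ m * (\<Sum>i\<le>k. J (P i) * x ^ i)
          = (\<Sum>i\<le>m. J d ^ m * (J (P i) * x ^ i)) + J d ^ m * (J (P k) * x ^ k)"
        by (simp add: m distrib_left sum_distrib_left)
      also have "J d ^ m * (J (P k) * x ^ k) = (J d * x) ^ k"
        by (simp add: m d_def power_mult_distrib mult_ac)
      also have "(\<Sum>i\<le>m. J d ^ m * (J (P i) * x ^ i)) = (\<Sum>i\<le>m. J (P i * d ^ (m - i)) * (J d * x) ^ i)"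
        by (intro sum.cong refl t) simp
      finally show ?thesis .
    qed
    then have "(\<Sum>i\<le>m. J (P i * d ^ (m - i)) * (J d * x) ^ i) + (J d * x) ^ k = 0" using rel by simp
    then have "jK ((\<Sum>i\<le>m. J (P i * d ^ (m - i)) * (J d * x) ^ i) + (J d * x) ^ k) = 0" by simp
    then have "(\<Sum>i\<le>m. c i * y ^ i) + y ^ k = 0" by (simp add: c_def y_def)
    then have "y ^ k = - (\<Sum>i\<le>m. c i * y ^ i)" by (simp add: eq_neg_iff_add_eq_0 add.commute)
    then have "y = - (\<Sum>i\<le>m. c i * y ^ i) * inverse y ^ m"
      using y0 by (simp add: m power_inverse field_simps)
    also have "\<dots> = - (\<Sum>i\<le>m. c i * inverse y ^ (m - i))"
    proof -
      have "y ^ i * inverse y ^ m = inverse y ^ (m - i)" if "i \<le> m" for i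
        using y0 that by (simp add: power_inverse power_diff field_simps)
      then show ?thesis by (simp add: sum_distrib_right mult.assoc)
    qed
    also have "\<dots> \<in> Q"
      by (intro is_subringD(5)[OF sub] is_subringD(8)[OF sub] is_subringD(4)[OF sub] cQ is_subringD(7)[OF sub] iy)
    finally show False using Q(3) by (simp add: y_def)
  qed
  then show ?thesis using k(2) unfolding d_def by blast
qed

lemma hj: "vector_space (\<lambda>c x. j c * x)" by (rule field_hom_vector_space[OF hom_j])

lemma v_j: "c \<noteq> 0 \<Longrightarrow> \<exists>n::int. v (\<alpha>0 (j c)) = real q powi n"
proof -
  assume c: "c \<noteq> 0"
  obtain u w where uw: "w \<noteq> 0" "c = poly_fract u / poly_fract w" using fract_eq_quotient by blast
  then have u: "u \<noteq> 0" using c by (auto simp: poly_fract_simps)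
  have "j c = J u / J w" by (simp add: uw(2) J_def field_hom_simps[OF hom_j])
  then have "v (\<alpha>0 (j c)) = real q ^ degree u / real q ^ degree w"
    using v_emb_J[OF emb0] u uw(1) by (simp add: field_hom_simps[OF embD(1)[OF emb0]] v_divide)
  also have "\<dots> = real q powi (int (degree u) - int (degree w))"
    using q_gt_1 by (simp add: power_int_diff)
  finally show ?thesis ..
qed

text \<open>Nonzero elements of the rational function field have powers of q as values, so the terms
  of a linear relation would have pairwise distinct absolute values and could not cancel.\<close>

lemma card_distinct_values_le:
  assumes S: "finite S" "0 \<notin> S"
    and d: "\<And>x y n. x \<in> S \<Longrightarrow> y \<in> S \<Longrightarrow> v (\<alpha>0 x) = v (\<alpha>0 y) * real q powi n \<Longrightarrow> x = y"
  shows "card S \<le> r"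
proof -
  interpret VJ: vector_space "\<lambda>c x. j c * x" by (rule hj)
  note h = field_hom_simps[OF embD(1)[OF emb0]]
  obtain B where B: "finite B" "card B = r" "VJ.span B = UNIV"
    using ext unfolding finite_separable_extension_def by blast
  have "VJ.independent S"
  proof
    assume "VJ.dependent S"
    then obtain t u where t: "finite t" "t \<subseteq> S" "(\<Sum>x\<in>t. j (u x) * x) = 0" "\<exists>x\<in>t. u x \<noteq> 0"
      unfolding VJ.dependent_explicit by blast
    define t' where "t' = {x \<in> t. u x \<noteq> 0}"
    have nz: "j (u x) * x \<noteq> 0" if "x \<in> t'" for x
      using that t(2) S(2) by (auto simp: t'_def field_hom_simps[OF hom_j])
    have "(\<Sum>x\<in>t. j (u x) * x) = (\<Sum>x\<in>t'. j (u x) * x)"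
      using t(1) by (intro sum.mono_neutral_right) (auto simp: t'_def field_hom_simps[OF hom_j])
    then have "\<alpha>0 (\<Sum>x\<in>t'. j (u x) * x) = 0" using t(3) h by simp
    then have z: "(\<Sum>x\<in>t'. \<alpha>0 (j (u x) * x)) = 0" by (simp only: h)
    have "(\<Sum>x\<in>t'. \<alpha>0 (j (u x) * x)) \<noteq> 0"
    proof (rule v_sum_distinct)
      show "finite t'" "t' \<noteq> {}" using t by (auto simp: t'_def)
      show "\<alpha>0 (j (u x) * x) \<noteq> 0" if "x \<in> t'" for x using nz[OF that] h(9)[of "j (u x) * x"] by blast
      show "inj_on (\<lambda>x. v (\<alpha>0 (j (u x) * x))) t'"
      proof (rule inj_onI)
        fix x y assume xy: "x \<in> t'" "y \<in> t'" "v (\<alpha>0 (j (u x) * x)) = v (\<alpha>0 (j (u y) * y))"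
        obtain m n where m: "v (\<alpha>0 (j (u x))) = real q powi m" and n: "v (\<alpha>0 (j (u y))) = real q powi n"
          using v_j[of "u x"] v_j[of "u y"] xy(1,2) by (auto simp: t'_def)
        have "real q powi m * v (\<alpha>0 x) = real q powi n * v (\<alpha>0 y)" using xy(3) m n by (simp add: h v_mult)
        then have "v (\<alpha>0 x) = v (\<alpha>0 y) * real q powi (n - m)"
          using q_gt_1 by (simp add: power_int_diff field_simps)
        then show "x = y" using d xy(1,2) t(2) by (auto simp: t'_def)
      qed
    qed
    then show False using z by simp
  qed
  then show ?thesis using VJ.independent_span_bound[OF B(1), of S] B by simp
qed

text \<open>\<open>D\<close> is the pole order at infinity, normalised by an element of degree 1,
  and \<open>\<rho>\<close> is the ramification index over the rational function field, which is
  kept as a parameter until it is known to be \<open>r\<close>.\<close>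

definition is_degree :: "('k \<Rightarrow> int) \<Rightarrow> nat \<Rightarrow> bool" where
  "is_degree D \<rho> \<longleftrightarrow> \<rho> > 0 \<and> (\<forall>x. x \<noteq> 0 \<longrightarrow> v (\<alpha>0 x) = real q powr (D x / \<rho>)) \<and> (\<exists>x. x \<noteq> 0 \<and> D x = 1)"

lemma degree_lemmas:
  assumes D: "is_degree D \<rho>"
  shows "x \<noteq> 0 \<Longrightarrow> y \<noteq> 0 \<Longrightarrow> D (x * y) = D x + D y"
    "x \<noteq> 0 \<Longrightarrow> y \<noteq> 0 \<Longrightarrow> D x \<le> D y \<longleftrightarrow> v (\<alpha>0 x) \<le> v (\<alpha>0 y)"
    "D TK = \<rho>" "D 1 = 0" "x \<noteq> 0 \<Longrightarrow> D (inverse x) = - D x" "c \<noteq> 0 \<Longrightarrow> D (iK c) = 0"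
    "x \<noteq> 0 \<Longrightarrow> D (x ^ n) = int n * D x"
    "graded_space (\<lambda>c x. iK c * x) D"
proof -
  have q1: "real q > 1" using q_gt_1 by simp
  note h = field_hom_simps[OF embD(1)[OF emb0]]
  have \<rho>: "\<rho> > 0" and val: "x \<noteq> 0 \<Longrightarrow> v (\<alpha>0 x) = real q powr (D x / \<rho>)" for x
    using D by (auto simp: is_degree_def)
  have le: "D x \<le> D y \<longleftrightarrow> v (\<alpha>0 x) \<le> v (\<alpha>0 y)" if "x \<noteq> 0" "y \<noteq> 0" for x y
    using that val q1 \<rho> by (simp add: divide_le_cancel)
  have eq: "D x = n" if "x \<noteq> 0" "v (\<alpha>0 x) = real q powr (n / \<rho>)" for x and n :: int
  proof -
    have "real q powr (D x / \<rho>) = real q powr (n / \<rho>)" using val[OF that(1)] that(2) by simp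
    then show ?thesis using q1 \<rho> by (simp add: powr_inj)
  qed
  show "D x \<le> D y \<longleftrightarrow> v (\<alpha>0 x) \<le> v (\<alpha>0 y)" if "x \<noteq> 0" "y \<noteq> 0" for x y by (rule le[OF that])
  show mult: "D (x * y) = D x + D y" if "x \<noteq> 0" "y \<noteq> 0" for x y
    by (rule eq) (use that val in \<open>simp_all add: h v_mult add_divide_distrib powr_add\<close>)
  show "D TK = \<rho>" by (rule eq) (use q1 \<rho> in \<open>simp_all add: embD(3)[OF emb0] v_theta\<close>)
  show one: "D 1 = 0" by (rule eq) (use q1 in \<open>simp_all add: h\<close>)
  show "D (inverse x) = - D x" if "x \<noteq> 0" for x using mult[of x "inverse x"] that one by simp
  show D0: "D (iK c) = 0" if "c \<noteq> 0" for c
    by (rule eq) (use q1 v_iC[OF that] that in \<open>simp_all add: embD(2)[OF emb0]\<close>)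
  show "D (x ^ n) = int n * D x" if "x \<noteq> 0" for x
    by (induction n) (use that one mult in \<open>simp_all add: algebra_simps\<close>)
  show "graded_space (\<lambda>c x. iK c * x) D"
  proof
    fix x y :: 'k
    assume n: "x \<noteq> 0" "y \<noteq> 0"
    show "D (x + y) \<le> max (D x) (D y)" if "x + y \<noteq> 0"
      using v_add[of "\<alpha>0 x" "\<alpha>0 y"] le[OF that n(1)] le[OF that n(2)] by (auto simp: h max_def split: if_splits)
    assume e: "D x = D y"
    have "v (\<alpha>0 x) = v (\<alpha>0 y)" using val[OF n(1)] val[OF n(2)] e by simp
    then have "v (\<alpha>0 (x / y)) \<le> 1" using n by (simp add: h v_divide)
    \<comment> \<open>A quotient of two elements of equal value has a residue in the finite field
      itself; this makes the graded pieces of K one-dimensional.\<close>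
    then obtain c where c: "v (\<alpha>0 (x / y) - iC c) < 1" using residue_rational[OF emb0] by blast
    have "\<alpha>0 (x - iK c * y) = (\<alpha>0 (x / y) - iC c) * \<alpha>0 y"
      using n by (simp add: h embD(2)[OF emb0] field_simps)
    then have "v (\<alpha>0 (x - iK c * y)) < v (\<alpha>0 y)" using c n by (simp add: v_mult h)
    then show "\<exists>c. x - iK c * y = 0 \<or> D (x - iK c * y) < D x"
      using le[OF n(2), of "x - iK c * y"] e by (intro exI[of _ c]) (auto simp: not_le[symmetric])
  next
    fix c :: 'f and x :: 'k assume "c \<noteq> 0" "x \<noteq> 0"
    then show "D (iK c * x) = D x" using mult[of "iK c" x] D0[of c] by simp
  qed
qed

text \<open>The fundamental equality e f = n with f = 1. The powers with exponent below
  \<open>\<rho>\<close> of an element of degree 1 are independent over the rational functions.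
  Conversely A is generated over the polynomials in T by at most one element per degree class modulo
  \<open>\<rho>\<close>, and these span K once denominators are inverted.\<close>

lemma degree_unit_rank:
  assumes D: "is_degree D \<rho>"
  shows "\<rho> = r"
proof -
  note d = degree_lemmas[OF D]
  interpret G: graded_space "\<lambda>c x. iK c * x" D by (rule d(8))
  interpret VJ: vector_space "\<lambda>c x. j c * x" by (rule hj)
  have \<rho>: "\<rho> > 0" and val: "x \<noteq> 0 \<Longrightarrow> v (\<alpha>0 x) = real q powr (D x / \<rho>)" for x
    using D by (auto simp: is_degree_def)
  have q1: "real q > 1" using q_gt_1 by simp
  obtain x1 where x1: "x1 \<noteq> 0" "D x1 = 1" using D by (auto simp: is_degree_def)
  have "\<rho> \<le> r"
  proof -
    define S where "S = (\<lambda>i. x1 ^ i) ` {..<\<rho>}"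
    have Dx: "D (x1 ^ i) = int i" for i using d(7)[OF x1(1)] x1(2) by simp
    have inj: "inj_on (\<lambda>i. x1 ^ i) {..<\<rho>}" by (rule inj_onI) (metis Dx of_nat_eq_iff)
    have "card S \<le> r"
    proof (rule card_distinct_values_le)
      show "finite S" "0 \<notin> S" using x1(1) by (auto simp: S_def)
      fix x y n assume xy: "x \<in> S" "y \<in> S" "v (\<alpha>0 x) = v (\<alpha>0 y) * real q powi n"
      obtain a b where ab: "x = x1 ^ a" "a < \<rho>" "y = x1 ^ b" "b < \<rho>" using xy by (auto simp: S_def)
      have "real q powr (a / \<rho>) = real q powr (b / \<rho>) * real q powr n"
        using xy(3) val[of x] val[of y] ab x1(1) q1 by (simp add: Dx powr_real_of_int')
      then have "real q powr (a / \<rho>) = real q powr (b / \<rho> + n)" by (simp add: powr_add)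
      then have ab': "real a / real \<rho> = real b / real \<rho> + of_int n" using q1 by (simp add: powr_inj)
      have "real a = real a / real \<rho> * real \<rho>" using \<rho> by simp
      also have "\<dots> = (real b / real \<rho> + of_int n) * real \<rho>" by (simp only: ab')
      also have "\<dots> = real b + of_int n * real \<rho>" using \<rho> by (simp add: distrib_right)
      finally have "real_of_int (int a) = real_of_int (int b + n * int \<rho>)" by simp
      then have e: "int a = int b + n * int \<rho>" by (simp only: of_int_eq_iff)
      have "int a mod int \<rho> = int b mod int \<rho>" unfolding e by simp
      then have "a = b" using ab(2,4) by simp
      then show "x = y" using ab by simp
    qed
    then show ?thesis using card_image[OF inj] by (simp add: S_def)
  qed
  moreover have "r \<le> \<rho>"
  proof -
    have ge0: "0 \<le> D x" if "x \<in> A" "x \<noteq> 0" for x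
      using d(2)[of 1 x] d(4) A_value_ge_1[OF that] that field_hom_simps(2)[OF embD(1)[OF emb0]] by simp
    obtain B where B: "finite B" "B \<subseteq> A" "card B = card ((\<lambda>x. D x mod int \<rho>) ` (A - {0}))"
      "\<And>x. x \<in> A \<Longrightarrow> \<exists>c. x = (\<Sum>b\<in>B. G.ev (c b) (\<lambda>k. ((*) TK ^^ k) b))"
    proof (rule G.graded_operator_basis[OF A_subspace, of "(*) TK" "int \<rho>" 0])
      show "TK * x \<in> A" if "x \<in> A" for x using that A_TK is_subringD(4)[OF A_subring] by simp
      show "TK * x \<noteq> 0 \<and> D (TK * x) = D x + int \<rho>" if "x \<in> A" "x \<noteq> 0" for x
        using that d(1)[of TK x] d(3) by simp
    qed (use \<rho> ge0 that in auto)
    have "card ((\<lambda>x. D x mod int \<rho>) ` (A - {0})) \<le> card {0..<int \<rho>}"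
      by (intro card_mono) (use \<rho> in auto)
    then have cB: "card B \<le> \<rho>" using B(3) by simp
    have tk: "((*) TK ^^ k) b = TK ^ k * b" for k b by (induction k) (auto simp: mult.assoc)
    have evJ: "G.ev p (\<lambda>k. ((*) TK ^^ k) b) = J p * b" for p b
      unfolding G.ev_def J_altdef poly_altdef tk map_poly_hom_simps(5)[OF hom_iK] coeff_map_poly_hom[OF hom_iK]
      by (simp add: sum_distrib_right mult.assoc)
    have "VJ.span B = UNIV"
    proof -
      have "x \<in> VJ.span B" for x
      proof -
        obtain e where e: "e \<noteq> 0" "J e * x \<in> A" using A_denominator by blast
        obtain c where c: "J e * x = (\<Sum>b\<in>B. J (c b) * b)" using B(4)[OF e(2)] by (auto simp: evJ)
        have "(\<Sum>b\<in>B. J (c b) * b) \<in> VJ.span B" unfolding J_def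
          by (intro VJ.span_sum VJ.span_scale VJ.span_base)
        then have "j (inverse (poly_fract e)) * (J e * x) \<in> VJ.span B" unfolding c by (rule VJ.span_scale)
        moreover have "j (inverse (poly_fract e)) * (J e * x) = x"
          using e(1) J_simps(5)[of e] by (simp add: field_hom_simps[OF hom_j] J_def)
        ultimately show ?thesis by simp
      qed
      then show ?thesis by auto
    qed
    moreover obtain B' where B': "finite B'" "card B' = r" "VJ.independent B'"
      using ext unfolding finite_separable_extension_def by blast
    ultimately have "card B' \<le> card B" using VJ.independent_span_bound[OF B(1), of B'] by simp
    then show ?thesis using cB B'(2) by simp
  qed
  ultimately show ?thesis by simp
qed

text \<open>Among the r + 1 powers 1, x, ..., x^r two must have values differing by a power of q. So
  some positive multiple, at most r, of the logarithm is an integer, and r! is a common multiple of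
  all these numbers.\<close>

lemma value_torsion:
  assumes x: "x \<noteq> 0"
  shows "\<exists>n::int. real (fact r) * log q (v (\<alpha>0 x)) = n"
proof -
  note h = field_hom_simps[OF embD(1)[OF emb0]]
  have q1: "real q > 1" using q_gt_1 by simp
  define u where "u = log q (v (\<alpha>0 x))"
  have vx: "v (\<alpha>0 x) = real q powr u" using q1 x by (simp add: u_def h)
  have vp: "v (\<alpha>0 (x ^ i)) = real q powr (i * u)" for i :: nat
    using q1 powr_powr[of "real q" u "real i"] by (simp add: h v_power vx powr_realpow mult.commute)
  have "\<exists>(a::nat) b (n::int). a < b \<and> b \<le> r \<and> a * u = b * u + of_int n"
  proof (rule ccontr)
    assume c: "\<not> ?thesis"
    have key: "a = b" if "a \<le> r" "b \<le> r" "real a * u = real b * u + of_int n" for a b and n :: int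
    proof (cases a b rule: linorder_cases)
      case less
      then show ?thesis using c that by blast
    next
      case greater
      have "real b * u = real a * u + of_int (- n)" using that(3) by simp
      then show ?thesis using c that greater by blast
    qed
    define S where "S = (\<lambda>i. x ^ i) ` {..r}"
    have inj: "inj_on (\<lambda>i. x ^ i) {..r}"
    proof (rule inj_onI)
      fix a b assume ab: "a \<in> {..r}" "b \<in> {..r}" "x ^ a = x ^ b"
      have "real q powr (a * u) = real q powr (b * u)" using vp[of a] vp[of b] ab(3) by simp
      then have "real a * u = real b * u + of_int 0" using q1 by (simp add: powr_inj)
      then show "a = b" using key[of a b 0] ab by simp
    qed
    have "card S \<le> r"
    proof (rule card_distinct_values_le)
      show "finite S" "0 \<notin> S" using x by (auto simp: S_def)
      fix y z n assume yz: "y \<in> S" "z \<in> S" "v (\<alpha>0 y) = v (\<alpha>0 z) * real q powi n"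
      obtain a b where ab: "y = x ^ a" "a \<le> r" "z = x ^ b" "b \<le> r" using yz by (auto simp: S_def)
      have "real q powr (a * u) = real q powr (b * u + of_int n)"
        using yz(3) q1 unfolding ab vp by (simp add: powr_add powr_real_of_int')
      then have "real a * u = real b * u + of_int n" using q1 by (simp add: powr_inj)
      then show "y = z" using key ab by blast
    qed
    then show False using card_image[OF inj] by (simp add: S_def)
  qed
  then obtain a b :: nat and n :: int where ab: "a < b" "b \<le> r" "a * u = b * u + of_int n" by blast
  have "b - a dvd fact r" using ab by (intro dvd_fact) auto
  then obtain m where m: "fact r = (b - a) * m" ..
  have e: "real (b - a) * u = - of_int n" using ab by (simp add: of_nat_diff algebra_simps)
  have "real (fact r) * u = real m * (real (b - a) * u)" unfolding m by (simp only: of_nat_mult mult_ac)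
  also have "\<dots> = of_int (- n * int m)" unfolding e by simp
  finally have "real (fact r) * u = of_int (- n * int m)" .
  then show ?thesis unfolding u_def by blast
qed

text \<open>Multiplied by r!, the logarithms of the values form a subgroup of the integers. Dividing
  by its least positive member \<open>e\<close> gives a degree that takes the value 1, with
  ramification index r!/e.\<close>

lemma degree_exists: "\<exists>D. is_degree D r"
proof -
  note h = field_hom_simps[OF embD(1)[OF emb0]]
  have q1: "real q > 1" using q_gt_1 by simp
  define f where "f x = real (fact r) * log q (v (\<alpha>0 x))" for x
  have f_int: "x \<noteq> 0 \<Longrightarrow> \<exists>n::int. f x = n" for x using value_torsion by (simp add: f_def)
  have fm: "f (x * y) = f x + f y" if "x \<noteq> 0" "y \<noteq> 0" for x y
    using that q1 by (simp add: f_def h v_mult log_mult distrib_left)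
  have fi: "f (inverse x) = - f x" if "x \<noteq> 0" for x
    using that q1 by (simp add: f_def h v_inverse log_inverse)
  have fT: "f TK = fact r" using q1 by (simp add: f_def embD(3)[OF emb0] v_theta)
  define Hs where "Hs = {n::nat. n > 0 \<and> (\<exists>x. x \<noteq> 0 \<and> f x = n)}"
  have "fact r \<in> Hs" using fT unfolding Hs_def by (intro CollectI conjI exI[of _ TK]) auto
  then obtain e where e: "e \<in> Hs" and emin: "\<And>n. n \<in> Hs \<Longrightarrow> e \<le> n"
    using ex_has_least_nat[of "\<lambda>n. n \<in> Hs" "fact r" "\<lambda>n. n"] by blast
  obtain x1 where x1: "x1 \<noteq> 0" "f x1 = e" and e0: "e > 0" using e by (auto simp: Hs_def)
  have fp: "f (x1 powi n) = of_int n * real e" for n :: int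
  proof -
    have "f (x1 ^ k) = real k * real e" for k :: nat
    proof (induction k)
      case 0
      show ?case by (simp add: f_def h)
    next
      case (Suc k)
      then show ?case using fm[of x1 "x1 ^ k"] x1 by (simp add: algebra_simps)
    qed
    then show ?thesis using fi[of "x1 ^ nat (- n)"] x1(1)
      by (cases "n \<ge> 0") (simp_all add: power_int_def power_inverse)
  qed
  have dv: "\<exists>n::int. f x = of_int n * real e" if x: "x \<noteq> 0" for x
  proof -
    obtain m where m: "f x = of_int m" using f_int[OF x] by blast
    \<comment> \<open>Division with remainder: the logarithm of \<open>y\<close> is the remainder,
      which vanishes because \<open>e\<close> is minimal.\<close>
    define k where "k = m div int e"
    define y where "y = x * inverse (x1 powi k)"
    have y0: "y \<noteq> 0" using x x1(1) by (simp add: y_def)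
    have fy: "f y = of_int (m mod int e)"
      using fm[of x "inverse (x1 powi k)"] fi[of "x1 powi k"] x x1(1) fp[of k] m
      by (simp add: y_def k_def minus_div_mult_eq_mod[symmetric])
    have bd: "0 \<le> m mod int e" "m mod int e < int e" using e0 by auto
    have mz: "m mod int e = 0"
    proof (rule ccontr)
      assume ne: "m mod int e \<noteq> 0"
      have "nat (m mod int e) \<in> Hs" unfolding Hs_def
        using fy bd ne y0 by (intro CollectI conjI exI[of _ y]) auto
      then have "e \<le> nat (m mod int e)" by (rule emin)
      then show False using bd by linarith
    qed
    have "m = k * int e" using div_mult_mod_eq[of m "int e"] mz by (simp add: k_def)
    then show ?thesis by (intro exI[of _ k]) (simp add: m)
  qed
  then obtain D :: "'k \<Rightarrow> int" where D: "\<And>x. x \<noteq> 0 \<Longrightarrow> f x = of_int (D x) * real e" by metis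
  obtain \<rho> where \<rho>: "fact r = int \<rho> * int e" 
  proof -
    have "real_of_int (int (fact r)) = real_of_int (D TK * int e)" using D[of TK] fT by simp
    then have i: "int (fact r) = D TK * int e" by (simp only: of_int_eq_iff)
    moreover have "0 < int (fact r)" by simp
    then have "D TK > 0" unfolding i using e0 by (simp add: zero_less_mult_iff)
    ultimately show ?thesis using that[of "nat (D TK)"] by simp
  qed
  have \<rho>0: "\<rho> > 0" using \<rho> by (cases \<rho>) auto
  have "real_of_int (fact r) = real_of_int (int \<rho> * int e)" by (simp only: \<rho>)
  then have \<rho>r: "real (fact r) = real \<rho> * real e" by simp
  have "is_degree D \<rho>" unfolding is_degree_def
  proof (intro conjI allI impI)
    fix x :: 'k assume x: "x \<noteq> 0"
    have "real \<rho> * real e * log q (v (\<alpha>0 x)) = of_int (D x) * real e" using D[OF x] by (simp only: f_def \<rho>r)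
    then have "real e * (real \<rho> * log q (v (\<alpha>0 x))) = real e * of_int (D x)" by (simp only: mult_ac)
    then have "real \<rho> * log q (v (\<alpha>0 x)) = of_int (D x)" using e0 by simp
    then have "log q (v (\<alpha>0 x)) = D x / \<rho>" using \<rho>0 by (simp add: eq_divide_eq mult.commute)
    then show "v (\<alpha>0 x) = real q powr (D x / \<rho>)" using powr_log_cancel[of "real q" "v (\<alpha>0 x)"] q1 x
      by (simp add: h)
  next
    have "D x1 = 1" using D[OF x1(1)] x1(2) e0 by simp
    then show "\<exists>x. x \<noteq> 0 \<and> D x = 1" using x1(1) by blast
  qed (rule \<rho>0)
  then show ?thesis using degree_unit_rank by metis
qed

definition Dg :: "'k \<Rightarrow> int" where "Dg = (SOME D. is_degree D r)"

lemma is_degree_Dg: "is_degree Dg r"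
  unfolding Dg_def by (rule someI_ex[OF degree_exists])

lemmas Dg = degree_lemmas[OF is_degree_Dg]

lemma r_pos: "r > 0" using is_degree_Dg by (simp add: is_degree_def)

lemma Dg_nonneg: "x \<in> A \<Longrightarrow> x \<noteq> 0 \<Longrightarrow> 0 \<le> Dg x"
  using Dg(2)[of 1 x] Dg(4) A_value_ge_1[of x] field_hom_simps(2)[OF embD(1)[OF emb0]] by simp

lemma emb_value: "emb \<alpha> \<Longrightarrow> x \<noteq> 0 \<Longrightarrow> v (\<alpha> x) = (real q powr (1 / r)) powr (Dg x)"
  using is_degree_Dg emb_value_unique[OF _ emb0, of \<alpha> x] by (simp add: is_degree_def powr_powr)

text \<open>Only finitely many degrees are missing from A, the weak form of Riemann-Roch used from
  here on. Clearing a denominator by a polynomial in T changes the degree by a multiple of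
  \<open>r\<close>, so A meets every class modulo \<open>r\<close>; powers of T then move upwards
  within a class.\<close>

lemma Dg_cofinite: "\<exists>n0. \<forall>n\<ge>n0. \<exists>a\<in>A. a \<noteq> 0 \<and> Dg a = int n"
proof -
  obtain x1 where x1: "x1 \<noteq> 0" "Dg x1 = 1" using is_degree_Dg by (auto simp: is_degree_def)
  have "\<exists>a\<in>A. a \<noteq> 0 \<and> Dg a mod int r = int i" if i: "i < r" for i
  proof -
    obtain e where e: "e \<noteq> 0" "J e * x1 ^ i \<in> A" using A_denominator by blast
    have "\<exists>k. Dg (J e) = k * int r" 
    proof -
      have "real q powr (Dg (J e) / r) = real q powr (degree e)"
        using is_degree_Dg v_emb_J[OF emb0 e(1)] e(1) q_gt_1 by (simp add: is_degree_def powr_realpow)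
      then have "Dg (J e) / r = degree e" using q_gt_1 by (simp add: powr_inj)
      then have "real_of_int (Dg (J e)) = real_of_int (int (degree e) * int r)" using r_pos by (simp add: divide_eq_eq)
      then have "Dg (J e) = int (degree e) * int r" by (simp only: of_int_eq_iff)
      then show ?thesis by blast
    qed
    then obtain k where "Dg (J e) = k * int r" ..
    then have "Dg (J e * x1 ^ i) mod int r = int i" using Dg(1)[of "J e" "x1 ^ i"] Dg(7)[OF x1(1), of i] x1 e(1) i by simp
    then show ?thesis using e x1(1) by (intro bexI[OF _ e(2)]) simp
  qed
  then obtain a where a: "\<And>i. i < r \<Longrightarrow> a i \<in> A \<and> a i \<noteq> 0 \<and> Dg (a i) mod int r = int i" by metis
  define n0 where "n0 = (\<Sum>i<r. nat (Dg (a i)))"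
  have "\<exists>b\<in>A. b \<noteq> 0 \<and> Dg b = int n" if n: "n \<ge> n0" for n
  proof -
    define i where "i = n mod r"
    have i: "i < r" using r_pos by (simp add: i_def)
    note ai = a[OF i]
    have "nat (Dg (a i)) \<le> n0" unfolding n0_def using i by (intro member_le_sum) auto
    then have le: "Dg (a i) \<le> int n" using n by linarith
    have "int r dvd int n - Dg (a i)" using ai by (simp add: mod_eq_dvd_iff[symmetric] i_def zmod_int)
    then obtain k where k: "int n - Dg (a i) = int r * k" ..
    have "k \<ge> 0"
    proof (rule ccontr)
      assume "\<not> k \<ge> 0"
      then have "int r * k < 0" using r_pos by (intro mult_pos_neg) auto
      then show False using k le by linarith
    qed
    then have "Dg (TK ^ nat k * a i) = int n" using Dg(1)[of "TK ^ nat k" "a i"] Dg(7)[of TK] Dg(3) ai k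
      by (simp add: mult.commute)
    moreover have "TK ^ nat k * a i \<in> A" using ai A_TK is_subringD(4,7)[OF A_subring] by simp
    ultimately show ?thesis using ai by (intro bexI[of _ "TK ^ nat k * a i"]) simp_all
  qed
  then show ?thesis by blast
qed

end

section \<open>The lattice of one embedding and its basis by increasing degree\<close>

text \<open>Here \<open>\<rho>\<close> is the base of the absolute value, to be taken as q^(1/r),
  and not a ramification index.\<close>

locale drinfeld_lattice = nonarch_field v
  for v :: "'c::field \<Rightarrow> real" +
  fixes iK :: "'f::{field,finite} \<Rightarrow> 'k::field" and iC :: "'f \<Rightarrow> 'c" and A :: "'k set"
    and D :: "'k \<Rightarrow> int" and \<alpha> :: "'k \<Rightarrow> 'c" and q :: nat and \<rho> :: real
  assumes q_def: "q = CARD('f)" and hom_iK: "field_hom iK" and hom_iC: "field_hom iC"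
    and complete: "(\<And>\<epsilon>. \<epsilon> > 0 \<Longrightarrow> \<exists>N. \<forall>m\<ge>N. \<forall>n\<ge>N. v (s m - s n) < \<epsilon>) \<Longrightarrow> \<exists>l. (\<lambda>n. v (s n - l)) \<longlonglongrightarrow> 0"
    and A: "is_subring A" "iK c \<in> A"
    and hom_\<alpha>: "field_hom \<alpha>" and \<alpha>_iK: "\<alpha> (iK c) = iC c"
    and D_mult: "x \<noteq> 0 \<Longrightarrow> y \<noteq> 0 \<Longrightarrow> D (x * y) = D x + D y"
    and D_nonneg: "x \<in> A \<Longrightarrow> x \<noteq> 0 \<Longrightarrow> 0 \<le> D x"
    and D_graded: "graded_space (\<lambda>c x. iK c * x) D"
    and v_\<alpha>: "x \<noteq> 0 \<Longrightarrow> v (\<alpha> x) = \<rho> powr D x" and \<rho>: "\<rho> > 1"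
    and cofinite: "\<exists>n0. \<forall>n\<ge>n0. \<exists>a\<in>A. a \<noteq> 0 \<and> D a = int n"
begin

sublocale G: graded_space "\<lambda>c x. iK c * x" D by (rule D_graded)

declare G.scale_scale [simp del]

lemmas iK_simps [simp] = field_hom_simps[OF hom_iK]
lemmas iC_simps [simp] = field_hom_simps[OF hom_iC]
lemmas \<alpha>_simps [simp] = field_hom_simps[OF hom_\<alpha>]
lemmas frob = frobenius_over_finite_field[OF hom_iC, folded q_def]

lemma q_gt_1: "q > 1"
proof -
  have "card {0, 1 :: 'f} \<le> q" unfolding q_def by (rule card_mono) auto
  then show ?thesis by simp
qed

lemma zero_power_q [simp]: "(0::'c) ^ (q ^ k) = 0"
  using q_gt_1 by simp

lemma power_q: "(x::'a::monoid_mult) ^ q = x * x ^ (q - 1)"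
proof -
  have "q = Suc (q - 1)" using q_gt_1 by simp
  then show ?thesis by (metis power_Suc)
qed

definition degs :: "nat set" where "degs = {n. \<exists>a\<in>A. a \<noteq> 0 \<and> D a = int n}"

definition sdeg :: "nat \<Rightarrow> nat" where "sdeg = enumerate degs"

text \<open>A basis of A over the finite field with one element for each degree that occurs. Its
  images under \<open>\<alpha>\<close> are lattice vectors of strictly increasing size.\<close>

definition b :: "nat \<Rightarrow> 'k" where "b k = (SOME a. a \<in> A \<and> a \<noteq> 0 \<and> D a = int (sdeg k))"

lemma infinite_degs: "infinite degs"
proof
  assume "finite degs"
  obtain n0 where "\<forall>n\<ge>n0. \<exists>a\<in>A. a \<noteq> 0 \<and> D a = int n" using cofinite by blast
  then have "{n0..} \<subseteq> degs" by (auto simp: degs_def)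
  then show False using \<open>finite degs\<close> infinite_Ici finite_subset by blast
qed

lemma b: "b k \<in> A" "b k \<noteq> 0" "D (b k) = int (sdeg k)"
proof -
  have "sdeg k \<in> degs" unfolding sdeg_def by (rule enumerate_in_set[OF infinite_degs])
  then have "\<exists>a. a \<in> A \<and> a \<noteq> 0 \<and> D a = int (sdeg k)" by (auto simp: degs_def)
  then have "b k \<in> A \<and> b k \<noteq> 0 \<and> D (b k) = int (sdeg k)" unfolding b_def by (rule someI_ex)
  then show "b k \<in> A" "b k \<noteq> 0" "D (b k) = int (sdeg k)" by auto
qed

lemma sdeg_mono: "strict_mono sdeg"
  unfolding sdeg_def using infinite_degs by (rule strict_mono_enumerate)

lemma sdeg_less_iff [simp]: "sdeg m < sdeg n \<longleftrightarrow> m < n"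
  by (rule strict_mono_less[OF sdeg_mono])

lemma sdeg_exists: "a \<in> A \<Longrightarrow> a \<noteq> 0 \<Longrightarrow> \<exists>k. D a = int (sdeg k)"
proof -
  assume a: "a \<in> A" "a \<noteq> 0"
  then have "nat (D a) \<in> degs" using D_nonneg[OF a] by (auto simp: degs_def)
  then obtain k where "enumerate degs k = nat (D a)" using enumerate_Ex[OF infinite_degs] by blast
  then show ?thesis using D_nonneg[OF a] by (intro exI[of _ k]) (simp add: sdeg_def)
qed

text \<open>The degrees have no gaps from some index on. This gives the Drinfeld module rank one:
  multiplication by an element of degree d eventually shifts the index of a basis vector by exactly
  d.\<close>

lemma sdeg_eventually: "\<exists>n0. \<forall>n\<ge>n0. \<forall>d. sdeg (n + d) = sdeg n + d"
proof -
  obtain n0 where n0: "\<forall>n\<ge>n0. \<exists>a\<in>A. a \<noteq> 0 \<and> D a = int n" using cofinite by blast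
  have step: "sdeg (Suc n) = Suc (sdeg n)" if "n \<ge> n0" for n
  proof -
    have "n \<le> sdeg n" using strict_mono_imp_increasing[OF sdeg_mono] by simp
    then have "n0 \<le> Suc (sdeg n)" using that by simp
    then have "Suc (sdeg n) \<in> degs" using n0 unfolding degs_def by blast
    then obtain k where k: "sdeg k = Suc (sdeg n)" using enumerate_Ex[OF infinite_degs] by (auto simp: sdeg_def)
    have "n < k" using k sdeg_less_iff[of n k] by simp
    then have "sdeg (Suc n) \<le> sdeg k" using strict_mono_less_eq[OF sdeg_mono] by simp
    moreover have "sdeg n < sdeg (Suc n)" by simp
    ultimately show ?thesis using k by linarith
  qed
  have "sdeg (n + d) = sdeg n + d" if "n \<ge> n0" for n d
    by (induction d) (use step that in auto)
  then show ?thesis by blast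
qed

lemma A_expand: "a \<in> A \<Longrightarrow> a = 0 \<or> D a < int (sdeg n) \<Longrightarrow> \<exists>c. a = (\<Sum>k<n. iK (c k) * b k)"
proof (induction n arbitrary: a)
  case 0
  have "a = 0"
  proof (rule ccontr)
    assume a: "a \<noteq> 0"
    then obtain k where "D a = int (sdeg k)" using sdeg_exists 0 by blast
    then have "sdeg k < sdeg 0" using 0 a by simp
    then show False by (simp only: sdeg_less_iff not_less_zero)
  qed
  then show ?case by simp
next
  case (Suc n)
  show ?case
  proof (cases "a = 0 \<or> D a < int (sdeg n)")
    case True
    then obtain c where "a = (\<Sum>k<n. iK (c k) * b k)" using Suc by blast
    then show ?thesis by (intro exI[of _ "\<lambda>k. if k < n then c k else 0"]) simp
  next
    case False
    then have a: "a \<noteq> 0" "D a \<ge> int (sdeg n)" by auto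
    obtain k where k: "D a = int (sdeg k)" using sdeg_exists Suc(2) a by blast
    have "D a < int (sdeg (Suc n))" using Suc(3) a(1) by blast
    then have "sdeg k < sdeg (Suc n)" "\<not> sdeg k < sdeg n" using a(2) k by linarith+
    then have "k = n" unfolding sdeg_less_iff by simp
    then have "D a = D (b n)" using k b(3) by simp
    then obtain c where c: "a - iK c * b n = 0 \<or> D (a - iK c * b n) < D a"
      using G.D_cancel[OF a(1) b(2)] by blast
    have "a - iK c * b n \<in> A" using Suc(2) A b(1) is_subringD(3,4)[OF A(1)] by simp
    then obtain c' where c': "a - iK c * b n = (\<Sum>k<n. iK (c' k) * b k)"
      using Suc(1) c k \<open>k = n\<close> by metis
    have "(\<Sum>k<n. iK ((c'(n := c)) k) * b k) = (\<Sum>k<n. iK (c' k) * b k)" by (intro sum.cong) auto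
    then have "a = (\<Sum>k<Suc n. iK ((c'(n := c)) k) * b k)" using c' by (simp add: algebra_simps)
    then show ?thesis by blast
  qed
qed

subsection \<open>The exponential of the lattice\<close>

definition bC :: "nat \<Rightarrow> 'c" where "bC k = \<alpha> (b k)"

lemma bC_nonzero [simp]: "bC k \<noteq> 0" using b(2) by (simp add: bC_def)

lemma v_bC: "v (bC k) = \<rho> powr sdeg k" using v_\<alpha>[OF b(2)] b(3) by (simp add: bC_def)

lemma v_bC_less: "v (bC m) < v (bC n) \<longleftrightarrow> m < n"
  unfolding v_bC using \<rho> by simp

lemma v_bC_ge: "v (bC k) \<ge> \<rho> powr k"
  unfolding v_bC using \<rho> strict_mono_imp_increasing[OF sdeg_mono, of k] by simp

lemma v_bC_ge_1: "v (bC k) \<ge> 1"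
  unfolding v_bC using \<rho> by (simp add: ge_one_powr_ge_zero)

text \<open>\<open>E n x\<close> is x times the product of 1 - x/\<lambda> over the nonzero
  \<lambda> in the span of the first n lattice vectors. The step composes with z - z^q / y^(q-1),
  the polynomial whose kernel is the line through y = \<open>E n (bC n)\<close>.\<close>

primrec E :: "nat \<Rightarrow> 'c \<Rightarrow> 'c" where
  "E 0 x = x"
| "E (Suc n) x = E n x - E n x ^ q / E n (bC n) ^ (q - 1)"

definition yy :: "nat \<Rightarrow> 'c" where "yy n = E n (bC n)"

definition pii :: "nat \<Rightarrow> 'c" where "pii n = inverse (yy n ^ (q - 1))"

lemma E_Suc: "E (Suc n) x = E n x - pii n * E n x ^ q"
  by (simp add: pii_def yy_def field_simps)

lemma E_add: "E n (x + y) = E n x + E n y"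
  by (induction n) (simp_all add: E_Suc frob(3)[of _ _ 1, simplified] algebra_simps del: E.simps(2))

lemma E_scale: "E n (iC c * x) = iC c * E n x"
  by (induction n) (simp_all add: E_Suc power_mult_distrib frob(6)[of _ 1, simplified] algebra_simps del: E.simps(2))

lemma E_0: "E n 0 = 0" using E_scale[of n 0 0] by simp

lemma E_sum: "E n (sum f I) = (\<Sum>i\<in>I. E n (f i))"
  by (induction I rule: infinite_finite_induct) (simp_all add: E_0 E_add)

text \<open>The absolute value of the leading coefficient of \<open>E n\<close>, that is, the
  product of 1/|\<lambda>| over the nonzero vectors of the span. The next step adds q^(n+1) - q^n
  vectors, all of the size of \<open>bC n\<close>.\<close>

primrec L :: "nat \<Rightarrow> real" where
  "L 0 = 1"
| "L (Suc n) = L n * (v (bC n) ^ (q ^ n) / v (bC n) ^ (q ^ Suc n))"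

lemma L_pos: "L n > 0"
  by (induction n) simp_all

text \<open>For \<open>x\<close> larger than the first n lattice vectors the top term of
  \<open>E n\<close> dominates. The lower bound makes the values \<open>yy n\<close> at the next
  lattice vector grow, so the coefficients \<open>pii n\<close> of the correction terms tend to
  0.\<close>

lemma v_E:
  assumes "\<And>k. k < n \<Longrightarrow> v (bC k) < v x"
  shows "v (E n x) = L n * v x ^ (q ^ n) \<and> v x \<le> v (E n x)"
  using assms
proof (induction n arbitrary: x)
  case (Suc n)
  obtain p where p: "q - Suc 0 = p" "p > 0" using q_gt_1 by simp
  have pw: "(z::real) ^ q = z * z ^ p" for z using power_q[of z] by (simp add: p(1))
  define s where "s = v (E n x)"
  define t where "t = v (yy n)"
  have "v (E n x) = L n * v x ^ (q ^ n) \<and> v x \<le> v (E n x)"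
    by (rule Suc.IH) (use Suc.prems in simp)
  then have s: "s = L n * v x ^ (q ^ n)" "v x \<le> s" unfolding s_def by blast+
  have t: "t = L n * v (bC n) ^ (q ^ n)" "v (bC n) \<le> t"
    using Suc.IH[of "bC n"] v_bC_less by (auto simp: t_def yy_def)
  have "v (bC n) < v x" using Suc by simp
  then have "v (bC n) ^ (q ^ n) < v x ^ (q ^ n)" using q_gt_1 by (intro power_strict_mono) auto
  then have ts: "t < s" using L_pos[of n] by (simp add: s t)
  have t0: "t > 0" using t(2) v_bC_ge_1[of n] by linarith
  have big: "v (pii n * E n x ^ q) = s * (s / t) ^ p"
    using t0 by (simp add: v_mult v_power pii_def v_inverse p(1) pw s_def t_def divide_inverse power_mult_distrib power_inverse)
  have gt: "s < s * (s / t) ^ p" using ts t0 p(2) by (simp add: one_less_power)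
  have "v (E (Suc n) x) = v (- (pii n * E n x ^ q) + E n x)" unfolding E_Suc by simp
  also have "\<dots> = v (- (pii n * E n x ^ q))" by (rule v_add_eq) (simp add: big gt s_def[symmetric])
  finally have e: "v (E (Suc n) x) = s * (s / t) ^ p" by (simp add: big)
  have "s * (s / t) ^ p = L n * v x ^ (q ^ n) * (v x ^ (q ^ n) / v (bC n) ^ (q ^ n)) ^ p"
    unfolding s(1) t(1) using L_pos[of n] by simp
  also have "\<dots> = L n * (v x ^ (q ^ n)) ^ q * (v (bC n) ^ (q ^ n) / (v (bC n) ^ (q ^ n)) ^ q)"
    by (simp add: pw power_divide)
  also have "\<dots> = L (Suc n) * v x ^ (q ^ Suc n)"
    by (simp add: power_mult[symmetric] mult.commute[of q])
  finally show ?case using e gt s(2) by simp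
qed simp

lemma v_yy: "v (yy n) = L n * v (bC n) ^ (q ^ n)" "v (bC n) \<le> v (yy n)"
  using v_E[of n "bC n"] v_bC_less by (auto simp: yy_def)

lemma yy_nonzero [simp]: "yy n \<noteq> 0"
  using v_yy(2)[of n] v_bC_ge_1[of n] by auto

lemma v_pii: "v (pii n) \<le> inverse (\<rho> powr n)"
proof -
  obtain p where p: "q - Suc 0 = Suc p" using q_gt_1 by (cases "q - Suc 0") auto
  have "1 \<le> v (yy n)" using v_yy(2)[of n] v_bC_ge_1[of n] by linarith
  then have "v (yy n) * 1 \<le> v (yy n) * v (yy n) ^ p" by (intro mult_left_mono one_le_power) auto
  then have "\<rho> powr n \<le> v (yy n) * v (yy n) ^ p" using v_yy(2)[of n] v_bC_ge[of n] by linarith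
  then have "\<rho> powr n \<le> v (yy n) ^ (q - 1)" by (simp add: p)
  moreover have "\<rho> powr n > 0" using \<rho> by simp
  ultimately show ?thesis by (simp add: pii_def v_inverse v_power le_imp_inverse_le)
qed

lemma E_bC: "k < n \<Longrightarrow> E n (bC k) = 0"
proof (induction n)
  case (Suc n)
  show ?case
  proof (cases "k = n")
    case True
    have "yy n ^ q = yy n * yy n ^ (q - 1)" by (rule power_q)
    then have "yy n ^ q / yy n ^ (q - 1) = yy n" by simp
    then show ?thesis using True by (simp add: yy_def)
  next
    case False
    then have "E n (bC k) = 0" using Suc by simp
    then show ?thesis using q_gt_1 by simp
  qed
qed simp

lemma E_lattice: "a \<in> A \<Longrightarrow> a = 0 \<or> D a < int (sdeg n) \<Longrightarrow> E n (\<alpha> a) = 0"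
proof -
  assume "a \<in> A" "a = 0 \<or> D a < int (sdeg n)"
  then obtain c where "a = (\<Sum>k<n. iK (c k) * b k)" using A_expand by blast
  then have "\<alpha> a = (\<Sum>k<n. iC (c k) * bC k)" by (simp add: \<alpha>_iK bC_def)
  then show ?thesis by (simp add: E_sum E_scale E_bC)
qed

text \<open>The product of twisted power series in \<tau>, where \<tau> c = c^q \<tau>, written on
  coefficient sequences.\<close>

definition tm :: "(nat \<Rightarrow> 'c) \<Rightarrow> (nat \<Rightarrow> 'c) \<Rightarrow> nat \<Rightarrow> 'c" where
  "tm f g n = (\<Sum>i\<le>n. f i * g (n - i) ^ (q ^ i))"

definition cst :: "'c \<Rightarrow> nat \<Rightarrow> 'c" where "cst c k = (if k = 0 then c else 0)"

lemma tm_assoc: "tm (tm f g) h = tm f (tm g h)"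
proof
  fix k
  define F where "F i j l = f i * g j ^ (q ^ i) * h l ^ (q ^ (i + j))" for i j l
  have "tm (tm f g) h k = (\<Sum>m\<le>k. \<Sum>i\<le>m. F i (m - i) (k - m))"
    by (simp add: tm_def F_def sum_distrib_right)
  also have "\<dots> = (\<Sum>i\<le>k. \<Sum>l\<le>k - i. F i l (k - i - l))"
    by (simp add: sum.Sigma Sigma_def)
      (rule sum.reindex_bij_witness[of _ "\<lambda>(i, l). (i + l, i)" "\<lambda>(m, i). (i, m - i)"], auto)
  also have "\<dots> = tm f (tm g h) k"
    by (simp add: tm_def F_def sum_distrib_left frob power_mult_distrib mult.assoc power_add
        flip: power_mult) (simp add: mult.commute)
  finally show "tm (tm f g) h k = tm f (tm g h) k" .
qed

lemma tm_cst: "tm f (cst c) k = f k * c ^ (q ^ k)"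
proof -
  have "tm f (cst c) k = (\<Sum>i\<le>k. if i = k then f k * c ^ (q ^ k) else 0)"
    unfolding tm_def by (intro sum.cong) (auto simp: cst_def)
  then show ?thesis by simp
qed

lemma tm_cst_left: "tm (cst c) g k = c * g k"
proof -
  have "tm (cst c) g k = (\<Sum>i\<le>k. if i = 0 then c * g k else 0)"
    unfolding tm_def by (intro sum.cong) (auto simp: cst_def)
  then show ?thesis by simp
qed

lemma tm_top:
  assumes "\<And>i. i > m \<Longrightarrow> f i = 0" "\<And>i. i > n \<Longrightarrow> g i = 0"
  shows "tm f g (m + n) = f m * g n ^ (q ^ m)" "k > m + n \<Longrightarrow> tm f g k = 0"
proof -
  have z: "f i * g (k - i) ^ (q ^ i) = 0" if "i \<noteq> m" "k \<ge> m + n" for i k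
    using that assms by (cases "i < m") (auto simp: not_less)
  have "tm f g (m + n) = (\<Sum>i\<le>m + n. if i = m then f m * g n ^ (q ^ m) else 0)"
    unfolding tm_def using z[of _ "m + n"] by (intro sum.cong) auto
  then show "tm f g (m + n) = f m * g n ^ (q ^ m)" by simp
  show "tm f g k = 0" if "k > m + n"
    unfolding tm_def
  proof (rule sum.neutral, rule ballI)
    fix i show "f i * g (k - i) ^ (q ^ i) = 0"
      using z[of i k] that assms(2)[of "k - m"] by (cases "i = m") auto
  qed
qed

definition evs :: "(nat \<Rightarrow> 'c) \<Rightarrow> nat \<Rightarrow> 'c \<Rightarrow> 'c" where
  "evs f n x = (\<Sum>k\<le>n. f k * x ^ (q ^ k))"

lemma evs_bound: "(\<And>i. i > m \<Longrightarrow> f i = 0) \<Longrightarrow> m \<le> n \<Longrightarrow> evs f n x = evs f m x"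
  unfolding evs_def by (intro sum.mono_neutral_right) auto

text \<open>Additive polynomials compose as twisted polynomials multiply. The bounds on the supports
  allow the triangle of indices of the product to be cut down to a rectangle.\<close>

lemma evs_tm:
  assumes f: "\<And>i. i > m \<Longrightarrow> f i = 0" and g: "\<And>i. i > n \<Longrightarrow> g i = 0"
  shows "evs (tm f g) (m + n) x = evs f m (evs g n x)"
proof -
  define F where "F i l = f i * g l ^ (q ^ i) * x ^ (q ^ (i + l))" for i l
  have "evs (tm f g) (m + n) x = (\<Sum>k\<le>m + n. \<Sum>i\<le>k. F i (k - i))"
    by (simp add: evs_def tm_def F_def sum_distrib_right)
  also have "\<dots> = (\<Sum>(i, l)\<in>{(i, l). i + l \<le> m + n}. F i l)"
    by (simp add: sum.Sigma Sigma_def)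
      (rule sum.reindex_bij_witness[of _ "\<lambda>(i, l). (i + l, i)" "\<lambda>(k, i). (i, k - i)"], auto)
  also have "\<dots> = (\<Sum>(i, l)\<in>{..m} \<times> {..n}. F i l)"
  proof (rule sum.mono_neutral_right)
    have "{(i, l). i + l \<le> m + n} \<subseteq> {..m + n} \<times> {..m + n}" by auto
    then show "finite {(i, l). i + l \<le> m + n}" by (rule finite_subset) simp
    show "{..m} \<times> {..n} \<subseteq> {(i, l). i + l \<le> m + n}" by auto
    show "\<forall>p\<in>{(i, l). i + l \<le> m + n} - {..m} \<times> {..n}. (case p of (i, l) \<Rightarrow> F i l) = 0"
    proof (rule ballI)
      fix p assume p: "p \<in> {(i, l). i + l \<le> m + n} - {..m} \<times> {..n}"
      obtain i l where il: "p = (i, l)" by (cases p)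
      have "i > m \<or> l > n" using p il by auto
      then have "F i l = 0" unfolding F_def using f[of i] g[of l] zero_power_q[of i] by (elim disjE) simp_all
      then show "(case p of (i, l) \<Rightarrow> F i l) = 0" by (simp add: il)
    qed
  qed
  also have "\<dots> = evs f m (evs g n x)"
    by (simp add: sum.cartesian_product[symmetric] evs_def F_def frob power_mult_distrib
        sum_distrib_left power_add mult.assoc flip: power_mult) (simp add: mult.commute)
  finally show ?thesis .
qed

text \<open>The twisted polynomial 1 - p \<tau>.\<close>

definition lin1 :: "'c \<Rightarrow> nat \<Rightarrow> 'c" where
  "lin1 p k = (if k = 0 then 1 else if k = 1 then - p else 0)"

lemma tm_lin1_left: "tm (lin1 p) g k = g k - (if k = 0 then 0 else p * g (k - 1) ^ q)"
proof (cases k)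
  case (Suc m)
  have "tm (lin1 p) g k = (\<Sum>i\<in>{0, 1}. lin1 p i * g (k - i) ^ (q ^ i))"
    unfolding tm_def using Suc by (intro sum.mono_neutral_right) (auto simp: lin1_def)
  then show ?thesis using Suc by (simp add: lin1_def)
qed (simp add: tm_def lin1_def)

lemma neg_power_q: "(- p :: 'c) ^ (q ^ k) = - (p ^ (q ^ k))"
  using frob(4)[of 0 p k] by simp

lemma tm_lin1_right: "tm f (lin1 p) k = f k - (if k = 0 then 0 else f (k - 1) * p ^ (q ^ (k - 1)))"
proof (cases k)
  case (Suc m)
  have "tm f (lin1 p) k = (\<Sum>i\<in>{k - 1, k}. f i * lin1 p (k - i) ^ (q ^ i))"
    unfolding tm_def using Suc q_gt_1 by (intro sum.mono_neutral_right) (auto simp: lin1_def)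
  then show ?thesis using Suc by (simp add: lin1_def neg_power_q)
qed (simp add: tm_def lin1_def)

text \<open>The twisted polynomial of \<open>E n\<close>. Each new factor stands on the left because
  it is applied last.\<close>

primrec P :: "nat \<Rightarrow> nat \<Rightarrow> 'c" where
  "P 0 = cst 1"
| "P (Suc n) = tm (lin1 (pii n)) (P n)"

lemma P_Suc: "P (Suc n) k = P n k - (if k = 0 then 0 else pii n * P n (k - 1) ^ q)"
  by (simp add: tm_lin1_left)

lemma P_support: "k > n \<Longrightarrow> P n k = 0"
proof (induction n arbitrary: k)
  case (Suc n)
  then show ?case unfolding P_Suc using q_gt_1 by simp
qed (simp add: cst_def)

lemma P_const: "P n 0 = 1"
  by (induction n) (simp_all add: cst_def P_Suc del: P.simps(2))

lemma evs_P: "evs (P n) n x = E n x"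
proof (induction n arbitrary: x)
  case 0
  show ?case by (simp add: evs_def cst_def)
next
  case (Suc n)
  have "evs (P (Suc n)) (1 + n) x = evs (lin1 (pii n)) 1 (evs (P n) n x)"
    unfolding P.simps(2) by (rule evs_tm) (simp_all add: lin1_def P_support)
  also have "\<dots> = E (Suc n) x" unfolding E_Suc Suc by (simp add: evs_def lin1_def)
  finally show ?case by simp
qed

lemma v_P_le: "v (P n k) \<le> 1"
proof (induction n arbitrary: k)
  case (Suc n)
  have "v (pii n) \<le> 1" using v_pii[of n] \<rho> ge_one_powr_ge_zero[of \<rho> n]
    by (metis inverse_le_1_iff less_imp_le of_nat_0_le_iff order_trans)
  then have "v (pii n * P n (k - 1) ^ q) \<le> 1"
    using Suc[of "k - 1"] by (simp add: v_mult v_power mult_le_one power_le_one)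
  then have "v (P n k - pii n * P n (k - 1) ^ q) \<le> 1"
    using v_diff[of "P n k" "pii n * P n (k - 1) ^ q"] Suc[of k] by linarith
  then show ?case unfolding P_Suc using Suc[of k] by (cases "k = 0") simp_all
qed (simp add: cst_def)

lemma v_P_top: "v (P n n) = L n"
proof (induction n)
  case (Suc n)
  obtain p where p: "q - Suc 0 = p" by simp
  have pw: "(z::real) ^ q = z * z ^ p" for z using power_q[of z] by (simp add: p)
  have "v (P (Suc n) (Suc n)) = v (pii n) * v (P n n) ^ q"
    unfolding P_Suc by (simp add: P_support v_mult v_power)
  also have "\<dots> = L n ^ q / (L n * v (bC n) ^ (q ^ n)) ^ p"
    by (simp add: Suc pii_def v_inverse v_power v_yy(1) p divide_inverse)
  also have "\<dots> = L n / (v (bC n) ^ (q ^ n)) ^ p" using L_pos[of n] by (simp add: pw power_mult_distrib)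
  also have "\<dots> = L n * (v (bC n) ^ (q ^ n) / (v (bC n) ^ (q ^ n)) ^ q)" by (simp add: pw)
  also have "\<dots> = L (Suc n)" by (simp add: power_mult[symmetric] mult.commute[of q])
  finally show ?case .
qed (simp add: cst_def)

definition conv :: "(nat \<Rightarrow> 'c) \<Rightarrow> 'c \<Rightarrow> bool" where
  "conv s l \<longleftrightarrow> (\<lambda>n. v (s n - l)) \<longlonglongrightarrow> 0"

lemma convI:
  assumes "\<And>n. v (s n - l) \<le> B n" "B \<longlonglongrightarrow> 0"
  shows "conv s l"
  unfolding conv_def
  by (rule tendsto_sandwich[OF _ _ tendsto_const assms(2)]) (simp_all add: assms(1))

lemma conv_const: "conv (\<lambda>_. c) c" by (simp add: conv_def)

lemma conv_mult:
  assumes "conv s l" "conv t m"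
  shows "conv (\<lambda>n. s n * t n) (l * m)"
proof (rule convI)
  fix n
  have e: "s n * t n - l * m = (s n - l) * (t n - m) + (l * (t n - m) + m * (s n - l))" by (simp add: algebra_simps)
  have "v (s n * t n - l * m) \<le> max (v ((s n - l) * (t n - m))) (max (v (l * (t n - m))) (v (m * (s n - l))))"
    unfolding e using v_add[of "(s n - l) * (t n - m)"] v_add[of "l * (t n - m)" "m * (s n - l)"]
    by (meson max.mono order_refl order_trans)
  also have "\<dots> \<le> v (s n - l) * v (t n - m) + (v l * v (t n - m) + v m * v (s n - l))"
    by (simp add: v_mult)
  finally show "v (s n * t n - l * m) \<le> v (s n - l) * v (t n - m) + (v l * v (t n - m) + v m * v (s n - l))" .
next
  have "(\<lambda>n. v (s n - l) * v (t n - m) + (v l * v (t n - m) + v m * v (s n - l))) \<longlonglongrightarrow> 0 * 0 + (v l * 0 + v m * 0)"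
    using assms unfolding conv_def by (intro tendsto_intros)
  then show "(\<lambda>n. v (s n - l) * v (t n - m) + (v l * v (t n - m) + v m * v (s n - l))) \<longlonglongrightarrow> 0" by simp
qed

lemma conv_power: "conv s l \<Longrightarrow> conv (\<lambda>n. s n ^ k) (l ^ k)"
  by (induction k) (simp_all add: conv_const conv_mult)

lemma conv_diff:
  assumes "conv s l" "conv t m"
  shows "conv (\<lambda>n. s n - t n) (l - m)"
proof (rule convI)
  fix n
  have "v ((s n - t n) - (l - m)) = v ((s n - l) - (t n - m))" by (simp add: algebra_simps)
  also have "\<dots> \<le> max (v (s n - l)) (v (t n - m))" by (rule v_diff)
  also have "\<dots> \<le> v (s n - l) + v (t n - m)" by simp
  finally show "v ((s n - t n) - (l - m)) \<le> v (s n - l) + v (t n - m)" .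
next
  have "(\<lambda>n. v (s n - l) + v (t n - m)) \<longlonglongrightarrow> 0 + 0"
    using assms unfolding conv_def by (intro tendsto_intros)
  then show "(\<lambda>n. v (s n - l) + v (t n - m)) \<longlonglongrightarrow> 0" by simp
qed

lemma conv_sum: "(\<And>i. i \<in> I \<Longrightarrow> conv (s i) (l i)) \<Longrightarrow> conv (\<lambda>n. \<Sum>i\<in>I. s i n) (\<Sum>i\<in>I. l i)"
proof (induction I rule: infinite_finite_induct)
  case (insert i I)
  have "conv (\<lambda>n. s i n - (0 - (\<Sum>i\<in>I. s i n))) (l i - (0 - (\<Sum>i\<in>I. l i)))"
    using insert by (intro conv_diff conv_const) auto
  then show ?case using insert by simp
qed (simp_all add: conv_const)

lemma conv_unique:
  assumes "conv s l" "conv s m"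
  shows "l = m"
proof -
  have "conv (\<lambda>n. s n - s n) (l - m)" by (rule conv_diff[OF assms])
  then have "(\<lambda>n. v (l - m)) \<longlonglongrightarrow> 0" by (simp add: conv_def v_diff_commute)
  then show ?thesis by (simp add: LIMSEQ_const_iff)
qed

lemma conv_shift: "conv s l \<Longrightarrow> conv (\<lambda>n. s (n + k)) l"
  unfolding conv_def by (rule LIMSEQ_ignore_initial_segment)

lemma conv_eventually: "(\<forall>n\<ge>N. s n = t n) \<Longrightarrow> conv s l \<Longrightarrow> conv t l"
  unfolding conv_def by (rule Lim_transform_eventually) (auto simp: eventually_sequentially intro!: exI[of _ N])

text \<open>One more factor changes a coefficient by \<open>pii\<close> times something of size at
  most 1, and by the ultrametric inequality many changes are no larger than the largest of
  them.\<close>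

lemma P_Cauchy: "v (P (n + d) k - P n k) \<le> inverse (\<rho> powr n)"
proof (induction d)
  case (Suc d)
  have "v (P (Suc (n + d)) k - P (n + d) k) \<le> inverse (\<rho> powr n)"
  proof (cases "k = 0")
    case False
    have "v (P (Suc (n + d)) k - P (n + d) k) = v (pii (n + d)) * v (P (n + d) (k - 1)) ^ q"
      unfolding P_Suc using False by (simp add: v_mult v_power)
    also have "\<dots> \<le> v (pii (n + d)) * 1" using v_P_le by (intro mult_left_mono power_le_one) auto
    also have "\<dots> \<le> inverse (\<rho> powr (n + d))" using v_pii[of "n + d"] by simp
    also have "\<dots> \<le> inverse (\<rho> powr n)" using \<rho> by (intro le_imp_inverse_le) auto
    finally show ?thesis .
  qed (use \<rho> in \<open>simp add: P_const del: P.simps(2)\<close>)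
  moreover have "P (n + Suc d) k - P n k = (P (Suc (n + d)) k - P (n + d) k) + (P (n + d) k - P n k)" by simp
  ultimately show ?case using v_add[of "P (Suc (n + d)) k - P (n + d) k" "P (n + d) k - P n k"] Suc
    by (simp only:)
qed simp

lemma inverse_rho_tendsto: "(\<lambda>n. inverse (\<rho> powr real n)) \<longlonglongrightarrow> 0"
proof -
  have "(\<lambda>n. inverse \<rho> ^ n) \<longlonglongrightarrow> 0" using \<rho> by (intro LIMSEQ_realpow_zero) (auto simp: inverse_less_1_iff)
  moreover have "inverse (\<rho> powr real n) = inverse \<rho> ^ n" for n using \<rho> by (simp add: powr_realpow power_inverse)
  ultimately show ?thesis by simp
qed

lemma P_converges: "\<exists>l. conv (\<lambda>n. P n k) l"
  unfolding conv_def
proof (rule complete)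
  fix \<epsilon> :: real assume "\<epsilon> > 0"
  then have "eventually (\<lambda>n. inverse (\<rho> powr real n) < \<epsilon>) sequentially"
    by (rule order_tendstoD(2)[OF inverse_rho_tendsto])
  then obtain N where N: "\<And>n. n \<ge> N \<Longrightarrow> inverse (\<rho> powr real n) < \<epsilon>"
    unfolding eventually_sequentially by blast
  have "v (P m k - P n k) < \<epsilon>" if "m \<ge> N" "n \<ge> N" for m n
  proof (cases "n \<le> m")
    case True
    then show ?thesis using P_Cauchy[of n "m - n" k] N[OF that(2)] by simp
  next
    case False
    then show ?thesis using P_Cauchy[of m "n - m" k] N[OF that(1)] by (simp add: v_diff_commute)
  qed
  then show "\<exists>N. \<forall>m\<ge>N. \<forall>n\<ge>N. v (P m k - P n k) < \<epsilon>" by blast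
qed

text \<open>The coefficients of the exponential function of the lattice, used as a formal twisted
  power series.\<close>

definition ee :: "nat \<Rightarrow> 'c" where "ee k = (SOME l. conv (\<lambda>n. P n k) l)"

lemma ee: "conv (\<lambda>n. P n k) (ee k)"
  unfolding ee_def by (rule someI_ex[OF P_converges])

lemma ee_0: "ee 0 = 1"
  using conv_unique[OF ee[of 0]] conv_const[of 1] by (simp add: P_const)

lemma tm_ee_cancel:
  assumes "tm f ee = tm g ee"
  shows "f = g"
proof
  fix k show "f k = g k"
  proof (induction k rule: less_induct)
    case (less k)
    have e: "tm h ee k = h k + (\<Sum>i<k. h i * ee (k - i) ^ (q ^ i))" for h
      unfolding tm_def by (simp add: ee_0 lessThan_Suc_atMost[symmetric] add.commute)
    have "(\<Sum>i<k. f i * ee (k - i) ^ (q ^ i)) = (\<Sum>i<k. g i * ee (k - i) ^ (q ^ i))"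
      using less by (intro sum.cong) auto
    moreover have "tm f ee k = tm g ee k" using assms by simp
    ultimately show ?case by (simp add: e)
  qed
qed


subsection \<open>The Drinfeld module of the lattice\<close>

text \<open>Right quotients: \<open>FF a n m\<close> times \<open>P m\<close> is \<open>P n\<close>
  times the constant \<open>\<alpha> a\<close>. The step divides on the right by 1 -
  \<open>pii m\<close> \<tau>: after the k-th coefficient is multiplied by the power q^k of
  \<open>yy m\<close>, this factor takes differences of consecutive coefficients, so division means
  summation.\<close>

primrec FF :: "'k \<Rightarrow> nat \<Rightarrow> nat \<Rightarrow> nat \<Rightarrow> 'c" where
  "FF a n 0 = tm (P n) (cst (\<alpha> a))"
| "FF a n (Suc m) = (\<lambda>k. (\<Sum>i\<le>k. FF a n m i * yy m ^ (q ^ i)) / yy m ^ (q ^ k))"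

lemma pii_power: "pii m ^ (q ^ l) = yy m ^ (q ^ l) / yy m ^ (q ^ Suc l)"
proof -
  have "pii m = yy m / yy m ^ q" unfolding pii_def power_q[of "yy m"] by (simp add: divide_inverse)
  then show ?thesis by (simp add: power_divide power_mult[symmetric])
qed

lemma FF_step: "FF a n m = tm (FF a n (Suc m)) (lin1 (pii m))"
proof
  fix k
  show "FF a n m k = tm (FF a n (Suc m)) (lin1 (pii m)) k"
  proof (cases k)
    case 0
    then show ?thesis by (simp add: tm_lin1_right)
  next
    case (Suc l)
    show ?thesis unfolding tm_lin1_right Suc
      by (simp add: pii_power add_divide_distrib del: power_Suc)
  qed
qed

lemma FF_P: "tm (FF a n m) (P m) = FF a n 0"
proof (induction m)
  case 0
  show ?case by (rule ext) (simp only: P.simps(1) tm_cst power_one mult_1_right)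
next
  case (Suc m)
  have "tm (FF a n (Suc m)) (P (Suc m)) = tm (tm (FF a n (Suc m)) (lin1 (pii m))) (P m)"
    by (simp only: P.simps(2) tm_assoc)
  then show ?case using Suc by (simp only: FF_step[symmetric])
qed

text \<open>The sum defining the next quotient is the value of the additive polynomial
  \<open>FF a n m\<close> at \<open>yy m\<close>, hence the value of \<open>E n\<close> at the
  lattice vector of \<open>a * b m\<close>. It vanishes when that vector lies in the span of the
  first n, so the division is exact and lowers the degree by one.\<close>

lemma FF_support:
  assumes a: "a \<in> A" and m: "m \<le> n" "\<And>l. l < m \<Longrightarrow> a = 0 \<or> D a + int (sdeg l) < int (sdeg n)"
    and k: "k > n - m"
  shows "FF a n m k = 0"
  using m k
proof (induction m arbitrary: k)
  case 0
  then show ?case by (simp add: tm_cst P_support)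
next
  case (Suc m)
  have sup: "FF a n m i = 0" if "i > n - m" for i
    by (rule Suc.IH) (use Suc.prems that in auto)
  have "(\<Sum>i\<le>k. FF a n m i * yy m ^ (q ^ i)) = evs (FF a n m) k (yy m)" by (simp add: evs_def)
  also have "\<dots> = evs (FF a n m) (n - m) (evs (P m) m (bC m))"
    unfolding evs_P yy_def[symmetric] by (rule evs_bound) (use sup Suc.prems in auto)
  also have "\<dots> = evs (tm (FF a n m) (P m)) (n - m + m) (bC m)"
    by (rule evs_tm[symmetric]) (use sup P_support in auto)
  also have "\<dots> = evs (FF a n 0) n (bC m)" using Suc.prems by (simp add: FF_P del: FF.simps)
  also have "\<dots> = evs (P n) n (\<alpha> a * bC m)"
    unfolding evs_def by (intro sum.cong) (simp_all add: tm_cst power_mult_distrib mult.assoc)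
  also have "\<dots> = E n (\<alpha> (a * b m))" by (simp add: evs_P bC_def)
  also have "\<dots> = 0"
  proof (rule E_lattice)
    show "a * b m \<in> A" using a b(1) is_subringD(4)[OF A(1)] by simp
    show "a * b m = 0 \<or> D (a * b m) < int (sdeg n)"
      using Suc.prems(2)[of m] D_mult[of a "b m"] b(2,3) by (cases "a = 0") auto
  qed
  finally show ?case by simp
qed

text \<open>The coefficientwise solution of the functional equation
  \<open>tm (phi a) ee = tm ee (cst (\<alpha> a))\<close>, solvable because \<open>ee 0\<close> is
  1. At first it is only a power series; that it is a polynomial for \<open>a\<close> in A comes
  from the quotients \<open>FF\<close>.\<close>

fun phi :: "'k \<Rightarrow> nat \<Rightarrow> 'c" where
  "phi a k = ee k * \<alpha> a ^ (q ^ k) - (\<Sum>i<k. phi a i * ee (k - i) ^ (q ^ i))"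

declare phi.simps [simp del]

lemma tm_split: "tm f g k = f k * g 0 ^ (q ^ k) + (\<Sum>i<k. f i * g (k - i) ^ (q ^ i))"
  unfolding tm_def by (simp add: lessThan_Suc_atMost[symmetric] add.commute)

lemma tm_phi: "tm (phi a) ee = tm ee (cst (\<alpha> a))"
proof
  fix k
  have "phi a k + (\<Sum>i<k. phi a i * ee (k - i) ^ (q ^ i)) = ee k * \<alpha> a ^ (q ^ k)"
    unfolding phi.simps[of a k] by simp
  then show "tm (phi a) ee k = tm ee (cst (\<alpha> a)) k" by (simp add: tm_split[of "phi a"] tm_cst ee_0)
qed

lemma phi_unique: "tm f ee = tm ee (cst (\<alpha> a)) \<Longrightarrow> f = phi a"
  by (rule tm_ee_cancel) (simp add: tm_phi)

text \<open>The quotients satisfy the recursion of \<open>phi\<close> with the polynomials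
  \<open>P\<close> in place of the exponential, so they converge along with these, coefficient by
  coefficient.\<close>

lemma phi_conv: "conv (\<lambda>n. FF a (n + d) n k) (phi a k)"
proof (induction k rule: less_induct)
  case (less k)
  have e: "FF a (n + d) n k = P (n + d) k * \<alpha> a ^ (q ^ k) - (\<Sum>i<k. FF a (n + d) n i * P n (k - i) ^ (q ^ i))" for n
  proof -
    have "tm (FF a (n + d) n) (P n) k = tm (P (n + d)) (cst (\<alpha> a)) k" by (simp only: FF_P FF.simps(1))
    then show ?thesis by (simp add: tm_split[of "FF a (n + d) n"] tm_cst P_const eq_diff_eq)
  qed
  show ?case unfolding e phi.simps[of a k]
    by (intro conv_diff conv_sum conv_mult conv_const conv_power conv_shift[OF ee] ee) (use less in auto)
qed

text \<open>For large n, multiplication by \<open>a\<close> maps the span of the first n basis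
  vectors into that of the first n + d, where d is the degree of \<open>a\<close>. So the quotient
  has degree at most d, and this bound passes to the limit.\<close>

lemma phi_support:
  assumes a: "a \<in> A" "a \<noteq> 0" and k: "k > nat (D a)"
  shows "phi a k = 0"
proof -
  define d where "d = nat (D a)"
  have d: "D a = int d" using D_nonneg[OF a] by (simp add: d_def)
  obtain n0 where n0: "\<And>n d. n \<ge> n0 \<Longrightarrow> sdeg (n + d) = sdeg n + d" using sdeg_eventually by blast
  have "FF a (n + d) n k = 0" if "n \<ge> n0" for n
    by (rule FF_support[OF a(1)]) (use n0[OF that, of d] k d in \<open>auto simp: d_def[symmetric]\<close>)
  then have "\<forall>n\<ge>n0. FF a (n + d) n k = 0" by blast
  then have "conv (\<lambda>_. 0) (phi a k)" using phi_conv[of a d k] by (rule conv_eventually)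
  then show ?thesis using conv_unique conv_const by blast
qed

text \<open>The leading coefficients of the quotients \<open>P\<^sub>n\<^sub>+\<^sub>d a / P\<^sub>n\<close> have constant absolute value for large \<open>n\<close>,
  so the degree does not drop in the limit.\<close>

lemma phi_top:
  assumes a: "a \<in> A" "a \<noteq> 0"
  shows "phi a (nat (D a)) \<noteq> 0"
proof
  assume z: "phi a (nat (D a)) = 0"
  define d where "d = nat (D a)"
  have d: "D a = int d" using D_nonneg[OF a] by (simp add: d_def)
  obtain n0 where n0: "\<And>n d. n \<ge> n0 \<Longrightarrow> sdeg (n + d) = sdeg n + d" using sdeg_eventually by blast
  define w where "w = v (\<alpha> a)"
  have w0: "w > 0" using a(2) by (simp add: w_def)
  define Q where "Q n = v (FF a (n + d) n d)" for n
  have Q: "Q n * L n ^ (q ^ d) = L (n + d) * w ^ (q ^ (n + d))" if n: "n \<ge> n0" for n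
  proof -
    have sup: "FF a (n + d) n i = 0" if "i > d" for i
      by (rule FF_support[OF a(1)]) (use n0[OF n, of d] that d in auto)
    have "tm (FF a (n + d) n) (P n) (d + n) = FF a (n + d) n d * P n n ^ (q ^ d)"
      by (rule tm_top(1)) (use sup P_support in auto)
    then have "FF a (n + d) n d * P n n ^ (q ^ d) = P (n + d) (n + d) * \<alpha> a ^ (q ^ (n + d))"
      by (simp only: FF_P FF.simps(1) tm_cst add.commute[of d])
    then have "v (FF a (n + d) n d * P n n ^ (q ^ d)) = v (P (n + d) (n + d) * \<alpha> a ^ (q ^ (n + d)))" by simp
    then show ?thesis by (simp add: v_mult v_power v_P_top Q_def w_def)
  qed
  have step: "Q (Suc n) = Q n" if n: "n \<ge> n0" for n
  proof -
    define \<beta> where "\<beta> = v (bC n)"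
    have \<beta>0: "\<beta> > 0" by (simp add: \<beta>_def)
    \<comment> \<open>Because the degrees have no gaps here, the lattice vector of index n + d is as
      large as \<open>\<alpha> a\<close> times the one of index n.\<close>
    have B: "v (bC (n + d)) = w * \<beta>"
      unfolding v_bC n0[OF n] w_def \<beta>_def v_\<alpha>[OF a(2)] d by (simp add: powr_add)
    define s where "s = q ^ (n + d)"
    define t where "t = q ^ Suc (n + d)"
    have st: "q ^ n * q ^ d = s" "q ^ Suc n * q ^ d = t" by (simp_all add: s_def t_def power_add)
    have LL: "L (Suc n) ^ (q ^ d) = L n ^ (q ^ d) * (\<beta> ^ s / \<beta> ^ t)"
      unfolding L.simps \<beta>_def[symmetric] power_mult_distrib power_divide power_mult[symmetric] st ..
    have L2: "L (Suc n + d) = L (n + d) * ((w * \<beta>) ^ s / (w * \<beta>) ^ t)"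
      by (simp add: B s_def t_def del: power_Suc)
    have "Q (Suc n) * (L n ^ (q ^ d) * (\<beta> ^ s / \<beta> ^ t)) = L (n + d) * ((w * \<beta>) ^ s / (w * \<beta>) ^ t) * w ^ t"
      using Q[of "Suc n"] n unfolding LL L2 by (simp add: t_def del: power_Suc L.simps)
    also have "\<dots> = L (n + d) * w ^ s * (\<beta> ^ s / \<beta> ^ t)" using w0 by (simp add: power_mult_distrib)
    also have "\<dots> = Q n * (L n ^ (q ^ d) * (\<beta> ^ s / \<beta> ^ t))" using Q[OF n] by (simp add: s_def)
    finally show ?thesis using L_pos[of n] \<beta>0 by simp
  qed
  have const: "Q (n0 + n) = Q n0" for n
    by (induction n) (simp_all add: step)
  have "(\<lambda>n. Q n) \<longlonglongrightarrow> 0" using phi_conv[of a d d] z unfolding conv_def Q_def d_def[symmetric] by simp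
  then have "(\<lambda>n. Q (n + n0)) \<longlonglongrightarrow> 0" by (rule LIMSEQ_ignore_initial_segment)
  then have "(\<lambda>n. Q n0) \<longlonglongrightarrow> 0" by (simp add: const add.commute[of _ n0])
  then have "Q n0 = 0" by (simp add: LIMSEQ_const_iff)
  moreover have "Q n0 * L n0 ^ (q ^ d) > 0" unfolding Q[OF order_refl] using L_pos w0 by simp
  ultimately show False by simp
qed

text \<open>Right multiplication by the Drinfeld polynomial of \<open>a\<close>, which commutes with
  scalars and \<tau> on the left. At a = 0 the summation bound is arbitrary, but
  \<open>phi a\<close> vanishes.\<close>

definition rmul :: "'k \<Rightarrow> 'c poly \<Rightarrow> 'c poly" where
  "rmul a m = (\<Sum>k\<le>degree m + nat (D a). monom (tm (coeff m) (phi a) k) k)"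

lemma phi_0: "phi 0 = (\<lambda>_. 0)"
  by (rule phi_unique[symmetric]) (rule ext, simp add: tm_cst, simp add: tm_def)

lemma coeff_rmul: assumes a: "a \<in> A" shows "coeff (rmul a m) = tm (coeff m) (phi a)"
proof
  fix k
  have "coeff (rmul a m) k = (if k \<le> degree m + nat (D a) then tm (coeff m) (phi a) k else 0)"
    unfolding rmul_def by (simp add: coeff_sum)
  moreover have "tm (coeff m) (phi a) k = 0" if "k > degree m + nat (D a)"
  proof (cases "a = 0")
    case True
    then show ?thesis by (simp add: phi_0 tm_def)
  next
    case False
    show ?thesis by (rule tm_top(2)[OF _ _ that]) (use phi_support[OF a False] coeff_eq_0 in auto)
  qed
  ultimately show "coeff (rmul a m) k = tm (coeff m) (phi a) k" by auto
qed

definition tauop :: "'c poly \<Rightarrow> 'c poly" where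
  "tauop m = pCons 0 (map_poly (\<lambda>c. c ^ q) m)"

lemma coeff_tauop: "coeff (tauop m) = tm (\<lambda>k. if k = 1 then 1 else 0) (coeff m)"
proof
  fix k
  have cm: "coeff (map_poly (\<lambda>c. c ^ q) m) l = coeff m l ^ q" for l
    using q_gt_1 by (subst coeff_map_poly) auto
  show "coeff (tauop m) k = tm (\<lambda>k. if k = 1 then 1 else 0) (coeff m) k"
  proof (cases k)
    case (Suc l)
    have "tm (\<lambda>k. if k = 1 then 1 else 0) (coeff m) k = (\<Sum>i\<le>k. if i = 1 then coeff m l ^ q else 0)"
      unfolding tm_def Suc by (intro sum.cong) auto
    then show ?thesis by (simp add: tauop_def Suc cm)
  qed (simp add: tauop_def tm_def)
qed

lemma tm_add_left: "tm (\<lambda>k. f k + g k) h k = tm f h k + tm g h k"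
  and tm_scale_left: "tm (\<lambda>k. c * f k) h k = c * tm f h k"
  and tm_add_right: "tm f (\<lambda>k. g k + h k) k = tm f g k + tm f h k"
  by (simp_all add: tm_def distrib_right distrib_left sum.distrib sum_distrib_left mult.assoc frob)

text \<open>The laws for \<open>phi\<close> follow from the uniqueness of the solution of the
  functional equation. The product is taken in the order \<open>phi a'\<close> times
  \<open>phi a\<close>, which makes right multiplications compose as required; the degree is exact
  by \<open>phi_top\<close>.\<close>

lemma rmul_lemmas:
  assumes a: "a \<in> A" and a': "a' \<in> A"
  shows "rmul a (m + m') = rmul a m + rmul a m'" "rmul a (smult c m) = smult c (rmul a m)"
    "rmul a (tauop m) = tauop (rmul a m)" "rmul (a + a') m = rmul a m + rmul a' m"
    "rmul (a * a') m = rmul a (rmul a' m)" "rmul (iK e) m = smult (iC e) m"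
    "coeff (rmul a m) 0 = \<alpha> a * coeff m 0"
    "a \<noteq> 0 \<Longrightarrow> m \<noteq> 0 \<Longrightarrow> rmul a m \<noteq> 0 \<and> int (degree (rmul a m)) = int (degree m) + D a"
proof -
  note cr = coeff_rmul[OF a] and cr' = coeff_rmul[OF a']
  have AA: "a + a' \<in> A" "a * a' \<in> A" using is_subringD(4,6)[OF A(1)] a a' by auto
  have c1: "coeff (m + m') = (\<lambda>k. coeff m k + coeff m' k)" by (rule ext) simp
  have c2: "coeff (smult c m) = (\<lambda>k. c * coeff m k)" by (rule ext) simp
  show "rmul a (m + m') = rmul a m + rmul a m'"
    by (rule poly_eqI) (simp only: cr c1 tm_add_left coeff_add)
  show "rmul a (smult c m) = smult c (rmul a m)"
    by (rule poly_eqI) (simp only: cr c2 tm_scale_left coeff_smult)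
  show "rmul a (tauop m) = tauop (rmul a m)"
    by (rule poly_eqI) (simp only: cr coeff_tauop tm_assoc)
  have "tm (\<lambda>k. phi a k + phi a' k) ee = tm ee (cst (\<alpha> (a + a')))"
    by (rule ext) (simp add: tm_add_left tm_phi tm_cst frob distrib_left)
  then have p1: "phi (a + a') = (\<lambda>k. phi a k + phi a' k)" by (rule phi_unique[symmetric])
  show "rmul (a + a') m = rmul a m + rmul a' m"
    by (rule poly_eqI) (simp add: coeff_rmul[OF AA(1)] cr cr' p1 tm_add_right)
  have "tm (tm (phi a') (phi a)) ee = tm ee (cst (\<alpha> (a * a')))"
  proof -
    have "tm (tm (phi a') (phi a)) ee = tm (phi a') (tm (phi a) ee)" by (rule tm_assoc)
    also have "\<dots> = tm (phi a') (tm ee (cst (\<alpha> a)))" by (simp only: tm_phi)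
    also have "\<dots> = tm (tm (phi a') ee) (cst (\<alpha> a))" by (rule tm_assoc[symmetric])
    also have "\<dots> = tm ee (cst (\<alpha> (a * a')))"
      by (rule ext) (simp add: tm_phi tm_cst power_mult_distrib mult_ac)
    finally show ?thesis .
  qed
  then have p2: "phi (a * a') = tm (phi a') (phi a)" by (rule phi_unique[symmetric])
  show "rmul (a * a') m = rmul a (rmul a' m)"
    by (rule poly_eqI) (simp only: coeff_rmul[OF AA(2)] cr cr' p2 tm_assoc)
  have "tm (cst (iC e)) ee = tm ee (cst (\<alpha> (iK e)))"
    by (rule ext) (simp add: tm_cst tm_cst_left \<alpha>_iK frob mult.commute)
  then have p3: "phi (iK e) = cst (iC e)" by (rule phi_unique[symmetric])
  show "rmul (iK e) m = smult (iC e) m"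
    by (rule poly_eqI) (simp add: coeff_rmul[OF A(2)] p3 tm_cst frob mult.commute)
  have "phi a 0 = \<alpha> a" unfolding phi.simps[of a 0] by (simp add: ee_0)
  then show "coeff (rmul a m) 0 = \<alpha> a * coeff m 0" by (simp add: cr tm_def mult.commute)
  show "rmul a m \<noteq> 0 \<and> int (degree (rmul a m)) = int (degree m) + D a" if a0: "a \<noteq> 0" and m: "m \<noteq> 0"
  proof -
    define d where "d = nat (D a)"
    have d: "D a = int d" using D_nonneg[OF a a0] by (simp add: d_def)
    have sup: "\<And>i. i > degree m \<Longrightarrow> coeff m i = 0" "\<And>i. i > d \<Longrightarrow> phi a i = 0"
      using phi_support[OF a a0] by (auto simp: coeff_eq_0 d_def)
    have "coeff (rmul a m) (degree m + d) = lead_coeff m * phi a d ^ (q ^ degree m)"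
      unfolding cr by (rule tm_top(1)) (use sup in auto)
    then have nz: "coeff (rmul a m) (degree m + d) \<noteq> 0"
      using m phi_top[OF a a0] by (simp add: d_def)
    have "degree (rmul a m) \<le> degree m + d"
      by (rule degree_le) (use tm_top(2)[of "degree m" "coeff m" d "phi a"] sup in \<open>auto simp: cr\<close>)
    then have "degree (rmul a m) = degree m + d" using le_degree[OF nz] by simp
    then show ?thesis using nz d by auto
  qed
qed

end

section \<open>The algebra A tensor C acting on twisted polynomials\<close>

text \<open>What remains of the analysis is purely algebraic: a degree on K with one-dimensional
  graded pieces and few gaps in A, separable equations over the polynomials in T, and q-th roots in
  C.\<close>

locale cm_ring = scalar_extension iK iC jK jC
  for iK :: "'f::{field,finite} \<Rightarrow> 'k::field" and iC :: "'f \<Rightarrow> 'c::field"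
    and jK :: "'k \<Rightarrow> 'l::field" and jC :: "'c \<Rightarrow> 'l" +
  fixes A :: "'k set" and D :: "'k \<Rightarrow> int" and q r :: nat and TK :: 'k and \<theta> :: 'c
  assumes q_def: "q = CARD('f)" and r_pos: "r > 0"
    and A_ring: "is_subring A" and A_iK: "iK c \<in> A" and A_TK: "TK \<in> A" and T0: "TK \<noteq> 0"
    and A_frac: "\<exists>d\<in>A. d \<noteq> 0 \<and> d * x \<in> A"
    and D_mult: "x \<noteq> 0 \<Longrightarrow> x' \<noteq> 0 \<Longrightarrow> D (x * x') = D x + D x'"
    and D_nonneg: "x \<in> A \<Longrightarrow> x \<noteq> 0 \<Longrightarrow> 0 \<le> D x"
    and D_graded: "graded_space (\<lambda>c x. iK c * x) D"
    and D_TK: "D TK = int r"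
    and cofinite: "\<exists>n0. \<forall>n\<ge>n0. \<exists>a\<in>A. a \<noteq> 0 \<and> D a = int n"
    and perfect: "\<exists>d. d ^ q = (y::'c)"
    and separable: "\<exists>n P. (\<Sum>i\<le>n. poly (map_poly iK (P i)) TK * x ^ i) = 0 \<and>
          (\<Sum>i\<le>n. of_nat i * poly (map_poly iK (P i)) TK * x ^ (i - 1)) \<noteq> 0"
begin

lemmas frob = frobenius_over_finite_field[OF hom_iC, folded q_def]

lemma q_gt_1: "q > 1"
proof -
  have "card {0, 1 :: 'f} \<le> q" unfolding q_def by (rule card_mono) auto
  then show ?thesis by simp
qed

lemma frob1: "(x + y :: 'c) ^ q = x ^ q + y ^ q" "(iC c) ^ q = iC c" "x ^ q = y ^ q \<longleftrightarrow> x = y"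
  using frob(3)[of x y 1] frob(6)[of c 1] frob(8)[of x 1 y] by simp_all

lemma zero_power_q [simp]: "(0::'c) ^ q = 0" using q_gt_1 by simp

text \<open>A tensor C inside L: the coordinate ring of the curve without the point at
  infinity.\<close>

definition AC :: "'l set" where "AC = span_of A"

lemma AC_ring: "is_subring AC" unfolding AC_def by (rule is_subring_span_of[OF A_ring])

lemmas AC_closed = is_subringD[OF AC_ring]

lemma A_subspace: "VK.subspace A"
  unfolding VK.subspace_def using is_subringD(2,4,6)[OF A_ring] A_iK by simp

lemma AC_gen: "a \<in> A \<Longrightarrow> jC c * jK a \<in> AC"
  unfolding AC_def span_of_def by (rule CollectI, rule exI[of _ "[(c, a)]"]) simp

lemma AC_jK: "a \<in> A \<Longrightarrow> jK a \<in> AC" using AC_gen[of a 1] by simp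

lemma AC_jC: "jC c \<in> AC" using AC_gen[of 1 c] is_subringD(1)[OF A_ring] by simp

lemma AC_induct [consumes 1, case_names zero step]:
  assumes "z \<in> AC" "P 0" "\<And>c a z. a \<in> A \<Longrightarrow> z \<in> AC \<Longrightarrow> P z \<Longrightarrow> P (jC c * jK a + z)"
  shows "P z"
proof -
  obtain xs where xs: "z = lin xs" "snd ` set xs \<subseteq> A" using assms(1) by (auto simp: AC_def span_of_def)
  have "lin xs \<in> AC \<and> P (lin xs)" using xs(2)
  proof (induction xs)
    case Nil
    then show ?case using assms(2) AC_closed(2) by simp
  next
    case (Cons p xs)
    obtain c a where p: "p = (c, a)" by (cases p)
    have "a \<in> A" "lin xs \<in> AC" "P (lin xs)" using Cons p by auto
    then show ?case using assms(3)[of a "lin xs" c] AC_gen[of a c] AC_closed(6) by (simp add: p)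
  qed
  then show ?thesis using xs by simp
qed

lemma extend_AC:
  fixes scl :: "'c \<Rightarrow> 'e::ab_group_add \<Rightarrow> 'e"
  assumes vs: "vector_space scl"
    and h: "\<And>x y. x \<in> A \<Longrightarrow> y \<in> A \<Longrightarrow> h (x + y) = h x + h y"
      "\<And>c x. x \<in> A \<Longrightarrow> h (iK c * x) = scl (iC c) (h x)"
  shows "a \<in> A \<Longrightarrow> extend A scl h (jC c * jK a) = scl c (h a)"
    "z \<in> AC \<Longrightarrow> z' \<in> AC \<Longrightarrow> extend A scl h (z + z') = extend A scl h z + extend A scl h z'"
    "extend A scl h 0 = 0"
proof -
  have ex: "extend A scl h (lin xs) = lsum scl h xs" if "snd ` set xs \<subseteq> A" for xs
    by (rule extend_lin[OF vs A_subspace _ _ that]) (use h in auto)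
  show "extend A scl h (jC c * jK a) = scl c (h a)" if "a \<in> A" using ex[of "[(c, a)]"] that by simp
  show "extend A scl h 0 = 0" using ex[of "[]"] by simp
  show "extend A scl h (z + z') = extend A scl h z + extend A scl h z'" if "z \<in> AC" "z' \<in> AC"
  proof -
    obtain xs ys where "z = lin xs" "snd ` set xs \<subseteq> A" "z' = lin ys" "snd ` set ys \<subseteq> A"
      using \<open>z \<in> AC\<close> \<open>z' \<in> AC\<close> by (auto simp: AC_def span_of_def)
    then show ?thesis using ex[of "xs @ ys"] by (simp add: ex image_Un)
  qed
qed

subsection \<open>Drinfeld modules as modules over the extended ring\<close>

text \<open>Left multiplication by \<tau>. Twisted polynomials are stored as ordinary ones with
  coefficients on the left.\<close>

definition tw :: "'c poly \<Rightarrow> 'c poly" where "tw m = pCons 0 (map_poly (\<lambda>c. c ^ q) m)"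

lemma tw_simps: "tw (m + m') = tw m + tw m'" "tw (smult c m) = smult (c ^ q) (tw m)" "coeff (tw m) 0 = 0"
  "tw m = 0 \<longleftrightarrow> m = 0" "m \<noteq> 0 \<Longrightarrow> degree (tw m) = Suc (degree m)"
proof -
  have cm: "coeff (map_poly (\<lambda>c. c ^ q) m) l = coeff m l ^ q" for m :: "'c poly" and l
    by (subst coeff_map_poly) auto
  show "tw (m + m') = tw m + tw m'" "tw (smult c m) = smult (c ^ q) (tw m)" "coeff (tw m) 0 = 0"
    unfolding tw_def
    by (auto intro!: poly_eqI simp: coeff_pCons cm frob1 power_mult_distrib split: nat.split)
  have z: "map_poly (\<lambda>c. c ^ q) m = 0 \<longleftrightarrow> m = 0" using q_gt_1 by (auto simp: poly_eq_iff cm)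
  show "tw m = 0 \<longleftrightarrow> m = 0" by (simp add: tw_def z)
  have "degree (map_poly (\<lambda>c. c ^ q) m) = degree m" by (rule degree_map_poly) (use q_gt_1 in auto)
  then show "m \<noteq> 0 \<Longrightarrow> degree (tw m) = Suc (degree m)" by (simp add: tw_def z)
qed

lemma poly_vs: "vector_space (smult :: 'c \<Rightarrow> 'c poly \<Rightarrow> 'c poly)"
  by unfold_locales (auto simp: smult_add_right smult_add_left)

lemma poly_graded: "graded_space (smult :: 'c \<Rightarrow> 'c poly \<Rightarrow> 'c poly) (\<lambda>m. int (degree m))"
proof -
  interpret V: vector_space "smult :: 'c \<Rightarrow> 'c poly \<Rightarrow> 'c poly" by (rule poly_vs)
  show ?thesis
  proof
    fix x y :: "'c poly" assume n: "x \<noteq> 0" "y \<noteq> 0"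
    show "int (degree (x + y)) \<le> max (int (degree x)) (int (degree y))"
      using degree_add_le_max[of x y] by (simp add: max_def split: if_splits)
    assume e: "int (degree x) = int (degree y)"
    define c where "c = lead_coeff x / lead_coeff y"
    have cf: "coeff (x - smult c y) (degree x) = 0" using e n by (simp add: c_def)
    have "degree (x - smult c y) \<le> degree x"
      by (intro degree_diff_le) (use e in \<open>auto intro: order_trans[OF degree_smult_le]\<close>)
    moreover have "x - smult c y = 0" if "degree (x - smult c y) = degree x"
    proof -
      have "lead_coeff (x - smult c y) = 0" unfolding that by (rule cf)
      then show ?thesis by (simp only: leading_coeff_0_iff)
    qed
    ultimately have "x - smult c y = 0 \<or> degree (x - smult c y) < degree x" by (meson le_neq_implies_less)
    then show "\<exists>c. x - smult c y = 0 \<or> int (degree (x - smult c y)) < int (degree x)"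
      by (intro exI[of _ c]) auto
  next
    fix c :: 'c and x :: "'c poly" assume "c \<noteq> 0" "x \<noteq> 0"
    then show "int (degree (smult c x)) = int (degree x)" by simp
  qed
qed

sublocale PG: graded_space "smult :: 'c \<Rightarrow> 'c poly \<Rightarrow> 'c poly" "\<lambda>m. int (degree m)" by (rule poly_graded)
sublocale KG: graded_space "\<lambda>c x. iK c * x" D by (rule D_graded)

text \<open>A Drinfeld module of rank one with characteristic \<open>\<alpha>\<close>, given through
  the right multiplications it induces on C[\<tau>]. Constant coefficients are multiplied by
  \<open>\<alpha> a\<close>, and the rank is encoded by the growth of degrees by exactly
  \<open>D a\<close>.\<close>

definition drin :: "('k \<Rightarrow> 'c) \<Rightarrow> ('k \<Rightarrow> 'c poly \<Rightarrow> 'c poly) \<Rightarrow> bool" where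
  "drin \<alpha> R \<longleftrightarrow> field_hom \<alpha> \<and> (\<forall>c. \<alpha> (iK c) = iC c) \<and> \<alpha> TK = \<theta> \<and>
    (\<forall>a\<in>A. \<forall>m m'. R a (m + m') = R a m + R a m') \<and>
    (\<forall>a\<in>A. \<forall>c m. R a (smult c m) = smult c (R a m)) \<and>
    (\<forall>a\<in>A. \<forall>m. R a (tw m) = tw (R a m)) \<and>
    (\<forall>a\<in>A. \<forall>a'\<in>A. \<forall>m. R (a + a') m = R a m + R a' m \<and> R (a * a') m = R a (R a' m)) \<and>
    (\<forall>c m. R (iK c) m = smult (iC c) m) \<and>
    (\<forall>a\<in>A. \<forall>m. coeff (R a m) 0 = \<alpha> a * coeff m 0) \<and>
    (\<forall>a\<in>A. \<forall>m. a \<noteq> 0 \<longrightarrow> m \<noteq> 0 \<longrightarrow> R a m \<noteq> 0 \<and> int (degree (R a m)) = int (degree m) + D a)"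

lemma drinD:
  assumes "drin \<alpha> R"
  shows "field_hom \<alpha>" "\<alpha> (iK e) = iC e" "\<alpha> TK = \<theta>"
    "a \<in> A \<Longrightarrow> R a (m + m') = R a m + R a m'" "a \<in> A \<Longrightarrow> R a (smult c m) = smult c (R a m)"
    "a \<in> A \<Longrightarrow> R a (tw m) = tw (R a m)" "a \<in> A \<Longrightarrow> a' \<in> A \<Longrightarrow> R (a + a') m = R a m + R a' m"
    "a \<in> A \<Longrightarrow> a' \<in> A \<Longrightarrow> R (a * a') m = R a (R a' m)" "R (iK e) m = smult (iC e) m"
    "a \<in> A \<Longrightarrow> coeff (R a m) 0 = \<alpha> a * coeff m 0"
    "a \<in> A \<Longrightarrow> a \<noteq> 0 \<Longrightarrow> m \<noteq> 0 \<Longrightarrow> R a m \<noteq> 0"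
    "a \<in> A \<Longrightarrow> a \<noteq> 0 \<Longrightarrow> m \<noteq> 0 \<Longrightarrow> int (degree (R a m)) = int (degree m) + D a"
  using assms unfolding drin_def by simp_all

definition act :: "('k \<Rightarrow> 'c poly \<Rightarrow> 'c poly) \<Rightarrow> 'l \<Rightarrow> 'c poly \<Rightarrow> 'c poly" where
  "act R z m = extend A smult (\<lambda>a. R a m) z"

text \<open>Evaluation of functions at the C-point of the curve defined by
  \<open>\<alpha>\<close>.\<close>

definition chi :: "('k \<Rightarrow> 'c) \<Rightarrow> 'l \<Rightarrow> 'c" where
  "chi \<alpha> z = extend A (*) \<alpha> z"

definition sigA :: "'l \<Rightarrow> 'l" where
  "sigA z = extend A (\<lambda>c x. jC (c ^ q) * x) jK z"

lemma hom_frob: "field_hom (\<lambda>c. jC (c ^ q))"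
  by (simp add: field_hom_def frob1 power_mult_distrib del: jC_simps(7))

lemma sigA_simps: "a \<in> A \<Longrightarrow> sigA (jC c * jK a) = jC (c ^ q) * jK a"
  "z \<in> AC \<Longrightarrow> z' \<in> AC \<Longrightarrow> sigA (z + z') = sigA z + sigA z'" "sigA 0 = 0"
  unfolding sigA_def
  by (rule extend_AC[OF field_hom_vector_space[OF hom_frob]]; simp add: jK_iK frob1)+

lemma sigA_AC: "z \<in> AC \<Longrightarrow> sigA z \<in> AC"
proof (induction z rule: AC_induct)
  case (step c a z)
  then show ?case by (simp add: sigA_simps AC_gen AC_closed(6) del: jC_simps(7))
qed (simp add: sigA_simps AC_closed(2))

lemma sigA_mult: "z \<in> AC \<Longrightarrow> z' \<in> AC \<Longrightarrow> sigA (z * z') = sigA z * sigA z'"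
  unfolding sigA_def AC_def
  by (rule extend_mult(1)[OF field_hom_vector_space[OF hom_frob] _ A_ring A_iK])
    (simp_all add: power_mult_distrib mult_ac jK_iK frob1)

context
  fixes \<alpha> :: "'k \<Rightarrow> 'c"
  assumes \<alpha>: "field_hom \<alpha>" "\<And>c. \<alpha> (iK c) = iC c"
begin

lemma chi_simps: "a \<in> A \<Longrightarrow> chi \<alpha> (jC c * jK a) = c * \<alpha> a"
  "z \<in> AC \<Longrightarrow> z' \<in> AC \<Longrightarrow> chi \<alpha> (z + z') = chi \<alpha> z + chi \<alpha> z'" "chi \<alpha> 0 = 0"
proof -
  have vs: "vector_space ((*) :: 'c \<Rightarrow> 'c \<Rightarrow> 'c)" by unfold_locales (auto simp: algebra_simps)
  show "a \<in> A \<Longrightarrow> chi \<alpha> (jC c * jK a) = c * \<alpha> a"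
    "z \<in> AC \<Longrightarrow> z' \<in> AC \<Longrightarrow> chi \<alpha> (z + z') = chi \<alpha> z + chi \<alpha> z'" "chi \<alpha> 0 = 0"
    unfolding chi_def by (rule extend_AC[OF vs]; simp add: field_hom_simps[OF \<alpha>(1)] \<alpha>(2))+
qed

lemma chi_mult: "z \<in> AC \<Longrightarrow> z' \<in> AC \<Longrightarrow> chi \<alpha> (z * z') = chi \<alpha> z * chi \<alpha> z'"
proof -
  have vs: "vector_space ((*) :: 'c \<Rightarrow> 'c \<Rightarrow> 'c)" by unfold_locales (auto simp: algebra_simps)
  show "z \<in> AC \<Longrightarrow> z' \<in> AC \<Longrightarrow> chi \<alpha> (z * z') = chi \<alpha> z * chi \<alpha> z'"
    unfolding chi_def AC_def
    by (rule extend_mult(1)[OF vs _ A_ring A_iK]) (simp_all add: field_hom_simps[OF \<alpha>(1)] \<alpha>(2) mult_ac)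
qed

lemma chi_jK: "a \<in> A \<Longrightarrow> chi \<alpha> (jK a) = \<alpha> a" using chi_simps(1)[of a 1] by simp

lemma chi_jC: "chi \<alpha> (jC c) = c"
  using chi_simps(1)[of 1 c] is_subringD(1)[OF A_ring] by (simp add: field_hom_simps[OF \<alpha>(1)])

lemma chi_1: "chi \<alpha> 1 = 1" using chi_jC[of 1] by simp

lemma chi_diff: "z \<in> AC \<Longrightarrow> z' \<in> AC \<Longrightarrow> chi \<alpha> (z - z') = chi \<alpha> z - chi \<alpha> z'"
  using chi_simps(2)[of "z - z'" z'] AC_closed(3) by (simp add: eq_diff_eq)

lemma chi_power: "z \<in> AC \<Longrightarrow> chi \<alpha> (z ^ n) = chi \<alpha> z ^ n"
  by (induction n) (simp_all add: chi_1 chi_mult AC_closed(7))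

lemma chi_sum: "(\<And>i. i \<in> I \<Longrightarrow> f i \<in> AC) \<Longrightarrow> chi \<alpha> (sum f I) = (\<Sum>i\<in>I. chi \<alpha> (f i))"
  by (induction I rule: infinite_finite_induct) (simp_all add: chi_simps(2,3) AC_closed(8))

lemma chi_prod: "(\<And>i. i \<in> I \<Longrightarrow> f i \<in> AC) \<Longrightarrow> chi \<alpha> (prod f I) = (\<Prod>i\<in>I. chi \<alpha> (f i))"
  by (induction I rule: infinite_finite_induct) (simp_all add: chi_1 chi_mult AC_closed(9))

end

context
  fixes \<alpha> R
  assumes d: "drin \<alpha> R"
begin

lemma act_simps: "a \<in> A \<Longrightarrow> act R (jC c * jK a) m = smult c (R a m)"
  "z \<in> AC \<Longrightarrow> z' \<in> AC \<Longrightarrow> act R (z + z') m = act R z m + act R z' m" "act R 0 m = 0"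
  unfolding act_def by (rule extend_AC[OF poly_vs]; simp add: drinD(7,8,9)[OF d] A_iK)+

lemma act_add: "z \<in> AC \<Longrightarrow> act R z (m + m') = act R z m + act R z m'"
  by (induction z rule: AC_induct)
    (simp_all add: act_simps AC_gen drinD(4)[OF d] smult_add_right)

lemma act_mult:
  assumes "z \<in> AC" "z' \<in> AC"
  shows "act R (z * z') m = act R z (act R z' m)"
  using assms(1)
proof (induction z rule: AC_induct)
  case (step c a z)
  have "act R (jC c * jK a * z') m = smult c (R a (act R z' m))"
    using assms(2)
  proof (induction z' rule: AC_induct)
    case zero
    show ?case using drinD(5)[OF d step(1), of 0 0] by (simp add: act_simps)
  next
    case (step c' a' z')
    have aa: "a * a' \<in> A" using \<open>a \<in> A\<close> \<open>a' \<in> A\<close> is_subringD(4)[OF A_ring] by simp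
    have "jC c * jK a * (jC c' * jK a' + z') = jC (c * c') * jK (a * a') + jC c * jK a * z'"
      by (simp add: distrib_left mult_ac)
    moreover have "jC c * jK a * z' \<in> AC" using step AC_gen[OF \<open>a \<in> A\<close>] AC_closed(4) by simp
    ultimately have "act R (jC c * jK a * (jC c' * jK a' + z')) m
        = smult (c * c') (R a (R a' m)) + smult c (R a (act R z' m))"
      using step aa AC_gen[OF aa] act_simps(1)[OF aa, of "c * c'" m]
      by (simp add: act_simps(2) drinD(8)[OF d \<open>a \<in> A\<close> \<open>a' \<in> A\<close>] del: jC_simps jK_simps)
    then show ?case using step \<open>a \<in> A\<close>
      by (simp add: act_simps AC_gen drinD(4,5)[OF d] smult_add_right)
  qed
  then show ?case using step AC_gen[OF step(1)] AC_closed(4) assms(2)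
    by (simp add: distrib_right act_simps(1,2))
qed (simp add: act_simps(3))

lemma act_sig: "z \<in> AC \<Longrightarrow> act R (sigA z) (tw m) = tw (act R z m)"
  by (induction z rule: AC_induct)
    (simp_all add: sigA_simps act_simps AC_gen sigA_AC drinD(6)[OF d] tw_simps del: jC_simps(7))

text \<open>Right multiplication by a polynomial with constant term \<open>\<alpha> a\<close>
  multiplies constant coefficients by \<open>\<alpha> a\<close>. So the constant coefficient factors
  through the fibre of C[\<tau>] at the point \<open>\<alpha>\<close>.\<close>

lemma act_coeff: "z \<in> AC \<Longrightarrow> coeff (act R z m) 0 = chi \<alpha> z * coeff m 0"
  by (induction z rule: AC_induct)
    (simp_all add: act_simps AC_gen drinD(10)[OF d] chi_simps[OF drinD(1,2)[OF d]] algebra_simps)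

end

subsection \<open>The degree on the extended ring\<close>

text \<open>One element of A for each degree; the value 0 at missing degrees lets ordinary
  polynomials index all combinations.\<close>

definition bt :: "nat \<Rightarrow> 'k" where
  "bt n = (if \<exists>a\<in>A. a \<noteq> 0 \<and> D a = int n then SOME a. a \<in> A \<and> a \<noteq> 0 \<and> D a = int n else 0)"

lemma bt: "bt n \<in> A" "bt n \<noteq> 0 \<Longrightarrow> D (bt n) = int n" "a \<in> A \<Longrightarrow> a \<noteq> 0 \<Longrightarrow> bt (nat (D a)) \<noteq> 0"
proof -
  have s: "bt n \<in> A \<and> bt n \<noteq> 0 \<and> D (bt n) = int n" if "\<exists>a\<in>A. a \<noteq> 0 \<and> D a = int n" for n
  proof -
    have "\<exists>a. a \<in> A \<and> a \<noteq> 0 \<and> D a = int n" using that by blast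
    from someI_ex[OF this] show ?thesis using that by (simp add: bt_def)
  qed
  show "bt n \<in> A"
  proof (cases "\<exists>a\<in>A. a \<noteq> 0 \<and> D a = int n")
    case True
    then show ?thesis using s by blast
  next
    case False
    then have "bt n = 0" unfolding bt_def by (rule if_not_P)
    then show ?thesis using is_subringD(2)[OF A_ring] by simp
  qed
  show "D (bt n) = int n" if "bt n \<noteq> 0"
  proof (cases "\<exists>a\<in>A. a \<noteq> 0 \<and> D a = int n")
    case False
    then have "bt n = 0" unfolding bt_def by (rule if_not_P)
    then show ?thesis using that by simp
  qed (use s in blast)
  show "bt (nat (D a)) \<noteq> 0" if "a \<in> A" "a \<noteq> 0" using s[of "nat (D a)"] D_nonneg[OF that] that by auto
qed

text \<open>Coordinates on A tensor C: the exponent n stands for the basis element of degree n. For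
  reduced polynomials, which avoid the missing degrees, the ordinary degree is the degree of the
  element represented.\<close>

definition kap :: "'c poly \<Rightarrow> 'l" where
  "kap p = (\<Sum>n\<le>degree p. jC (coeff p n) * jK (bt n))"

definition reduced :: "'c poly \<Rightarrow> bool" where
  "reduced p \<longleftrightarrow> (\<forall>n. coeff p n \<noteq> 0 \<longrightarrow> bt n \<noteq> 0)"

lemma kap_bound: "degree p \<le> N \<Longrightarrow> kap p = (\<Sum>n\<le>N. jC (coeff p n) * jK (bt n))"
  unfolding kap_def by (intro sum.mono_neutral_left) (auto simp: coeff_eq_0)

lemma kap_add: "kap (p + p') = kap p + kap p'"
proof -
  define N where "N = max (degree p) (degree p')"
  have "degree (p + p') \<le> N" "degree p \<le> N" "degree p' \<le> N" by (auto simp: N_def degree_add_le_max)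
  then show ?thesis by (simp add: kap_bound[of _ N] distrib_right sum.distrib)
qed

lemma kap_smult: "kap (smult c p) = jC c * kap p"
  using kap_bound[of "smult c p" "degree p"] by (simp add: degree_smult_le kap_def sum_distrib_left mult.assoc)

lemma kap_monom: "kap (monom c n) = jC c * jK (bt n)"
proof -
  have "kap (monom c n) = (\<Sum>i\<le>n. if i = n then jC c * jK (bt n) else 0)"
    unfolding kap_bound[OF degree_monom_le] by (intro sum.cong) auto
  then show ?thesis by simp
qed

lemma reduced_add: "reduced p \<Longrightarrow> reduced p' \<Longrightarrow> reduced (p + p')"
  unfolding reduced_def by (metis add.right_neutral coeff_add)

lemma reduced_smult: "reduced p \<Longrightarrow> reduced (smult c p)"
  unfolding reduced_def by auto

lemma A_kap: "a \<in> A \<Longrightarrow> \<exists>p. reduced p \<and> jK a = kap p"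
proof (induction "if a = 0 then 0 else Suc (nat (D a))" arbitrary: a rule: less_induct)
  case less
  show ?case
  proof (cases "a = 0")
    case True
    then show ?thesis by (intro exI[of _ 0]) (simp add: reduced_def kap_def)
  next
    case False
    define n where "n = nat (D a)"
    have n: "D a = int n" using D_nonneg[OF less(2) False] by (simp add: n_def)
    have b0: "bt n \<noteq> 0" using bt(3)[OF less(2) False] by (simp add: n_def)
    then have "D a = D (bt n)" using bt(2) n by simp
    then obtain c where c: "a - iK c * bt n = 0 \<or> D (a - iK c * bt n) < D a"
      using KG.D_cancel[OF False b0] by blast
    have mem: "a - iK c * bt n \<in> A" using less(2) bt(1) A_iK is_subringD(3,4)[OF A_ring] by simp
    have "\<exists>p. reduced p \<and> jK (a - iK c * bt n) = kap p"
    proof (rule less(1)[OF _ mem])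
      show "(if a - iK c * bt n = 0 then 0 else Suc (nat (D (a - iK c * bt n)))) < (if a = 0 then 0 else Suc (nat (D a)))"
        using c False n D_nonneg[OF mem] by (cases "a - iK c * bt n = 0") auto
    qed
    then obtain p where p: "reduced p" "jK (a - iK c * bt n) = kap p" by blast
    have "jK a = kap (p + monom (iC c) n)"
      unfolding kap_add kap_monom p(2)[symmetric] by (simp add: jK_iK)
    moreover have "reduced (p + monom (iC c) n)"
      by (rule reduced_add[OF p(1)]) (use b0 in \<open>auto simp: reduced_def\<close>)
    ultimately show ?thesis by blast
  qed
qed

lemma AC_kap: "z \<in> AC \<Longrightarrow> \<exists>p. reduced p \<and> z = kap p"
proof (induction z rule: AC_induct)
  case zero
  show ?case by (intro exI[of _ 0]) (simp add: reduced_def kap_def)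
next
  case (step c a z)
  then obtain p p' where "reduced p" "jK a = kap p" "reduced p'" "z = kap p'" using A_kap by blast
  then show ?case by (intro exI[of _ "smult c p + p'"]) (simp add: kap_add kap_smult reduced_add reduced_smult)
qed

text \<open>The terms have pairwise distinct degrees, so the top one survives. Hence the action has
  no torsion, and the degree it adds is the same for every Drinfeld module \<open>R\<close>.\<close>

lemma act_kap:
  assumes d: "drin \<alpha> R" and p: "reduced p" "p \<noteq> 0" and m: "m \<noteq> 0"
  shows "act R (kap p) m \<noteq> 0" "degree (act R (kap p) m) = degree p + degree m"
proof -
  define I where "I = {n. n \<le> degree p \<and> coeff p n \<noteq> 0}"
  have lin: "act R (\<Sum>n\<in>F. jC (coeff p n) * jK (bt n)) m = (\<Sum>n\<in>F. smult (coeff p n) (R (bt n) m))" for F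
    by (induction F rule: infinite_finite_induct)
      (simp_all add: act_simps[OF d] AC_gen bt(1) AC_closed(8))
  have "act R (kap p) m = (\<Sum>n\<le>degree p. smult (coeff p n) (R (bt n) m))" unfolding kap_def by (rule lin)
  also have "\<dots> = (\<Sum>n\<in>I. smult (coeff p n) (R (bt n) m))"
    by (intro sum.mono_neutral_right) (auto simp: I_def)
  finally have e: "act R (kap p) m = (\<Sum>n\<in>I. smult (coeff p n) (R (bt n) m))" .
  have t: "smult (coeff p n) (R (bt n) m) \<noteq> 0 \<and> int (degree (smult (coeff p n) (R (bt n) m))) = int (degree m) + int n"
    if "n \<in> I" for n
  proof -
    have "coeff p n \<noteq> 0" "bt n \<noteq> 0" using that p(1) by (auto simp: I_def reduced_def)
    then show ?thesis using drinD(11,12)[OF d bt(1)[of n] _ m] bt(2)[of n] by simp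
  qed
  have top: "degree p \<in> I" using p(2) by (simp add: I_def)
  have fin: "finite I" by (simp add: I_def)
  have "\<exists>i\<in>I. (\<Sum>n\<in>I. smult (coeff p n) (R (bt n) m)) \<noteq> 0 \<and>
      int (degree (\<Sum>n\<in>I. smult (coeff p n) (R (bt n) m))) = int (degree (smult (coeff p i) (R (bt i) m))) \<and>
      (\<forall>k\<in>I. int (degree (smult (coeff p k) (R (bt k) m))) \<le> int (degree (smult (coeff p i) (R (bt i) m))))"
  proof (rule PG.D_sum_distinct)
    show "finite I" "I \<noteq> {}" using top fin by auto
    show "smult (coeff p i) (R (bt i) m) \<noteq> 0" if "i \<in> I" for i using t[OF that] by blast
    show "inj_on (\<lambda>i. int (degree (smult (coeff p i) (R (bt i) m)))) I"
    proof (rule inj_onI)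
      fix x y assume xy: "x \<in> I" "y \<in> I" "int (degree (smult (coeff p x) (R (bt x) m))) = int (degree (smult (coeff p y) (R (bt y) m)))"
      then show "x = y" using conjunct2[OF t[OF xy(1)]] conjunct2[OF t[OF xy(2)]] by linarith
    qed
  qed
  then obtain i where i: "i \<in> I" "act R (kap p) m \<noteq> 0"
      "int (degree (act R (kap p) m)) = int (degree (smult (coeff p i) (R (bt i) m)))"
      "int (degree (smult (coeff p (degree p)) (R (bt (degree p)) m))) \<le> int (degree (smult (coeff p i) (R (bt i) m)))"
    unfolding e using top by blast
  show "act R (kap p) m \<noteq> 0" by (rule i(2))
  have "i \<le> degree p" using i(1) by (simp add: I_def)
  then show "degree (act R (kap p) m) = degree p + degree m"
    using i(3,4) conjunct2[OF t[OF i(1)]] conjunct2[OF t[OF top]] by linarith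
qed


lemma AC_nonzero_kap:
  assumes z: "z \<in> AC" "z \<noteq> 0"
  obtains p where "reduced p" "p \<noteq> 0" "z = kap p"
proof -
  obtain p where p: "reduced p" "z = kap p" using AC_kap[OF z(1)] by blast
  have "p \<noteq> 0" using z(2) p(2) by (auto simp: kap_def)
  then show ?thesis using that p by blast
qed

end

section \<open>Degree and Frobenius on the function field\<close>

locale cm_ring_drinfeld = cm_ring iK iC jK jC A D q r TK \<theta>
  for iK :: "'f::{field,finite} \<Rightarrow> 'k::field" and iC :: "'f \<Rightarrow> 'c::field"
    and jK :: "'k \<Rightarrow> 'l::field" and jC :: "'c \<Rightarrow> 'l" and A D q r TK \<theta> +
  fixes \<alpha>0 :: "'k \<Rightarrow> 'c" and R0 :: "'k \<Rightarrow> 'c poly \<Rightarrow> 'c poly"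
  assumes dr0: "drin \<alpha>0 R0"
begin

text \<open>The auxiliary Drinfeld module \<open>R0\<close> measures degrees on A tensor C; by
  \<open>act_kap\<close> any other gives the same result.\<close>

definition DA :: "'l \<Rightarrow> int" where "DA z = int (degree (act R0 z 1))"

lemma DA_kap: "reduced p \<Longrightarrow> p \<noteq> 0 \<Longrightarrow> DA (kap p) = int (degree p)"
  using act_kap(2)[OF dr0, of p 1] by (simp add: DA_def)

lemma act_degree:
  assumes d: "drin \<alpha> R" and z: "z \<in> AC" "z \<noteq> 0" and m: "m \<noteq> 0"
  shows "act R z m \<noteq> 0" "int (degree (act R z m)) = DA z + int (degree m)"
proof -
  obtain p where "reduced p" "p \<noteq> 0" "z = kap p" using AC_nonzero_kap[OF z] by blast
  then show "act R z m \<noteq> 0" "int (degree (act R z m)) = DA z + int (degree m)"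
    using act_kap[OF d, of p m] DA_kap m by simp_all
qed

lemma act_inj: "drin \<alpha> R \<Longrightarrow> z \<in> AC \<Longrightarrow> z' \<in> AC \<Longrightarrow> act R z 1 = act R z' 1 \<Longrightarrow> z = z'"
proof (rule ccontr)
  assume d: "drin \<alpha> R" and z: "z \<in> AC" "z' \<in> AC" "act R z 1 = act R z' 1" "z \<noteq> z'"
  have zz: "z - z' \<in> AC" using z AC_closed(3) by simp
  have "act R ((z - z') + z') 1 = act R (z - z') 1 + act R z' 1" by (rule act_simps(2)[OF d zz z(2)])
  then have "act R (z - z') 1 = 0" using z(3) by simp
  then show False using act_degree(1)[OF d zz, of 1] z(4) by simp
qed

lemma DA_mult: "z \<in> AC \<Longrightarrow> z \<noteq> 0 \<Longrightarrow> z' \<in> AC \<Longrightarrow> z' \<noteq> 0 \<Longrightarrow> DA (z * z') = DA z + DA z'"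
  using act_degree[OF dr0, of z "act R0 z' 1"] act_degree(1)[OF dr0, of z' 1] act_mult[OF dr0, of z z' 1]
  by (simp add: DA_def[of "z * z'"] DA_def[of z'])

lemma DA_nonneg: "0 \<le> DA z" by (simp add: DA_def)

lemma DA_jC: "c \<noteq> 0 \<Longrightarrow> DA (jC c) = 0"
  using act_simps(1)[OF dr0, of 1 c 1] drinD(9)[OF dr0, of 1 1] is_subringD(1)[OF A_ring] by (simp add: DA_def)

lemma DA_jK: "a \<in> A \<Longrightarrow> a \<noteq> 0 \<Longrightarrow> DA (jK a) = D a"
  using act_simps(1)[OF dr0, of a 1 1] drinD(12)[OF dr0, of a 1] by (simp add: DA_def)

lemma DA_add: "z \<in> AC \<Longrightarrow> z' \<in> AC \<Longrightarrow> DA (z + z') \<le> max (DA z) (DA z')"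
  using degree_add_le_max[of "act R0 z 1" "act R0 z' 1"] act_simps(2)[OF dr0, of z z' 1]
  by (auto simp: DA_def max_def)

lemma DA_cancel:
  assumes z: "z \<in> AC" "z \<noteq> 0" and z': "z' \<in> AC" "z' \<noteq> 0" and e: "DA z = DA z'"
  shows "\<exists>c. z - jC c * z' = 0 \<or> DA (z - jC c * z') < DA z"
proof -
  obtain p where p: "reduced p" "p \<noteq> 0" "z = kap p" by (rule AC_nonzero_kap[OF z])
  obtain p' where p': "reduced p'" "p' \<noteq> 0" "z' = kap p'" by (rule AC_nonzero_kap[OF z'])
  have "int (degree p) = int (degree p')" using e DA_kap p p' by simp
  then obtain c where c: "p - smult c p' = 0 \<or> int (degree (p - smult c p')) < int (degree p)"
    using PG.D_cancel[OF p(2) p'(2)] by blast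
  have "reduced (p - smult c p')" using reduced_add[OF p(1) reduced_smult[OF p'(1), of "- c"]] by simp
  moreover have k: "kap (p - smult c p') = z - jC c * z'"
    using kap_add[of p "smult (- c) p'"] kap_smult[of "- c" p'] p(3) p'(3) by simp
  ultimately have "p - smult c p' \<noteq> 0 \<Longrightarrow> DA (z - jC c * z') = int (degree (p - smult c p'))"
    using DA_kap[of "p - smult c p'"] by simp
  moreover have "kap 0 = 0" by (simp add: kap_def)
  ultimately show ?thesis using c k DA_kap[OF p(1,2)] p(3)
    by (intro exI[of _ c]) (cases "p - smult c p' = 0"; simp)
qed

text \<open>The Frobenius image of z applied to \<tau> is \<tau> times z applied to 1, and neither
  left multiplication by \<tau> nor the action of a nonzero z kills anything.\<close>

lemma sigA_nonzero: "z \<in> AC \<Longrightarrow> z \<noteq> 0 \<Longrightarrow> sigA z \<noteq> 0"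
proof
  assume z: "z \<in> AC" "z \<noteq> 0" "sigA z = 0"
  have "tw (act R0 z 1) = act R0 0 (tw 1)" using act_sig[OF dr0 z(1), of 1] z(3) by simp
  then have "act R0 z 1 = 0" by (simp add: act_simps(3)[OF dr0] tw_simps)
  then show False using act_degree(1)[OF dr0 z(1,2), of 1] by simp
qed

lemma DA_sig: assumes z: "z \<in> AC" "z \<noteq> 0" shows "DA (sigA z) = DA z"
proof -
  have "int (degree (act R0 (sigA z) (tw 1))) = DA (sigA z) + int (degree (tw 1))"
    by (rule act_degree(2)[OF dr0 sigA_AC[OF z(1)] sigA_nonzero[OF z]]) (simp add: tw_simps)
  moreover have "int (degree (tw (act R0 z 1))) = int (degree (act R0 z 1)) + 1"
    using tw_simps(5)[OF act_degree(1)[OF dr0 z, of 1]] by simp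
  moreover have "degree (tw 1) = 1" using tw_simps(5)[of 1] by simp
  ultimately show ?thesis using act_sig[OF dr0 z(1), of 1] by (simp add: DA_def[of z])
qed

subsection \<open>Extension to the function field\<close>

lemma AC_fractions: "\<exists>u\<in>AC. \<exists>w\<in>AC. w \<noteq> 0 \<and> x = u / w"
proof -
  have den: "\<exists>d\<in>A. d \<noteq> 0 \<and> jK d * u \<in> AC" if "u \<in> VL.span (range jK)" for u
    using that
  proof (induction rule: VL.span_induct)
    case (base)
    show ?case
    proof (rule VL.subspaceI)
      show "0 \<in> {u. \<exists>d\<in>A. d \<noteq> 0 \<and> jK d * u \<in> AC}"
        using is_subringD(1)[OF A_ring] AC_closed(2) by (intro CollectI bexI[of _ 1]) simp_all
    next
      fix x y assume "x \<in> {u. \<exists>d\<in>A. d \<noteq> 0 \<and> jK d * u \<in> AC}" "y \<in> {u. \<exists>d\<in>A. d \<noteq> 0 \<and> jK d * u \<in> AC}"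
      then obtain d e where de: "d \<in> A" "d \<noteq> 0" "jK d * x \<in> AC" "e \<in> A" "e \<noteq> 0" "jK e * y \<in> AC" by blast
      have "jK e * (jK d * x) + jK d * (jK e * y) \<in> AC"
        using de AC_jK AC_closed(4,6) by simp
      moreover have "jK e * (jK d * x) + jK d * (jK e * y) = jK (d * e) * (x + y)" by (simp add: algebra_simps)
      ultimately show "x + y \<in> {u. \<exists>d\<in>A. d \<noteq> 0 \<and> jK d * u \<in> AC}"
        using de is_subringD(4)[OF A_ring] by (intro CollectI bexI[of _ "d * e"]) simp_all
    next
      fix c x assume "x \<in> {u. \<exists>d\<in>A. d \<noteq> 0 \<and> jK d * u \<in> AC}"
      then obtain d where d: "d \<in> A" "d \<noteq> 0" "jK d * x \<in> AC" by blast
      have "jC c * (jK d * x) \<in> AC" using d AC_jC AC_closed(4) by simp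
      then have "jK d * (jC c * x) \<in> AC" by (simp add: mult_ac)
      then show "jC c * x \<in> {u. \<exists>d\<in>A. d \<noteq> 0 \<and> jK d * u \<in> AC}" using d by blast
    qed
  next
    case (step x)
    then obtain y where y: "x = jK y" by blast
    obtain d where "d \<in> A" "d \<noteq> 0" "d * y \<in> A" using A_frac by blast
    then show ?case using AC_jK[of "d * y"] y by (intro bexI[of _ d]) simp_all
  qed
  obtain u w where uw: "u \<in> VL.span (range jK)" "w \<in> VL.span (range jK)" "w \<noteq> 0" "x = u / w"
    using tensor unfolding tensor_field_def by blast
  obtain d e where de: "d \<in> A" "d \<noteq> 0" "jK d * u \<in> AC" "e \<in> A" "e \<noteq> 0" "jK e * w \<in> AC"
    using den[OF uw(1)] den[OF uw(2)] by blast
  have "x = (jK e * (jK d * u)) / (jK d * (jK e * w))" using uw de by simp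
  moreover have "jK e * (jK d * u) \<in> AC" "jK d * (jK e * w) \<in> AC" using de AC_jK AC_closed(4) by simp_all
  moreover have "jK d * (jK e * w) \<noteq> 0" using uw de by simp
  ultimately show ?thesis by blast
qed

definition nd :: "'l \<Rightarrow> 'l \<times> 'l" where
  "nd x = (SOME p. fst p \<in> AC \<and> snd p \<in> AC \<and> snd p \<noteq> 0 \<and> x = fst p / snd p)"

lemma nd: "fst (nd x) \<in> AC" "snd (nd x) \<in> AC" "snd (nd x) \<noteq> 0" "x = fst (nd x) / snd (nd x)"
proof -
  have "\<exists>p. fst p \<in> AC \<and> snd p \<in> AC \<and> snd p \<noteq> 0 \<and> x = fst p / snd p"
    using AC_fractions[of x] by fastforce
  from someI_ex[OF this, folded nd_def]
  show "fst (nd x) \<in> AC" "snd (nd x) \<in> AC" "snd (nd x) \<noteq> 0" "x = fst (nd x) / snd (nd x)" by blast+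
qed

definition DL :: "'l \<Rightarrow> int" where "DL x = DA (fst (nd x)) - DA (snd (nd x))"

definition sig :: "'l \<Rightarrow> 'l" where "sig x = sigA (fst (nd x)) / sigA (snd (nd x))"

lemma DL_frac: assumes "u \<in> AC" "w \<in> AC" "u \<noteq> 0" "w \<noteq> 0" shows "DL (u / w) = DA u - DA w"
proof -
  note n = nd[of "u / w"]
  have "u * snd (nd (u / w)) = fst (nd (u / w)) * w" using n(3,4) assms(4) by (simp add: frac_eq_eq)
  moreover have "fst (nd (u / w)) \<noteq> 0" using n(4) assms by auto
  ultimately have "DA u + DA (snd (nd (u / w))) = DA (fst (nd (u / w))) + DA w"
    using DA_mult[of u "snd (nd (u / w))"] DA_mult[of "fst (nd (u / w))" w] n assms by metis
  then show ?thesis by (simp add: DL_def)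
qed

lemma sig_frac: assumes "u \<in> AC" "w \<in> AC" "w \<noteq> 0" shows "sig (u / w) = sigA u / sigA w"
proof -
  note n = nd[of "u / w"]
  have "u * snd (nd (u / w)) = fst (nd (u / w)) * w" using n(3,4) assms(3) by (simp add: frac_eq_eq)
  then have "sigA u * sigA (snd (nd (u / w))) = sigA (fst (nd (u / w))) * sigA w"
    using sigA_mult n assms by metis
  then show ?thesis using sigA_nonzero n assms by (simp add: sig_def frac_eq_eq)
qed

lemma sig_AC: "z \<in> AC \<Longrightarrow> sig z = sigA z"
proof -
  assume z: "z \<in> AC"
  have "sigA 1 = 1" using sigA_simps(1)[of 1 1] is_subringD(1)[OF A_ring] by simp
  then show "sig z = sigA z" using sig_frac[OF z AC_closed(1)] by simp
qed

lemma sig_jC: "sig (jC c) = jC (c ^ q)"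
  using sig_AC[OF AC_jC] sigA_simps(1)[of 1 c] is_subringD(1)[OF A_ring] by (simp del: jC_simps(7))

lemma sig_jK: "a \<in> A \<Longrightarrow> sig (jK a) = jK a"
  using sig_AC[OF AC_jK] sigA_simps(1)[of a 1] by simp

lemma sig_hom: "field_hom sig"
  unfolding field_hom_def
proof (intro conjI allI)
  show "sig 1 = 1" using sig_jC[of 1] by simp
  fix x y
  obtain u w where x: "u \<in> AC" "w \<in> AC" "w \<noteq> 0" "x = u / w" using AC_fractions by blast
  obtain u' w' where y: "u' \<in> AC" "w' \<in> AC" "w' \<noteq> 0" "y = u' / w'" using AC_fractions by blast
  have ww: "w * w' \<in> AC" "w * w' \<noteq> 0" using x y AC_closed(4) by simp_all
  have uw: "u * w' \<in> AC" "u' * w \<in> AC" "u * u' \<in> AC" using x y AC_closed(4) by simp_all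
  note nz = sigA_nonzero[OF x(2,3)] sigA_nonzero[OF y(2,3)]
  have "x + y = (u * w' + u' * w) / (w * w')" using x y by (simp add: add_frac_eq)
  then have "sig (x + y) = sigA (u * w' + u' * w) / sigA (w * w')"
    using sig_frac ww uw AC_closed(6) by simp
  also have "\<dots> = sigA u / sigA w + sigA u' / sigA w'"
    using nz x y uw by (simp add: sigA_simps(2) sigA_mult add_frac_eq)
  finally show "sig (x + y) = sig x + sig y" using sig_frac x y by simp
  have "x * y = (u * u') / (w * w')" using x y by simp
  then have "sig (x * y) = sigA (u * u') / sigA (w * w')" using sig_frac ww uw by simp
  then show "sig (x * y) = sig x * sig y" using sig_frac x y by (simp add: sigA_mult)
qed

lemmas sig_simps = field_hom_simps[OF sig_hom]

lemma DL_AC: "z \<in> AC \<Longrightarrow> z \<noteq> 0 \<Longrightarrow> DL z = DA z"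
  using DL_frac[OF _ AC_closed(1), of z] DA_jC[of 1] by simp

lemma nonzero_fraction:
  assumes "x \<noteq> 0"
  obtains u w where "u \<in> AC" "w \<in> AC" "u \<noteq> 0" "w \<noteq> 0" "x = u / w"
  using AC_fractions[of x] assms by auto

lemma DL_mult: assumes "x \<noteq> 0" "y \<noteq> 0" shows "DL (x * y) = DL x + DL y"
proof -
  obtain u w where x: "u \<in> AC" "w \<in> AC" "u \<noteq> 0" "w \<noteq> 0" "x = u / w" by (rule nonzero_fraction[OF assms(1)])
  obtain u' w' where y: "u' \<in> AC" "w' \<in> AC" "u' \<noteq> 0" "w' \<noteq> 0" "y = u' / w'" by (rule nonzero_fraction[OF assms(2)])
  have "x * y = (u * u') / (w * w')" using x y by simp
  then have "DL (x * y) = DA (u * u') - DA (w * w')" using DL_frac x y AC_closed(4) by simp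
  then show ?thesis using DL_frac x y by (simp add: DA_mult)
qed

lemma DL_sig: assumes "x \<noteq> 0" shows "DL (sig x) = DL x"
proof -
  obtain u w where x: "u \<in> AC" "w \<in> AC" "u \<noteq> 0" "w \<noteq> 0" "x = u / w" by (rule nonzero_fraction[OF assms])
  then show ?thesis using sig_frac[OF x(1,2,4)] DL_frac[of "sigA u" "sigA w"] DL_frac[OF x(1-4)]
    by (simp add: sigA_AC sigA_nonzero DA_sig)
qed

lemma L_graded: "graded_space (\<lambda>c x. jC c * x) DL"
proof
  fix x y :: 'l assume n: "x \<noteq> 0" "y \<noteq> 0"
  obtain u w where x: "u \<in> AC" "w \<in> AC" "u \<noteq> 0" "w \<noteq> 0" "x = u / w" by (rule nonzero_fraction[OF n(1)])
  obtain u' w' where y: "u' \<in> AC" "w' \<in> AC" "u' \<noteq> 0" "w' \<noteq> 0" "y = u' / w'" by (rule nonzero_fraction[OF n(2)])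
  define W where "W = w * w'"
  have W: "W \<in> AC" "W \<noteq> 0" using x y AC_closed(4) by (simp_all add: W_def)
  define Xn where "Xn = u * w'"
  define Yn where "Yn = u' * w"
  have Xn: "Xn \<in> AC" "Xn \<noteq> 0" "x = Xn / W" and Yn: "Yn \<in> AC" "Yn \<noteq> 0" "y = Yn / W"
    using x y AC_closed(4) by (simp_all add: Xn_def Yn_def W_def)
  have Dx: "DL x = DA Xn - DA W" "DL y = DA Yn - DA W" using DL_frac Xn Yn W by simp_all
  show "DL (x + y) \<le> max (DL x) (DL y)" if "x + y \<noteq> 0"
  proof -
    have s: "x + y = (Xn + Yn) / W" using Xn Yn by (simp add: add_divide_distrib)
    then have "Xn + Yn \<noteq> 0" using that by auto
    then have "DL (x + y) = DA (Xn + Yn) - DA W" unfolding s using DL_frac Xn Yn W AC_closed(6) by simp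
    then show ?thesis using DA_add[OF Xn(1) Yn(1)] Dx by linarith
  qed
  assume e: "DL x = DL y"
  then obtain c where c: "Xn - jC c * Yn = 0 \<or> DA (Xn - jC c * Yn) < DA Xn"
    using DA_cancel[OF Xn(1,2) Yn(1,2)] Dx by force
  have s: "x - jC c * y = (Xn - jC c * Yn) / W" using Xn Yn by (simp add: diff_divide_distrib)
  have mem: "Xn - jC c * Yn \<in> AC" using Xn Yn AC_jC AC_closed(3,4) by simp
  have "DL (x - jC c * y) = DA (Xn - jC c * Yn) - DA W" if "Xn - jC c * Yn \<noteq> 0"
    unfolding s using DL_frac[OF mem W(1) that W(2)] .
  then show "\<exists>c. x - jC c * y = 0 \<or> DL (x - jC c * y) < DL x"
    using c s Dx by (intro exI[of _ c]) (cases "Xn - jC c * Yn = 0"; simp)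
next
  fix c :: 'c and x :: 'l assume "c \<noteq> 0" "x \<noteq> 0"
  then show "DL (jC c * x) = DL x" using DL_mult[of "jC c" x] DL_AC[OF AC_jC, of c] DA_jC[of c] by simp
qed

sublocale LG: graded_space "\<lambda>c x. jC c * x" DL by (rule L_graded)

lemma AC_subspace: "VL.subspace AC"
  unfolding VL.subspace_def using AC_closed(2,4,6) AC_jC by simp

end

section \<open>Polynomials in T inside the function field\<close>

context cm_ring_drinfeld
begin

definition pT :: "'c poly \<Rightarrow> 'l" where "pT W = poly (map_poly jC W) (jK TK)"

lemma pT_simps: "pT (W + W') = pT W + pT W'" "pT (W * W') = pT W * pT W'" "pT (smult c W) = jC c * pT W"
  "pT [:c:] = jC c" "pT [:c, 1:] = jC c + jK TK" "pT 0 = 0" "pT (monom c k) = jC c * jK TK ^ k"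
proof -
  have mm: "map_poly jC (smult c W) = smult (jC c) (map_poly jC W)" for c W
    by (rule poly_eqI) (simp add: coeff_map_poly_hom[OF hom_jC])
  have mo: "map_poly jC (monom c k) = monom (jC c) k"
    by (rule poly_eqI) (simp add: coeff_map_poly_hom[OF hom_jC])
  show "pT (W + W') = pT W + pT W'" "pT (W * W') = pT W * pT W'" "pT (smult c W) = jC c * pT W"
    "pT [:c:] = jC c" "pT [:c, 1:] = jC c + jK TK" "pT 0 = 0" "pT (monom c k) = jC c * jK TK ^ k"
    by (simp_all add: pT_def map_poly_hom_simps[OF hom_jC] mm mo map_poly_pCons poly_monom)
qed

lemma pT_sum: "pT (sum f I) = (\<Sum>i\<in>I. pT (f i))"
  by (induction I rule: infinite_finite_induct) (simp_all add: pT_simps)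

lemma pT_altdef: "pT W = (\<Sum>k\<le>degree W. jC (coeff W k) * jK (TK ^ k))"
  by (simp add: pT_def poly_altdef map_poly_hom_simps(5)[OF hom_jC] coeff_map_poly_hom[OF hom_jC])

lemma A_TK_power: "TK ^ k \<in> A" using A_TK is_subringD(7)[OF A_ring] by simp

lemma pT_AC: "pT W \<in> AC"
  unfolding pT_altdef by (intro AC_closed(8) AC_gen A_TK_power)

lemma D_TK_power: "D (TK ^ k) = int k * int r"
proof (induction k)
  case 0
  have "D (1 * 1) = D 1 + D 1" by (rule D_mult) simp_all
  then show ?case by simp
next
  case (Suc k)
  then show ?case using D_mult[of TK "TK ^ k"] T0 D_TK by (simp add: algebra_simps)
qed

text \<open>The powers of T have distinct degrees, the multiples of \<open>r\<close>, so T is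
  transcendental over C in L.\<close>

lemma pT_nonzero: assumes W: "W \<noteq> 0" shows "pT W \<noteq> 0"
proof -
  define I where "I = {k. k \<le> degree W \<and> coeff W k \<noteq> 0}"
  have e: "pT W = (\<Sum>k\<in>I. jC (coeff W k) * jK (TK ^ k))"
    unfolding pT_altdef by (intro sum.mono_neutral_right) (auto simp: I_def)
  have t: "jC (coeff W k) * jK (TK ^ k) \<noteq> 0" "DL (jC (coeff W k) * jK (TK ^ k)) = int k * int r" if "k \<in> I" for k
  proof -
    have c: "coeff W k \<noteq> 0" using that by (simp add: I_def)
    have tk: "jK (TK ^ k) \<noteq> 0" using T0 by simp
    show "jC (coeff W k) * jK (TK ^ k) \<noteq> 0" using c T0 by simp
    have "DL (jK (TK ^ k)) = int k * int r"
      using DL_AC[OF AC_jK[OF A_TK_power] tk] DA_jK[OF A_TK_power] T0 D_TK_power by simp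
    then show "DL (jC (coeff W k) * jK (TK ^ k)) = int k * int r" using LG.D_scale[OF c tk] by simp
  qed
  have "\<exists>i\<in>I. (\<Sum>k\<in>I. jC (coeff W k) * jK (TK ^ k)) \<noteq> 0 \<and>
      DL (\<Sum>k\<in>I. jC (coeff W k) * jK (TK ^ k)) = DL (jC (coeff W i) * jK (TK ^ i)) \<and>
      (\<forall>k\<in>I. DL (jC (coeff W k) * jK (TK ^ k)) \<le> DL (jC (coeff W i) * jK (TK ^ i)))"
  proof (rule LG.D_sum_distinct)
    show "finite I" "I \<noteq> {}" using W by (auto simp: I_def)
    show "jC (coeff W k) * jK (TK ^ k) \<noteq> 0" if "k \<in> I" for k by (rule t(1)[OF that])
    show "inj_on (\<lambda>k. DL (jC (coeff W k) * jK (TK ^ k))) I"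
      using t(2) r_pos by (intro inj_onI) simp
  qed
  then show ?thesis unfolding e by blast
qed

lemma poly_TK: "jK (poly (map_poly iK p) TK) = pT (map_poly iC p)" "poly (map_poly iK p) TK \<in> A"
proof -
  show "jK (poly (map_poly iK p) TK) = pT (map_poly iC p)"
    by (induction p) (simp_all add: pT_def map_poly_pCons jK_iK)
  show "poly (map_poly iK p) TK \<in> A"
    by (induction p) (simp_all add: map_poly_pCons is_subringD(2,4,6)[OF A_ring] A_iK A_TK)
qed

text \<open>A is generated over the polynomials in T by one element for each degree class modulo
  \<open>r\<close> that occurs, and the same elements generate A tensor C over C[T].\<close>

lemma AC_generators:
  "\<exists>B. finite B \<and> B \<subseteq> A \<and> (\<forall>z\<in>AC. \<exists>W. z = (\<Sum>b\<in>B. pT (W b) * jK b))"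
proof -
  obtain B where B: "finite B" "B \<subseteq> A"
    "\<And>x. x \<in> A \<Longrightarrow> \<exists>c. x = (\<Sum>b\<in>B. KG.ev (c b) (\<lambda>k. ((*) TK ^^ k) b))"
  proof (rule KG.graded_operator_basis[OF A_subspace, of "(*) TK" "int r" 0])
    show "TK * x \<in> A" if "x \<in> A" for x using that A_TK is_subringD(4)[OF A_ring] by simp
    show "TK * x \<noteq> 0 \<and> D (TK * x) = D x + int r" if "x \<in> A" "x \<noteq> 0" for x
      using that D_mult[OF T0, of x] D_TK T0 by simp
  qed (use r_pos D_nonneg that in auto)
  have tk: "((*) TK ^^ k) b = TK ^ k * b" for k b by (induction k) (auto simp: mult.assoc)
  have evJ: "KG.ev p (\<lambda>k. ((*) TK ^^ k) b) = poly (map_poly iK p) TK * b" for p b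
    unfolding KG.ev_def poly_altdef tk map_poly_hom_simps(5)[OF hom_iK] coeff_map_poly_hom[OF hom_iK]
    by (simp add: sum_distrib_right mult.assoc)
  have "\<exists>W. z = (\<Sum>b\<in>B. pT (W b) * jK b)" if "z \<in> AC" for z
    using that
  proof (induction z rule: AC_induct)
    case zero
    show ?case by (intro exI[of _ "\<lambda>_. 0"]) (simp add: pT_simps)
  next
    case (step c a z)
    then obtain W where W: "z = (\<Sum>b\<in>B. pT (W b) * jK b)" by blast
    obtain p where p: "a = (\<Sum>b\<in>B. poly (map_poly iK (p b)) TK * b)" using B(3)[OF step(1)] by (auto simp: evJ)
    have "jK a = (\<Sum>b\<in>B. pT (map_poly iC (p b)) * jK b)" unfolding p by (simp add: poly_TK(1))
    then have "jC c * jK a + z = (\<Sum>b\<in>B. pT (smult c (map_poly iC (p b)) + W b) * jK b)"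
      by (simp add: W pT_simps distrib_right sum.distrib sum_distrib_left mult.assoc)
    then show ?case by (intro exI[of _ "\<lambda>b. smult c (map_poly iC (p b)) + W b"])
  qed
  then show ?thesis using B(1,2) by (intro exI[of _ B]) simp
qed

text \<open>A dimension count in place of a norm: the multiples of \<open>s\<close> attain all large
  degrees, hence have finite codimension in A tensor C, and some nontrivial combination of powers of
  T is a multiple of \<open>s\<close>.\<close>

lemma divides_poly:
  assumes s: "s \<in> AC" "s \<noteq> 0"
  shows "\<exists>W s'. W \<noteq> 0 \<and> s' \<in> AC \<and> s * s' = pT W"
proof -
  obtain n0 where n0: "\<forall>n\<ge>n0. \<exists>a\<in>A. a \<noteq> 0 \<and> D a = int n" using cofinite by blast
  define Yn where "Yn = (*) s ` AC"
  \<comment> \<open>Every degree from \<open>N\<close> on is attained by a multiple of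
    \<open>s\<close>, so at most \<open>N\<close> degrees are missing, and the \<open>N + 1\<close>
    powers of T up to exponent \<open>N\<close> must be dependent modulo these multiples.\<close>
  define N where "N = n0 + nat (DA s)"
  have sub: "VL.subspace Yn" unfolding VL.subspace_def
  proof (intro conjI ballI allI)
    show "0 \<in> Yn" unfolding Yn_def using AC_closed(2) by (intro image_eqI[of _ _ 0]) simp_all
    fix x assume "x \<in> Yn"
    then obtain u where u: "x = s * u" "u \<in> AC" by (auto simp: Yn_def)
    show "jC c * x \<in> Yn" for c unfolding Yn_def
      using u AC_jC[of c] AC_closed(4) by (intro image_eqI[of _ _ "jC c * u"]) (simp_all add: mult_ac)
    fix y assume "y \<in> Yn"
    then obtain w where w: "y = s * w" "w \<in> AC" by (auto simp: Yn_def)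
    show "x + y \<in> Yn" unfolding Yn_def
      using u w AC_closed(6) by (intro image_eqI[of _ _ "u + w"]) (simp_all add: distrib_left)
  qed
  have "\<exists>l. (\<exists>x\<in>{..N}. l x \<noteq> 0) \<and> (\<Sum>x\<in>{..N}. jC (l x) * jK (TK ^ x)) \<in> Yn"
  proof (rule LG.dependent_modulo_subspace[OF AC_subspace sub, of 0 "{0..<int N}"])
    show "Yn \<subseteq> AC" using s AC_closed(4) by (auto simp: Yn_def)
    show "0 \<le> DL x" if "x \<in> AC" "x \<noteq> 0" for x using DL_AC[OF that] DA_nonneg by simp
    show "DL ` (AC - {0}) \<subseteq> {0..<int N} \<union> DL ` (Yn - {0})"
    proof (rule image_subsetI)
      fix z assume "z \<in> AC - {0}"
      then have z: "DL z = DA z" using DL_AC by simp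
      show "DL z \<in> {0..<int N} \<union> DL ` (Yn - {0})"
      proof (cases "DA z < int N")
        case True
        then show ?thesis using z DA_nonneg[of z] by simp
      next
        case False
        define n where "n = nat (DA z) - nat (DA s)"
        have "n \<ge> n0" "DA z = DA s + int n" using False DA_nonneg[of s] by (auto simp: n_def N_def)
        then obtain a where a: "a \<in> A" "a \<noteq> 0" "D a = int n" using n0 by blast
        have "s * jK a \<in> Yn - {0}" using a s AC_jK by (simp add: Yn_def)
        moreover have "DL (s * jK a) = DL z"
          using DL_mult[of s "jK a"] DL_AC[OF s] DL_AC[OF AC_jK[OF a(1)]] DA_jK[OF a(1,2)] a s z \<open>DA z = DA s + int n\<close> by simp
        ultimately show ?thesis by (metis UnI2 imageI)
      qed
    qed
    show "jK (TK ^ x) \<in> AC" for x by (rule AC_jK[OF A_TK_power])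
  qed simp_all
  then obtain l where l: "\<exists>x\<le>N. l x \<noteq> 0" "(\<Sum>x\<le>N. jC (l x) * jK (TK ^ x)) \<in> Yn" by auto
  define W where "W = (\<Sum>x\<le>N. monom (l x) x)"
  have cW: "coeff W k = (if k \<le> N then l k else 0)" for k by (simp add: W_def coeff_sum)
  have "W \<noteq> 0" using l(1) cW by (metis coeff_0)
  moreover have "pT W = (\<Sum>x\<le>N. jC (l x) * jK (TK ^ x))" unfolding W_def pT_sum by (simp add: pT_simps)
  moreover obtain u where "u \<in> AC" "(\<Sum>x\<le>N. jC (l x) * jK (TK ^ x)) = s * u"
    using l(2) unfolding Yn_def by (rule imageE)
  ultimately show ?thesis by (intro exI[of _ W] exI[of _ u]) (simp only: conj_assoc simp_thms not_False_eq_True)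
qed

subsection \<open>The local rings over \<open>T = \<theta>\<close>\<close>

text \<open>T - \<theta>, which is shown to be a uniformiser at every embedding: a separable
  covering is unramified over the transcendental point \<theta>.\<close>

definition pi0 :: 'l where "pi0 = jK TK - jC \<theta>"

text \<open>The local ring at the point \<open>\<alpha>\<close>: fractions with a denominator not
  vanishing there. The function \<open>rho\<close> defined next is its residue map, and
  \<open>rho_eq\<close> shows that the fraction chosen is immaterial.\<close>

definition loc :: "('k \<Rightarrow> 'c) \<Rightarrow> 'l set" where
  "loc \<alpha> = {x. \<exists>s\<in>AC. \<exists>t\<in>AC. chi \<alpha> t \<noteq> 0 \<and> t * x = s}"

definition rho :: "('k \<Rightarrow> 'c) \<Rightarrow> 'l \<Rightarrow> 'c" where
  "rho \<alpha> x = (THE y. \<exists>s\<in>AC. \<exists>t\<in>AC. chi \<alpha> t \<noteq> 0 \<and> t * x = s \<and> y = chi \<alpha> s / chi \<alpha> t)"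

context
  fixes \<alpha> :: "'k \<Rightarrow> 'c"
  assumes \<alpha>: "field_hom \<alpha>" "\<And>c. \<alpha> (iK c) = iC c" "\<alpha> TK = \<theta>"
begin

lemmas chi_lemmas = chi_simps[OF \<alpha>(1,2)] chi_mult[OF \<alpha>(1,2)] chi_jK[OF \<alpha>(1,2)] chi_jC[OF \<alpha>(1,2)]
  chi_1[OF \<alpha>(1,2)] chi_diff[OF \<alpha>(1,2)] chi_power[OF \<alpha>(1,2)]

lemma \<alpha>_poly: "\<alpha> (poly (map_poly iK p) TK) = poly (map_poly iC p) \<theta>"
  by (induction p) (simp_all add: map_poly_pCons field_hom_simps[OF \<alpha>(1)] \<alpha>)

lemma pi0: "pi0 \<in> AC" "chi \<alpha> pi0 = 0" "pi0 \<noteq> 0"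
proof -
  show "pi0 \<in> AC" using AC_jK[OF A_TK] AC_jC AC_closed(3) by (simp add: pi0_def)
  show "chi \<alpha> pi0 = 0" using AC_jK[OF A_TK] AC_jC by (simp add: pi0_def chi_lemmas A_TK \<alpha>(3))
  have "pT [:- \<theta>, 1:] \<noteq> 0" by (rule pT_nonzero) simp
  then show "pi0 \<noteq> 0" by (simp add: pT_simps pi0_def)
qed

lemma chi_pT: "chi \<alpha> (pT W) = poly W \<theta>"
proof -
  have "chi \<alpha> (pT W) = (\<Sum>k\<le>degree W. chi \<alpha> (jC (coeff W k) * jK (TK ^ k)))"
    unfolding pT_altdef by (rule chi_sum[OF \<alpha>(1,2)]) (rule AC_gen[OF A_TK_power])
  also have "\<dots> = (\<Sum>k\<le>degree W. coeff W k * \<theta> ^ k)"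
    by (intro sum.cong refl) (simp add: chi_simps(1)[OF \<alpha>(1,2) A_TK_power] field_hom_simps[OF \<alpha>(1)] \<alpha>(3) del: jK_simps)
  finally show ?thesis by (simp add: poly_altdef)
qed

lemma pT_root: "poly W \<theta> = 0 \<Longrightarrow> \<exists>W'. pT W = pi0 * pT W'"
proof -
  assume "poly W \<theta> = 0"
  then obtain W' where "W = [:- \<theta>, 1:] * W'" by (auto simp: poly_eq_0_iff_dvd elim: dvdE)
  then have "pT W = pi0 * pT W'" by (simp only: pT_simps) (simp add: pi0_def)
  then show ?thesis ..
qed

text \<open>Expanding the separable equation of \<open>a\<close> around \<open>\<alpha>(a)\<close>: the linear coefficient is the value
  of the derivative, which does not vanish because \<open>\<theta>\<close> is transcendental.\<close>

lemma separable_element: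
  assumes a: "a \<in> A"
  shows "\<exists>t\<in>AC. chi \<alpha> t \<noteq> 0 \<and> (\<exists>s\<in>AC. t * (jK a - jC (\<alpha> a)) = pi0 * s)"
proof -
  note h = field_hom_simps[OF \<alpha>(1)]
  obtain n P where P: "(\<Sum>i\<le>n. poly (map_poly iK (P i)) TK * a ^ i) = 0"
    "(\<Sum>i\<le>n. of_nat i * poly (map_poly iK (P i)) TK * a ^ (i - 1)) \<noteq> 0"
    using separable[of a] by blast
  define Jp where "Jp i = poly (map_poly iK (P i)) TK" for i
  have JA: "Jp i \<in> A" for i by (simp add: Jp_def poly_TK(2))
  define x where "x = jK a"
  define c where "c = jC (\<alpha> a)"
  have xA: "x \<in> AC" "c \<in> AC" using a by (simp_all add: x_def c_def AC_jK AC_jC)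
  \<comment> \<open>The divided difference of \<open>x^i\<close> and \<open>c^i\<close>. Thus
    \<open>t * (x - c)\<close> is the equation evaluated at \<open>x\<close> minus the same
    expression at \<open>c\<close>, and at the point \<open>\<alpha>\<close> each \<open>g i\<close>
    becomes the derivative of the i-th power.\<close>
  define g where "g i = (\<Sum>l<i. c ^ (i - Suc l) * x ^ l)" for i
  define t where "t = (\<Sum>i\<le>n. jK (Jp i) * g i)"
  have gA: "g i \<in> AC" for i unfolding g_def
    by (intro AC_closed(8) AC_closed(4) AC_closed(7) xA)
  have tA: "t \<in> AC" unfolding t_def by (intro AC_closed(8) AC_closed(4) AC_jK JA gA)
  have cg: "chi \<alpha> (g i) = of_nat i * \<alpha> a ^ (i - 1)" for i
  proof -
    have "chi \<alpha> (g i) = (\<Sum>l<i. chi \<alpha> (c ^ (i - Suc l) * x ^ l))"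
      unfolding g_def by (rule chi_sum[OF \<alpha>(1,2)]) (intro AC_closed(4) AC_closed(7) xA)
    also have "\<dots> = (\<Sum>l<i. \<alpha> a ^ (i - 1))"
    proof (rule sum.cong[OF refl])
      fix l assume "l \<in> {..<i}"
      then have "i - 1 = (i - Suc l) + l" by auto
      then show "chi \<alpha> (c ^ (i - Suc l) * x ^ l) = \<alpha> a ^ (i - 1)"
        using xA AC_closed(7) by (simp add: chi_lemmas power_add) (simp add: c_def x_def chi_lemmas a)
    qed
    finally show ?thesis by simp
  qed
  have nat: "\<alpha> (of_nat i) = of_nat i" for i by (induction i) (simp_all add: h)
  have "chi \<alpha> t = (\<Sum>i\<le>n. chi \<alpha> (jK (Jp i) * g i))"
    unfolding t_def by (rule chi_sum[OF \<alpha>(1,2)]) (intro AC_closed(4) AC_jK JA gA)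
  also have "\<dots> = (\<Sum>i\<le>n. \<alpha> (of_nat i * Jp i * a ^ (i - 1)))"
    by (intro sum.cong refl) (simp add: chi_lemmas AC_jK JA gA cg h nat mult_ac)
  also have "\<dots> = \<alpha> (\<Sum>i\<le>n. of_nat i * Jp i * a ^ (i - 1))" by (simp only: h(12))
  finally have ct: "chi \<alpha> t \<noteq> 0" using P(2) h(9) unfolding Jp_def by metis
  \<comment> \<open>The equation of \<open>a\<close> with the constant \<open>\<alpha> a\<close>
    substituted. It is a polynomial in T that vanishes at \<theta>, hence a multiple of T -
    \<theta>.\<close>
  define W where "W = (\<Sum>i\<le>n. smult (\<alpha> a ^ i) (map_poly iC (P i)))"
  have pW: "pT W = (\<Sum>i\<le>n. jK (Jp i) * c ^ i)"
    unfolding W_def pT_sum by (intro sum.cong refl) (simp add: pT_simps c_def Jp_def poly_TK(1))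
  have "poly W \<theta> = (\<Sum>i\<le>n. \<alpha> (Jp i * a ^ i))"
    unfolding W_def poly_sum by (intro sum.cong refl) (simp add: h Jp_def \<alpha>_poly mult.commute)
  also have "\<dots> = \<alpha> (\<Sum>i\<le>n. Jp i * a ^ i)" by (simp only: h(12))
  finally have "poly W \<theta> = 0" using P(1) h(1) by (simp add: Jp_def)
  then obtain W' where W': "pT W = pi0 * pT W'" using pT_root by blast
  have "t * (x - c) = (\<Sum>i\<le>n. jK (Jp i) * ((x - c) * g i))"
    unfolding t_def sum_distrib_right by (intro sum.cong refl) (simp add: mult_ac)
  also have "\<dots> = (\<Sum>i\<le>n. jK (Jp i) * (x ^ i - c ^ i))"
    unfolding g_def by (simp only: power_diff_sumr2)
  also have "\<dots> = (\<Sum>i\<le>n. jK (Jp i * a ^ i)) - pT W"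
    unfolding pW by (simp add: right_diff_distrib sum_subtractf x_def)
  also have "(\<Sum>i\<le>n. jK (Jp i * a ^ i)) = jK (\<Sum>i\<le>n. Jp i * a ^ i)" by (simp only: jK_simps(12))
  finally have "t * (x - c) = pi0 * (- pT W')" using P(1) W' by (simp add: Jp_def)
  moreover have "- pT W' \<in> AC" using pT_AC AC_closed(5) by simp
  ultimately show ?thesis using tA ct unfolding x_def c_def by blast
qed

text \<open>Modulo T - \<theta>, a function vanishing at \<open>\<alpha>\<close> is a combination of
  the differences b - \<open>\<alpha> b\<close> for finitely many module generators b. Each
  difference is a multiple of T - \<theta> up to a local unit by \<open>separable_element\<close>,
  and the product of these units serves all functions at once.\<close>

lemma uniformizer:
  "\<exists>t\<in>AC. chi \<alpha> t \<noteq> 0 \<and> (\<forall>s\<in>AC. chi \<alpha> s = 0 \<longrightarrow> (\<exists>s'\<in>AC. t * s = pi0 * s'))"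
proof -
  obtain B where B: "finite B" "B \<subseteq> A" "\<And>z. z \<in> AC \<Longrightarrow> \<exists>W. z = (\<Sum>b\<in>B. pT (W b) * jK b)"
    using AC_generators by metis
  have "\<forall>b\<in>B. \<exists>t s. t \<in> AC \<and> chi \<alpha> t \<noteq> 0 \<and> s \<in> AC \<and> t * (jK b - jC (\<alpha> b)) = pi0 * s"
    using separable_element B(2) by blast
  then obtain t s where ts: "\<And>b. b \<in> B \<Longrightarrow> t b \<in> AC \<and> chi \<alpha> (t b) \<noteq> 0 \<and> s b \<in> AC \<and> t b * (jK b - jC (\<alpha> b)) = pi0 * s b"
    by metis
  define t0 where "t0 = (\<Prod>b\<in>B. t b)"
  have t0: "t0 \<in> AC" unfolding t0_def by (rule AC_closed(9)) (use ts in blast)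
  have "chi \<alpha> t0 = (\<Prod>b\<in>B. chi \<alpha> (t b))" unfolding t0_def by (rule chi_prod[OF \<alpha>(1,2)]) (use ts in blast)
  then have ct0: "chi \<alpha> t0 \<noteq> 0" using ts B(1) by simp
  have tb: "\<exists>u\<in>AC. t0 * (jK b - jC (\<alpha> b)) = pi0 * u" if b: "b \<in> B" for b
  proof -
    define u where "u = (\<Prod>b\<in>B - {b}. t b)"
    have u: "u \<in> AC" unfolding u_def by (rule AC_closed(9)) (use ts in blast)
    have "t0 = t b * u" unfolding t0_def u_def using B(1) b by (simp add: prod.remove)
    then have "t0 * (jK b - jC (\<alpha> b)) = u * (t b * (jK b - jC (\<alpha> b)))" by (simp only: mult_ac)
    also have "\<dots> = pi0 * (u * s b)" using ts[OF b] by (simp add: mult_ac)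
    finally show ?thesis using u ts[OF b] AC_closed(4) by blast
  qed
  have "\<exists>s'\<in>AC. t0 * z = pi0 * s'" if z: "z \<in> AC" "chi \<alpha> z = 0" for z
  proof -
    obtain W where W: "z = (\<Sum>b\<in>B. pT (W b) * jK b)" using B(3)[OF z(1)] by blast
    have bA: "b \<in> A" if "b \<in> B" for b using that B(2) by blast
    have "\<exists>s'\<in>AC. t0 * (pT (W b) * jK b - jC (poly (W b) \<theta> * \<alpha> b)) = pi0 * s'" if b: "b \<in> B" for b
    proof -
      obtain u where u: "u \<in> AC" "t0 * (jK b - jC (\<alpha> b)) = pi0 * u" using tb[OF b] by blast
      obtain W' where W': "pT (W b - [:poly (W b) \<theta>:]) = pi0 * pT W'" using pT_root[of "W b - [:poly (W b) \<theta>:]"] by auto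
      have "pT (W b) = pT ((W b - [:poly (W b) \<theta>:]) + [:poly (W b) \<theta>:])" by simp
      then have p: "pT (W b) = pi0 * pT W' + jC (poly (W b) \<theta>)" by (simp only: pT_simps(1,4) W')
      have "t0 * (pT (W b) * jK b - jC (poly (W b) \<theta> * \<alpha> b))
          = pi0 * (t0 * pT W' * jK b) + jC (poly (W b) \<theta>) * (t0 * (jK b - jC (\<alpha> b)))"
        unfolding p by (simp add: algebra_simps)
      also have "\<dots> = pi0 * (t0 * pT W' * jK b + jC (poly (W b) \<theta>) * u)" unfolding u(2) by (simp add: algebra_simps)
      moreover have "t0 * pT W' * jK b + jC (poly (W b) \<theta>) * u \<in> AC"
        by (intro AC_closed(4,6) t0 u(1) pT_AC AC_jK bA b AC_jC)
      ultimately show ?thesis by (metis (no_types))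
    qed
    then obtain s' where s': "\<And>b. b \<in> B \<Longrightarrow> s' b \<in> AC \<and> t0 * (pT (W b) * jK b - jC (poly (W b) \<theta> * \<alpha> b)) = pi0 * s' b"
      by metis
    have "chi \<alpha> z = (\<Sum>b\<in>B. chi \<alpha> (pT (W b) * jK b))"
      unfolding W by (rule chi_sum[OF \<alpha>(1,2)]) (intro AC_closed(4) pT_AC AC_jK bA)
    also have "\<dots> = (\<Sum>b\<in>B. poly (W b) \<theta> * \<alpha> b)"
      by (intro sum.cong refl) (simp add: chi_lemmas pT_AC AC_jK bA chi_pT)
    finally have "jC (\<Sum>b\<in>B. poly (W b) \<theta> * \<alpha> b) = 0" using z(2) by simp
    then have c0: "(\<Sum>b\<in>B. jC (poly (W b) \<theta> * \<alpha> b)) = 0" by (simp only: jC_simps(12))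
    have "t0 * z = (\<Sum>b\<in>B. t0 * (pT (W b) * jK b - jC (poly (W b) \<theta> * \<alpha> b)))"
      using c0 by (simp only: W sum_distrib_left[symmetric] sum_subtractf diff_0_right)
    also have "\<dots> = pi0 * (\<Sum>b\<in>B. s' b)" unfolding sum_distrib_left by (intro sum.cong refl) (use s' in blast)
    finally show ?thesis using AC_closed(8)[of B s'] s' by blast
  qed
  then show ?thesis using t0 ct0 by blast
qed

text \<open>The order of vanishing at \<open>\<alpha>\<close> is bounded, because \<open>s\<close>
  divides a nonzero polynomial in T, whose order at \<theta> is finite. At the largest possible
  exponent the cofactor cannot vanish at \<open>\<alpha>\<close>, or \<open>uniformizer\<close>
  would extract one more factor T - \<theta>.\<close>

lemma AC_order:
  assumes s: "s \<in> AC" "s \<noteq> 0"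
  shows "\<exists>k::nat. \<exists>s'\<in>AC. \<exists>t\<in>AC. chi \<alpha> s' \<noteq> 0 \<and> chi \<alpha> t \<noteq> 0 \<and> t * s = pi0 ^ k * s'"
proof -
  obtain W s1 where W: "W \<noteq> 0" "s1 \<in> AC" "s * s1 = pT W" using divides_poly[OF s] by blast
  define n where "n = Polynomial.order \<theta> W"
  obtain V where V: "W = [:- \<theta>, 1:] ^ n * V" "\<not> [:- \<theta>, 1:] dvd V"
    using order_decomp[OF W(1), of \<theta>] unfolding n_def by blast
  have V0: "poly V \<theta> \<noteq> 0" using V(2) by (simp add: poly_eq_0_iff_dvd)
  have pw: "pT ([:- \<theta>, 1:] ^ n) = pi0 ^ n"
  proof (induction n)
    case 0
    show ?case using pT_simps(4)[of 1] by (simp add: one_pCons)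
  next
    case (Suc n)
    have "pT [:- \<theta>, 1:] = pi0" by (simp add: pT_simps pi0_def)
    then show ?case using Suc by (simp only: power_Suc pT_simps(2))
  qed
  have pWV: "s * s1 = pi0 ^ n * pT V" unfolding W(3) V(1) by (simp only: pT_simps(2) pw)
  obtain t0 where t0: "t0 \<in> AC" "chi \<alpha> t0 \<noteq> 0" "\<And>s. s \<in> AC \<Longrightarrow> chi \<alpha> s = 0 \<Longrightarrow> \<exists>s'\<in>AC. t0 * s = pi0 * s'"
    using uniformizer by blast
  define Q where "Q k \<longleftrightarrow> (\<exists>s'\<in>AC. \<exists>t\<in>AC. chi \<alpha> t \<noteq> 0 \<and> t * s = pi0 ^ k * s')" for k
  have Q0: "Q 0" unfolding Q_def using s AC_closed(1) chi_lemmas(7) by (intro bexI[of _ s] bexI[of _ 1]) simp_all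
  have bd: "k \<le> n" if Qk: "Q k" for k
  proof (rule ccontr)
    assume "\<not> k \<le> n"
    then obtain d where k: "k = n + Suc d" using less_imp_Suc_add[of n k] by auto
    obtain s' t where st: "s' \<in> AC" "t \<in> AC" "chi \<alpha> t \<noteq> 0" "t * s = pi0 ^ k * s'" using Qk unfolding Q_def by blast
    have "pi0 ^ n * (t * pT V) = t * (s * s1)" unfolding pWV by (simp only: mult_ac)
    also have "\<dots> = pi0 ^ k * s' * s1" using st(4) by (simp only: mult.assoc[symmetric])
    also have "\<dots> = pi0 ^ n * (pi0 * (pi0 ^ d * s' * s1))" by (simp add: k power_add mult_ac)
    finally have e: "t * pT V = pi0 * (pi0 ^ d * s' * s1)" using pi0(3) by simp
    have m: "pi0 ^ d * s' * s1 \<in> AC" by (intro AC_closed(4,7) pi0(1) st(1) W(2))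
    have "chi \<alpha> (t * pT V) = chi \<alpha> pi0 * chi \<alpha> (pi0 ^ d * s' * s1)"
      unfolding e by (rule chi_mult[OF \<alpha>(1,2) pi0(1) m])
    then have "chi \<alpha> t * poly V \<theta> = 0" using chi_mult[OF \<alpha>(1,2) st(2) pT_AC[of V]] pi0(2) chi_pT by simp
    then show False using st(3) V0 by simp
  qed
  have "\<exists>k. Q k \<and> (\<forall>k'. Q k' \<longrightarrow> k' \<le> k)"
  proof -
    have "{k. Q k} \<subseteq> {..n}" using bd by blast
    then have "finite {k. Q k}" using finite_subset by blast
    moreover have "{k. Q k} \<noteq> {}" using Q0 by blast
    ultimately have "Max {k. Q k} \<in> {k. Q k}" by (rule Max_in)
    moreover have "k' \<le> Max {k. Q k}" if "Q k'" for k'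
      using Max_ge[OF \<open>finite {k. Q k}\<close>, of k'] that by blast
    ultimately show ?thesis by blast
  qed
  then obtain k where k: "Q k" "\<And>k'. Q k' \<Longrightarrow> k' \<le> k" by blast
  obtain s' t where st: "s' \<in> AC" "t \<in> AC" "chi \<alpha> t \<noteq> 0" "t * s = pi0 ^ k * s'" using k(1) unfolding Q_def by blast
  have "chi \<alpha> s' \<noteq> 0"
  proof
    assume "chi \<alpha> s' = 0"
    then obtain s2 where s2: "s2 \<in> AC" "t0 * s' = pi0 * s2" using t0(3) st(1) by blast
    have "(t0 * t) * s = pi0 ^ k * (t0 * s')" by (simp only: mult.assoc st(4)) (simp only: mult.left_commute)
    then have "(t0 * t) * s = pi0 ^ Suc k * s2" unfolding s2(2) by (simp only: power_Suc mult_ac)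
    moreover have "chi \<alpha> (t0 * t) \<noteq> 0" using chi_mult[OF \<alpha>(1,2) t0(1) st(2)] t0(2) st(3) by simp
    moreover have "t0 * t \<in> AC" using t0(1) st(2) AC_closed(4) by blast
    ultimately have "Q (Suc k)" unfolding Q_def using s2(1) by blast
    then show False using k(2) by fastforce
  qed
  then show ?thesis using st by blast
qed

lemma rho_eq:
  assumes "s \<in> AC" "t \<in> AC" "chi \<alpha> t \<noteq> 0" "t * x = s"
  shows "rho \<alpha> x = chi \<alpha> s / chi \<alpha> t"
  unfolding rho_def
proof (rule the_equality)
  show "\<exists>s'\<in>AC. \<exists>t'\<in>AC. chi \<alpha> t' \<noteq> 0 \<and> t' * x = s' \<and> chi \<alpha> s / chi \<alpha> t = chi \<alpha> s' / chi \<alpha> t'"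
    using assms by blast
  fix y assume "\<exists>s'\<in>AC. \<exists>t'\<in>AC. chi \<alpha> t' \<noteq> 0 \<and> t' * x = s' \<and> y = chi \<alpha> s' / chi \<alpha> t'"
  then obtain s' t' where st: "s' \<in> AC" "t' \<in> AC" "chi \<alpha> t' \<noteq> 0" "t' * x = s'" "y = chi \<alpha> s' / chi \<alpha> t'" by blast
  have "t' * s = t * s'" using assms(4) st(4) by (metis mult.left_commute)
  then have "chi \<alpha> t' * chi \<alpha> s = chi \<alpha> t * chi \<alpha> s'"
    using chi_mult[OF \<alpha>(1,2)] st assms by metis
  then show "y = chi \<alpha> s / chi \<alpha> t" using st(3,5) assms(3) by (simp add: frac_eq_eq mult_ac)
qed

lemma locE:
  assumes "x \<in> loc \<alpha>"
  obtains s t where "s \<in> AC" "t \<in> AC" "chi \<alpha> t \<noteq> 0" "t * x = s" "rho \<alpha> x = chi \<alpha> s / chi \<alpha> t"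
proof -
  obtain s t where st: "s \<in> AC" "t \<in> AC" "chi \<alpha> t \<noteq> 0" "t * x = s" using assms unfolding loc_def by blast
  show ?thesis by (rule that[OF st rho_eq[OF st]])
qed

lemma locI: "s \<in> AC \<Longrightarrow> t \<in> AC \<Longrightarrow> chi \<alpha> t \<noteq> 0 \<Longrightarrow> t * x = s \<Longrightarrow> x \<in> loc \<alpha>"
  unfolding loc_def by blast

lemma loc_add: assumes "x \<in> loc \<alpha>" "y \<in> loc \<alpha>"
  shows "x + y \<in> loc \<alpha>" "rho \<alpha> (x + y) = rho \<alpha> x + rho \<alpha> y"
proof -
  obtain s t where x: "s \<in> AC" "t \<in> AC" "chi \<alpha> t \<noteq> 0" "t * x = s" "rho \<alpha> x = chi \<alpha> s / chi \<alpha> t" by (rule locE[OF assms(1)])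
  obtain s' t' where y: "s' \<in> AC" "t' \<in> AC" "chi \<alpha> t' \<noteq> 0" "t' * y = s'" "rho \<alpha> y = chi \<alpha> s' / chi \<alpha> t'" by (rule locE[OF assms(2)])
  have m: "t' * s + t * s' \<in> AC" "t * t' \<in> AC" "t' * s \<in> AC" "t * s' \<in> AC" by (intro AC_closed(4,6) x(1,2) y(1,2))+
  have e: "(t * t') * (x + y) = t' * s + t * s'" unfolding x(4)[symmetric] y(4)[symmetric] by (simp add: algebra_simps)
  have n: "chi \<alpha> (t * t') \<noteq> 0" using chi_mult[OF \<alpha>(1,2) x(2) y(2)] x(3) y(3) by simp
  show "x + y \<in> loc \<alpha>" by (rule locI[OF m(1,2) n e])
  have "rho \<alpha> (x + y) = chi \<alpha> (t' * s + t * s') / chi \<alpha> (t * t')" by (rule rho_eq[OF m(1,2) n e])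
  also have "\<dots> = rho \<alpha> x + rho \<alpha> y"
    using x y m by (simp add: chi_lemmas(2) chi_mult[OF \<alpha>(1,2)] add_frac_eq mult_ac)
  finally show "rho \<alpha> (x + y) = rho \<alpha> x + rho \<alpha> y" .
qed

lemma loc_mult: assumes "x \<in> loc \<alpha>" "y \<in> loc \<alpha>"
  shows "x * y \<in> loc \<alpha>" "rho \<alpha> (x * y) = rho \<alpha> x * rho \<alpha> y"
proof -
  obtain s t where x: "s \<in> AC" "t \<in> AC" "chi \<alpha> t \<noteq> 0" "t * x = s" "rho \<alpha> x = chi \<alpha> s / chi \<alpha> t" by (rule locE[OF assms(1)])
  obtain s' t' where y: "s' \<in> AC" "t' \<in> AC" "chi \<alpha> t' \<noteq> 0" "t' * y = s'" "rho \<alpha> y = chi \<alpha> s' / chi \<alpha> t'" by (rule locE[OF assms(2)])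
  have m: "s * s' \<in> AC" "t * t' \<in> AC" using x y AC_closed(4) by blast+
  have e: "(t * t') * (x * y) = s * s'" unfolding x(4)[symmetric] y(4)[symmetric] by (simp only: mult_ac)
  have n: "chi \<alpha> (t * t') \<noteq> 0" using chi_mult[OF \<alpha>(1,2) x(2) y(2)] x(3) y(3) by simp
  show "x * y \<in> loc \<alpha>" by (rule locI[OF m n e])
  show "rho \<alpha> (x * y) = rho \<alpha> x * rho \<alpha> y"
    using rho_eq[OF m n e] x y by (simp add: chi_mult[OF \<alpha>(1,2)])
qed

lemma loc_AC: "z \<in> AC \<Longrightarrow> z \<in> loc \<alpha>" "z \<in> AC \<Longrightarrow> rho \<alpha> z = chi \<alpha> z"
  using locI[OF _ AC_closed(1), of z z] rho_eq[OF _ AC_closed(1), of z z] chi_lemmas(7) by simp_all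

text \<open>A fractional ideal is locally generated by an element of minimal order.\<close>

lemma local_generator:
  assumes w: "w \<in> AC" "w \<noteq> 0" "\<And>x. x \<in> I \<Longrightarrow> w * x \<in> AC" and I: "x0 \<in> I" "x0 \<noteq> 0"
  shows "\<exists>g\<in>I. g \<noteq> 0 \<and> (\<forall>x\<in>I. x / g \<in> loc \<alpha>)"
proof -
  define Q where "Q x k \<longleftrightarrow> (\<exists>s'\<in>AC. \<exists>t\<in>AC. chi \<alpha> s' \<noteq> 0 \<and> chi \<alpha> t \<noteq> 0 \<and> t * (w * x) = pi0 ^ k * s')" for x and k :: nat
  have "\<exists>k. Q x k" if "x \<in> I" "x \<noteq> 0" for x
    unfolding Q_def by (rule AC_order) (use w that in auto)
  then obtain n where n: "\<And>x. x \<in> I \<Longrightarrow> x \<noteq> 0 \<Longrightarrow> Q x (n x)" by metis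
  obtain g where g: "g \<in> I" "g \<noteq> 0" "\<And>x. x \<in> I \<Longrightarrow> x \<noteq> 0 \<Longrightarrow> n g \<le> n x"
    using ex_has_least_nat[of "\<lambda>x. x \<in> I \<and> x \<noteq> 0" x0 n] I by blast
  have "x / g \<in> loc \<alpha>" if x: "x \<in> I" for x
  proof (cases "x = 0")
    case True
    then show ?thesis using loc_AC(1)[OF AC_closed(2)] by simp
  next
    case False
    obtain s t where st: "s \<in> AC" "t \<in> AC" "chi \<alpha> s \<noteq> 0" "chi \<alpha> t \<noteq> 0" "t * (w * x) = pi0 ^ n x * s"
      using n[OF x False] unfolding Q_def by blast
    obtain s' t' where st': "s' \<in> AC" "t' \<in> AC" "chi \<alpha> s' \<noteq> 0" "chi \<alpha> t' \<noteq> 0" "t' * (w * g) = pi0 ^ n g * s'"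
      using n[OF g(1,2)] unfolding Q_def by blast
    obtain d where d: "n x = n g + d" using g(3)[OF x False] le_Suc_ex by blast
    have "(t * s') * (w * x) * pi0 ^ n g = s' * (t * (w * x)) * pi0 ^ n g" by (simp only: mult_ac)
    also have "\<dots> = pi0 ^ n x * s * (pi0 ^ n g * s')" unfolding st(5) by (simp only: mult_ac)
    also have "\<dots> = pi0 ^ n x * s * (t' * (w * g))" unfolding st'(5) ..
    also have "\<dots> = (pi0 ^ d * s * t') * (w * g) * pi0 ^ n g" by (simp only: d power_add mult_ac)
    finally have "(t * s') * (w * x) = (pi0 ^ d * s * t') * (w * g)" using pi0(3) by simp
    then have "w * ((t * s') * x) = w * ((pi0 ^ d * s * t') * g)" by (simp only: mult_ac)
    then have "(t * s') * x = (pi0 ^ d * s * t') * g" using w(2) by simp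
    then have e: "(t * s') * (x / g) = pi0 ^ d * s * t'" using g(2) by (simp add: divide_eq_eq)
    have "chi \<alpha> (t * s') \<noteq> 0" using chi_mult[OF \<alpha>(1,2) st(2) st'(1)] st(4) st'(3) by simp
    moreover have "t * s' \<in> AC" "pi0 ^ d * s * t' \<in> AC" by (intro AC_closed(4,7) pi0(1) st(1,2) st'(1,2))+
    ultimately show ?thesis using locI e by blast
  qed
  then show ?thesis using g by blast
qed

end

end

section \<open>Twisted polynomials as a fractional ideal of L\<close>

lemma generated_ideal_induct [consumes 1, case_names zero step]:
  assumes "x \<in> generated_ideal J V" "P 0"
    "\<And>a v x. a \<in> J \<Longrightarrow> v \<in> V \<Longrightarrow> x \<in> generated_ideal J V \<Longrightarrow> P x \<Longrightarrow> P (a * v + x)"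
  shows "P x"
proof -
  obtain xs where xs: "set xs \<subseteq> J \<times> V" "(\<Sum>(a, v)\<leftarrow>xs. a * v) = x" by (rule generated_idealE[OF assms(1)])
  have "P (\<Sum>(a, v)\<leftarrow>xs. a * v)" using xs(1)
  proof (induction xs)
    case (Cons p xs)
    obtain a v where p: "p = (a, v)" by (cases p)
    have "a \<in> J" "v \<in> V" "set xs \<subseteq> J \<times> V" using Cons(2) p by auto
    then show ?case using assms(3)[of a v "\<Sum>(a, v)\<leftarrow>xs. a * v"] Cons(1) generated_idealI[of xs J V] by (simp add: p)
  qed (simp add: assms(2))
  then show ?thesis using xs(2) by simp
qed

context cm_ring_drinfeld
begin

text \<open>If w applied to \<open>m\<close> equals y applied to 1, then \<open>m\<close> has to
  correspond to y/w. The quotient is unique because the action is free of torsion.\<close>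

definition EE :: "('k \<Rightarrow> 'c poly \<Rightarrow> 'c poly) \<Rightarrow> 'c poly \<Rightarrow> 'l" where
  "EE R m = (THE x. \<exists>w\<in>AC. \<exists>y\<in>AC. w \<noteq> 0 \<and> act R w m = act R y 1 \<and> x = y / w)"

context
  fixes \<alpha> R
  assumes d: "drin \<alpha> R"
begin

lemma act_jC: "act R (jC c) m = smult c m"
  using act_simps(1)[OF d, of 1 c m] drinD(9)[OF d, of 1 m] is_subringD(1)[OF A_ring] by simp

lemma act_pT: "act R (pT W) m = (\<Sum>k\<le>degree W. smult (coeff W k) (R (TK ^ k) m))"
proof -
  have "act R (\<Sum>k\<in>F. jC (coeff W k) * jK (TK ^ k)) m = (\<Sum>k\<in>F. smult (coeff W k) (R (TK ^ k) m))" for F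
  proof (induction F rule: infinite_finite_induct)
    case (insert k F)
    have "(\<Sum>k\<in>F. jC (coeff W k) * jK (TK ^ k)) \<in> AC" by (intro AC_closed(8) AC_gen A_TK_power)
    then show ?case using insert(1,2,3) act_simps(1)[OF d A_TK_power[of k], of "coeff W k" m]
        act_simps(2)[OF d AC_gen[OF A_TK_power[of k], of "coeff W k"], of "\<Sum>k\<in>F. jC (coeff W k) * jK (TK ^ k)" m]
      by (simp del: jK_simps)
  qed (simp_all add: act_simps(3)[OF d])
  then show ?thesis unfolding pT_altdef .
qed

text \<open>The submodule generated by 1 contains elements of every degree from \<open>n0\<close>
  on, so it has finite codimension over C in C[\<tau>]. Hence some nonzero polynomial in T carries
  \<open>m\<close> into it.\<close>

lemma EE_exists: "\<exists>w\<in>AC. \<exists>y\<in>AC. w \<noteq> 0 \<and> act R w m = act R y 1"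
proof -
  obtain n0 where n0: "\<forall>n\<ge>n0. \<exists>a\<in>A. a \<noteq> 0 \<and> D a = int n" using cofinite by blast
  define Yn where "Yn = (\<lambda>y. act R y 1) ` AC"
  have sub: "PG.subspace Yn"
  proof (rule PG.subspaceI)
    show "0 \<in> Yn" unfolding Yn_def using AC_closed(2) act_simps(3)[OF d] by (intro image_eqI[of _ _ 0]) simp_all
  next
    fix c x assume "x \<in> Yn"
    then obtain u where u: "x = act R u 1" "u \<in> AC" by (auto simp: Yn_def)
    then show "smult c x \<in> Yn" unfolding Yn_def
      using AC_jC[of c] AC_closed(4) act_mult[OF d AC_jC u(2), of c 1] act_jC
      by (intro image_eqI[of _ _ "jC c * u"]) simp_all
  next
    fix x y assume "x \<in> Yn" "y \<in> Yn"
    then obtain u w where u: "x = act R u 1" "u \<in> AC" and w: "y = act R w 1" "w \<in> AC" by (auto simp: Yn_def)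
    then show "x + y \<in> Yn" unfolding Yn_def
      using AC_closed(6) act_simps(2)[OF d u(2) w(2)] by (intro image_eqI[of _ _ "u + w"]) simp_all
  qed
  have "\<exists>l. (\<exists>x\<in>{..n0}. l x \<noteq> 0) \<and> (\<Sum>x\<in>{..n0}. smult (l x) (R (TK ^ x) m)) \<in> Yn"
  proof (rule PG.dependent_modulo_subspace[OF PG.subspace_UNIV sub, of 0 "{0..<int n0}"])
    show "(\<lambda>m. int (degree m)) ` (UNIV - {0 :: 'c poly}) \<subseteq> {0..<int n0} \<union> (\<lambda>m. int (degree m)) ` (Yn - {0})"
    proof (rule image_subsetI)
      fix z :: "'c poly"
      show "int (degree z) \<in> {0..<int n0} \<union> (\<lambda>m. int (degree m)) ` (Yn - {0})"
      proof (cases "degree z < n0")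
        case False
        then obtain a where a: "a \<in> A" "a \<noteq> 0" "D a = int (degree z)" using n0 by (meson not_less)
        have e: "act R (jK a) 1 = R a 1" using act_simps(1)[OF d a(1), of 1 1] by simp
        have "R a 1 \<in> Yn - {0}" using a drinD(11)[OF d a(1,2), of 1] AC_jK[OF a(1)] e
          unfolding Yn_def by (metis (no_types, lifting) Diff_iff imageI one_neq_zero singletonD)
        moreover have "int (degree (R a 1)) = int (degree z)" using drinD(12)[OF d a(1,2), of 1] a(3) by simp
        ultimately show ?thesis by (metis (no_types, lifting) UnI2 imageI)
      qed simp
    qed
  qed simp_all
  then obtain l where l: "\<exists>x\<le>n0. l x \<noteq> 0" "(\<Sum>x\<le>n0. smult (l x) (R (TK ^ x) m)) \<in> Yn" by auto
  define W where "W = (\<Sum>x\<le>n0. monom (l x) x)"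
  have cW: "coeff W k = (if k \<le> n0 then l k else 0)" for k by (simp add: W_def coeff_sum)
  have W0: "W \<noteq> 0" using l(1) cW by (metis coeff_0)
  have dW: "degree W \<le> n0" by (rule degree_le) (simp add: cW)
  have "act R (pT W) m = (\<Sum>k\<le>n0. smult (coeff W k) (R (TK ^ k) m))"
    unfolding act_pT using dW by (intro sum.mono_neutral_left) (auto simp: coeff_eq_0)
  also have "\<dots> = (\<Sum>x\<le>n0. smult (l x) (R (TK ^ x) m))" by (intro sum.cong) (simp_all add: cW)
  finally have "act R (pT W) m \<in> Yn" using l(2) by simp
  then show ?thesis using pT_AC pT_nonzero[OF W0] by (auto simp: Yn_def)
qed

lemma EE_eq:
  assumes "w \<in> AC" "y \<in> AC" "w \<noteq> 0" "act R w m = act R y 1"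
  shows "EE R m = y / w"
  unfolding EE_def
proof (rule the_equality)
  show "\<exists>w'\<in>AC. \<exists>y'\<in>AC. w' \<noteq> 0 \<and> act R w' m = act R y' 1 \<and> y / w = y' / w'" using assms by blast
  fix x assume "\<exists>w'\<in>AC. \<exists>y'\<in>AC. w' \<noteq> 0 \<and> act R w' m = act R y' 1 \<and> x = y' / w'"
  then obtain w' y' where w: "w' \<in> AC" "y' \<in> AC" "w' \<noteq> 0" "act R w' m = act R y' 1" "x = y' / w'" by blast
  have "act R (w' * y) 1 = act R w' (act R w m)" using act_mult[OF d w(1) assms(2)] assms(4) by simp
  also have "\<dots> = act R (w * w') m" using act_mult[OF d w(1) assms(1)] by (simp add: mult.commute)
  also have "\<dots> = act R (w * y') 1" using act_mult[OF d assms(1) w(1)] act_mult[OF d assms(1) w(2)] w(4) by simp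
  finally have ee: "act R (w' * y) 1 = act R (w * y') 1" .
  have "w' * y = w * y'" by (rule act_inj[OF d _ _ ee]) (intro AC_closed(4) w(1,2) assms(1,2))+
  then show "x = y / w" using w(3,5) assms(3) by (simp add: frac_eq_eq mult_ac)
qed

lemma EE_E:
  obtains w y where "w \<in> AC" "y \<in> AC" "w \<noteq> 0" "act R w m = act R y 1" "EE R m = y / w"
  using EE_exists EE_eq by blast

lemma EE_add: "EE R (m + m') = EE R m + EE R m'"
proof -
  obtain w y where w: "w \<in> AC" "y \<in> AC" "w \<noteq> 0" "act R w m = act R y 1" "EE R m = y / w" by (rule EE_E)
  obtain w' y' where w': "w' \<in> AC" "y' \<in> AC" "w' \<noteq> 0" "act R w' m' = act R y' 1" "EE R m' = y' / w'" by (rule EE_E)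
  have m: "w * w' \<in> AC" "w' * y \<in> AC" "w * y' \<in> AC" "w' * y + w * y' \<in> AC" by (intro AC_closed(4,6) w(1,2) w'(1,2))+
  have "act R (w * w') (m + m') = act R (w' * w) m + act R (w * w') m'"
    using act_add[OF d m(1)] by (simp add: mult.commute)
  also have "\<dots> = act R (w' * y) 1 + act R (w * y') 1" using w w' by (simp add: act_mult[OF d])
  also have "\<dots> = act R (w' * y + w * y') 1" using act_simps(2)[OF d m(2,3)] by simp
  finally have "EE R (m + m') = (w' * y + w * y') / (w * w')" using w(3) w'(3) by (intro EE_eq m) simp_all
  then show ?thesis using w(3,5) w'(3,5) by (simp add: add_frac_eq mult_ac)
qed

lemma EE_act: assumes "z \<in> AC" shows "EE R (act R z m) = z * EE R m"
proof -
  obtain w y where w: "w \<in> AC" "y \<in> AC" "w \<noteq> 0" "act R w m = act R y 1" "EE R m = y / w" by (rule EE_E)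
  have "act R w (act R z m) = act R z (act R w m)"
    using act_mult[OF d w(1) assms, of m] act_mult[OF d assms w(1), of m] by (simp add: mult.commute)
  also have "\<dots> = act R (z * y) 1" using act_mult[OF d assms w(2)] w(4) by simp
  finally have "EE R (act R z m) = (z * y) / w" using w assms AC_closed(4) by (intro EE_eq) simp_all
  then show ?thesis using w(5) by simp
qed

lemma EE_1: "EE R 1 = 1"
  using EE_eq[OF AC_closed(1) AC_closed(1), of 1] by simp

lemma EE_sum: "EE R (sum f I) = (\<Sum>i\<in>I. EE R (f i))"
proof (induction I rule: infinite_finite_induct)
  have "EE R 0 = EE R 0 + EE R 0" using EE_add[of 0 0] by (simp only: add_0)
  then have "EE R 0 = 0" by (metis add_cancel_right_right)
  then show "\<not> finite I \<Longrightarrow> EE R (sum f I) = (\<Sum>i\<in>I. EE R (f i))" "EE R (sum f {}) = (\<Sum>i\<in>{}. EE R (f i))" for I by simp_all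
qed (simp add: EE_add)

text \<open>Applying \<tau> to a relation between \<open>m\<close> and 1 replaces the coefficients
  by their Frobenius images and 1 by \<tau>. So \<tau> acts on the fractional ideal through the
  Frobenius followed by multiplication with the image of \<tau>, the shtuka function.\<close>

lemma EE_tw: "EE R (tw m) = EE R (tw 1) * sig (EE R m)"
proof -
  obtain w y where w: "w \<in> AC" "y \<in> AC" "w \<noteq> 0" "act R w m = act R y 1" "EE R m = y / w" by (rule EE_E)
  have "sigA w * EE R (tw m) = EE R (act R (sigA w) (tw m))" using EE_act[OF sigA_AC[OF w(1)]] by simp
  also have "\<dots> = EE R (act R (sigA y) (tw 1))" using act_sig[OF d w(1)] act_sig[OF d w(2)] w(4) by simp
  also have "\<dots> = sigA y * EE R (tw 1)" using EE_act[OF sigA_AC[OF w(2)]] by simp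
  finally have "sigA w * EE R (tw m) = sigA y * EE R (tw 1)" .
  then have "sigA w * EE R (tw m) = sigA w * (EE R (tw 1) * sig (EE R m))"
    using sig_frac[OF w(2,1,3)] sigA_nonzero[OF w(1,3)] w(5) by simp
  then show ?thesis using sigA_nonzero[OF w(1,3)] by simp
qed

lemma EE_degree: assumes "m \<noteq> 0" shows "EE R m \<noteq> 0" "DL (EE R m) = int (degree m)"
proof -
  obtain w y where w: "w \<in> AC" "y \<in> AC" "w \<noteq> 0" "act R w m = act R y 1" "EE R m = y / w" by (rule EE_E)
  note wm = act_degree[OF d w(1,3) assms]
  have y0: "y \<noteq> 0" using wm(1) w(4) act_simps(3)[OF d] by auto
  show "EE R m \<noteq> 0" using y0 w by simp
  have "DA w + int (degree m) = DA y" using wm(2) w(4) act_degree(2)[OF d w(2) y0, of 1] by simp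
  then show "DL (EE R m) = int (degree m)" using DL_frac[OF w(2,1) y0 w(3)] w(5) by simp
qed

text \<open>T raises degrees of twisted polynomials by \<open>r\<close>, so C[\<tau>] is finitely
  generated over C[T], and the product of denominators of the generators works for all
  elements.\<close>

lemma EE_denominator: "\<exists>w\<in>AC. w \<noteq> 0 \<and> (\<forall>m. w * EE R m \<in> AC)"
proof -
  obtain B where B: "finite B" "\<And>x. x \<in> UNIV \<Longrightarrow> \<exists>c. x = (\<Sum>b\<in>B. PG.ev (c b) (\<lambda>k. (R TK ^^ k) b))"
  proof (rule PG.graded_operator_basis[OF PG.subspace_UNIV, of "R TK" "int r" 0])
    show "R TK x \<noteq> 0 \<and> int (degree (R TK x)) = int (degree x) + int r" if "x \<noteq> 0" for x
      using drinD(11,12)[OF d A_TK T0 that] D_TK by simp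
  qed (use r_pos that in auto)
  have Rk: "(R TK ^^ k) b = R (TK ^ k) b" for k b
  proof (induction k)
    case 0
    show ?case using drinD(9)[OF d, of 1 b] by simp
  next
    case (Suc k)
    then show ?case using drinD(8)[OF d A_TK A_TK_power[of k]] by simp
  qed
  have ev: "PG.ev p (\<lambda>k. (R TK ^^ k) b) = act R (pT p) b" for p b
    unfolding PG.ev_def act_pT Rk ..
  have "\<forall>b\<in>B. \<exists>w. w \<in> AC \<and> w \<noteq> 0 \<and> w * EE R b \<in> AC"
  proof
    fix b
    obtain w y where "w \<in> AC" "y \<in> AC" "w \<noteq> 0" "act R w b = act R y 1" "EE R b = y / w" by (rule EE_E)
    then show "\<exists>w. w \<in> AC \<and> w \<noteq> 0 \<and> w * EE R b \<in> AC" by (intro exI[of _ w]) simp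
  qed
  then obtain w where w: "\<And>b. b \<in> B \<Longrightarrow> w b \<in> AC \<and> w b \<noteq> 0 \<and> w b * EE R b \<in> AC" by metis
  define w0 where "w0 = (\<Prod>b\<in>B. w b)"
  have w0: "w0 \<in> AC" "w0 \<noteq> 0" unfolding w0_def using w B(1) by (auto intro!: AC_closed(9))
  have wb: "w0 * EE R b \<in> AC" if b: "b \<in> B" for b
  proof -
    define u where "u = (\<Prod>b\<in>B - {b}. w b)"
    have u: "u \<in> AC" unfolding u_def by (rule AC_closed(9)) (use w in blast)
    have "w0 = w b * u" unfolding w0_def u_def using B(1) b by (simp add: prod.remove)
    then have "w0 * EE R b = u * (w b * EE R b)" by (simp only: mult_ac)
    moreover have "u * (w b * EE R b) \<in> AC" using u w[OF b] AC_closed(4) by blast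
    ultimately show ?thesis by (simp only:)
  qed
  have "w0 * EE R m \<in> AC" for m
  proof -
    obtain c where "m = (\<Sum>b\<in>B. act R (pT (c b)) b)" using B(2)[of m] by (auto simp: ev)
    then have "EE R m = (\<Sum>b\<in>B. pT (c b) * EE R b)" by (simp add: EE_sum EE_act pT_AC)
    then have "w0 * EE R m = (\<Sum>b\<in>B. pT (c b) * (w0 * EE R b))" by (simp add: sum_distrib_left mult_ac)
    then show ?thesis using wb pT_AC AC_closed(4) by (auto intro!: AC_closed(8))
  qed
  then show ?thesis using w0 by blast
qed

end

section \<open>Fractional ideals with shtuka functions and their products\<close>

definition embp :: "('k \<Rightarrow> 'c) \<Rightarrow> bool" where
  "embp \<alpha> \<longleftrightarrow> field_hom \<alpha> \<and> (\<forall>c. \<alpha> (iK c) = iC c) \<and> \<alpha> TK = \<theta>"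

text \<open>The last clause says that, at each point of \<open>\<Phi>\<close>, the image of
  \<open>I\<close> under \<tau> lies in the maximal ideal times \<open>I\<close>, expressed through
  a local generator g. The inclusion of A tensor C makes \<open>I\<close> nonzero and gives it
  elements of every large degree.\<close>

definition lat :: "'l set \<Rightarrow> 'l \<Rightarrow> ('k \<Rightarrow> 'c) set \<Rightarrow> bool" where
  "lat I f \<Phi> \<longleftrightarrow> (\<forall>x\<in>I. \<forall>y\<in>I. x + y \<in> I) \<and> (\<forall>z\<in>AC. \<forall>x\<in>I. z * x \<in> I) \<and> AC \<subseteq> I \<and>
     (\<exists>w\<in>AC. w \<noteq> 0 \<and> (\<forall>x\<in>I. w * x \<in> AC)) \<and> f \<noteq> 0 \<and> DL f = int (card \<Phi>) \<and> (\<forall>x\<in>I. f * sig x \<in> I) \<and>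
     (\<forall>\<alpha>\<in>\<Phi>. \<exists>g\<in>I. g \<noteq> 0 \<and> (\<forall>x\<in>I. x / g \<in> loc \<alpha> \<and> rho \<alpha> (f * sig x / g) = 0))"

lemma latD:
  assumes "lat I f \<Phi>"
  shows "x \<in> I \<Longrightarrow> y \<in> I \<Longrightarrow> x + y \<in> I" "z \<in> AC \<Longrightarrow> x \<in> I \<Longrightarrow> z * x \<in> I" "z \<in> AC \<Longrightarrow> z \<in> I"
    "\<exists>w\<in>AC. w \<noteq> 0 \<and> (\<forall>x\<in>I. w * x \<in> AC)" "f \<noteq> 0" "DL f = int (card \<Phi>)" "x \<in> I \<Longrightarrow> f * sig x \<in> I"
    "\<alpha> \<in> \<Phi> \<Longrightarrow> \<exists>g\<in>I. g \<noteq> 0 \<and> (\<forall>x\<in>I. x / g \<in> loc \<alpha> \<and> rho \<alpha> (f * sig x / g) = 0)"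
  using assms unfolding lat_def by blast+

text \<open>It covers every embedding over T = \<theta>, also those outside \<open>\<Phi>\<close>:
  at a point belonging to one factor of a product, the other factor has to be generated by one
  element as well.\<close>

lemma lat_local_generator:
  assumes "embp \<alpha>" "lat I f \<Phi>"
  shows "\<exists>g\<in>I. g \<noteq> 0 \<and> (\<forall>x\<in>I. x / g \<in> loc \<alpha>)"
proof -
  have e: "field_hom \<alpha>" "\<And>c. \<alpha> (iK c) = iC c" "\<alpha> TK = \<theta>" using assms(1) by (simp_all add: embp_def)
  obtain w where w: "w \<in> AC" "w \<noteq> 0" "\<forall>x\<in>I. w * x \<in> AC" using latD(4)[OF assms(2)] by blast
  have "1 \<in> I" using latD(3)[OF assms(2)] AC_closed(1) by blast
  then show ?thesis using w by (intro local_generator[OF e w(1,2), of I 1]) auto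
qed

lemma lat_empty: "lat AC 1 {}"
proof -
  have "DL 1 = 0" using DL_AC[OF AC_closed(1)] DA_jC[of 1] by simp
  moreover have "sig x \<in> AC" if "x \<in> AC" for x using sig_AC[OF that] sigA_AC[OF that] by simp
  ultimately show ?thesis unfolding lat_def using AC_closed(1,4,6) by (auto intro!: bexI[of _ 1])
qed

text \<open>If the image of \<tau>m generated the ideal at \<open>\<alpha>\<close>, then 1 times a
  function not vanishing at \<open>\<alpha>\<close> would be a multiple of \<tau>m. Comparing
  constant coefficients refutes this, since that of \<tau>m is 0.\<close>

lemma lat_single:
  assumes d: "drin \<alpha> R"
  shows "\<exists>I f. lat I f {\<alpha>}"
proof -
  note e = drinD(1,2,3)[OF d]
  define f where "f = EE R (tw 1)"
  define I where "I = range (EE R)"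
  have tw1: "tw (1 :: 'c poly) \<noteq> 0" "degree (tw (1 :: 'c poly)) = 1" using tw_simps(4)[of 1] tw_simps(5)[of 1] by simp_all
  have add: "x + y \<in> I" if xy: "x \<in> I" "y \<in> I" for x y 
  proof -
    obtain m m' where "x = EE R m" "y = EE R m'" using xy by (auto simp: I_def)
    then show ?thesis using EE_add[OF d, of m m', symmetric] unfolding I_def by (simp only: rangeI)
  qed
  have mul: "z * x \<in> I" if xy: "z \<in> AC" "x \<in> I" for z x 
  proof -
    obtain m where "x = EE R m" using xy(2) by (auto simp: I_def)
    then show ?thesis using EE_act[OF d xy(1), of m, symmetric] unfolding I_def by (simp only: rangeI)
  qed
  have AI: "z \<in> I" if "z \<in> AC" for z 
  proof -
    have "1 \<in> I" unfolding I_def using rangeI[of "EE R" 1] EE_1[OF d] by simp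
    then show ?thesis using mul[OF that, of 1] by simp
  qed
  obtain w where w: "w \<in> AC" "w \<noteq> 0" "\<forall>x\<in>I. w * x \<in> AC" using EE_denominator[OF d] by (auto simp: I_def)
  have sg: "f * sig x \<in> I" if xy: "x \<in> I" for x 
  proof -
    obtain m where "x = EE R m" using xy by (auto simp: I_def)
    then show ?thesis using EE_tw[OF d, of m, symmetric] unfolding I_def f_def by (simp only: rangeI)
  qed
  have f: "f \<noteq> 0" "DL f = 1" using EE_degree[OF d tw1(1)] tw1(2) by (simp_all add: f_def)
  have I1: "1 \<in> I" using AI AC_closed(1) by blast
  obtain g where g: "g \<in> I" "g \<noteq> 0" "\<And>x. x \<in> I \<Longrightarrow> x / g \<in> loc \<alpha>"
    using local_generator[OF e w(1,2), of I 1] w(3) I1 by auto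
  have "rho \<alpha> (f * sig x / g) = 0" if x: "x \<in> I" for x
  proof (rule ccontr)
    assume nz: "rho \<alpha> (f * sig x / g) \<noteq> 0"
    obtain m where m: "x = EE R m" using x by (auto simp: I_def)
    define y where "y = f * sig x"
    have y: "y = EE R (tw m)" using EE_tw[OF d, of m] by (simp add: y_def f_def m)
    obtain s t where st: "s \<in> AC" "t \<in> AC" "chi \<alpha> t \<noteq> 0" "t * (y / g) = s" "rho \<alpha> (y / g) = chi \<alpha> s / chi \<alpha> t"
      using locE[OF e g(3)[OF sg[OF x]]] unfolding y_def by blast
    have cs: "chi \<alpha> s \<noteq> 0" using nz st(5) by (auto simp: y_def)
    obtain s' t' where st': "s' \<in> AC" "t' \<in> AC" "chi \<alpha> t' \<noteq> 0" "t' * (1 / g) = s'"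
      using locE[OF e g(3)[OF I1]] by blast
    have "(t' * s) * 1 = (s' * t) * y" using st(4) st'(4) g(2) by (simp add: field_simps)
    moreover have mm: "t' * s \<in> AC" "s' * t \<in> AC" by (intro AC_closed(4) st(1,2) st'(1,2))+
    ultimately have "EE R (act R (t' * s) 1) = EE R (act R (s' * t) (tw m))"
      by (simp only: EE_act[OF d mm(1)] EE_act[OF d mm(2)] EE_1[OF d] y)
    moreover have "m1 = m2" if "EE R m1 = EE R m2" for m1 m2
    proof (rule ccontr)
      assume "m1 \<noteq> m2"
      then have "EE R (m1 - m2) \<noteq> 0" using EE_degree(1)[OF d] by simp
      then show False using EE_add[OF d, of "m1 - m2" m2] that by simp
    qed
    ultimately have "act R (t' * s) 1 = act R (s' * t) (tw m)" by blast
    then have "chi \<alpha> (t' * s) * coeff 1 0 = chi \<alpha> (s' * t) * coeff (tw m) 0"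
      using act_coeff[OF d mm(1), of 1] act_coeff[OF d mm(2), of "tw m"] by simp
    then have "chi \<alpha> (t' * s) = 0" by (simp add: tw_simps)
    then show False using chi_mult[OF e(1,2) st'(2) st(1)] cs st'(3) by simp
  qed
  then have "lat I f {\<alpha>}" unfolding lat_def using add mul AI w sg f g by auto
  then show ?thesis by blast
qed

text \<open>Local generators multiply and residues are multiplicative, so at each point one
  vanishing factor suffices. Because \<open>\<beta>\<close> is new, the degree of the shtuka
  function grows in step with the size of \<open>\<Phi>\<close>.\<close>

lemma lat_product:
  assumes l: "lat I f \<Phi>" and l': "lat I' f' {\<beta>}" and \<beta>: "\<beta> \<notin> \<Phi>" "finite \<Phi>"
    and e: "\<And>\<alpha>. \<alpha> \<in> insert \<beta> \<Phi> \<Longrightarrow> embp \<alpha>"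
  shows "lat (generated_ideal I I') (f * f') (insert \<beta> \<Phi>)"
proof -
  define II where "II = generated_ideal I I'"
  have add: "x + y \<in> II" if "x \<in> II" "y \<in> II" for x y using that unfolding II_def by (rule generated_ideal_add)
  have inc: "x * x' \<in> II" if "x \<in> I" "x' \<in> I'" for x x' using that unfolding II_def by (rule generated_ideal_incl)
  have II0: "0 \<in> II" unfolding II_def by (rule generated_ideal_0)
  have mul: "z * x \<in> II" if z: "z \<in> AC" and x: "x \<in> II" for z x
    using x unfolding II_def
  proof (induction rule: generated_ideal_induct)
    case (step a v x)
    have "z * (a * v + x) = (z * a) * v + z * x" by (simp add: distrib_left mult.assoc)
    then show ?case using step inc[OF latD(2)[OF l z step(1)] step(2)] add unfolding II_def by simp
  qed (simp add: generated_ideal_0)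
  have AI: "z \<in> II" if "z \<in> AC" for z
    using inc[OF latD(3)[OF l that] latD(3)[OF l' AC_closed(1)]] by simp
  obtain w w' where w: "w \<in> AC" "w \<noteq> 0" "\<forall>x\<in>I. w * x \<in> AC" and w': "w' \<in> AC" "w' \<noteq> 0" "\<forall>x\<in>I'. w' * x \<in> AC"
    using latD(4)[OF l] latD(4)[OF l'] by blast
  have den: "(w * w') * x \<in> AC" if "x \<in> II" for x
    using that unfolding II_def
  proof (induction rule: generated_ideal_induct)
    case (step a v x)
    have "(w * w') * (a * v + x) = (w * a) * (w' * v) + (w * w') * x" by (simp add: algebra_simps)
    then show ?case using step w(3) w'(3) AC_closed(4,6) by simp
  qed (simp add: AC_closed(2))
  have split: "f * f' * sig (a * v + x) = (f * sig a) * (f' * sig v) + f * f' * sig x" for a v x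
    by (simp add: sig_simps algebra_simps)
  have sg: "f * f' * sig x \<in> II" if "x \<in> II" for x
    using that unfolding II_def
  proof (induction rule: generated_ideal_induct)
    case (step a v x)
    show ?case unfolding split
      using step inc[OF latD(7)[OF l step(1)] latD(7)[OF l' step(2)]] add unfolding II_def by simp
  qed (simp add: sig_simps generated_ideal_0)
  have "DL (f * f') = int (card (insert \<beta> \<Phi>))"
    using DL_mult[OF latD(5)[OF l] latD(5)[OF l']] latD(6)[OF l] latD(6)[OF l'] \<beta> by simp
  moreover have "\<exists>g\<in>II. g \<noteq> 0 \<and> (\<forall>x\<in>II. x / g \<in> loc \<alpha> \<and> rho \<alpha> (f * f' * sig x / g) = 0)"
    if \<alpha>: "\<alpha> \<in> insert \<beta> \<Phi>" for \<alpha>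
  proof -
    have em: "field_hom \<alpha>" "\<And>c. \<alpha> (iK c) = iC c" "\<alpha> TK = \<theta>" using e[OF \<alpha>] by (simp_all add: embp_def)
    \<comment> \<open>The factor to which \<open>\<alpha>\<close> belongs contributes the vanishing,
      the other one a mere local generator.\<close>
    have "\<exists>g\<in>I. \<exists>g'\<in>I'. g \<noteq> 0 \<and> g' \<noteq> 0 \<and> (\<forall>x\<in>I. x / g \<in> loc \<alpha>) \<and> (\<forall>x\<in>I'. x / g' \<in> loc \<alpha>) \<and>
        ((\<forall>x\<in>I. rho \<alpha> (f * sig x / g) = 0) \<or> (\<forall>x\<in>I'. rho \<alpha> (f' * sig x / g') = 0))"
    proof (cases "\<alpha> = \<beta>")
      case True
      then obtain g' where g': "g' \<in> I'" "g' \<noteq> 0" "\<forall>x\<in>I'. x / g' \<in> loc \<alpha> \<and> rho \<alpha> (f' * sig x / g') = 0"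
        using latD(8)[OF l', of \<alpha>] by auto
      obtain g where "g \<in> I" "g \<noteq> 0" "\<forall>x\<in>I. x / g \<in> loc \<alpha>" using lat_local_generator[OF e[OF \<alpha>] l] by blast
      then show ?thesis using g' by blast
    next
      case False
      then obtain g where g: "g \<in> I" "g \<noteq> 0" "\<forall>x\<in>I. x / g \<in> loc \<alpha> \<and> rho \<alpha> (f * sig x / g) = 0"
        using latD(8)[OF l, of \<alpha>] \<alpha> by auto
      obtain g' where "g' \<in> I'" "g' \<noteq> 0" "\<forall>x\<in>I'. x / g' \<in> loc \<alpha>" using lat_local_generator[OF e[OF \<alpha>] l'] by blast
      then show ?thesis using g by blast
    qed
    then obtain g g' where g: "g \<in> I" "g' \<in> I'" "g \<noteq> 0" "g' \<noteq> 0" "\<And>x. x \<in> I \<Longrightarrow> x / g \<in> loc \<alpha>"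
      "\<And>x. x \<in> I' \<Longrightarrow> x / g' \<in> loc \<alpha>"
      "(\<forall>x\<in>I. rho \<alpha> (f * sig x / g) = 0) \<or> (\<forall>x\<in>I'. rho \<alpha> (f' * sig x / g') = 0)" by blast
    have dv: "(a * v + x) / (g * g') = (a / g) * (v / g') + x / (g * g')" for a v x by (simp add: add_divide_distrib)
    have z: "0 \<in> loc \<alpha>" "rho \<alpha> 0 = 0"
      using loc_AC[OF em AC_closed(2)] chi_simps(3)[OF em(1,2)] by simp_all
    have lc: "x / (g * g') \<in> loc \<alpha>" if "x \<in> II" for x
      using that unfolding II_def
    proof (induction rule: generated_ideal_induct)
      case (step a v x)
      show ?case unfolding dv
        by (rule loc_add(1)[OF em loc_mult(1)[OF em g(5)[OF step(1)] g(6)[OF step(2)]] step(4)])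
    qed (simp add: z)
    have "rho \<alpha> (f * f' * sig x / (g * g')) = 0" if "x \<in> II" for x
      using that unfolding II_def
    proof (induction rule: generated_ideal_induct)
      case zero
      show ?case by (simp add: sig_simps z)
    next
      case (step a v x)
      have m: "(f * sig a) / g \<in> loc \<alpha>" "(f' * sig v) / g' \<in> loc \<alpha>" "f * f' * sig x / (g * g') \<in> loc \<alpha>"
        using g(5)[OF latD(7)[OF l step(1)]] g(6)[OF latD(7)[OF l' step(2)]] lc[OF sg] step(3) by (simp_all add: II_def)
      show ?case unfolding split dv
        using loc_add(2)[OF em loc_mult(1)[OF em m(1,2)] m(3)] loc_mult(2)[OF em m(1,2)] step g(7) by auto
    qed
    then show ?thesis using lc inc[OF g(1,2)] g(3,4) by (intro bexI[of _ "g * g'"]) auto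
  qed
  ultimately show ?thesis unfolding lat_def II_def[symmetric]
    using add mul AI den sg w(1,2) w'(1,2) AC_closed(4)[of w w'] latD(5)[OF l] latD(5)[OF l']
    by (auto intro!: bexI[of _ "w * w'"])
qed

lemma lat_exists:
  assumes "finite \<Phi>" "\<And>\<alpha>. \<alpha> \<in> \<Phi> \<Longrightarrow> \<exists>R. drin \<alpha> R"
  shows "\<exists>I f. lat I f \<Phi>"
  using assms
proof (induction \<Phi> rule: finite_induct)
  case empty
  show ?case using lat_empty by blast
next
  case (insert \<beta> \<Phi>)
  obtain I f where l: "lat I f \<Phi>" using insert by blast
  obtain R where "drin \<beta> R" using insert(4) by blast
  then obtain I' f' where l': "lat I' f' {\<beta>}" using lat_single by blast
  have "embp \<alpha>" if "\<alpha> \<in> insert \<beta> \<Phi>" for \<alpha>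
    using insert(4)[OF that] drinD(1,2,3) unfolding embp_def by blast
  then show ?case using lat_product[OF l l' insert(2,1)] by blast
qed

end

subsection \<open>The motive attached to a lattice\<close>

context cm_ring_drinfeld
begin

context
  fixes I :: "'l set" and f :: 'l and \<Phi> :: "('k \<Rightarrow> 'c) set"
  assumes lt: "lat I f \<Phi>" and fin: "finite \<Phi>" and ne: "\<Phi> \<noteq> {}"
    and em: "\<And>\<alpha>. \<alpha> \<in> \<Phi> \<Longrightarrow> embp \<alpha>"
begin

definition tauI :: "'l \<Rightarrow> 'l" where "tauI x = f * sig x"

text \<open>The action of the skew ring: T multiplies as an element of L, and \<tau> acts by
  \<open>tauI\<close>, which satisfies the commutation rule because the Frobenius fixes T.\<close>

definition skm :: "'c poly poly \<Rightarrow> 'l \<Rightarrow> 'l" where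
  "skm F x = (\<Sum>i\<le>degree F. pT (coeff F i) * (tauI ^^ i) x)"

definition MM :: "('c poly poly, 'l) module" where
  "MM = \<lparr>carrier = I, monoid.mult = undefined, one = undefined, ring.zero = 0, add = (+), module.smult = skm\<rparr>"

lemma MM_simps [simp]: "carrier MM = I" "ring.zero MM = 0" "add MM = (+)" "module.smult MM = skm"
  by (simp_all add: MM_def)

lemma I_0: "0 \<in> I" by (rule latD(3)[OF lt AC_closed(2)])

lemma I_add: "x \<in> I \<Longrightarrow> y \<in> I \<Longrightarrow> x + y \<in> I" by (rule latD(1)[OF lt])

lemma I_mult: "z \<in> AC \<Longrightarrow> x \<in> I \<Longrightarrow> z * x \<in> I" by (rule latD(2)[OF lt])

lemma I_uminus: "x \<in> I \<Longrightarrow> - x \<in> I" using I_mult[OF AC_jC[of "- 1"], of x] by simp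

lemma I_diff: "x \<in> I \<Longrightarrow> y \<in> I \<Longrightarrow> x - y \<in> I" using I_add[OF _ I_uminus, of x y] by simp

lemma I_sum: "(\<And>i. i \<in> S \<Longrightarrow> h i \<in> I) \<Longrightarrow> sum h S \<in> I"
  by (induction S rule: infinite_finite_induct) (simp_all add: I_0 I_add)

lemma tauI_I: "x \<in> I \<Longrightarrow> tauI x \<in> I" unfolding tauI_def by (rule latD(7)[OF lt])

lemma tauI_pow_I: "x \<in> I \<Longrightarrow> (tauI ^^ i) x \<in> I" by (induction i) (simp_all add: tauI_I)

lemma tauI_add: "tauI (x + y) = tauI x + tauI y" by (simp add: tauI_def sig_simps distrib_left)

lemma tauI_0: "tauI 0 = 0" by (simp add: tauI_def sig_simps)

lemma tauI_sum: "tauI (sum h S) = (\<Sum>i\<in>S. tauI (h i))"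
  by (induction S rule: infinite_finite_induct) (simp_all add: tauI_0 tauI_add)

lemma tauI_mult: "tauI (z * x) = sig z * tauI x" by (simp add: tauI_def sig_simps mult_ac)

lemma tauI_pow_add: "(tauI ^^ i) (x + y) = (tauI ^^ i) x + (tauI ^^ i) y" by (induction i) (simp_all add: tauI_add)

lemma tauI_pow_sum: "(tauI ^^ i) (sum h S) = (\<Sum>k\<in>S. (tauI ^^ i) (h k))"
  by (induction i) (simp_all add: tauI_sum)

lemma tauI_pow_jK: "a \<in> A \<Longrightarrow> (tauI ^^ i) (jK a * x) = jK a * (tauI ^^ i) x"
  by (induction i) (simp_all add: tauI_mult sig_jK)

lemma twist_simps:
  "frob_twist q i (frob_twist q k g) = frob_twist q (i + k) (g :: 'c poly)" "frob_twist q 0 g = g"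
  using frob(2) frob_twist_simps(5,6)[OF frob(1)] by blast+

lemma sig_pT: "sig (pT p) = pT (frob_twist q 1 p)"
proof (induction p)
  case 0
  show ?case by (simp add: frob_twist_def pT_simps(6) sig_simps)
next
  case (pCons c p)
  have e: "pT (pCons c p) = jC c + jK TK * pT p" for c p
    by (simp add: pT_def map_poly_pCons field_hom_simps(1)[OF hom_jC])
  have "frob_twist q 1 (pCons c p) = pCons (c ^ q) (frob_twist q 1 p)"
    unfolding frob_twist_def by (simp add: map_poly_pCons)
  then show ?case by (simp only: e sig_simps(3,6) sig_jC sig_jK[OF A_TK] pCons.IH)
qed

lemma tauI_pow_pT: "(tauI ^^ i) (pT p * x) = pT (frob_twist q i p) * (tauI ^^ i) x"
proof (induction i)
  case (Suc i)
  then show ?case by (simp add: tauI_mult sig_pT twist_simps(1))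
qed (simp add: twist_simps(2))

lemma skm_bound: "degree F \<le> n \<Longrightarrow> skm F x = (\<Sum>i\<le>n. pT (coeff F i) * (tauI ^^ i) x)"
  unfolding skm_def by (intro sum.mono_neutral_left) (auto simp: coeff_eq_0 pT_simps(6))

lemma skm_add_left: "skm (F + G) x = skm F x + skm G x"
  using skm_bound[of "F + G" "max (degree F) (degree G)" x] skm_bound[of F "max (degree F) (degree G)" x]
    skm_bound[of G "max (degree F) (degree G)" x] degree_add_le_max[of F G]
  by (simp add: pT_simps(1) distrib_right sum.distrib)

lemma skm_monom: "skm (monom p i) x = pT p * (tauI ^^ i) x"
proof -
  have "skm (monom p i) x = (\<Sum>k\<le>i. if k = i then pT p * (tauI ^^ i) x else 0)"
    unfolding skm_bound[OF degree_monom_le] by (intro sum.cong refl) (auto simp: pT_simps(6))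
  then show ?thesis by simp
qed

lemma skm_const: "skm [:p:] x = pT p * x" using skm_monom[of p 0 x] by (simp add: monom_0)

lemma skm_tau: "skm tau x = tauI x"
proof -
  have t: "(tau :: 'c poly poly) = monom 1 1" by (simp add: tau_def monom_Suc monom_0 one_pCons)
  have "pT 1 = 1" using pT_simps(4)[of 1] by (simp add: one_pCons)
  then show ?thesis unfolding t skm_monom by simp
qed

lemma skm_sum: "skm (sum G S) x = (\<Sum>s\<in>S. skm (G s) x)"
proof -
  have "skm 0 x = 0" by (simp add: skm_def pT_simps(6))
  then show ?thesis by (induction S rule: infinite_finite_induct) (simp_all add: skm_add_left)
qed

lemma skm_add_right: "skm F (x + y) = skm F x + skm F y"
  by (simp add: skm_def tauI_pow_add distrib_left sum.distrib)

lemma skm_jK: "a \<in> A \<Longrightarrow> skm F (jK a * x) = jK a * skm F x"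
  by (simp only: skm_def tauI_pow_jK sum_distrib_left mult.left_commute)

lemma skm_mult: "skm (skew_mult q F G) x = skm F (skm G x)"
proof -
  have "skm (skew_mult q F G) x
      = (\<Sum>i\<le>degree F. \<Sum>j\<le>degree G. pT (coeff F i * frob_twist q i (coeff G j)) * (tauI ^^ (i + j)) x)"
    unfolding skew_mult_def by (simp only: skm_sum skm_monom)
  also have "\<dots> = (\<Sum>i\<le>degree F. pT (coeff F i) * (\<Sum>j\<le>degree G. pT (frob_twist q i (coeff G j)) * (tauI ^^ i) ((tauI ^^ j) x)))"
    by (simp only: pT_simps(2) sum_distrib_left mult.assoc funpow_add comp_apply)
  also have "\<dots> = skm F (skm G x)"
    unfolding skm_def by (simp only: tauI_pow_sum tauI_pow_pT)
  finally show ?thesis .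
qed

lemma skm_I: "x \<in> I \<Longrightarrow> skm F x \<in> I"
  unfolding skm_def by (intro I_sum I_mult pT_AC tauI_pow_I)

lemma MM_group: "abelian_group MM"
proof (rule abelian_groupI)
  fix x assume "x \<in> carrier MM"
  then show "\<exists>y\<in>carrier MM. y \<oplus>\<^bsub>MM\<^esub> x = \<zero>\<^bsub>MM\<^esub>" using I_uminus by (intro bexI[of _ "- x"]) simp_all
qed (simp_all add: I_0 I_add add_ac)

lemma MM_left_module: "left_module (skew_ring q) MM"
proof (rule left_module.intro)
  show "ring (skew_ring q :: 'c poly poly ring)" using frob(2) ring_skew_ring[OF frob(1)] by blast
  have "pT 1 = 1" using pT_simps(4)[of 1] by (simp add: one_pCons)
  then have "skm 1 x = x" for x using skm_const[of 1 x] by (simp add: one_pCons[symmetric])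
  then show "left_module_axioms (skew_ring q) MM"
    by unfold_locales (simp_all add: skew_ring_def skm_I skm_add_left skm_add_right skm_mult)
qed (rule MM_group)

lemma MM_finsum: "finite B \<Longrightarrow> (\<And>b. b \<in> B \<Longrightarrow> h b \<in> I) \<Longrightarrow> finsum MM h B = sum h B"
proof (induction B rule: finite_induct)
  case empty
  show ?case using abelian_monoid.finsum_empty[OF abelian_group.axioms(1)[OF MM_group]] by simp
next
  case (insert b B)
  then show ?case using abelian_monoid.finsum_insert[OF abelian_group.axioms(1)[OF MM_group], of B b h] by auto
qed

text \<open>Treats C[T] and C[\<tau>] together: \<open>enc\<close> places an ordinary polynomial in
  the skew ring, and \<open>u\<close> describes how it acts on basis vectors. Uniqueness reduces to
  independence by taking differences.\<close>

lemma MM_free: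
  assumes B: "finite B" "B \<subseteq> I" and enc: "inj enc" "S = range enc"
    and u: "\<And>p b. b \<in> B \<Longrightarrow> skm (enc p) b = u p b" "\<And>p p' b. u (p - p') b = u p b - u p' b"
    and span: "\<And>x. x \<in> I \<Longrightarrow> \<exists>c. x = (\<Sum>b\<in>B. u (c b) b)"
    and indep: "\<And>c. (\<Sum>b\<in>B. u (c b) b) = 0 \<Longrightarrow> \<forall>b\<in>B. c b = (0 :: 'c poly)"
  shows "free_of_rank S MM (card B)"
  unfolding free_of_rank_def
proof (intro exI[of _ B] conjI ballI)
  fix x assume "x \<in> carrier MM"
  then have x: "x \<in> I" by simp
  have fs: "finsum MM (\<lambda>b. h b \<odot>\<^bsub>MM\<^esub> b) B = (\<Sum>b\<in>B. skm (h b) b)" for h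
    using MM_finsum[OF B(1), of "\<lambda>b. skm (h b) b"] skm_I B(2) by auto
  obtain c where c: "x = (\<Sum>b\<in>B. u (c b) b)" using span[OF x] by blast
  show "\<exists>!c. c \<in> B \<rightarrow>\<^sub>E S \<and> x = (\<Oplus>\<^bsub>MM\<^esub>b\<in>B. c b \<odot>\<^bsub>MM\<^esub> b)"
  proof (rule ex1I)
    have "(\<Sum>b\<in>B. skm (restrict (\<lambda>b. enc (c b)) B b) b) = (\<Sum>b\<in>B. u (c b) b)"
      by (intro sum.cong refl) (simp add: u(1))
    then show "restrict (\<lambda>b. enc (c b)) B \<in> B \<rightarrow>\<^sub>E S \<and> x = (\<Oplus>\<^bsub>MM\<^esub>b\<in>B. restrict (\<lambda>b. enc (c b)) B b \<odot>\<^bsub>MM\<^esub> b)"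
      unfolding fs using c enc(2) by auto
  next
    fix h assume h: "h \<in> B \<rightarrow>\<^sub>E S \<and> x = (\<Oplus>\<^bsub>MM\<^esub>b\<in>B. h b \<odot>\<^bsub>MM\<^esub> b)"
    have "\<exists>p. h b = enc p" if "b \<in> B" for b using h that enc(2) by (blast dest: PiE_mem)
    then obtain d where d: "\<And>b. b \<in> B \<Longrightarrow> h b = enc (d b)" by metis
    have "x = (\<Sum>b\<in>B. u (d b) b)" using h unfolding fs by (simp add: d u(1))
    then have "(\<Sum>b\<in>B. u (d b - c b) b) = 0" using c by (simp only: u(2) sum_subtractf diff_self)
    then have "\<forall>b\<in>B. d b - c b = 0" by (rule indep)
    then have "\<And>b. b \<in> B \<Longrightarrow> d b = c b" by simp
    then show "h = restrict (\<lambda>b. enc (c b)) B"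
      using h d by (intro PiE_ext[of h B "\<lambda>_. S"]) (auto simp: enc(2))
  qed
qed (use B in auto)

lemma I_subspace: "VL.subspace I"
  by (rule VL.subspaceI) (auto intro: I_0 I_add I_mult AC_jC)

text \<open>A common denominator moves \<open>I\<close> into A tensor C, where degrees are
  nonnegative.\<close>

lemma I_bounded: "\<exists>m. \<forall>x\<in>I. x \<noteq> 0 \<longrightarrow> m \<le> DL x"
proof -
  obtain w where w: "w \<in> AC" "w \<noteq> 0" "\<forall>x\<in>I. w * x \<in> AC" using latD(4)[OF lt] by blast
  show ?thesis
  proof (intro exI[of _ "- DL w"] ballI impI)
    fix x assume x: "x \<in> I" "x \<noteq> 0"
    have "DL (w * x) = DA (w * x)" by (rule DL_AC) (use w x in auto)
    then show "- DL w \<le> DL x" using DL_mult[OF w(2) x(2)] DA_nonneg[of "w * x"] by linarith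
  qed
qed

lemma DL_jK: "a \<in> A \<Longrightarrow> a \<noteq> 0 \<Longrightarrow> DL (jK a) = D a"
  using DL_AC[OF AC_jK, of a] DA_jK[of a] by simp

lemma MM_free_T: "free_of_rank C_T MM r"
proof -
  obtain m where m: "\<And>x. x \<in> I \<Longrightarrow> x \<noteq> 0 \<Longrightarrow> m \<le> DL x" using I_bounded by blast
  have t: "jK TK * x \<noteq> 0 \<and> DL (jK TK * x) = DL x + int r" if "x \<in> I" "x \<noteq> 0" for x
    using DL_mult[of "jK TK" x] DL_jK[OF A_TK T0] that(2) T0 D_TK by simp
  obtain B where B: "finite B" "B \<subseteq> I" "card B = card ((\<lambda>x. DL x mod int r) ` (I - {0}))"
    "\<And>x. x \<in> I \<Longrightarrow> \<exists>c. x = (\<Sum>b\<in>B. LG.ev (c b) (\<lambda>k. ((*) (jK TK) ^^ k) b))"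
    "\<And>c. (\<Sum>b\<in>B. LG.ev (c b) (\<lambda>k. ((*) (jK TK) ^^ k) b)) = 0 \<Longrightarrow> \<forall>b\<in>B. c b = 0"
    by (rule LG.graded_operator_basis[OF I_subspace, of "(*) (jK TK)" "int r" m])
      (use t m r_pos I_mult[OF AC_jK[OF A_TK]] in auto)
  have pw: "((*) (jK TK) ^^ k) b = jK (TK ^ k) * b" for k and b :: 'l by (induction k) (simp_all add: mult_ac)
  have ev: "LG.ev p (\<lambda>k. ((*) (jK TK) ^^ k) b) = pT p * b" for p b
    unfolding LG.ev_def pT_altdef pw sum_distrib_right by (simp only: mult.assoc)
  \<comment> \<open>\<open>I\<close> contains A, whose degrees include all large integers, so every
    class modulo \<open>r\<close> occurs and the rank is exactly \<open>r\<close>.\<close>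
  have "(\<lambda>x. DL x mod int r) ` (I - {0}) = {0..<int r}"
  proof (intro equalityI subsetI)
    fix i assume i: "i \<in> {0..<int r}"
    obtain n0 where n0: "\<forall>n\<ge>n0. \<exists>a\<in>A. a \<noteq> 0 \<and> D a = int n" using cofinite by blast
    have "n0 * 1 \<le> n0 * r" using r_pos by (intro mult_le_mono2) simp
    then have "n0 \<le> n0 * r + nat i" by linarith
    then obtain a where a: "a \<in> A" "a \<noteq> 0" "D a = int (n0 * r + nat i)" using n0 by blast
    have "DL (jK a) = i + int n0 * int r" using DL_jK[OF a(1,2)] a(3) i by simp
    then have "DL (jK a) mod int r = i" using i by simp
    moreover have "jK a \<in> I - {0}" using latD(3)[OF lt AC_jK[OF a(1)]] a(2) by simp
    ultimately show "i \<in> (\<lambda>x. DL x mod int r) ` (I - {0})" by (metis (no_types, lifting) imageI)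
  qed (use r_pos in auto)
  then have cB: "card B = r" using B(3) by simp
  have "free_of_rank C_T MM (card B)"
  proof (rule MM_free[OF B(1,2), where enc = "\<lambda>p. [:p:]" and u = "\<lambda>p b. pT p * b"])
    show "pT (p - p') * b = pT p * b - pT p' * b" for p p' b
      using pT_simps(1)[of "p - p'" p'] by (simp add: algebra_simps)
  qed (use B(4,5) in \<open>simp_all add: ev inj_def C_T_def skm_const\<close>)
  then show ?thesis unfolding cB .
qed

definition tau_base :: "'l set \<Rightarrow> bool" where
  "tau_base B \<longleftrightarrow> finite B \<and> B \<subseteq> I \<and> card B \<le> card \<Phi> \<and>
    (\<forall>x\<in>I. \<exists>c. x = (\<Sum>b\<in>B. LG.ev (c b) (\<lambda>k. (tauI ^^ k) b))) \<and>
    (\<forall>c. (\<Sum>b\<in>B. LG.ev (c b) (\<lambda>k. (tauI ^^ k) b)) = 0 \<longrightarrow> (\<forall>b\<in>B. c b = 0))"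

lemma tau_baseD:
  assumes "tau_base B"
  shows "finite B" "B \<subseteq> I" "card B \<le> card \<Phi>"
    "x \<in> I \<Longrightarrow> \<exists>c. x = (\<Sum>b\<in>B. LG.ev (c b) (\<lambda>k. (tauI ^^ k) b))"
    "(\<Sum>b\<in>B. LG.ev (c b) (\<lambda>k. (tauI ^^ k) b)) = 0 \<Longrightarrow> \<forall>b\<in>B. c b = 0"
proof -
  note b = assms[unfolded tau_base_def]
  show "finite B" "B \<subseteq> I" "card B \<le> card \<Phi>" using b by simp_all
  note b' = b[THEN conjunct2, THEN conjunct2, THEN conjunct2]
  show "x \<in> I \<Longrightarrow> \<exists>c. x = (\<Sum>b\<in>B. LG.ev (c b) (\<lambda>k. (tauI ^^ k) b))" by (rule bspec[OF conjunct1[OF b']])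
  show "(\<Sum>b\<in>B. LG.ev (c b) (\<lambda>k. (tauI ^^ k) b)) = 0 \<Longrightarrow> \<forall>b\<in>B. c b = 0" by (rule mp[OF spec[OF conjunct2[OF b']]])
qed

text \<open>The Frobenius preserves degrees and the degree of \<open>f\<close> is the size of
  \<open>\<Phi>\<close>, so \<tau> raises degrees by that number and there is at most one basis
  vector per class. Nonemptiness of \<open>\<Phi>\<close> makes the increase positive.\<close>

lemma tau_basis: "\<exists>B. tau_base B"
proof -
  obtain m where m: "\<And>x. x \<in> I \<Longrightarrow> x \<noteq> 0 \<Longrightarrow> m \<le> DL x" using I_bounded by blast
  have c0: "card \<Phi> > 0" using fin ne by (simp add: card_gt_0_iff)
  have t: "tauI x \<noteq> 0 \<and> DL (tauI x) = DL x + int (card \<Phi>)" if "x \<in> I" "x \<noteq> 0" for x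
    using DL_mult[of f "sig x"] DL_sig[of x] latD(5,6)[OF lt] that(2) by (simp add: tauI_def sig_simps)
  obtain B where B: "finite B" "B \<subseteq> I" "card B = card ((\<lambda>x. DL x mod int (card \<Phi>)) ` (I - {0}))"
    "\<And>x. x \<in> I \<Longrightarrow> \<exists>c. x = (\<Sum>b\<in>B. LG.ev (c b) (\<lambda>k. (tauI ^^ k) b))"
    "\<And>c. (\<Sum>b\<in>B. LG.ev (c b) (\<lambda>k. (tauI ^^ k) b)) = 0 \<Longrightarrow> \<forall>b\<in>B. c b = 0"
    by (rule LG.graded_operator_basis[OF I_subspace, of tauI "int (card \<Phi>)" m])
      (use t m c0 tauI_I in auto)
  have "card B \<le> card {0..<int (card \<Phi>)}" unfolding B(3) by (rule card_mono) (use c0 in auto)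
  then have "card B \<le> card \<Phi>" by simp
  moreover have x4: "\<forall>x\<in>I. \<exists>c. x = (\<Sum>b\<in>B. LG.ev (c b) (\<lambda>k. (tauI ^^ k) b))" by (rule ballI) (rule B(4))
  moreover have x5: "\<forall>c. (\<Sum>b\<in>B. LG.ev (c b) (\<lambda>k. (tauI ^^ k) b)) = 0 \<longrightarrow> (\<forall>b\<in>B. c b = 0)"
    by (intro allI impI) (rule B(5))
  ultimately show ?thesis using B(1,2) unfolding tau_base_def by (intro exI[of _ B] conjI)
qed

lemma MM_free_tau: "\<exists>n. free_of_rank C_tau MM n"
proof -
  obtain B where "tau_base B" using tau_basis ..
  note B = tau_baseD[OF this]
  have cf: "coeff (map_poly (\<lambda>c. [:c:]) p) k = [:coeff p k:]" for p :: "'c poly" and k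
    by (simp add: coeff_map_poly)
  have dg: "degree (map_poly (\<lambda>c. [:c:]) p) \<le> degree p" for p :: "'c poly"
    by (rule degree_le) (simp add: cf coeff_eq_0)
  have "free_of_rank C_tau MM (card B)"
  proof (rule MM_free[OF B(1,2), where enc = "map_poly (\<lambda>c. [:c:])" and u = "\<lambda>p b. LG.ev p (\<lambda>k. (tauI ^^ k) b)"])
    show "inj (map_poly (\<lambda>c::'c. [:c:]))"
    proof (rule injI)
      fix p p' :: "'c poly" assume e: "map_poly (\<lambda>c. [:c:]) p = map_poly (\<lambda>c. [:c:]) p'"
      have "[:coeff p k:] = [:coeff p' k:]" for k using cf[of p k] cf[of p' k] e by metis
      then show "p = p'" by (intro poly_eqI) simp
    qed
    show "skm (map_poly (\<lambda>c. [:c:]) p) b = LG.ev p (\<lambda>k. (tauI ^^ k) b)" for p b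
      unfolding skm_bound[OF dg] LG.ev_def cf pT_simps(4) ..
  qed (use B(4,5) in \<open>simp_all add: C_tau_def LG.ev_diff\<close>)
  then show ?thesis by blast
qed

section \<open>The fibres of the ideal at the points of the CM-type\<close>

lemma embD': "\<alpha> \<in> \<Phi> \<Longrightarrow> field_hom \<alpha>" "\<alpha> \<in> \<Phi> \<Longrightarrow> \<alpha> (iK c) = iC c" "\<alpha> \<in> \<Phi> \<Longrightarrow> \<alpha> TK = \<theta>"
  using em[of \<alpha>] by (auto simp: embp_def)

definition gen :: "('k \<Rightarrow> 'c) \<Rightarrow> 'l" where
  "gen \<alpha> = (SOME g. g \<in> I \<and> g \<noteq> 0 \<and> (\<forall>x\<in>I. x / g \<in> loc \<alpha> \<and> rho \<alpha> (f * sig x / g) = 0))"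

text \<open>The value of a section in the fibre of \<open>I\<close> at \<open>\<alpha>\<close>, with
  the fibre identified with C by the local generator.\<close>

definition ell :: "('k \<Rightarrow> 'c) \<Rightarrow> 'l \<Rightarrow> 'c" where "ell \<alpha> x = rho \<alpha> (x / gen \<alpha>)"

lemma gen:
  assumes "\<alpha> \<in> \<Phi>"
  shows "gen \<alpha> \<in> I" "gen \<alpha> \<noteq> 0" "x \<in> I \<Longrightarrow> x / gen \<alpha> \<in> loc \<alpha>" "x \<in> I \<Longrightarrow> ell \<alpha> (tauI x) = 0"
proof -
  have "\<exists>g. g \<in> I \<and> g \<noteq> 0 \<and> (\<forall>x\<in>I. x / g \<in> loc \<alpha> \<and> rho \<alpha> (f * sig x / g) = 0)"
    using latD(8)[OF lt assms] by blast
  from someI_ex[OF this, folded gen_def]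
  show "gen \<alpha> \<in> I" "gen \<alpha> \<noteq> 0" "x \<in> I \<Longrightarrow> x / gen \<alpha> \<in> loc \<alpha>" "x \<in> I \<Longrightarrow> ell \<alpha> (tauI x) = 0"
    by (auto simp: ell_def tauI_def)
qed

context
  fixes \<alpha> assumes \<alpha>\<Phi>: "\<alpha> \<in> \<Phi>"
begin

lemmas emb\<alpha> = embD'(1)[OF \<alpha>\<Phi>] embD'(2)[OF \<alpha>\<Phi>] embD'(3)[OF \<alpha>\<Phi>]

lemma ell_add: "x \<in> I \<Longrightarrow> y \<in> I \<Longrightarrow> ell \<alpha> (x + y) = ell \<alpha> x + ell \<alpha> y"
  using loc_add(2)[OF emb\<alpha> gen(3)[OF \<alpha>\<Phi>] gen(3)[OF \<alpha>\<Phi>], of x y] by (simp add: ell_def add_divide_distrib)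

lemma ell_mult: "z \<in> AC \<Longrightarrow> x \<in> I \<Longrightarrow> ell \<alpha> (z * x) = chi \<alpha> z * ell \<alpha> x"
  using loc_mult(2)[OF emb\<alpha> loc_AC(1)[OF emb\<alpha>] gen(3)[OF \<alpha>\<Phi>], of z x] loc_AC(2)[OF emb\<alpha>, of z]
  by (simp add: ell_def)

lemma ell_scale: "x \<in> I \<Longrightarrow> ell \<alpha> (jC c * x) = c * ell \<alpha> x"
  using ell_mult[OF AC_jC, of x c] chi_jC[OF emb\<alpha>(1,2)] by simp

lemma ell_0: "ell \<alpha> 0 = 0"
  using ell_scale[OF I_0, of 0] by simp

lemma ell_sum: "(\<And>i. i \<in> S \<Longrightarrow> h i \<in> I) \<Longrightarrow> ell \<alpha> (sum h S) = (\<Sum>i\<in>S. ell \<alpha> (h i))"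
  by (induction S rule: infinite_finite_induct) (simp_all add: ell_0 ell_add I_sum)

lemma ell_gen: "ell \<alpha> (gen \<alpha>) = 1"
  using gen(2)[OF \<alpha>\<Phi>] loc_AC(2)[OF emb\<alpha> AC_closed(1)] chi_1[OF emb\<alpha>(1,2)] by (simp add: ell_def)

end

lemma separate:
  assumes "\<alpha> \<in> \<Phi>" "\<beta> \<in> \<Phi>" "\<alpha> \<noteq> \<beta>"
  shows "\<exists>a\<in>A. \<alpha> a \<noteq> \<beta> a"
proof (rule ccontr)
  assume n: "\<not> (\<exists>a\<in>A. \<alpha> a \<noteq> \<beta> a)"
  have "\<alpha> x = \<beta> x" for x
  proof -
    obtain d where d: "d \<in> A" "d \<noteq> 0" "d * x \<in> A" using A_frac by blast
    have "\<alpha> (d * x) = \<beta> (d * x)" "\<alpha> d = \<beta> d" using n d by blast+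
    then have "\<alpha> d * \<alpha> x = \<alpha> d * \<beta> x"
      using field_hom_simps(6)[OF embD'(1)[OF assms(1)], of d x] field_hom_simps(6)[OF embD'(1)[OF assms(2)], of d x] by simp
    then show ?thesis using field_hom_simps(9)[OF embD'(1)[OF assms(1)], of d] d(2) by simp
  qed
  then show False using assms(3) by blast
qed

text \<open>For each \<beta> different from \<alpha> some element a of A takes different values
  under the two; the function a - \<beta>(a) then vanishes at \<beta> and not at \<alpha>. The
  product of these functions times the generator at \<alpha>, suitably scaled, is dual to
  \<alpha>.\<close>

lemma ell_dual:
  assumes \<alpha>: "\<alpha> \<in> \<Phi>"
  shows "\<exists>x\<in>I. \<forall>\<beta>\<in>\<Phi>. ell \<beta> x = (if \<beta> = \<alpha> then 1 else 0)"
proof -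
  have "\<forall>\<beta>\<in>\<Phi> - {\<alpha>}. \<exists>a. a \<in> A \<and> \<alpha> a \<noteq> \<beta> a" using separate[OF \<alpha>] by blast
  then obtain a where a: "\<And>\<beta>. \<beta> \<in> \<Phi> - {\<alpha>} \<Longrightarrow> a \<beta> \<in> A \<and> \<alpha> (a \<beta>) \<noteq> \<beta> (a \<beta>)" by metis
  define z where "z = (\<Prod>\<beta>\<in>\<Phi> - {\<alpha>}. jK (a \<beta>) - jC (\<beta> (a \<beta>)))"
  have m: "jK (a \<beta>) - jC (\<beta> (a \<beta>)) \<in> AC" if "\<beta> \<in> \<Phi> - {\<alpha>}" for \<beta>
    using a[OF that] by (intro AC_closed(3) AC_jK AC_jC) simp
  have zA: "z \<in> AC" unfolding z_def by (rule AC_closed(9)) (rule m)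
  have cz: "chi \<gamma> z = (\<Prod>\<beta>\<in>\<Phi> - {\<alpha>}. \<gamma> (a \<beta>) - \<beta> (a \<beta>))" if g: "\<gamma> \<in> \<Phi>" for \<gamma>
  proof -
    note e = embD'(1)[OF g] embD'(2)[OF g]
    have "chi \<gamma> z = (\<Prod>\<beta>\<in>\<Phi> - {\<alpha>}. chi \<gamma> (jK (a \<beta>) - jC (\<beta> (a \<beta>))))"
      unfolding z_def by (rule chi_prod[OF e m])
    also have "\<dots> = (\<Prod>\<beta>\<in>\<Phi> - {\<alpha>}. \<gamma> (a \<beta>) - \<beta> (a \<beta>))"
      by (intro prod.cong refl) (use a in \<open>simp add: chi_diff[OF e AC_jK AC_jC] chi_jK[OF e] chi_jC[OF e]\<close>)
    finally show ?thesis .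
  qed
  have z1: "chi \<alpha> z \<noteq> 0" unfolding cz[OF \<alpha>] using a fin by (simp add: prod_zero_iff)
  have z0: "chi \<gamma> z = 0" if "\<gamma> \<in> \<Phi>" "\<gamma> \<noteq> \<alpha>" for \<gamma>
    unfolding cz[OF that(1)] using that fin by (intro prod_zero) auto
  define x where "x = jC (inverse (chi \<alpha> z)) * (z * gen \<alpha>)"
  have zg: "z * gen \<alpha> \<in> I" by (intro I_mult zA gen(1) \<alpha>)
  have "ell \<beta> x = (if \<beta> = \<alpha> then 1 else 0)" if b: "\<beta> \<in> \<Phi>" for \<beta>
    unfolding x_def ell_scale[OF b zg] ell_mult[OF b zA gen(1)[OF \<alpha>]] using z0[OF b] z1 ell_gen[OF \<alpha>] by simp
  moreover have "x \<in> I" unfolding x_def by (intro I_mult AC_jC zg)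
  ultimately show ?thesis by blast
qed

lemma ell_surj: "\<exists>x\<in>I. \<forall>\<beta>\<in>\<Phi>. ell \<beta> x = y \<beta>"
proof -
  have "\<forall>\<alpha>\<in>\<Phi>. \<exists>x. x \<in> I \<and> (\<forall>\<beta>\<in>\<Phi>. ell \<beta> x = (if \<beta> = \<alpha> then 1 else 0))"
  proof
    fix \<alpha> assume "\<alpha> \<in> \<Phi>"
    from ell_dual[OF this] show "\<exists>x. x \<in> I \<and> (\<forall>\<beta>\<in>\<Phi>. ell \<beta> x = (if \<beta> = \<alpha> then 1 else 0))" by blast
  qed
  from bchoice[OF this] obtain E where
    E': "\<forall>\<alpha>\<in>\<Phi>. E \<alpha> \<in> I \<and> (\<forall>\<beta>\<in>\<Phi>. ell \<beta> (E \<alpha>) = (if \<beta> = \<alpha> then 1 else 0))" ..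
  then have E: "E \<alpha> \<in> I \<and> (\<forall>\<beta>\<in>\<Phi>. ell \<beta> (E \<alpha>) = (if \<beta> = \<alpha> then 1 else 0))" if "\<alpha> \<in> \<Phi>" for \<alpha>
    using that by blast
  define x where "x = (\<Sum>\<alpha>\<in>\<Phi>. jC (y \<alpha>) * E \<alpha>)"
  have m: "jC (y \<alpha>) * E \<alpha> \<in> I" if "\<alpha> \<in> \<Phi>" for \<alpha> using E[OF that] by (intro I_mult AC_jC) simp
  have "ell \<beta> x = y \<beta>" if b: "\<beta> \<in> \<Phi>" for \<beta>
  proof -
    have "ell \<beta> x = (\<Sum>\<alpha>\<in>\<Phi>. ell \<beta> (jC (y \<alpha>) * E \<alpha>))" unfolding x_def by (rule ell_sum[OF b m])
    also have "\<dots> = (\<Sum>\<alpha>\<in>\<Phi>. if \<alpha> = \<beta> then y \<alpha> else 0)"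
      by (intro sum.cong refl) (use E b ell_scale[OF b] in auto)
    finally show ?thesis using fin b by simp
  qed
  moreover have "x \<in> I" unfolding x_def by (rule I_sum[OF m])
  ultimately show ?thesis by blast
qed

text \<open>A scalar passes through \<tau> after a q-th root is taken, so perfectness of C makes the
  image of \<tau> a C-subspace.\<close>

lemma jC_tauI: "\<exists>d. \<forall>x. jC c * tauI x = tauI (jC d * x)"
proof -
  obtain d where "d ^ q = c" using perfect by blast
  then show ?thesis using tauI_mult[of "jC d"] sig_jC[of d] by (intro exI[of _ d]) simp
qed

lemma tau_decomposition:
  assumes b: "b \<in> I"
  shows "\<exists>x'\<in>I. LG.ev p (\<lambda>k. (tauI ^^ k) b) = jC (coeff p 0) * b + tauI x'"
proof -
  have "\<forall>c. \<exists>d. \<forall>x. jC c * tauI x = tauI (jC d * x)" by (rule allI) (rule jC_tauI)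
  from choice[OF this] obtain d where d': "\<forall>c x. jC c * tauI x = tauI (jC (d c) * x)" ..
  then have d: "jC c * tauI x = tauI (jC (d c) * x)" for c x by blast
  define x' where "x' = (\<Sum>k<degree p. jC (d (coeff p (Suc k))) * (tauI ^^ k) b)"
  have "LG.ev p (\<lambda>k. (tauI ^^ k) b) = jC (coeff p 0) * b + (\<Sum>k<degree p. jC (coeff p (Suc k)) * tauI ((tauI ^^ k) b))"
    unfolding LG.ev_def sum.atMost_shift by simp
  also have "(\<Sum>k<degree p. jC (coeff p (Suc k)) * tauI ((tauI ^^ k) b)) = tauI x'"
    unfolding x'_def tauI_sum d ..
  finally have e: "LG.ev p (\<lambda>k. (tauI ^^ k) b) = jC (coeff p 0) * b + tauI x'" .
  have "x' \<in> I" unfolding x'_def by (intro I_sum I_mult AC_jC tauI_pow_I b)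
  then show ?thesis using e by blast
qed

text \<open>Since the images of a \<open>\<tau>\<close>-basis of at most \<open>card \<Phi>\<close> elements span \<open>C\<^sup>\<Phi>\<close>, they are
  linearly independent; so the common kernel of the functionals is not larger than \<open>\<tau>I\<close>.\<close>

lemma ell_kernel:
  assumes x: "x \<in> I" "\<And>\<alpha>. \<alpha> \<in> \<Phi> \<Longrightarrow> ell \<alpha> x = 0"
  shows "\<exists>x'\<in>I. x = tauI x'"
proof -
  obtain B where "tau_base B" using tau_basis ..
  note B = tau_baseD[OF this]
  have bI: "b \<in> I" if "b \<in> B" for b using that B(2) by blast
  have dec: "\<exists>c. \<exists>x'\<in>I. x = (\<Sum>b\<in>B. jC (c b) * b) + tauI x'" if xI: "x \<in> I" for x
  proof -
    obtain p where p: "x = (\<Sum>b\<in>B. LG.ev (p b) (\<lambda>k. (tauI ^^ k) b))" using B(4)[OF xI] by blast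
    have "\<forall>b\<in>B. \<exists>s. s \<in> I \<and> LG.ev (p b) (\<lambda>k. (tauI ^^ k) b) = jC (coeff (p b) 0) * b + tauI s"
    proof
      fix b assume "b \<in> B"
      from tau_decomposition[OF bI[OF this], of "p b"]
      show "\<exists>s. s \<in> I \<and> LG.ev (p b) (\<lambda>k. (tauI ^^ k) b) = jC (coeff (p b) 0) * b + tauI s" by blast
    qed
    from bchoice[OF this] obtain s where
      s: "\<forall>b\<in>B. s b \<in> I \<and> LG.ev (p b) (\<lambda>k. (tauI ^^ k) b) = jC (coeff (p b) 0) * b + tauI (s b)" ..
    have "x = (\<Sum>b\<in>B. jC (coeff (p b) 0) * b) + tauI (\<Sum>b\<in>B. s b)"
      unfolding p tauI_sum sum.distrib[symmetric] by (intro sum.cong refl) (use s in blast)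
    moreover have "(\<Sum>b\<in>B. s b) \<in> I" by (rule I_sum) (use s in blast)
    ultimately show ?thesis by (intro exI[of _ "\<lambda>b. coeff (p b) 0"] bexI[of _ "\<Sum>b\<in>B. s b"])
  qed
  have lin: "ell \<alpha> ((\<Sum>b\<in>B. jC (c b) * b) + tauI x') = (\<Sum>b\<in>B. c b * ell \<alpha> b)" if "\<alpha> \<in> \<Phi>" "x' \<in> I" for \<alpha> c x'
  proof -
    have m: "jC (c b) * b \<in> I" if "b \<in> B" for b by (intro I_mult AC_jC bI that)
    have "ell \<alpha> ((\<Sum>b\<in>B. jC (c b) * b) + tauI x') = ell \<alpha> (\<Sum>b\<in>B. jC (c b) * b) + ell \<alpha> (tauI x')"
      by (intro ell_add that(1) I_sum m tauI_I that(2))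
    also have "\<dots> = (\<Sum>b\<in>B. ell \<alpha> (jC (c b) * b))" using ell_sum[OF that(1) m] gen(4)[OF that] by simp
    also have "\<dots> = (\<Sum>b\<in>B. c b * ell \<alpha> b)" by (intro sum.cong refl ell_scale that(1) bI)
    finally show ?thesis .
  qed
  obtain c x' where c: "x' \<in> I" "x = (\<Sum>b\<in>B. jC (c b) * b) + tauI x'" using dec[OF x(1)] by blast
  have c0: "(\<Sum>b\<in>B. c b * ell \<alpha> b) = 0" if "\<alpha> \<in> \<Phi>" for \<alpha> using x(2)[OF that] lin[OF that c(1)] c(2) by simp
  have "\<forall>b\<in>B. c b = 0"
  proof (rule ccontr)
    assume "\<not> (\<forall>b\<in>B. c b = 0)"
    then obtain b0 where b0: "b0 \<in> B" "c b0 \<noteq> 0" by blast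
    \<comment> \<open>Fewer equations than unknowns give a nontrivial combination of the functionals
      vanishing on all of \<open>B\<close> except possibly \<open>b0\<close>. The relation with
      nonzero coefficient at \<open>b0\<close> extends this to \<open>b0\<close>, hence to all of
      \<open>I\<close>, which contradicts the dual elements.\<close>
    have "card (B - {b0}) < card \<Phi>" using B(1,3) b0(1) card_Diff1_less[OF B(1) b0(1)] by linarith
    then obtain l where l: "\<exists>\<alpha>\<in>\<Phi>. l \<alpha> \<noteq> 0" "\<forall>b\<in>B - {b0}. (\<Sum>\<alpha>\<in>\<Phi>. l \<alpha> * ell \<alpha> b) = 0"
      using homogeneous_system_nontrivial[of "B - {b0}" \<Phi> ell] B(1) fin by auto
    have "(\<Sum>b\<in>B. c b * (\<Sum>\<alpha>\<in>\<Phi>. l \<alpha> * ell \<alpha> b)) = (\<Sum>\<alpha>\<in>\<Phi>. l \<alpha> * (\<Sum>b\<in>B. c b * ell \<alpha> b))"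
      unfolding sum_distrib_left by (subst sum.swap) (simp only: mult.left_commute)
    also have "\<dots> = 0" by (intro sum.neutral ballI) (simp add: c0)
    finally have "(\<Sum>b\<in>B. c b * (\<Sum>\<alpha>\<in>\<Phi>. l \<alpha> * ell \<alpha> b)) = 0" .
    then have "c b0 * (\<Sum>\<alpha>\<in>\<Phi>. l \<alpha> * ell \<alpha> b0) = 0"
      using l(2) by (simp add: sum.remove[OF B(1) b0(1)])
    then have lB: "(\<Sum>\<alpha>\<in>\<Phi>. l \<alpha> * ell \<alpha> b) = 0" if "b \<in> B" for b using b0(2) l(2) that by (cases "b = b0") auto
    have lI: "(\<Sum>\<alpha>\<in>\<Phi>. l \<alpha> * ell \<alpha> y) = 0" if yI: "y \<in> I" for y
    proof -
      obtain c x' where cx: "x' \<in> I" "y = (\<Sum>b\<in>B. jC (c b) * b) + tauI x'" using dec[OF yI] by blast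
      have "(\<Sum>\<alpha>\<in>\<Phi>. l \<alpha> * ell \<alpha> y) = (\<Sum>\<alpha>\<in>\<Phi>. l \<alpha> * (\<Sum>b\<in>B. c b * ell \<alpha> b))"
        unfolding cx(2) by (intro sum.cong refl) (simp only: lin cx(1))
      also have "\<dots> = (\<Sum>b\<in>B. c b * (\<Sum>\<alpha>\<in>\<Phi>. l \<alpha> * ell \<alpha> b))"
        unfolding sum_distrib_left by (subst sum.swap) (simp only: mult.left_commute)
      finally show ?thesis by (simp add: lB)
    qed
    obtain \<alpha> where al: "\<alpha> \<in> \<Phi>" "l \<alpha> \<noteq> 0" using l(1) by blast
    obtain y where y: "y \<in> I" "\<forall>\<beta>\<in>\<Phi>. ell \<beta> y = (if \<beta> = \<alpha> then 1 else 0)" using ell_dual[OF al(1)] by blast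
    have "(\<Sum>\<beta>\<in>\<Phi>. l \<beta> * ell \<beta> y) = (\<Sum>\<beta>\<in>\<Phi>. if \<beta> = \<alpha> then l \<beta> else 0)" using y(2) by (intro sum.cong) auto
    then show False using lI[OF y(1)] al fin by simp
  qed
  then have "x = tauI x'" using c(2) by simp
  then show ?thesis using c(1) by blast
qed

section \<open>The quotient by \<tau> and the representation of K on it\<close>

text \<open>The cosets of the image of \<tau>, parametrised by their coordinates in the fibres;
  \<open>y\<close> matters only on \<open>\<Phi>\<close>.\<close>

definition lev :: "(('k \<Rightarrow> 'c) \<Rightarrow> 'c) \<Rightarrow> 'l set" where "lev y = {x \<in> I. \<forall>\<alpha>\<in>\<Phi>. ell \<alpha> x = y \<alpha>}"

lemma lev_cong: "(\<And>\<alpha>. \<alpha> \<in> \<Phi> \<Longrightarrow> y \<alpha> = y' \<alpha>) \<Longrightarrow> lev y = lev y'" by (simp add: lev_def)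

lemma lev_nonempty: obtains x where "x \<in> lev y" using ell_surj[of y] by (auto simp: lev_def)

lemma tau_image_MM: "tau_image MM = lev (\<lambda>_. 0)"
proof (intro equalityI subsetI)
  fix x assume "x \<in> tau_image MM"
  then show "x \<in> lev (\<lambda>_. 0)" using gen(4) tauI_I by (auto simp: tau_image_def skm_tau lev_def)
next
  fix x assume "x \<in> lev (\<lambda>_. 0)"
  then show "x \<in> tau_image MM" using ell_kernel[of x] by (auto simp: tau_image_def skm_tau lev_def)
qed

lemma coset_lev: assumes "x \<in> I" shows "tau_image MM +>\<^bsub>MM\<^esub> x = lev (\<lambda>\<alpha>. ell \<alpha> x)"
proof -
  have "tau_image MM +>\<^bsub>MM\<^esub> x = (\<lambda>h. h + x) ` lev (\<lambda>_. 0)" by (auto simp: a_r_coset_def' tau_image_MM)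
  also have "\<dots> = lev (\<lambda>\<alpha>. ell \<alpha> x)"
  proof (intro equalityI subsetI)
    fix z assume "z \<in> (\<lambda>h. h + x) ` lev (\<lambda>_. 0)"
    then show "z \<in> lev (\<lambda>\<alpha>. ell \<alpha> x)" using assms by (auto simp: lev_def I_add ell_add)
  next
    fix z assume z: "z \<in> lev (\<lambda>\<alpha>. ell \<alpha> x)"
    have d: "z - x \<in> I" using z assms I_diff by (simp add: lev_def)
    have "ell \<alpha> (z - x) = 0" if "\<alpha> \<in> \<Phi>" for \<alpha> using ell_add[OF that d assms] z that by (simp add: lev_def)
    then have "z - x \<in> lev (\<lambda>_. 0)" using d by (simp add: lev_def)
    then show "z \<in> (\<lambda>h. h + x) ` lev (\<lambda>_. 0)" by (rule rev_image_eqI) simp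
  qed
  finally show ?thesis .
qed

lemma coset_map_lev:
  assumes "\<And>x. x \<in> I \<Longrightarrow> h x \<in> I" "\<And>x \<alpha>. x \<in> I \<Longrightarrow> \<alpha> \<in> \<Phi> \<Longrightarrow> ell \<alpha> (h x) = z \<alpha> * ell \<alpha> x"
  shows "coset_map MM (tau_image MM) h (lev y) = lev (\<lambda>\<alpha>. z \<alpha> * y \<alpha>)"
proof -
  have "tau_image MM +>\<^bsub>MM\<^esub> h x = lev (\<lambda>\<alpha>. z \<alpha> * y \<alpha>)" if x: "x \<in> lev y" for x
  proof -
    have xI: "x \<in> I" using x by (simp add: lev_def)
    show ?thesis unfolding coset_lev[OF assms(1)[OF xI]]
      by (rule lev_cong) (use assms(2)[OF xI] x in \<open>simp add: lev_def\<close>)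
  qed
  moreover obtain x where "x \<in> lev y" by (rule lev_nonempty)
  ultimately show ?thesis unfolding coset_map_def by blast
qed

lemma mod_tau_carrier: "carrier (mod_tau MM) = range lev"
proof -
  have "carrier (mod_tau MM) = (\<lambda>x. lev (\<lambda>\<alpha>. ell \<alpha> x)) ` I"
    unfolding mod_tau_def quot_module_def by (auto simp: A_RCOSETS_def' coset_lev)
  also have "\<dots> = range lev"
  proof (intro equalityI subsetI)
    fix Q assume "Q \<in> range lev"
    then obtain y where y: "Q = lev y" by blast
    obtain x where x: "x \<in> I" "\<forall>\<alpha>\<in>\<Phi>. ell \<alpha> x = y \<alpha>" using ell_surj by blast
    have "Q = lev (\<lambda>\<alpha>. ell \<alpha> x)" unfolding y by (rule lev_cong) (use x(2) in simp)
    then show "Q \<in> (\<lambda>x. lev (\<lambda>\<alpha>. ell \<alpha> x)) ` I" using x(1) by blast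
  qed blast
  finally show ?thesis .
qed

lemma mod_tau_zero: "\<zero>\<^bsub>mod_tau MM\<^esub> = lev (\<lambda>_. 0)"
  by (simp add: mod_tau_def quot_module_def tau_image_MM)

lemma mod_tau_add: "lev y \<oplus>\<^bsub>mod_tau MM\<^esub> lev y' = lev (\<lambda>\<alpha>. y \<alpha> + y' \<alpha>)"
proof -
  have "lev y \<oplus>\<^bsub>mod_tau MM\<^esub> lev y' = (\<Union>h\<in>lev y. \<Union>k\<in>lev y'. {h + k})"
    by (simp add: mod_tau_def quot_module_def set_add_def')
  also have "\<dots> = lev (\<lambda>\<alpha>. y \<alpha> + y' \<alpha>)"
  proof (intro equalityI subsetI)
    fix z assume "z \<in> (\<Union>h\<in>lev y. \<Union>k\<in>lev y'. {h + k})"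
    then show "z \<in> lev (\<lambda>\<alpha>. y \<alpha> + y' \<alpha>)" by (auto simp: lev_def I_add ell_add)
  next
    fix z assume z: "z \<in> lev (\<lambda>\<alpha>. y \<alpha> + y' \<alpha>)"
    obtain h where h: "h \<in> lev y" by (rule lev_nonempty)
    have d: "z - h \<in> I" "h \<in> I" using z h I_diff by (simp_all add: lev_def)
    have "ell \<alpha> (z - h) = y' \<alpha>" if "\<alpha> \<in> \<Phi>" for \<alpha> using ell_add[OF that d] z h that by (simp add: lev_def)
    then have "z - h \<in> lev y'" using d by (simp add: lev_def)
    then show "z \<in> (\<Union>h\<in>lev y. \<Union>k\<in>lev y'. {h + k})" using h by (intro UN_I[of h] UN_I[of "z - h"]) simp_all
  qed
  finally show ?thesis .
qed

text \<open>On the fibres \<tau> acts as 0 and T as \<theta>, so only the coefficient of \<tau>^0,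
  evaluated at \<theta>, survives.\<close>

lemma ell_skm: "\<alpha> \<in> \<Phi> \<Longrightarrow> x \<in> I \<Longrightarrow> ell \<alpha> (skm F x) = poly (coeff F 0) \<theta> * ell \<alpha> x"
proof -
  assume a: "\<alpha> \<in> \<Phi>" and x: "x \<in> I"
  have m: "pT (coeff F i) * (tauI ^^ i) x \<in> I" for i by (intro I_mult pT_AC tauI_pow_I x)
  have "ell \<alpha> (skm F x) = (\<Sum>i\<le>degree F. ell \<alpha> (pT (coeff F i) * (tauI ^^ i) x))"
    unfolding skm_def by (rule ell_sum[OF a m])
  also have "\<dots> = (\<Sum>i\<le>degree F. if i = 0 then poly (coeff F 0) \<theta> * ell \<alpha> x else 0)"
  proof (intro sum.cong refl)
    fix i
    show "ell \<alpha> (pT (coeff F i) * (tauI ^^ i) x) = (if i = 0 then poly (coeff F 0) \<theta> * ell \<alpha> x else 0)"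
      using ell_mult[OF a pT_AC tauI_pow_I[OF x], of "coeff F i" i] chi_pT[OF embD'[OF a]]
        gen(4)[OF a tauI_pow_I[OF x]] by (cases i) simp_all
  qed
  finally show ?thesis by simp
qed

lemma mod_tau_smult: "F \<odot>\<^bsub>mod_tau MM\<^esub> lev y = lev (\<lambda>\<alpha>. poly (coeff F 0) \<theta> * y \<alpha>)"
  using coset_map_lev[of "skm F" "\<lambda>_. poly (coeff F 0) \<theta>" y] skm_I ell_skm by (simp add: mod_tau_def quot_module_def)

lemma MM_motive: "abelian_T_motive q \<theta> MM"
  unfolding abelian_T_motive_def
proof (intro conjI)
  show "\<exists>m::nat. \<forall>Q\<in>carrier (mod_tau MM). ((T_el - sc \<theta>) [^]\<^bsub>skew_ring q\<^esub> m) \<odot>\<^bsub>mod_tau MM\<^esub> Q = \<zero>\<^bsub>mod_tau MM\<^esub>"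
  \<comment> \<open>The exponent is 1, since T acts on each fibre as \<theta>.\<close>
  proof (intro exI[of _ 1] ballI)
    fix Q assume "Q \<in> carrier (mod_tau MM)"
    then obtain y where Q: "Q = lev y" using mod_tau_carrier by blast
    have rg: "ring (skew_ring q :: 'c poly poly ring)" by (rule left_module.axioms(1)[OF MM_left_module])
    have p: "(T_el - sc \<theta>) [^]\<^bsub>skew_ring q\<^esub> (1::nat) = T_el - sc \<theta>"
      by (rule monoid.nat_pow_eone[OF ring.axioms(2)[OF rg]]) (simp add: skew_ring_def)
    show "((T_el - sc \<theta>) [^]\<^bsub>skew_ring q\<^esub> (1::nat)) \<odot>\<^bsub>mod_tau MM\<^esub> Q = \<zero>\<^bsub>mod_tau MM\<^esub>"
      unfolding p Q mod_tau_smult mod_tau_zero by (rule lev_cong) (simp add: T_el_def sc_def)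
  qed
  show "\<exists>n. free_of_rank C_T MM n" using MM_free_T by blast
qed (rule MM_left_module, rule MM_free_tau)

lemma MM_complete_multiplication:
  assumes J: "\<And>p. j (poly_fract p) = poly (map_poly iK p) TK"
  shows "has_complete_multiplication j iC A r \<Phi> MM"
proof -
  have act1: "acts_linearly A UNIV MM (\<lambda>a x. jK a * x)"
    unfolding acts_linearly_def by (auto simp: I_mult AC_jK distrib_left distrib_right mult.assoc skm_jK)
  have act2: "jK (j (poly_fract p)) * x = [:map_poly iC p:] \<odot>\<^bsub>MM\<^esub> x" for p x
    unfolding J poly_TK(1) by (simp add: skm_const)
  \<comment> \<open>Reads the fibre coordinates of a coset off an arbitrary member, cut down to
    \<open>\<Phi>\<close> to be extensional.\<close>
  define phi where "phi Q = restrict (\<lambda>\<alpha>. ell \<alpha> (SOME x. x \<in> Q)) \<Phi>" for Q :: "'l set"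
  have phi: "phi (lev y) = restrict y \<Phi>" for y
  proof -
    have "(SOME x. x \<in> lev y) \<in> lev y" using lev_nonempty[of y] by (metis someI)
    then show ?thesis unfolding phi_def by (intro restrict_ext) (simp add: lev_def)
  qed
  have phi_app: "phi (lev y) \<alpha> = y \<alpha>" if "\<alpha> \<in> \<Phi>" for y \<alpha> using that by (simp add: phi)
  \<comment> \<open>The representation of K is defined in coordinates, because an element of K
    outside A need not preserve \<open>I\<close>.\<close>
  define rh where "rh x Q = lev (\<lambda>\<alpha>. \<alpha> x * phi Q \<alpha>)" for x :: 'k and Q :: "'l set"
  have rh: "rh x (lev y) = lev (\<lambda>\<alpha>. \<alpha> x * y \<alpha>)" for x y
    unfolding rh_def by (rule lev_cong) (simp add: phi_app)
  have scm: "sc c \<odot>\<^bsub>mod_tau MM\<^esub> lev y = lev (\<lambda>\<alpha>. c * y \<alpha>)" for c y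
    unfolding mod_tau_smult by (simp add: sc_def)
  have hs: "\<alpha> 1 = 1" "\<alpha> (x + y) = \<alpha> x + \<alpha> y" "\<alpha> (x * y) = \<alpha> x * \<alpha> y" if "\<alpha> \<in> \<Phi>" for \<alpha> x y
    using field_hom_simps(2,3,6)[OF embD'(1)[OF that]] by simp_all
  have act3: "acts_linearly UNIV (range sc) (mod_tau MM) rh"
    unfolding acts_linearly_def mod_tau_carrier
    by (auto simp: rh mod_tau_add scm hs algebra_simps intro!: lev_cong)
  have act4: "rh a Q = coset_map MM (tau_image MM) (\<lambda>x. jK a * x) Q" if a: "a \<in> A" and Q: "Q \<in> carrier (mod_tau MM)" for a Q
  proof -
    obtain y where y: "Q = lev y" using Q mod_tau_carrier by blast
    have "coset_map MM (tau_image MM) (\<lambda>x. jK a * x) (lev y) = lev (\<lambda>\<alpha>. \<alpha> a * y \<alpha>)"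
    proof (rule coset_map_lev)
      show "jK a * x \<in> I" if "x \<in> I" for x using I_mult[OF AC_jK[OF a] that] .
      show "ell \<alpha> (jK a * x) = \<alpha> a * ell \<alpha> x" if "x \<in> I" "\<alpha> \<in> \<Phi>" for x \<alpha>
        using ell_mult[OF that(2) AC_jK[OF a] that(1)] chi_jK[OF embD'(1,2)[OF that(2)] a] by simp
    qed
    then show ?thesis unfolding y rh ..
  qed
  have "rep_iso_sum (mod_tau MM) rh \<Phi>"
    unfolding rep_iso_sum_def
  proof (intro exI[of _ phi] conjI)
    show "bij_betw phi (carrier (mod_tau MM)) (\<Phi> \<rightarrow>\<^sub>E UNIV)"
      unfolding bij_betw_def mod_tau_carrier
    proof
      show "inj_on phi (range lev)"
      proof (rule inj_onI)
        fix Q Q' assume "Q \<in> range lev" "Q' \<in> range lev" and e: "phi Q = phi Q'"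
        then obtain y y' where y: "Q = lev y" "Q' = lev y'" by blast
        have "y \<alpha> = y' \<alpha>" if "\<alpha> \<in> \<Phi>" for \<alpha> using phi_app[OF that, of y] phi_app[OF that, of y'] e y by simp
        then show "Q = Q'" unfolding y by (rule lev_cong)
      qed
      show "phi ` range lev = (\<Phi> \<rightarrow>\<^sub>E UNIV)"
      proof (intro equalityI subsetI)
        fix y :: "('k \<Rightarrow> 'c) \<Rightarrow> 'c" assume "y \<in> \<Phi> \<rightarrow>\<^sub>E UNIV"
        then have "y = phi (lev y)" unfolding phi by (simp add: PiE_restrict)
        then show "y \<in> phi ` range lev" by blast
      next
        fix y assume "y \<in> phi ` range lev"
        then obtain y' where "y = phi (lev y')" by blast
        then show "y \<in> \<Phi> \<rightarrow>\<^sub>E UNIV" by (simp add: phi)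
      qed
    qed
  qed (auto simp: mod_tau_carrier mod_tau_add scm rh phi_app)
  then show ?thesis
    unfolding has_complete_multiplication_def using MM_free_T act1 act2 act3 act4
    by (intro conjI exI[of _ "\<lambda>a x. jK a * x"] exI[of _ rh]) blast+
qed

end

lemma cm_motive_exists:
  assumes "finite \<Phi>" "\<Phi> \<noteq> {}" "\<And>\<alpha>. \<alpha> \<in> \<Phi> \<Longrightarrow> \<exists>R. drin \<alpha> R"
    and "\<And>p. j (poly_fract p) = poly (map_poly iK p) TK"
  shows "\<exists>M :: ('c poly poly, 'l) module. abelian_T_motive q \<theta> M \<and> has_complete_multiplication j iC A r \<Phi> M"
proof -
  obtain I f where l: "lat I f \<Phi>" using lat_exists[OF assms(1,3)] by blast
  have e: "embp \<alpha>" if "\<alpha> \<in> \<Phi>" for \<alpha> using assms(3)[OF that] drinD(1,2,3) unfolding embp_def by blast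
  show ?thesis using MM_motive[OF l assms(1,2) e] MM_complete_multiplication[OF l assms(1,2) e assms(4)] by blast
qed

end

section \<open>Finiteness of the CM-type and assembly of the construction\<close>

text \<open>An embedding is determined by its values on a finite basis, and each value is one of the
  finitely many roots of an equation over the rational functions.\<close>

lemma finite_embeddings:
  assumes ext: "finite_separable_extension j r" and h\<iota>: "field_hom \<iota>"
  shows "finite (embeddings_over j \<iota>)"
proof -
  have hj: "field_hom j" using ext by (simp add: finite_separable_extension_def)
  interpret V: vector_space "\<lambda>c x. j c * x" by (rule field_hom_vector_space[OF hj])
  obtain B where B: "finite B" "V.span B = UNIV" using ext by (auto simp: finite_separable_extension_def)
  have "\<forall>x. \<exists>p. irreducible p \<and> poly (map_poly j p) x = 0" using ext by (auto simp: finite_separable_extension_def)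
  from choice[OF this] obtain p where p: "\<And>x. irreducible (p x)" "\<And>x. poly (map_poly j (p x)) x = 0" by blast
  have nz: "map_poly \<iota> (p x) \<noteq> 0" for x
  proof
    assume "map_poly \<iota> (p x) = 0"
    then have "\<iota> (coeff (p x) (degree (p x))) = 0" using coeff_map_poly_hom[OF h\<iota>, of "p x"] by (metis coeff_0)
    then show False using p(1)[of x] field_hom_simps(9)[OF h\<iota>] by auto
  qed
  define S where "S x = {z. poly (map_poly \<iota> (p x)) z = 0}" for x
  have finS: "finite (S x)" for x unfolding S_def by (rule poly_roots_finite[OF nz])
  have root: "\<alpha> x \<in> S x" if a: "\<alpha> \<in> embeddings_over j \<iota>" for \<alpha> x
  proof -
    have h: "field_hom \<alpha>" "\<And>y. \<alpha> (j y) = \<iota> y" using a by (auto simp: embeddings_over_def)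
    have "\<alpha> (poly (map_poly j g) x) = poly (map_poly \<iota> g) (\<alpha> x)" for g
      by (induction g) (simp_all add: map_poly_pCons field_hom_simps[OF hj] field_hom_simps[OF h\<iota>] field_hom_simps[OF h(1)] h(2))
    from this[of "p x"] show ?thesis using p(2)[of x] field_hom_simps(1)[OF h(1)] by (simp add: S_def)
  qed
  have "inj_on (\<lambda>\<alpha>. restrict \<alpha> B) (embeddings_over j \<iota>)"
  proof (rule inj_onI)
    fix \<alpha> \<beta> assume ab: "\<alpha> \<in> embeddings_over j \<iota>" "\<beta> \<in> embeddings_over j \<iota>" and e: "restrict \<alpha> B = restrict \<beta> B"
    have h: "field_hom \<alpha>" "\<And>y. \<alpha> (j y) = \<iota> y" "field_hom \<beta>" "\<And>y. \<beta> (j y) = \<iota> y"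
      using ab by (auto simp: embeddings_over_def)
    have "V.span B \<subseteq> {x. \<alpha> x = \<beta> x}"
    proof (rule V.span_minimal)
      show "B \<subseteq> {x. \<alpha> x = \<beta> x}" using e by (metis (mono_tags, lifting) mem_Collect_eq restrict_apply' subsetI)
      show "V.subspace {x. \<alpha> x = \<beta> x}"
        by (rule V.subspaceI) (simp_all add: field_hom_simps(1,3,6)[OF h(1)] field_hom_simps(1,3,6)[OF h(3)] h(2,4))
    qed
    then show "\<alpha> = \<beta>" using B(2) by auto
  qed
  moreover have "(\<lambda>\<alpha>. restrict \<alpha> B) ` embeddings_over j \<iota> \<subseteq> (\<Pi>\<^sub>E b\<in>B. S b)" using root by auto
  moreover have "finite (\<Pi>\<^sub>E b\<in>B. S b)" by (intro finite_PiE B(1) finS)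
  ultimately show ?thesis by (meson finite_imageD finite_subset)
qed

theorem theorem12p6:
  fixes e :: "'f::{field,finite} fls alg_closure \<Rightarrow> 'c::field"
    and v :: "'c \<Rightarrow> real"
    and \<iota> :: "'f poly fract \<Rightarrow> 'c"
    and j :: "'f poly fract \<Rightarrow> 'k::field"
    and r :: nat
    and j\<^sub>K :: "'k \<Rightarrow> 'l::field"
    and j\<^sub>C :: "'c \<Rightarrow> 'l"
    and Pinf :: "'l set"
    and \<Phi> :: "('k \<Rightarrow> 'c) set"
  assumes "completed_alg_closure e v"
    and "is_iota e \<iota>"
    and "finite_separable_extension j r"
    and "tensor_field (\<lambda>c. j (poly_fract [:c:])) (const_C e) j\<^sub>K j\<^sub>C"
    and "points_over_infinity j\<^sub>C (j\<^sub>K (j T_fract)) = {Pinf}"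
    and "\<Phi> \<subseteq> embeddings_over j \<iota>"
    and "\<Phi> \<noteq> {}"
  shows "\<exists>M :: ('c poly poly, 'l) module.
           abelian_T_motive CARD('f) (theta e) M \<and>
           has_complete_multiplication j (const_C e) (regular_outside j\<^sub>K j\<^sub>C Pinf) r \<Phi> M"
proof -
  let ?iK = "\<lambda>c. j (poly_fract [:c:])" and ?A = "regular_outside j\<^sub>K j\<^sub>C Pinf"
  note C = completed_alg_closureD[OF assms(1)]
  have iota: "field_hom \<iota>" "\<And>c. \<iota> (poly_fract [:c:]) = const_C e c" "\<iota> T_fract = theta e"
    using assms(2) by (auto simp: is_iota_def)
  have fin: "finite \<Phi>" by (rule finite_subset[OF assms(6) finite_embeddings[OF assms(3) iota(1)]])
  have emb: "field_hom \<alpha>" "\<alpha> (?iK c) = const_C e c" "\<alpha> (j T_fract) = theta e" if "\<alpha> \<in> \<Phi>" for \<alpha> c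
  proof -
    have "\<alpha> \<in> embeddings_over j \<iota>" using that assms(6) by blast
    then show "field_hom \<alpha>" "\<alpha> (?iK c) = const_C e c" "\<alpha> (j T_fract) = theta e"
      using iota(2,3) by (simp_all add: embeddings_over_def)
  qed
  \<comment> \<open>Any member of \<open>\<Phi>\<close> can serve as the reference embedding that
    measures absolute values.\<close>
  obtain \<alpha>0 where a0: "\<alpha>0 \<in> \<Phi>" using assms(7) by blast
  have hj: "field_hom j" using assms(3) by (simp add: finite_separable_extension_def)
  have hiK: "field_hom ?iK"
    unfolding field_hom_def
  proof (intro conjI allI)
    have "poly_fract [:1 :: 'f:] = 1" by (simp add: poly_fract_def One_fract_def one_pCons)
    then show "?iK 1 = 1" using field_hom_simps(2)[OF hj] by simp
    fix a b :: 'f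
    have "poly_fract [:a + b:] = poly_fract [:a:] + poly_fract [:b:]" "poly_fract [:a * b:] = poly_fract [:a:] * poly_fract [:b:]"
      by (simp_all add: poly_fract_def mult.commute)
    then show "?iK (a + b) = ?iK a + ?iK b" "?iK (a * b) = ?iK a * ?iK b"
      using field_hom_simps(3,6)[OF hj] by simp_all
  qed
  have hiC: "field_hom (const_C e)" by (rule const_C_hom[OF C(1)])
  have nf: "nonarch_field v" by (rule nonarch_field.intro[OF C(2)])
  have se: "scalar_extension ?iK (const_C e) j\<^sub>K j\<^sub>C" by (rule scalar_extension.intro[OF hiK hiC assms(4)])
  interpret CC: cm_curve j "const_C e" j\<^sub>K j\<^sub>C v "CARD('f)" r "theta e" Pinf \<alpha>0
  proof (intro cm_curve.intro cm_curve_axioms.intro nf se assms(3,5) emb[OF a0] C(3,4))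
    show "\<exists>\<zeta>. poly (map_poly (const_C e) g) \<zeta> = 0 \<and> v (x - \<zeta>) < 1"
      if "g \<noteq> 0" "v (poly (map_poly (const_C e) g) x) < 1" for g x
      by (rule completion_residue_root[OF assms(1) that])
  qed simp_all
  interpret R: cm_ring ?iK "const_C e" j\<^sub>K j\<^sub>C ?A CC.Dg "CARD('f)" r "j T_fract" "theta e"
  proof (intro cm_ring.intro cm_ring_axioms.intro se CC.r_pos CC.A_subring CC.A_iK CC.A_TK CC.TK_nonzero CC.Dg(1,3,8)
      CC.Dg_nonneg CC.Dg_cofinite completion_perfect[OF assms(1)])
    fix x
    obtain d where d: "d \<noteq> 0" "CC.J d * x \<in> ?A" using CC.A_denominator by blast
    then show "\<exists>d\<in>?A. d \<noteq> 0 \<and> d * x \<in> ?A" using CC.A_J[of d] CC.J_simps(5)[of d] by (intro bexI[of _ "CC.J d"]) simp_all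
    show "\<exists>n P. (\<Sum>i\<le>n. poly (map_poly ?iK (P i)) (j T_fract) * x ^ i) = 0 \<and>
          (\<Sum>i\<le>n. of_nat i * poly (map_poly ?iK (P i)) (j T_fract) * x ^ (i - 1)) \<noteq> 0"
      using CC.separable_relation[of x] unfolding CC.J_altdef .
  qed simp_all
  have dr: "\<exists>R'. R.drin \<alpha> R'" if a: "\<alpha> \<in> \<Phi>" for \<alpha>
  proof -
    have ea: "CC.emb \<alpha>" using emb[OF a] by (simp add: CC.emb_def)
    \<comment> \<open>The base is q^(1/r) because \<open>\<alpha> x\<close> has absolute value
      q^(D/r), with D the degree of \<open>x\<close>.\<close>
    have q1: "real CARD('f) powr (1 / real r) > 1" using R.q_gt_1 CC.r_pos by (intro gr_one_powr) simp_all
    interpret L: drinfeld_lattice v ?iK "const_C e" ?A CC.Dg \<alpha> "CARD('f)" "real CARD('f) powr (1 / real r)"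
      by (intro drinfeld_lattice.intro drinfeld_lattice_axioms.intro nf refl hiK hiC C(6) CC.A_subring CC.A_iK
        emb[OF a] CC.Dg(1,8) CC.Dg_nonneg CC.emb_value[OF ea] q1 CC.Dg_cofinite)
    have tw: "L.tauop m = R.tw m" for m by (simp add: L.tauop_def R.tw_def)
    \<comment> \<open>The laws of \<open>rmul\<close> are stated for a pair of elements of A; where
      a clause speaks of fewer, the remaining places are filled with 1.\<close>
    have one: "1 \<in> ?A" by (rule is_subringD(1)[OF CC.A_subring])
    have "R.drin \<alpha> L.rmul"
      unfolding R.drin_def
      by (intro conjI allI ballI impI emb[OF a] L.rmul_lemmas(1,2,7)[OF _ one] L.rmul_lemmas(3)[OF _ one, unfolded tw]
        L.rmul_lemmas(4,5) L.rmul_lemmas(6)[OF one one] L.rmul_lemmas(8)[OF _ one, THEN conjunct1]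
        L.rmul_lemmas(8)[OF _ one, THEN conjunct2])
    then show ?thesis by blast
  qed
  obtain R0 where R0: "R.drin \<alpha>0 R0" using dr[OF a0] by blast
  interpret RD: cm_ring_drinfeld ?iK "const_C e" j\<^sub>K j\<^sub>C ?A CC.Dg "CARD('f)" r "j T_fract" "theta e" \<alpha>0 R0
    by unfold_locales (rule R0)
  show ?thesis
  proof (rule RD.cm_motive_exists[OF fin assms(7)])
    show "j (poly_fract p) = poly (map_poly ?iK p) (j T_fract)" for p by (rule CC.J_altdef[unfolded CC.J_def])
  qed (rule dr)
qed

end
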